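(* Let $n\ge 3$, let $\Pi$ be a finite projective geometry of algebraic dimension $n$ and order $q$, and let $\mathcal{T}$ be a triangle presentation of type $\tilde{\mathrm{A}}_{n-1}$ on $\Pi$ compatible with an involution $\sigma$. Let $\Gamma=\Gamma_{\mathcal{T}}$, and let $\Bbbk$ be a field of characteristic $p$ with $p\ge n-1$ and $q\equiv 1 \bmod p$. Let $V_a$ ($1\le a\le n$), $M_{a,b}:V_a\otimes V_b\to V_{a+b}$ and $S_{a,b}:V_{a+b}\to V_a\otimes V_b$ ($a,b\ge 1$, $a+b\le n$), and $E:V_n\to \Bbbk_1$, $E':\Bbbk_1\to V_n$ be the objects and morphisms of $\mathrm{Vec}(\Gamma)$ built from $\mathcal{T}$ as in the context. Then, setting $m_{a,b}=M_{a,b}$, $s_{a,b}=S_{a,b}$, $e=E$, $e'=E'$ (and suppressing the associators of vector spaces), these morphisms satisfy: (1) (associativity and coassociativity) $m_{a+b,c}(m_{a,b}\otimes 1_c)=m_{a,b+c}(1_a\otimes m_{b,c})$ and $(s_{a,b}\otimes 1_c)s_{a+b,c}=(1_a\otimes s_{b,c})s_{a,b+c}$ for $a+b+c\le n$; (2) (bigon bursting) $m_{a,b}s_{a,b}=\binom{a+b}{a}1_{a+b}$ for $a+b\le n$; (3) (first square switch) for all integers $a,b,c,d\ge 0$ with $d\le a$ and $a,\ b,\ a+c-d,\ b+d-c\in\{0,\dots,n\}$, $$(m_{a-d,c}\otimes 1)(1\otimes s_{c,b+d-c})(1\otimes m_{d,b})(s_{a-d,d}\otimes 1)=\sum_{t}\binom{a-b+c-d}{t}(1\otimes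 m_{d-t,b-c+t})(s_{a+c-d,d-t}\otimes 1)(m_{a,c-t}\otimes 1)(1\otimes s_{c-t,b-c+t});$$ (4) (second square switch) for all integers $a,b,c,d\ge 0$ with $c\le b$ and $a,\ b,\ a+c-d,\ b+d-c\in\{0,\dots,n\}$, $$(1\otimes m_{d,b-c})(s_{a+c-d,d}\otimes 1)(m_{a,c}\otimes 1)(1\otimes s_{c,b-c})=\sum_t\binom{b-a+d-c}{t}(m_{a-d+t,c-t}\otimes 1)(1\otimes s_{c-t,b+d-c})(1\otimes m_{d-t,b})(s_{a-d+t,d-t}\otimes 1);$$ (5) (rigid $\mathrm{SL}_n^-$ relations) for $1\le a\le n-1$, $$1_a=(e\otimes 1_a)(m_{a,n-a}\otimes 1_a)(1_a\otimes s_{n-a,a})(1_a\otimes e')=(1_a\otimes e)(1_a\otimes m_{n-a,a})(s_{a,n-a}\otimes 1_a)(e'\otimes 1_a).$$ Hence there is a $\Bbbk$-linear monoidal functor $F:\mathrm{Web}(\mathrm{SL}_n^-)\to \mathrm{Vec}(\Gamma)$ with $F(a)=V_a$, $F(m_{a,b})=M_{a,b}$, $F(s_{a,b})=S_{a,b}$, $F(e)=E$, $F(e')=E'$, and composing $F$ with the forgetful functor $\mathrm{Vec}(\Gamma)\to\mathrm{Vec}$ yields a fiber functor on $\mathrm{Web}(\mathrm{SL}_n^-)$.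
   Context: **Projective geometry.** A finite projective geometry consists of finite sets of points and lines with an incidence relation such that: any two distinct points lie on a unique common line; there are three non-collinear points; every line has at least 3 points; and a line meeting two sides of a triangle, but incident with none of its vertices, meets the third side (Veblen–Young). A subspace is a set of points containing the line through any two of its points; singletons are subspaces. The algebraic dimension $\dim(u)$ of a nonempty subspace $u$ is the maximal length of a strictly increasing chain of nonempty subspaces ending in $u$ (points have dimension 1, lines dimension 2). The geometry has algebraic dimension $n$ if its whole point set does. The order $q$ is one less than the number of points on a line. Let $\Pi_k$ be the set of subspaces of algebraic dimension $k$ and $\Pi=\bigsqcup_{1\le k\le n-1}\Pi_k$. Write $u\sim v$ ("incident") if $u\subseteq v$ or $v\subseteq u$. **Triangle presentation.** Let $\sigma:\Pi\to\Pi$ be an involution with $\sigma(\Pi_k)=\Pi_{n-k}$. A triangle presentation of type $\tilde{\mathrm{A}}_{n-1}$ compatible with $\sigma$ is a set $\mathcal{T}\subseteq\Pi\times\Pi\times\Pi$ such that: 1. for $u,v\in\Pi$, $(u,v,w)\in\mathcal{T}$ for some $w$ if and only if $\sigma(u)$ and $v$ are distinct and incident; 2. $(u,v,w)\in\mathcal{T}$ if and only if $(v,w,u)\in\mathcal{T}$; 3. $(u,v,w)\in\mathcal{T}$ implies $\dim(u)+\dim(v)+\dim(w)\equiv 0 \bmod n$; 4. $(u,v,w_1),(u,v,w_2)\in\mathcal{T}$ implies $w_1=w_2$; 5. $(u,v,w)\in\mathcal{T}$ implies $(\sigma(w),\sigma(v),\sigma(u))\in\mathcal{T}$; 6. if $(u_1,v_1,w)\in\mathcal{T}$,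 $(u_2,v_2,\sigma(w))\in\mathcal{T}$ and $\dim(u_i)+\dim(v_i)<n$ for $i=1,2$, then there is a unique $z$ with $(v_2,u_1,z)\in\mathcal{T}$ and $(v_1,u_2,\sigma(z))\in\mathcal{T}$. Its group is $\Gamma_{\mathcal{T}}=\langle u\in\Pi \mid uvw=1 \text{ if } (u,v,w)\in\mathcal{T},\ u\sigma(u)=1\rangle$. **Graded vector spaces.** $\mathrm{Vec}(\Gamma)$ is the monoidal category of finite-dimensional $\Gamma$-graded $\Bbbk$-vector spaces with grading-preserving linear maps; $\Bbbk_g$ is a copy of $\Bbbk$ in degree $g$, with basis vector $1_g$, and $\Bbbk_g\otimes\Bbbk_h\cong\Bbbk_{gh}$ via $1_g\otimes 1_h\mapsto 1_{gh}$. The unit object is $\Bbbk_1$. Put $V_a=\bigoplus_{u\in\Pi_a}\Bbbk_u$ for $0<a<n$, where the basis vector of the summand $\Bbbk_u$ is denoted $u$, and $V_n=\Bbbk_1$, with basis vector $1$. **The morphisms.** If $a+b<n$, for $u\in\Pi_a$, $v\in\Pi_b$: $M_{a,b}(u\otimes v)=w$ if there is $w\in\Pi_{a+b}$ with $(u,v,\sigma(w))\in\mathcal{T}$, and $0$ otherwise; for $u\in\Pi_{a+b}$: $S_{a,b}(u)=\sum v\otimes w$, summed over $(v,w)\in\Pi_a\times\Pi_b$ with $(v,w,\sigma(u))\in\mathcal{T}$. If $a+b=n$: $M_{a,n-a}(u\otimes v)=1$ if $v=\sigma(u)$ and $0$ otherwise, and $S_{a,n-a}(1)=\sum_{u\in\Pi_a}u\otimes\sigma(u)$.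 $E$ and $E'$ are the identity map of $\Bbbk_1$. **The category $\mathrm{Web}(\mathrm{SL}_n^-)$.** It is the strict $\Bbbk$-linear monoidal category whose objects are finite sequences in $\{1,\dots,n\}$ (tensor product is concatenation, unit is the empty sequence $\varnothing$), with generating morphisms the merges $m_{a,b}:(a,b)\to(a+b)$ and splits $s_{a,b}:(a+b)\to(a,b)$ for $a+b\le n$, the crossings $x_{a,b}:(a,b)\to(b,a)$ for $1\le a,b\le n$, and $e:(n)\to\varnothing$, $e':\varnothing\to(n)$, subject to: - the associativity, coassociativity and bigon relations displayed in (1) and (2) of the claim; - the bialgebra relation, for $a+c=b+d$: $$s_{b,d}\,m_{a,c}=\sum_s (m_{s,b-s}\otimes m_{a-s,c-b+s})(1_s\otimes x_{a-s,b-s}\otimes 1_{c-b+s})(s_{s,a-s}\otimes s_{b-s,c-b+s});$$ - $e'e=1_n$ and $ee'=1_\varnothing$; - $(e\otimes 1_a)x_{a,n}=(-1)^a(1_a\otimes e)$ and $(1_a\otimes e)x_{n,a}=(-1)^a(e\otimes 1_a)$ for $1\le a\le n$. In this category the crossing is determined by merges and splits: $$x_{a,b}=\sum_t(-1)^t(m_{t,b-t}\otimes 1_a)(1_t\otimes s_{b-t,a})(1_t\otimes m_{a-t,b})(s_{t,a-t}\otimes 1_b),$$ and it is a known fact that, in a monoidal category generated by merges and splits satisfying associativity, coassociativity and bigon bursting, with crossing defined by this formula, the bialgebra relation holds if and only if both square switch relations hold. **Conventions.** Label $0$ denotes the empty string: object $0$ is the unit, and merges, splits and crossings involving a label $0$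 are identities. Sums run over all $t$ (resp. $s$) for which the labels are allowed; any composite in which some string has a label outside $\{0,\dots,n\}$ is interpreted as zero. For $m\in\mathbb{Z}$, $t\ge 0$, $\binom{m}{t}=m(m-1)\cdots(m-t+1)/t!$. Compositions are read right to left, and $1_a$ is the identity of the object $a$ (or of $V_a$). A fiber functor on a $\Bbbk$-linear monoidal category is a ($\Bbbk$-linear, not necessarily braided) monoidal functor to the category $\mathrm{Vec}$ of finite-dimensional $\Bbbk$-vector spaces. *)

theory Defs
  imports
    Complex_Main
    "HOL-Algebra.Group"
    "HOL-Library.FuncSet"
    "HOL-Library.Function_Algebras"
    "HOL-Number_Theory.Cong"
begin

section \<open>Finite projective geometries\<close>

record ('p, 'l) geometry =
  points :: "'p set"
  lines :: "'l set"
  incid :: "'p \<Rightarrow> 'l \<Rightarrow> bool"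

definition line_points :: "('p, 'l) geometry \<Rightarrow> 'l \<Rightarrow> 'p set" where
  "line_points G l = {x \<in> points G. incid G x l}"

definition triangle :: "('p, 'l) geometry \<Rightarrow> 'p \<Rightarrow> 'p \<Rightarrow> 'p \<Rightarrow> bool" where
  "triangle G x y z \<longleftrightarrow> {x, y, z} \<subseteq> points G \<and> distinct [x, y, z] \<and>
     \<not> (\<exists>l\<in>lines G. incid G x l \<and> incid G y l \<and> incid G z l)"

definition meets :: "('p, 'l) geometry \<Rightarrow> 'l \<Rightarrow> 'l \<Rightarrow> bool" where
  "meets G l m \<longleftrightarrow> line_points G l \<inter> line_points G m \<noteq> {}"

locale projective_geometry =
  fixes G :: "('p, 'l) geometry"
  assumes finite_points: "finite (points G)"
    and finite_lines: "finite (lines G)"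
    and unique_line: "\<lbrakk>x \<in> points G; y \<in> points G; x \<noteq> y\<rbrakk>
          \<Longrightarrow> \<exists>!l. l \<in> lines G \<and> incid G x l \<and> incid G y l"
    and non_collinear: "\<exists>x y z. triangle G x y z"
    and three_points: "l \<in> lines G \<Longrightarrow> 3 \<le> card (line_points G l)"
    and veblen_young: "\<lbrakk>triangle G x y z; {lxy, lxz, lyz, m} \<subseteq> lines G;
            incid G x lxy; incid G y lxy; incid G x lxz; incid G z lxz; incid G y lyz; incid G z lyz;
            \<not> incid G x m; \<not> incid G y m; \<not> incid G z m; meets G m lxy; meets G m lxz\<rbrakk>
          \<Longrightarrow> meets G m lyz"

definition has_order :: "('p, 'l) geometry \<Rightarrow> nat \<Rightarrow> bool" where
  "has_order G q \<longleftrightarrow> (\<forall>l\<in>lines G. card (line_points G l) = q + 1)"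

definition proj_subspaces :: "('p, 'l) geometry \<Rightarrow> 'p set set" where
  "proj_subspaces G = {u. u \<subseteq> points G \<and>
     (\<forall>x\<in>u. \<forall>y\<in>u. \<forall>l\<in>lines G. x \<noteq> y \<and> incid G x l \<and> incid G y l \<longrightarrow> line_points G l \<subseteq> u)}"

definition alg_dim :: "('p, 'l) geometry \<Rightarrow> 'p set \<Rightarrow> nat" where
  "alg_dim G u = Max {length c | c. c \<noteq> [] \<and> sorted_wrt (\<subset>) c \<and>
     set c \<subseteq> proj_subspaces G - {{}} \<and> last c = u}"

definition Pi_dim :: "('p, 'l) geometry \<Rightarrow> nat \<Rightarrow> 'p set set" where
  "Pi_dim G k = {u \<in> proj_subspaces G. u \<noteq> {} \<and> alg_dim G u = k}"

definition Pi_all :: "('p, 'l) geometry \<Rightarrow> nat \<Rightarrow> 'p set set" where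
  "Pi_all G n = (\<Union>k\<in>{1..n - 1}. Pi_dim G k)"

definition incident :: "'p set \<Rightarrow> 'p set \<Rightarrow> bool" where
  "incident u v \<longleftrightarrow> u \<subseteq> v \<or> v \<subseteq> u"


section \<open>Triangle presentations\<close>

definition type_reversing_involution ::
    "('p, 'l) geometry \<Rightarrow> nat \<Rightarrow> ('p set \<Rightarrow> 'p set) \<Rightarrow> bool" where
  "type_reversing_involution G n \<sigma> \<longleftrightarrow>
     (\<forall>u\<in>Pi_all G n. \<sigma> u \<in> Pi_all G n \<and> \<sigma> (\<sigma> u) = u) \<and>
     (\<forall>k\<in>{1..n - 1}. \<sigma> ` Pi_dim G k = Pi_dim G (n - k))"

locale triangle_presentation =
  fixes G :: "('p, 'l) geometry" and n :: nat and \<sigma> :: "'p set \<Rightarrow> 'p set"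
    and T :: "('p set \<times> 'p set \<times> 'p set) set"
  assumes subset: "T \<subseteq> Pi_all G n \<times> Pi_all G n \<times> Pi_all G n"
    and extends_iff: "\<lbrakk>u \<in> Pi_all G n; v \<in> Pi_all G n\<rbrakk>
          \<Longrightarrow> (\<exists>w. (u, v, w) \<in> T) \<longleftrightarrow> \<sigma> u \<noteq> v \<and> incident (\<sigma> u) v"
    and cyclic: "(u, v, w) \<in> T \<longleftrightarrow> (v, w, u) \<in> T"
    and dim_sum: "(u, v, w) \<in> T \<Longrightarrow> [alg_dim G u + alg_dim G v + alg_dim G w = 0] (mod n)"
    and third_unique: "\<lbrakk>(u, v, w1) \<in> T; (u, v, w2) \<in> T\<rbrakk> \<Longrightarrow> w1 = w2"
    and dual: "(u, v, w) \<in> T \<Longrightarrow> (\<sigma> w, \<sigma> v, \<sigma> u) \<in> T"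
    and exchange: "\<lbrakk>(u1, v1, w) \<in> T; (u2, v2, \<sigma> w) \<in> T;
            alg_dim G u1 + alg_dim G v1 < n; alg_dim G u2 + alg_dim G v2 < n\<rbrakk>
          \<Longrightarrow> \<exists>!z. (v2, u1, z) \<in> T \<and> (v1, u2, \<sigma> z) \<in> T"


section \<open>Groups given by generators and relators\<close>

text \<open>A word is a list of letters \<open>(x, True)\<close>, standing for \<open>x\<close>, and \<open>(x, False)\<close>,
  standing for its inverse.\<close>

definition gwords :: "'a set \<Rightarrow> ('a \<times> bool) list set" where
  "gwords X = {w. fst ` set w \<subseteq> X}"

inductive pres_eq :: "'a set \<Rightarrow> ('a \<times> bool) list set \<Rightarrow>
    ('a \<times> bool) list \<Rightarrow> ('a \<times> bool) list \<Rightarrow> bool" for X R where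
  refl: "w \<in> gwords X \<Longrightarrow> pres_eq X R w w"
| sym: "pres_eq X R v w \<Longrightarrow> pres_eq X R w v"
| trans: "pres_eq X R u v \<Longrightarrow> pres_eq X R v w \<Longrightarrow> pres_eq X R u w"
| cancel: "\<lbrakk>v \<in> gwords X; w \<in> gwords X; x \<in> X\<rbrakk>
    \<Longrightarrow> pres_eq X R (v @ [(x, b), (x, \<not> b)] @ w) (v @ w)"
| relator: "\<lbrakk>v \<in> gwords X; w \<in> gwords X; r \<in> R; r \<in> gwords X\<rbrakk>
    \<Longrightarrow> pres_eq X R (v @ r @ w) (v @ w)"

definition pres_class ::
    "'a set \<Rightarrow> ('a \<times> bool) list set \<Rightarrow> ('a \<times> bool) list \<Rightarrow> ('a \<times> bool) list set" where
  "pres_class X R w = {v. pres_eq X R w v}"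

definition presented_group ::
    "'a set \<Rightarrow> ('a \<times> bool) list set \<Rightarrow> ('a \<times> bool) list set monoid" where
  "presented_group X R =
     \<lparr>carrier = pres_class X R ` gwords X,
      monoid.mult = (\<lambda>A B. \<Union>v\<in>A. \<Union>w\<in>B. pres_class X R (v @ w)),
      one = pres_class X R []\<rparr>"

lemma pres_eq_words: "pres_eq X R v w \<Longrightarrow> v \<in> gwords X \<and> w \<in> gwords X"
  by (induction rule: pres_eq.induct) (auto simp: gwords_def)

lemma pres_eq_left:
  assumes "pres_eq X R v w" "a \<in> gwords X" shows "pres_eq X R (a @ v) (a @ w)"
  using assms
proof (induction rule: pres_eq.induct)
  case (refl w) then show ?case by (intro pres_eq.refl) (auto simp: gwords_def)
next
  case (sym v w) then show ?case by (blast intro: pres_eq.sym)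
next
  case (trans u v w) then show ?case by (blast intro: pres_eq.trans)
next
  case (cancel v w x b)
  then show ?case using pres_eq.cancel[of "a @ v" X w x R b] by (auto simp: gwords_def image_Un)
next
  case (relator v w r)
  then show ?case using pres_eq.relator[of "a @ v" X w r R] by (auto simp: gwords_def image_Un)
qed

lemma pres_eq_right:
  assumes "pres_eq X R v w" "a \<in> gwords X" shows "pres_eq X R (v @ a) (w @ a)"
  using assms
proof (induction rule: pres_eq.induct)
  case (refl w) then show ?case by (intro pres_eq.refl) (auto simp: gwords_def)
next
  case (sym v w) then show ?case by (blast intro: pres_eq.sym)
next
  case (trans u v w) then show ?case by (blast intro: pres_eq.trans)
next
  case (cancel v w x b)
  then show ?case using pres_eq.cancel[of v X "w @ a" x R b] by (auto simp: gwords_def image_Un)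
next
  case (relator v w r)
  then show ?case using pres_eq.relator[of v X "w @ a" r R] by (auto simp: gwords_def image_Un)
qed

lemma pres_class_eq: "pres_eq X R v w \<Longrightarrow> pres_class X R v = pres_class X R w"
  unfolding pres_class_def by (blast intro: pres_eq.sym pres_eq.trans)

lemma presented_group_mult:
  assumes "v \<in> gwords X" "w \<in> gwords X"
  shows "pres_class X R v \<otimes>\<^bsub>presented_group X R\<^esub> pres_class X R w = pres_class X R (v @ w)"
proof -
  have "pres_class X R (v' @ w') = pres_class X R (v @ w)"
    if "v' \<in> pres_class X R v" "w' \<in> pres_class X R w" for v' w'
  proof -
    from that have e: "pres_eq X R v v'" "pres_eq X R w w'" by (auto simp: pres_class_def)
    have v': "v' \<in> gwords X" using pres_eq_words[OF e(1)] by blast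
    have "pres_eq X R (v @ w) (v' @ w')"
      using pres_eq.trans[OF pres_eq_right[OF e(1) assms(2)] pres_eq_left[OF e(2) v']] .
    then show ?thesis by (rule pres_class_eq[symmetric])
  qed
  moreover have "v \<in> pres_class X R v" "w \<in> pres_class X R w"
    using assms by (auto simp: pres_class_def intro: pres_eq.refl)
  ultimately have "(\<Union>v'\<in>pres_class X R v. \<Union>w'\<in>pres_class X R w. pres_class X R (v' @ w')) =
      pres_class X R (v @ w)" by blast
  then show ?thesis by (simp add: presented_group_def)
qed

lemma group_presented_group: "group (presented_group X R)"
proof (rule groupI)
  let ?G = "presented_group X R"
  have app: "v @ w \<in> gwords X" if "v \<in> gwords X" "w \<in> gwords X" for v w
    using that by (auto simp: gwords_def)
  have nil: "[] \<in> gwords X" by (simp add: gwords_def)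
  have car: "carrier ?G = pres_class X R ` gwords X" and one: "\<one>\<^bsub>?G\<^esub> = pres_class X R []"
    by (simp_all add: presented_group_def)
  show "x \<otimes>\<^bsub>?G\<^esub> y \<in> carrier ?G" if "x \<in> carrier ?G" "y \<in> carrier ?G" for x y
    using that app by (auto simp: car presented_group_mult)
  show "\<one>\<^bsub>?G\<^esub> \<in> carrier ?G" using nil by (auto simp: car one)
  show "x \<otimes>\<^bsub>?G\<^esub> y \<otimes>\<^bsub>?G\<^esub> z = x \<otimes>\<^bsub>?G\<^esub> (y \<otimes>\<^bsub>?G\<^esub> z)"
    if "x \<in> carrier ?G" "y \<in> carrier ?G" "z \<in> carrier ?G" for x y z
    using that app by (auto simp: car presented_group_mult)
  show "\<one>\<^bsub>?G\<^esub> \<otimes>\<^bsub>?G\<^esub> x = x" if "x \<in> carrier ?G" for x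
    using that nil by (auto simp: car one presented_group_mult)
  show "\<exists>y\<in>carrier ?G. y \<otimes>\<^bsub>?G\<^esub> x = \<one>\<^bsub>?G\<^esub>" if x: "x \<in> carrier ?G" for x
  proof -
    have "\<exists>v\<in>gwords X. pres_eq X R (v @ w) []" if "w \<in> gwords X" for w
      using that
    proof (induction w)
      case Nil
      have "pres_eq X R ([] @ []) []" using pres_eq.refl[OF nil] by simp
      then show ?case using nil by blast
    next
      case (Cons a w)
      then have w: "w \<in> gwords X" and a: "fst a \<in> X" by (auto simp: gwords_def)
      then obtain v where v: "v \<in> gwords X" "pres_eq X R (v @ w) []" using Cons by blast
      let ?v = "v @ [(fst a, \<not> snd a)]"
      have "pres_eq X R (?v @ a # w) (v @ w)"
        using pres_eq.cancel[of v X w "fst a" R "\<not> snd a"] v w a by simp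
      moreover have "?v \<in> gwords X" using v a by (auto simp: gwords_def)
      ultimately have "pres_eq X R (?v @ a # w) []" using v(2) pres_eq.trans by metis
      with \<open>?v \<in> gwords X\<close> show ?case by blast
    qed
    moreover obtain w where w: "w \<in> gwords X" "x = pres_class X R w" using x by (auto simp: car)
    ultimately obtain v where v: "v \<in> gwords X" "pres_eq X R (v @ w) []" by blast
    have "pres_class X R v \<otimes>\<^bsub>?G\<^esub> x = \<one>\<^bsub>?G\<^esub>"
      by (simp only: w(2) one presented_group_mult[OF v(1) w(1)] pres_class_eq[OF v(2)])
    then show ?thesis using v(1) by (auto simp: car)
  qed
qed

definition tri_relators :: "('p, 'l) geometry \<Rightarrow> nat \<Rightarrow> ('p set \<Rightarrow> 'p set) \<Rightarrow>
    ('p set \<times> 'p set \<times> 'p set) set \<Rightarrow> ('p set \<times> bool) list set" where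
  "tri_relators G n \<sigma> T =
     {[(u, True), (v, True), (w, True)] | u v w. (u, v, w) \<in> T} \<union>
     {[(u, True), (\<sigma> u, True)] | u. u \<in> Pi_all G n}"

type_synonym 'p tri_elem = "('p set \<times> bool) list set"

definition tri_group :: "('p, 'l) geometry \<Rightarrow> nat \<Rightarrow> ('p set \<Rightarrow> 'p set) \<Rightarrow>
    ('p set \<times> 'p set \<times> 'p set) set \<Rightarrow> 'p tri_elem monoid" where
  "tri_group G n \<sigma> T = presented_group (Pi_all G n) (tri_relators G n \<sigma> T)"

definition tri_gen :: "('p, 'l) geometry \<Rightarrow> nat \<Rightarrow> ('p set \<Rightarrow> 'p set) \<Rightarrow>
    ('p set \<times> 'p set \<times> 'p set) set \<Rightarrow> 'p set \<Rightarrow> 'p tri_elem" where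
  "tri_gen G n \<sigma> T u = pres_class (Pi_all G n) (tri_relators G n \<sigma> T) [(u, True)]"


section \<open>Linear monoidal categories and functors\<close>

text \<open>Composition \<open>g \<cdot> f\<close> is read right to left and \<open>\<star>\<close>, \<open>\<boxtimes>\<close> are the tensor products of objects
  and of morphisms.  \<open>Assoc X Y Z\<close> goes from \<open>(X \<star> Y) \<star> Z\<close> to \<open>X \<star> (Y \<star> Z)\<close>, \<open>Lun X\<close> from
  \<open>Uob \<star> X\<close> to \<open>X\<close> and \<open>Run X\<close> from \<open>X \<star> Uob\<close> to \<open>X\<close>; the primed fields are their inverses.\<close>

record ('o, 'm, 'k) lin_mon_cat =
  Ob :: "'o set"
  Hom :: "'o \<Rightarrow> 'o \<Rightarrow> 'm set"
  Idn :: "'o \<Rightarrow> 'm" (\<open>\<iota>\<index>\<close>)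
  Cmp :: "'m \<Rightarrow> 'm \<Rightarrow> 'm" (infixr \<open>\<cdot>\<index>\<close> 65)
  Zero :: "'o \<Rightarrow> 'o \<Rightarrow> 'm"
  Add :: "'m \<Rightarrow> 'm \<Rightarrow> 'm"
  Smul :: "'k \<Rightarrow> 'm \<Rightarrow> 'm"
  Tob :: "'o \<Rightarrow> 'o \<Rightarrow> 'o" (infixr \<open>\<star>\<index>\<close> 70)
  Tmor :: "'m \<Rightarrow> 'm \<Rightarrow> 'm" (infixr \<open>\<boxtimes>\<index>\<close> 70)
  Uob :: "'o"
  Assoc :: "'o \<Rightarrow> 'o \<Rightarrow> 'o \<Rightarrow> 'm" (\<open>\<alpha>\<index>\<close>)
  Assoc' :: "'o \<Rightarrow> 'o \<Rightarrow> 'o \<Rightarrow> 'm" (\<open>\<alpha>''\<index>\<close>)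
  Lun :: "'o \<Rightarrow> 'm"
  Lun' :: "'o \<Rightarrow> 'm"
  Run :: "'o \<Rightarrow> 'm"
  Run' :: "'o \<Rightarrow> 'm"

definition hom_sum :: "('o, 'm, 'k) lin_mon_cat \<Rightarrow> 'o \<Rightarrow> 'o \<Rightarrow> ('t \<Rightarrow> 'm) \<Rightarrow> 't list \<Rightarrow> 'm" where
  "hom_sum C X Y f ts = foldr (\<lambda>t m. Add C (f t) m) ts (Zero C X Y)"

definition is_iso :: "('o, 'm, 'k) lin_mon_cat \<Rightarrow> 'o \<Rightarrow> 'o \<Rightarrow> 'm \<Rightarrow> bool" where
  "is_iso C X Y f \<longleftrightarrow> f \<in> Hom C X Y \<and>
     (\<exists>g\<in>Hom C Y X. g \<cdot>\<^bsub>C\<^esub> f = \<iota>\<^bsub>C\<^esub> X \<and> f \<cdot>\<^bsub>C\<^esub> g = \<iota>\<^bsub>C\<^esub> Y)"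

text \<open>\<open>Fmul X Y\<close> is the coherence isomorphism from \<open>F X \<star> F Y\<close> to \<open>F (X \<star> Y)\<close>, and \<open>Funit\<close> the one
  from the unit of the target to the image of the unit.\<close>

record ('o, 'm, 'o2, 'm2) mon_functor =
  Fob :: "'o \<Rightarrow> 'o2"
  Fmor :: "'m \<Rightarrow> 'm2"
  Fmul :: "'o \<Rightarrow> 'o \<Rightarrow> 'm2"
  Funit :: "'m2"

locale linear_monoidal_functor =
  fixes C :: "('o, 'm, 'k) lin_mon_cat" and D :: "('o2, 'm2, 'k) lin_mon_cat"
    and F :: "('o, 'm, 'o2, 'm2) mon_functor"
  assumes ob: "X \<in> Ob C \<Longrightarrow> Fob F X \<in> Ob D"
    and mor: "\<lbrakk>X \<in> Ob C; Y \<in> Ob C; f \<in> Hom C X Y\<rbrakk> \<Longrightarrow> Fmor F f \<in> Hom D (Fob F X) (Fob F Y)"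
    and idn: "X \<in> Ob C \<Longrightarrow> Fmor F (\<iota>\<^bsub>C\<^esub> X) = \<iota>\<^bsub>D\<^esub> (Fob F X)"
    and cmp: "\<lbrakk>X \<in> Ob C; Y \<in> Ob C; Z \<in> Ob C; f \<in> Hom C X Y; g \<in> Hom C Y Z\<rbrakk>
          \<Longrightarrow> Fmor F (g \<cdot>\<^bsub>C\<^esub> f) = Fmor F g \<cdot>\<^bsub>D\<^esub> Fmor F f"
    and add: "\<lbrakk>X \<in> Ob C; Y \<in> Ob C; f \<in> Hom C X Y; g \<in> Hom C X Y\<rbrakk>
          \<Longrightarrow> Fmor F (Add C f g) = Add D (Fmor F f) (Fmor F g)"
    and smul: "\<lbrakk>X \<in> Ob C; Y \<in> Ob C; f \<in> Hom C X Y\<rbrakk>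
          \<Longrightarrow> Fmor F (Smul C c f) = Smul D c (Fmor F f)"
    and mul_iso: "\<lbrakk>X \<in> Ob C; Y \<in> Ob C\<rbrakk>
          \<Longrightarrow> is_iso D (Fob F X \<star>\<^bsub>D\<^esub> Fob F Y) (Fob F (X \<star>\<^bsub>C\<^esub> Y)) (Fmul F X Y)"
    and unit_iso: "is_iso D (Uob D) (Fob F (Uob C)) (Funit F)"
    and mul_natural: "\<lbrakk>X \<in> Ob C; Y \<in> Ob C; X' \<in> Ob C; Y' \<in> Ob C; f \<in> Hom C X X'; g \<in> Hom C Y Y'\<rbrakk>
          \<Longrightarrow> Fmor F (f \<boxtimes>\<^bsub>C\<^esub> g) \<cdot>\<^bsub>D\<^esub> Fmul F X Y = Fmul F X' Y' \<cdot>\<^bsub>D\<^esub> (Fmor F f \<boxtimes>\<^bsub>D\<^esub> Fmor F g)"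
    and mul_assoc: "\<lbrakk>X \<in> Ob C; Y \<in> Ob C; Z \<in> Ob C\<rbrakk>
          \<Longrightarrow> Fmor F (\<alpha>\<^bsub>C\<^esub> X Y Z) \<cdot>\<^bsub>D\<^esub> Fmul F (X \<star>\<^bsub>C\<^esub> Y) Z \<cdot>\<^bsub>D\<^esub> (Fmul F X Y \<boxtimes>\<^bsub>D\<^esub> \<iota>\<^bsub>D\<^esub> (Fob F Z)) =
              Fmul F X (Y \<star>\<^bsub>C\<^esub> Z) \<cdot>\<^bsub>D\<^esub> (\<iota>\<^bsub>D\<^esub> (Fob F X) \<boxtimes>\<^bsub>D\<^esub> Fmul F Y Z) \<cdot>\<^bsub>D\<^esub>
                \<alpha>\<^bsub>D\<^esub> (Fob F X) (Fob F Y) (Fob F Z)"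
    and unit_left: "X \<in> Ob C
          \<Longrightarrow> Fmor F (Lun C X) \<cdot>\<^bsub>D\<^esub> Fmul F (Uob C) X \<cdot>\<^bsub>D\<^esub> (Funit F \<boxtimes>\<^bsub>D\<^esub> \<iota>\<^bsub>D\<^esub> (Fob F X)) =
              Lun D (Fob F X)"
    and unit_right: "X \<in> Ob C
          \<Longrightarrow> Fmor F (Run C X) \<cdot>\<^bsub>D\<^esub> Fmul F X (Uob C) \<cdot>\<^bsub>D\<^esub> (\<iota>\<^bsub>D\<^esub> (Fob F X) \<boxtimes>\<^bsub>D\<^esub> Funit F) =
              Run D (Fob F X)"

text \<open>The composite of \<open>F\<close> with \<open>H\<close>, where \<open>E\<close> is the target category of \<open>H\<close>.\<close>

definition functor_comp :: "('o3, 'm3, 'k) lin_mon_cat \<Rightarrow> ('o2, 'm2, 'o3, 'm3) mon_functor \<Rightarrow>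
    ('o, 'm, 'o2, 'm2) mon_functor \<Rightarrow> ('o, 'm, 'o3, 'm3) mon_functor" where
  "functor_comp E H F =
     \<lparr>Fob = (\<lambda>X. Fob H (Fob F X)),
      Fmor = (\<lambda>f. Fmor H (Fmor F f)),
      Fmul = (\<lambda>X Y. Fmor H (Fmul F X Y) \<cdot>\<^bsub>E\<^esub> Fmul H (Fob F X) (Fob F Y)),
      Funit = Fmor H (Funit F) \<cdot>\<^bsub>E\<^esub> Funit H\<rparr>"


section \<open>Vector spaces and graded vector spaces\<close>

text \<open>To have a tensor product that stays within one type, vector spaces are taken to be
  finite-dimensional subspaces of the space of all functions from the type of binary trees below
  to the field.  The product of \<open>v\<close> and \<open>w\<close> is supported on trees \<open>Ipair s t\<close>, so that distinct
  tree shapes never interfere: \<open>(v, w) \<mapsto> v \<otimes> w\<close> induces an injection on the algebraic tensor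
  product of any two subspaces, and \<open>tensor_space V W\<close> is a tensor product of \<open>V\<close> and \<open>W\<close>.
  The index type is infinite, so every finite-dimensional space is isomorphic to one of these.\<close>

datatype 'b index = Iunit | Ibas 'b | Ipair "'b index" "'b index"

type_synonym ('b, 'k) vec = "'b index \<Rightarrow> 'k"

definition vscale :: "'k::field \<Rightarrow> ('i \<Rightarrow> 'k) \<Rightarrow> 'i \<Rightarrow> 'k" where
  "vscale c x = (\<lambda>i. c * x i)"

global_interpretation fvs: vector_space "vscale :: 'k::field \<Rightarrow> ('i \<Rightarrow> 'k) \<Rightarrow> 'i \<Rightarrow> 'k"
  by unfold_locales (auto simp: vscale_def fun_eq_iff algebra_simps)

definition ivec :: "'b index \<Rightarrow> ('b, 'k::field) vec" where
  "ivec i = (\<lambda>j. if j = i then 1 else 0)"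

abbreviation bas :: "'b \<Rightarrow> ('b, 'k::field) vec" where "bas u \<equiv> ivec (Ibas u)"

abbreviation one_vec :: "('b, 'k::field) vec" where "one_vec \<equiv> ivec Iunit"

definition tensor_vec :: "('b, 'k::field) vec \<Rightarrow> ('b, 'k) vec \<Rightarrow> ('b, 'k) vec" where
  "tensor_vec v w = (\<lambda>i. case i of Ipair s t \<Rightarrow> v s * w t | _ \<Rightarrow> 0)"

definition tensor_space :: "('b, 'k::field) vec set \<Rightarrow> ('b, 'k) vec set \<Rightarrow> ('b, 'k) vec set" where
  "tensor_space V W = fvs.span {tensor_vec v w | v w. v \<in> V \<and> w \<in> W}"

definition lin_on :: "('b, 'k::field) vec set \<Rightarrow> (('b, 'k) vec \<Rightarrow> ('b, 'k) vec) \<Rightarrow> bool" where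
  "lin_on V f \<longleftrightarrow> (\<forall>x\<in>V. \<forall>y\<in>V. f (x + y) = f x + f y) \<and> (\<forall>c. \<forall>x\<in>V. f (vscale c x) = vscale c (f x))"

definition tensor_map :: "('b, 'k::field) vec set \<Rightarrow> ('b, 'k) vec set \<Rightarrow>
    (('b, 'k) vec \<Rightarrow> ('b, 'k) vec) \<Rightarrow> (('b, 'k) vec \<Rightarrow> ('b, 'k) vec) \<Rightarrow> ('b, 'k) vec \<Rightarrow> ('b, 'k) vec" where
  "tensor_map V W f g = (THE h. h \<in> extensional (tensor_space V W) \<and> lin_on (tensor_space V W) h \<and>
     (\<forall>v\<in>V. \<forall>w\<in>W. h (tensor_vec v w) = tensor_vec (f v) (g w)))"

text \<open>These send \<open>(u \<otimes> v) \<otimes> w\<close> to \<open>u \<otimes> (v \<otimes> w)\<close> and back.\<close>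

definition reassoc :: "('b, 'k::field) vec \<Rightarrow> ('b, 'k) vec" where
  "reassoc x = (\<lambda>i. case i of Ipair r (Ipair s t) \<Rightarrow> x (Ipair (Ipair r s) t) | _ \<Rightarrow> 0)"

definition reassoc' :: "('b, 'k::field) vec \<Rightarrow> ('b, 'k) vec" where
  "reassoc' x = (\<lambda>i. case i of Ipair (Ipair r s) t \<Rightarrow> x (Ipair r (Ipair s t)) | _ \<Rightarrow> 0)"

text \<open>A morphism records its source, its underlying map (undefined outside the source space) and
  its target.\<close>

datatype ('o, 'v) arrow = Arr (src: 'o) (act: "'v \<Rightarrow> 'v") (tgt: 'o)

text \<open>The common shape of the two categories of interest: objects \<open>X\<close> have an underlying space
  \<open>U X\<close>, and morphisms are the linear maps satisfying \<open>pres\<close>.\<close>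

definition vec_cat :: "'o set \<Rightarrow> ('o \<Rightarrow> ('b, 'k::field) vec set) \<Rightarrow>
    ('o \<Rightarrow> (('b, 'k) vec \<Rightarrow> ('b, 'k) vec) \<Rightarrow> 'o \<Rightarrow> bool) \<Rightarrow> ('o \<Rightarrow> 'o \<Rightarrow> 'o) \<Rightarrow> 'o \<Rightarrow>
    ('o, ('o, ('b, 'k) vec) arrow, 'k) lin_mon_cat" where
  "vec_cat obs U pres ten un =
    (let mk = (\<lambda>X f Y. Arr X (restrict f (U X)) Y) in
     \<lparr>Ob = obs,
      Hom = (\<lambda>X Y. {Arr X f Y | f. f \<in> extensional (U X) \<and> lin_on (U X) f \<and> pres X f Y}),
      Idn = (\<lambda>X. mk X (\<lambda>x. x) X),
      Cmp = (\<lambda>g f. mk (src f) (\<lambda>x. act g (act f x)) (tgt g)),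
      Zero = (\<lambda>X Y. mk X (\<lambda>x. 0) Y),
      Add = (\<lambda>f g. mk (src f) (\<lambda>x. act f x + act g x) (tgt f)),
      Smul = (\<lambda>c f. mk (src f) (\<lambda>x. vscale c (act f x)) (tgt f)),
      Tob = ten,
      Tmor = (\<lambda>f g. mk (ten (src f) (src g)) (tensor_map (U (src f)) (U (src g)) (act f) (act g))
                       (ten (tgt f) (tgt g))),
      Uob = un,
      Assoc = (\<lambda>X Y Z. mk (ten (ten X Y) Z) reassoc (ten X (ten Y Z))),
      Assoc' = (\<lambda>X Y Z. mk (ten X (ten Y Z)) reassoc' (ten (ten X Y) Z)),
      Lun = (\<lambda>X. mk (ten un X) (\<lambda>x i. x (Ipair Iunit i)) X),
      Lun' = (\<lambda>X. mk X (\<lambda>x. tensor_vec one_vec x) (ten un X)),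
      Run = (\<lambda>X. mk (ten X un) (\<lambda>x i. x (Ipair i Iunit)) X),
      Run' = (\<lambda>X. mk X (\<lambda>x. tensor_vec x one_vec) (ten X un))\<rparr>)"

definition Vec :: "(('b, 'k::field) vec set, (('b, 'k) vec set, ('b, 'k) vec) arrow, 'k) lin_mon_cat" where
  "Vec = vec_cat {V. \<exists>B. finite B \<and> V = fvs.span B} (\<lambda>V. V) (\<lambda>V f W. f ` V \<subseteq> W)
           tensor_space (fvs.span {one_vec})"

text \<open>A graded space is given by its family of homogeneous components, indexed by the carrier of the
  grading group (and zero elsewhere); its total space is their internal direct sum.\<close>

type_synonym ('g, 'b, 'k) gvec = "'g \<Rightarrow> ('b, 'k) vec set"

definition total :: "('g, 'b, 'k::field) gvec \<Rightarrow> ('b, 'k) vec set" where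
  "total V = fvs.span (\<Union>g. V g)"

definition graded_spaces :: "'g monoid \<Rightarrow> ('g, 'b, 'k::field) gvec set" where
  "graded_spaces \<Gamma> = {V. (\<forall>g. fvs.subspace (V g)) \<and> (\<forall>g. g \<notin> carrier \<Gamma> \<longrightarrow> V g = {0}) \<and>
     (\<exists>B. finite B \<and> total V = fvs.span B) \<and>
     (\<forall>A x. finite A \<and> (\<forall>g\<in>A. x g \<in> V g) \<and> (\<Sum>g\<in>A. x g) = 0 \<longrightarrow> (\<forall>g\<in>A. x g = 0))}"

definition graded_tensor :: "'g monoid \<Rightarrow> ('g, 'b, 'k::field) gvec \<Rightarrow> ('g, 'b, 'k) gvec \<Rightarrow> ('g, 'b, 'k) gvec" where
  "graded_tensor \<Gamma> V W = (\<lambda>g. fvs.span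
     (\<Union>{tensor_space (V h) (W k) | h k. h \<in> carrier \<Gamma> \<and> k \<in> carrier \<Gamma> \<and> h \<otimes>\<^bsub>\<Gamma>\<^esub> k = g}))"

definition graded_unit :: "'g monoid \<Rightarrow> ('g, 'b, 'k::field) gvec" where
  "graded_unit \<Gamma> = (\<lambda>g. if g = \<one>\<^bsub>\<Gamma>\<^esub> then fvs.span {one_vec} else {0})"

definition GVec :: "'g monoid \<Rightarrow>
    (('g, 'b, 'k::field) gvec, (('g, 'b, 'k) gvec, ('b, 'k) vec) arrow, 'k) lin_mon_cat" where
  "GVec \<Gamma> = vec_cat (graded_spaces \<Gamma>) total (\<lambda>V f W. \<forall>g. f ` V g \<subseteq> W g)
              (graded_tensor \<Gamma>) (graded_unit \<Gamma>)"

definition forget :: "'g monoid \<Rightarrow> (('g, 'b, 'k::field) gvec, (('g, 'b, 'k) gvec, ('b, 'k) vec) arrow,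
    ('b, 'k) vec set, (('b, 'k) vec set, ('b, 'k) vec) arrow) mon_functor" where
  "forget \<Gamma> =
     \<lparr>Fob = total,
      Fmor = (\<lambda>f. Arr (total (src f)) (act f) (total (tgt f))),
      Fmul = (\<lambda>V W. \<iota>\<^bsub>Vec\<^esub> (tensor_space (total V) (total W))),
      Funit = \<iota>\<^bsub>Vec\<^esub> (Uob Vec)\<rparr>"

definition fiber_functor :: "('o, 'm, 'k::field) lin_mon_cat \<Rightarrow>
    ('o, 'm, ('b, 'k) vec set, (('b, 'k) vec set, ('b, 'k) vec) arrow) mon_functor \<Rightarrow> bool" where
  "fiber_functor C F \<longleftrightarrow> linear_monoidal_functor C Vec F"


section \<open>The objects and morphisms built from a triangle presentation\<close>

type_synonym ('p, 'k) tri_ob = "('p tri_elem, 'p set, 'k) gvec"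
type_synonym ('p, 'k) tri_mor = "(('p, 'k) tri_ob, ('p set, 'k) vec) arrow"

context
  fixes G :: "('p, 'l) geometry" and n :: nat and \<sigma> :: "'p set \<Rightarrow> 'p set"
    and T :: "('p set \<times> 'p set \<times> 'p set) set"
begin

abbreviation (input) "TC \<equiv> GVec (tri_group G n \<sigma> T) ::
  (('p, 'k::field) tri_ob, ('p, 'k) tri_mor, 'k) lin_mon_cat"

text \<open>Labels are integers.  The object of label \<open>0\<close> is the unit, and merges and splits with a label
  \<open>0\<close> are unitors.  An object whose label is outside \<open>0, \<dots>, n\<close> is the zero space, so that any
  composite passing through such a label is zero.\<close>

definition triV :: "int \<Rightarrow> ('p, 'k::field) tri_ob" where
  "triV a = (if a = 0 \<or> a = int n then graded_unit (tri_group G n \<sigma> T)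
     else if 0 < a \<and> a < int n
       then (\<lambda>g. fvs.span {bas u | u. u \<in> Pi_dim G (nat a) \<and> tri_gen G n \<sigma> T u = g})
     else (\<lambda>g. {0}))"

definition merge_val :: "int \<Rightarrow> int \<Rightarrow> 'p set \<Rightarrow> 'p set \<Rightarrow> ('p set, 'k::field) vec" where
  "merge_val a b u v = (if a + b = int n
     then (if v = \<sigma> u then one_vec else 0)
     else (if \<exists>w\<in>Pi_dim G (nat (a + b)). (u, v, \<sigma> w) \<in> T
           then bas (THE w. w \<in> Pi_dim G (nat (a + b)) \<and> (u, v, \<sigma> w) \<in> T) else 0))"

definition split_val :: "int \<Rightarrow> int \<Rightarrow> 'p set \<Rightarrow> ('p set, 'k::field) vec" where
  "split_val a b u =
     (\<Sum>(v, w) | v \<in> Pi_dim G (nat a) \<and> w \<in> Pi_dim G (nat b) \<and> (v, w, \<sigma> u) \<in> T.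
        tensor_vec (bas v) (bas w))"

text \<open>\<open>x (Ipair (Ibas u) (Ibas v))\<close> is the coordinate of \<open>x\<close> at \<open>u \<otimes> v\<close>, so the formulas below are
  the linear extensions of the values on basis vectors.\<close>

definition triM :: "int \<Rightarrow> int \<Rightarrow> ('p, 'k::field) tri_mor" where
  "triM a b = (if a = 0 then Lun TC (triV b)
     else if b = 0 then Run TC (triV a)
     else if 0 < a \<and> 0 < b \<and> a + b \<le> int n then
       Arr (triV a \<star>\<^bsub>TC\<^esub> triV b)
         (\<lambda>x\<in>total (triV a \<star>\<^bsub>TC\<^esub> triV b).
            \<Sum>u\<in>Pi_dim G (nat a). \<Sum>v\<in>Pi_dim G (nat b).
              vscale (x (Ipair (Ibas u) (Ibas v))) (merge_val a b u v))
         (triV (a + b))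
     else Zero TC (triV a \<star>\<^bsub>TC\<^esub> triV b) (triV (a + b)))"

definition triS :: "int \<Rightarrow> int \<Rightarrow> ('p, 'k::field) tri_mor" where
  "triS a b = (if a = 0 then Lun' TC (triV b)
     else if b = 0 then Run' TC (triV a)
     else if 0 < a \<and> 0 < b \<and> a + b < int n then
       Arr (triV (a + b))
         (\<lambda>x\<in>total (triV (a + b)).
            \<Sum>u\<in>Pi_dim G (nat (a + b)). vscale (x (Ibas u)) (split_val a b u))
         (triV a \<star>\<^bsub>TC\<^esub> triV b)
     else if 0 < a \<and> 0 < b \<and> a + b = int n then
       Arr (triV (a + b))
         (\<lambda>x\<in>total (triV (a + b)).
            vscale (x Iunit) (\<Sum>u\<in>Pi_dim G (nat a). tensor_vec (bas u) (bas (\<sigma> u))))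
         (triV a \<star>\<^bsub>TC\<^esub> triV b)
     else Zero TC (triV (a + b)) (triV a \<star>\<^bsub>TC\<^esub> triV b))"

text \<open>The identity of the unit object, which is also \<open>triV n\<close>.\<close>

definition triE :: "('p, 'k::field) tri_mor" where
  "triE = Idn TC (Uob TC)"

definition triE' :: "('p, 'k::field) tri_mor" where
  "triE' = Idn TC (Uob TC)"

end


definition int_binom :: "int \<Rightarrow> nat \<Rightarrow> int" where
  "int_binom m t = (\<Prod>i<t. m - int i) div fact t"


section \<open>The web category\<close>

datatype 'k web_term =
    WId "nat list" | WMerge nat nat | WSplit nat nat | WCross nat nat | WEv | WCoev
  | WComp "'k web_term" "'k web_term" | WTens "'k web_term" "'k web_term"
  | WZero "nat list" "nat list" | WAdd "'k web_term" "'k web_term" | WScale 'k "'k web_term"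

definition web_objects :: "nat \<Rightarrow> nat list set" where
  "web_objects n = {X. set X \<subseteq> {1..n}}"

text \<open>\<open>web_arr n X Y t\<close>: the term \<open>t\<close> denotes a morphism from \<open>X\<close> to \<open>Y\<close>.\<close>

inductive web_arr :: "nat \<Rightarrow> nat list \<Rightarrow> nat list \<Rightarrow> 'k web_term \<Rightarrow> bool" for n where
  "X \<in> web_objects n \<Longrightarrow> web_arr n X X (WId X)"
| "1 \<le> a \<Longrightarrow> 1 \<le> b \<Longrightarrow> a + b \<le> n \<Longrightarrow> web_arr n [a, b] [a + b] (WMerge a b)"
| "1 \<le> a \<Longrightarrow> 1 \<le> b \<Longrightarrow> a + b \<le> n \<Longrightarrow> web_arr n [a + b] [a, b] (WSplit a b)"
| "a \<in> {1..n} \<Longrightarrow> b \<in> {1..n} \<Longrightarrow> web_arr n [a, b] [b, a] (WCross a b)"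
| "web_arr n [n] [] WEv"
| "web_arr n [] [n] WCoev"
| "web_arr n X Y f \<Longrightarrow> web_arr n Y Z g \<Longrightarrow> web_arr n X Z (WComp g f)"
| "web_arr n X Y f \<Longrightarrow> web_arr n X' Y' g \<Longrightarrow> web_arr n (X @ X') (Y @ Y') (WTens f g)"
| "X \<in> web_objects n \<Longrightarrow> Y \<in> web_objects n \<Longrightarrow> web_arr n X Y (WZero X Y)"
| "web_arr n X Y f \<Longrightarrow> web_arr n X Y g \<Longrightarrow> web_arr n X Y (WAdd f g)"
| "web_arr n X Y f \<Longrightarrow> web_arr n X Y (WScale c f)"

text \<open>Merges, splits and crossings extended to the label \<open>0\<close>, which denotes the empty string.\<close>

definition lab :: "nat \<Rightarrow> nat list" where "lab a = (if a = 0 then [] else [a])"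

abbreviation lid :: "nat \<Rightarrow> 'k web_term" where "lid a \<equiv> WId (lab a)"

definition wmrg :: "nat \<Rightarrow> nat \<Rightarrow> 'k web_term" where
  "wmrg a b = (if a = 0 \<or> b = 0 then lid (a + b) else WMerge a b)"

definition wspl :: "nat \<Rightarrow> nat \<Rightarrow> 'k web_term" where
  "wspl a b = (if a = 0 \<or> b = 0 then lid (a + b) else WSplit a b)"

definition wcrs :: "nat \<Rightarrow> nat \<Rightarrow> 'k web_term" where
  "wcrs a b = (if a = 0 \<or> b = 0 then lid (a + b) else WCross a b)"

definition wsum :: "nat list \<Rightarrow> nat list \<Rightarrow> 'k web_term list \<Rightarrow> 'k web_term" where
  "wsum X Y ts = foldr WAdd ts (WZero X Y)"

text \<open>The defining relations.  In the bialgebra relation the composite through the label \<open>a + c\<close> is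
  zero when \<open>a + c > n\<close>; on the right hand side the labels are allowed iff \<open>a - s\<close>, \<open>b - s\<close> and
  \<open>c - b + s\<close> are nonnegative.\<close>

inductive web_rel :: "nat \<Rightarrow> nat list \<Rightarrow> nat list \<Rightarrow> 'k::field web_term \<Rightarrow> 'k web_term \<Rightarrow> bool" for n where
  merge_assoc: "a + b + c \<le> n \<Longrightarrow> web_rel n (lab a @ lab b @ lab c) (lab (a + b + c))
     (WComp (wmrg (a + b) c) (WTens (wmrg a b) (lid c)))
     (WComp (wmrg a (b + c)) (WTens (lid a) (wmrg b c)))"
| split_coassoc: "a + b + c \<le> n \<Longrightarrow> web_rel n (lab (a + b + c)) (lab a @ lab b @ lab c)
     (WComp (WTens (wspl a b) (lid c)) (wspl (a + b) c))
     (WComp (WTens (lid a) (wspl b c)) (wspl a (b + c)))"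
| bigon: "a + b \<le> n \<Longrightarrow> web_rel n (lab (a + b)) (lab (a + b))
     (WComp (wmrg a b) (wspl a b)) (WScale (of_nat ((a + b) choose a)) (lid (a + b)))"
| bialgebra: "\<lbrakk>a \<le> n; b \<le> n; c \<le> n; d \<le> n; a + c = b + d\<rbrakk>
     \<Longrightarrow> web_rel n (lab a @ lab c) (lab b @ lab d)
     (if a + c \<le> n then WComp (wspl b d) (wmrg a c) else WZero (lab a @ lab c) (lab b @ lab d))
     (wsum (lab a @ lab c) (lab b @ lab d)
        [WComp (WTens (wmrg s (b - s)) (wmrg (a - s) (c + s - b)))
          (WComp (WTens (lid s) (WTens (wcrs (a - s) (b - s)) (lid (c + s - b))))
            (WTens (wspl s (a - s)) (wspl (b - s) (c + s - b)))).
         s \<leftarrow> [0..<n + 1], s \<le> a, s \<le> b, b \<le> c + s])"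
| coev_ev: "web_rel n [n] [n] (WComp WCoev WEv) (WId [n])"
| ev_coev: "web_rel n [] [] (WComp WEv WCoev) (WId [])"
| ev_cross_left: "a \<in> {1..n} \<Longrightarrow> web_rel n [a, n] [a]
     (WComp (WTens WEv (WId [a])) (WCross a n)) (WScale ((-1) ^ a) (WTens (WId [a]) WEv))"
| ev_cross_right: "a \<in> {1..n} \<Longrightarrow> web_rel n [n, a] [a]
     (WComp (WTens (WId [a]) WEv) (WCross n a)) (WScale ((-1) ^ a) (WTens WEv (WId [a])))"

lemma web_rel_well_typed:
  assumes "web_rel n X Y f g" "1 \<le> n"
  shows "web_arr n X Y f \<and> web_arr n X Y g"
proof -
  have ob: "lab a \<in> web_objects n" if "a \<le> n" for a
    using that by (auto simp: lab_def web_objects_def)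
  have app: "X @ Y \<in> web_objects n" if "X \<in> web_objects n" "Y \<in> web_objects n" for X Y
    using that by (auto simp: web_objects_def)
  have m: "web_arr n (lab a @ lab b) (lab (a + b)) (wmrg a b)" if "a + b \<le> n" for a b
    using that ob[of "a + b"] by (auto simp: wmrg_def lab_def intro: web_arr.intros)
  have s: "web_arr n (lab (a + b)) (lab a @ lab b) (wspl a b)" if "a + b \<le> n" for a b
    using that ob[of "a + b"] by (auto simp: wspl_def lab_def intro: web_arr.intros)
  have x: "web_arr n (lab a @ lab b) (lab b @ lab a) (wcrs a b)" if "a \<le> n" "b \<le> n" for a b
    using that ob[of a] ob[of b] by (auto simp: wcrs_def lab_def intro: web_arr.intros)
  have i: "web_arr n (lab a) (lab a) (lid a)" if "a \<le> n" for a
    using that ob by (auto intro: web_arr.intros)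
  have sum: "web_arr n X Y (wsum X Y ts)"
    if "\<forall>t\<in>set ts. web_arr n X Y t" "X \<in> web_objects n" "Y \<in> web_objects n" for X Y ts
    using that by (induction ts) (auto simp: wsum_def intro: web_arr.intros)
  note C = web_arr.intros(7) and P = web_arr.intros(8)
  show ?thesis
    using assms(1)
  proof cases
    case (merge_assoc a b c)
    have "web_arr n (lab a @ lab b @ lab c) (lab (a + b + c))
        (WComp (wmrg (a + b) c) (WTens (wmrg a b) (lid c)))"
      using C[OF P[OF m[of a b] i[of c]] m[of "a + b" c]] merge_assoc by simp
    moreover have "web_arr n (lab a @ lab b @ lab c) (lab (a + b + c))
        (WComp (wmrg a (b + c)) (WTens (lid a) (wmrg b c)))"
      using C[OF P[OF i[of a] m[of b c]] m[of a "b + c"]] merge_assoc by (simp add: add.assoc)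
    ultimately show ?thesis using merge_assoc by simp
  next
    case (split_coassoc a b c)
    have "web_arr n (lab (a + b + c)) (lab a @ lab b @ lab c)
        (WComp (WTens (wspl a b) (lid c)) (wspl (a + b) c))"
      using C[OF s[of "a + b" c] P[OF s[of a b] i[of c]]] split_coassoc by simp
    moreover have "web_arr n (lab (a + b + c)) (lab a @ lab b @ lab c)
        (WComp (WTens (lid a) (wspl b c)) (wspl a (b + c)))"
      using C[OF s[of a "b + c"] P[OF i[of a] s[of b c]]] split_coassoc by (simp add: add.assoc)
    ultimately show ?thesis using split_coassoc by simp
  next
    case (bigon a b)
    then show ?thesis using C[OF s[of a b] m[of a b]] i[of "a + b"] by (auto intro: web_arr.intros)
  next
    case (bialgebra a b c d)
    let ?X = "lab a @ lab c" and ?Y = "lab b @ lab d"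
    have XY: "?X \<in> web_objects n" "?Y \<in> web_objects n"
      using bialgebra by (auto intro!: app ob)
    have "web_arr n ?X ?Y (WComp (WTens (wmrg s' (b - s')) (wmrg (a - s') (c + s' - b)))
          (WComp (WTens (lid s') (WTens (wcrs (a - s') (b - s')) (lid (c + s' - b))))
            (WTens (wspl s' (a - s')) (wspl (b - s') (c + s' - b)))))"
      if "s' \<le> a" "s' \<le> b" "b \<le> c + s'" for s'
    proof -
      have e: "a - s' + (c + s' - b) = d" "b - s' + (c + s' - b) = c" using that bialgebra by auto
      have "web_arr n ?X ((lab s' @ lab (a - s')) @ lab (b - s') @ lab (c + s' - b))
          (WTens (wspl s' (a - s')) (wspl (b - s') (c + s' - b)))"
        using P[OF s[of s' "a - s'"] s[of "b - s'" "c + s' - b"]] that bialgebra e by simp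
      moreover have "web_arr n (lab s' @ (lab (a - s') @ lab (b - s')) @ lab (c + s' - b))
          (lab s' @ (lab (b - s') @ lab (a - s')) @ lab (c + s' - b))
          (WTens (lid s') (WTens (wcrs (a - s') (b - s')) (lid (c + s' - b))))"
        using that bialgebra by (intro P i x) auto
      moreover have "web_arr n ((lab s' @ lab (b - s')) @ lab (a - s') @ lab (c + s' - b)) ?Y
          (WTens (wmrg s' (b - s')) (wmrg (a - s') (c + s' - b)))"
        using P[OF m[of s' "b - s'"] m[of "a - s'" "c + s' - b"]] that bialgebra e by simp
      ultimately show ?thesis by (auto intro: C)
    qed
    then have "web_arr n X Y g"
      unfolding bialgebra(1,2,4) using XY by (intro sum) (auto simp del: upt_Suc)
    moreover have "web_arr n X Y f"
      using C[OF m[of a c] s[of b d, folded bialgebra(9)]] XY bialgebra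
      by (auto intro: web_arr.intros)
    ultimately show ?thesis by simp
  next
    case coev_ev
    then show ?thesis using assms(2) by (auto intro!: web_arr.intros simp: web_objects_def)
  next
    case ev_coev
    then show ?thesis using assms(2) by (auto intro!: web_arr.intros simp: web_objects_def)
  next
    case (ev_cross_left a)
    have a: "web_arr n [a] [a] (WId [a])"
      using ev_cross_left by (auto intro!: web_arr.intros simp: web_objects_def)
    have "web_arr n [a, n] [n, a] (WCross a n)"
      using ev_cross_left assms(2) by (auto intro!: web_arr.intros)
    from C[OF this, of "[a]" "WTens WEv (WId [a])"] show ?thesis
      using ev_cross_left P[OF web_arr.intros(5) a] P[OF a web_arr.intros(5)]
      by (auto intro!: web_arr.intros(11))
  next
    case (ev_cross_right a)
    have a: "web_arr n [a] [a] (WId [a])"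
      using ev_cross_right by (auto intro!: web_arr.intros simp: web_objects_def)
    have "web_arr n [n, a] [a, n] (WCross n a)"
      using ev_cross_right assms(2) by (auto intro!: web_arr.intros)
    from C[OF this, of "[a]" "WTens (WId [a]) WEv"] show ?thesis
      using ev_cross_right P[OF web_arr.intros(5) a] P[OF a web_arr.intros(5)]
      by (auto intro!: web_arr.intros(11))
  qed
qed

text \<open>The congruence generated by the defining relations and the axioms of a strict linear monoidal
  category.\<close>

inductive web_eq :: "nat \<Rightarrow> nat list \<Rightarrow> nat list \<Rightarrow> 'k::field web_term \<Rightarrow> 'k web_term \<Rightarrow> bool" for n where
  rel: "web_rel n X Y f g \<Longrightarrow> web_arr n X Y f \<Longrightarrow> web_arr n X Y g \<Longrightarrow> web_eq n X Y f g"
| refl: "web_arr n X Y f \<Longrightarrow> web_eq n X Y f f"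
| sym: "web_eq n X Y f g \<Longrightarrow> web_eq n X Y g f"
| trans: "web_eq n X Y f g \<Longrightarrow> web_eq n X Y g h \<Longrightarrow> web_eq n X Y f h"
| comp_cong: "web_eq n X Y f f' \<Longrightarrow> web_eq n Y Z g g' \<Longrightarrow> web_eq n X Z (WComp g f) (WComp g' f')"
| tens_cong: "web_eq n X Y f f' \<Longrightarrow> web_eq n X' Y' g g'
    \<Longrightarrow> web_eq n (X @ X') (Y @ Y') (WTens f g) (WTens f' g')"
| add_cong: "web_eq n X Y f f' \<Longrightarrow> web_eq n X Y g g' \<Longrightarrow> web_eq n X Y (WAdd f g) (WAdd f' g')"
| scale_cong: "web_eq n X Y f f' \<Longrightarrow> web_eq n X Y (WScale c f) (WScale c f')"
| comp_id_left: "web_arr n X Y f \<Longrightarrow> web_eq n X Y (WComp (WId Y) f) f"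
| comp_id_right: "web_arr n X Y f \<Longrightarrow> web_eq n X Y (WComp f (WId X)) f"
| comp_assoc: "web_arr n W X f \<Longrightarrow> web_arr n X Y g \<Longrightarrow> web_arr n Y Z h
    \<Longrightarrow> web_eq n W Z (WComp (WComp h g) f) (WComp h (WComp g f))"
| tens_id: "X \<in> web_objects n \<Longrightarrow> Y \<in> web_objects n
    \<Longrightarrow> web_eq n (X @ Y) (X @ Y) (WTens (WId X) (WId Y)) (WId (X @ Y))"
| interchange: "\<lbrakk>web_arr n X Y f; web_arr n Y Z g; web_arr n X' Y' f'; web_arr n Y' Z' g'\<rbrakk>
    \<Longrightarrow> web_eq n (X @ X') (Z @ Z') (WTens (WComp g f) (WComp g' f'))
         (WComp (WTens g g') (WTens f f'))"
| tens_assoc: "\<lbrakk>web_arr n X X' f; web_arr n Y Y' g; web_arr n Z Z' h\<rbrakk>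
    \<Longrightarrow> web_eq n (X @ Y @ Z) (X' @ Y' @ Z') (WTens (WTens f g) h) (WTens f (WTens g h))"
| tens_unit_left: "web_arr n X Y f \<Longrightarrow> web_eq n X Y (WTens (WId []) f) f"
| tens_unit_right: "web_arr n X Y f \<Longrightarrow> web_eq n X Y (WTens f (WId [])) f"
| add_assoc: "\<lbrakk>web_arr n X Y f; web_arr n X Y g; web_arr n X Y h\<rbrakk>
    \<Longrightarrow> web_eq n X Y (WAdd (WAdd f g) h) (WAdd f (WAdd g h))"
| add_commute: "web_arr n X Y f \<Longrightarrow> web_arr n X Y g \<Longrightarrow> web_eq n X Y (WAdd f g) (WAdd g f)"
| add_zero: "web_arr n X Y f \<Longrightarrow> web_eq n X Y (WAdd f (WZero X Y)) f"
| scale_zero: "web_arr n X Y f \<Longrightarrow> web_eq n X Y (WScale 0 f) (WZero X Y)"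
| scale_one: "web_arr n X Y f \<Longrightarrow> web_eq n X Y (WScale 1 f) f"
| scale_scale: "web_arr n X Y f \<Longrightarrow> web_eq n X Y (WScale c (WScale d f)) (WScale (c * d) f)"
| scale_add_left: "web_arr n X Y f \<Longrightarrow> web_eq n X Y (WScale (c + d) f) (WAdd (WScale c f) (WScale d f))"
| scale_add_right: "web_arr n X Y f \<Longrightarrow> web_arr n X Y g
    \<Longrightarrow> web_eq n X Y (WScale c (WAdd f g)) (WAdd (WScale c f) (WScale c g))"
| comp_add_left: "\<lbrakk>web_arr n X Y f; web_arr n Y Z g; web_arr n Y Z h\<rbrakk>
    \<Longrightarrow> web_eq n X Z (WComp (WAdd g h) f) (WAdd (WComp g f) (WComp h f))"
| comp_add_right: "\<lbrakk>web_arr n X Y f; web_arr n X Y g; web_arr n Y Z h\<rbrakk>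
    \<Longrightarrow> web_eq n X Z (WComp h (WAdd f g)) (WAdd (WComp h f) (WComp h g))"
| comp_scale_left: "web_arr n X Y f \<Longrightarrow> web_arr n Y Z g
    \<Longrightarrow> web_eq n X Z (WComp (WScale c g) f) (WScale c (WComp g f))"
| comp_scale_right: "web_arr n X Y f \<Longrightarrow> web_arr n Y Z g
    \<Longrightarrow> web_eq n X Z (WComp g (WScale c f)) (WScale c (WComp g f))"
| tens_add_left: "\<lbrakk>web_arr n X Y f; web_arr n X Y g; web_arr n X' Y' h\<rbrakk>
    \<Longrightarrow> web_eq n (X @ X') (Y @ Y') (WTens (WAdd f g) h) (WAdd (WTens f h) (WTens g h))"
| tens_add_right: "\<lbrakk>web_arr n X Y h; web_arr n X' Y' f; web_arr n X' Y' g\<rbrakk>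
    \<Longrightarrow> web_eq n (X @ X') (Y @ Y') (WTens h (WAdd f g)) (WAdd (WTens h f) (WTens h g))"
| tens_scale_left: "web_arr n X Y f \<Longrightarrow> web_arr n X' Y' g
    \<Longrightarrow> web_eq n (X @ X') (Y @ Y') (WTens (WScale c f) g) (WScale c (WTens f g))"
| tens_scale_right: "web_arr n X Y f \<Longrightarrow> web_arr n X' Y' g
    \<Longrightarrow> web_eq n (X @ X') (Y @ Y') (WTens f (WScale c g)) (WScale c (WTens f g))"

definition web_class :: "nat \<Rightarrow> 'k::field web_term \<Rightarrow> 'k web_term set" where
  "web_class n f = {g. \<exists>X Y. web_eq n X Y f g}"

definition Web :: "nat \<Rightarrow> (nat list, 'k::field web_term set, 'k) lin_mon_cat" where
  "Web n =
     \<lparr>Ob = web_objects n,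
      Hom = (\<lambda>X Y. web_class n ` {f. web_arr n X Y f}),
      Idn = (\<lambda>X. web_class n (WId X)),
      Cmp = (\<lambda>A B. \<Union>g\<in>A. \<Union>f\<in>B. web_class n (WComp g f)),
      Zero = (\<lambda>X Y. web_class n (WZero X Y)),
      Add = (\<lambda>A B. \<Union>f\<in>A. \<Union>g\<in>B. web_class n (WAdd f g)),
      Smul = (\<lambda>c A. \<Union>f\<in>A. web_class n (WScale c f)),
      Tob = (@),
      Tmor = (\<lambda>A B. \<Union>f\<in>A. \<Union>g\<in>B. web_class n (WTens f g)),
      Uob = [],
      Assoc = (\<lambda>X Y Z. web_class n (WId (X @ Y @ Z))),
      Assoc' = (\<lambda>X Y Z. web_class n (WId (X @ Y @ Z))),
      Lun = (\<lambda>X. web_class n (WId X)),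
      Lun' = (\<lambda>X. web_class n (WId X)),
      Run = (\<lambda>X. web_class n (WId X)),
      Run' = (\<lambda>X. web_class n (WId X))\<rparr>"

end

theory Submission
  imports Defs "HOL-Computational_Algebra.Formal_Power_Series"
begin

text \<open>A triangle presentation makes the lattice of subspaces, with the empty subspace and the whole space
  included, into a graded partial monoid: \<open>R u v w\<close> means that \<open>u v = w\<close>, the rank is additive, and the product
  of \<open>u\<close> and \<open>v\<close> exists iff \<open>v\<close> lies in the dual \<open>sg u\<close> of \<open>u\<close>.  The exchange axiom is associativity, the rotation of triangles
  gives cancellation on both sides, and the left divisors of \<open>w\<close> are exactly the subspaces of \<open>w\<close>.
  Merges and splits are the structure constants of this monoid, so that every coefficient of a composite
  of merges and splits is a number of paths, that is, of ways to complete some products.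

  Associativity, coassociativity and rigidity express associativity and cancellation.  The remaining
  relations need counting.  As \<open>q = 1\<close> in the field, the number of subspaces of rank \<open>k\<close> in an interval of
  length \<open>r\<close> of the subspace lattice is the ordinary binomial \<open>r choose k\<close> in the field (\<open>card_ivl\<close>); this is
  bigon bursting.  A coefficient of a ladder in a square switch counts middle vertices: either
  common divisors \<open>x\<close> of \<open>u\<close> and \<open>u'\<close> (\<open>lower\<close>), or common multiples \<open>z\<close> (\<open>upper\<close>), subject to
  further products being defined.  All of them factor through the square spanned by the meet and the
  join of \<open>u\<close> and \<open>u'\<close>, and both sets are in bijection with levels of intervals, of lengths \<open>al\<close> and \<open>be\<close> with
  \<open>al - be\<close> determined by the labels (\<open>card_lower\<close>, \<open>card_upper\<close>, \<open>dims\<close>).  The square switches are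
  thus Vandermonde convolutions (\<open>switch_lower_upper\<close>, \<open>switch_upper_lower\<close>).

  For the functor on webs, the crossing becomes the alternating sum over \<open>lower\<close>.  In the bialgebra
  relation the terms are grouped by the right factor \<open>w\<close> common to \<open>v\<close> and \<open>v'\<close>; for fixed \<open>w\<close> an alternating
  Vandermonde sum leaves at most one sign, and the sum of these signs over \<open>w\<close> is a Moebius sum which
  detects whether the products \<open>u v\<close> and \<open>u' v'\<close> exist and agree (\<open>bialgebra_sum\<close>).

  On the categorical side, iterated tensor products are coordinate spaces with a basis of lists of
  subspaces in which brackets and units are invisible, and morphisms are matrices (\<open>shaped_category\<close>).  All
  relations become identities between finite sums, and the same computation serves
  graded spaces and plain spaces.  A matrix respects the grading because each product in \<open>R\<close> holds in the
  group.  Webs are interpreted by recursion on terms (\<open>sem\<close>), equivalent terms have equal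
  matrices (\<open>sem_sound\<close>), and forgetting the grading turns the functor so obtained
  into the same construction for plain spaces (\<open>forget_web_functor\<close>).\<close>


section \<open>Subspaces of a projective geometry\<close>

context projective_geometry
begin

abbreviation pts :: "'p set" where "pts \<equiv> points G"
abbreviation S :: "'p set set" where "S \<equiv> proj_subspaces G"

text \<open>The line through two distinct points; on the diagonal the description is void, so distinctness is
  carried along everywhere.\<close>

definition ln :: "'p \<Rightarrow> 'p \<Rightarrow> 'p set" where
  "ln x y = line_points G (THE l. l \<in> lines G \<and> incid G x l \<and> incid G y l)"

lemma ln_line_points:
  assumes "l \<in> lines G" "a \<in> line_points G l" "b \<in> line_points G l" "a \<noteq> b"
  shows "ln a b = line_points G l"
proof -
  have "a \<in> pts" "b \<in> pts" "incid G a l" "incid G b l" using assms by (auto simp: line_points_def)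
  with assms unique_line[of a b] have "(THE l. l \<in> lines G \<and> incid G a l \<and> incid G b l) = l"
    by (intro the1_equality) auto
  then show ?thesis by (simp add: ln_def)
qed

lemma ln_obtain:
  assumes "x \<in> pts" "y \<in> pts" "x \<noteq> y"
  obtains l where "l \<in> lines G" "ln x y = line_points G l" "x \<in> line_points G l" "y \<in> line_points G l"
proof -
  obtain l where l: "l \<in> lines G" "incid G x l" "incid G y l" using unique_line[OF assms] by blast
  with assms have "x \<in> line_points G l" "y \<in> line_points G l" by (auto simp: line_points_def)
  with l assms that ln_line_points show ?thesis by blast
qed

lemma ln_sub: "x \<in> pts \<Longrightarrow> y \<in> pts \<Longrightarrow> x \<noteq> y \<Longrightarrow> ln x y \<subseteq> pts"
  by (erule (2) ln_obtain) (auto simp: line_points_def)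

lemma ln_mem: "x \<in> pts \<Longrightarrow> y \<in> pts \<Longrightarrow> x \<noteq> y \<Longrightarrow> x \<in> ln x y \<and> y \<in> ln x y"
  by (erule (2) ln_obtain) auto

lemma ln_eq:
  assumes "x \<in> pts" "y \<in> pts" "x \<noteq> y" "a \<in> ln x y" "b \<in> ln x y" "a \<noteq> b"
  shows "ln a b = ln x y"
proof -
  obtain l where l: "l \<in> lines G" "ln x y = line_points G l" using ln_obtain assms(1-3) by blast
  then show ?thesis using ln_line_points[of l a b] assms by auto
qed

lemma sub_iff: "u \<in> S \<longleftrightarrow> u \<subseteq> pts \<and> (\<forall>x\<in>u. \<forall>y\<in>u. x \<noteq> y \<longrightarrow> ln x y \<subseteq> u)"
proof
  assume u: "u \<in> S"
  have "ln x y \<subseteq> u" if "x \<in> u" "y \<in> u" "x \<noteq> y" for x y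
  proof -
    have "x \<in> pts" "y \<in> pts" using u that by (auto simp: proj_subspaces_def)
    then obtain l where "l \<in> lines G" "ln x y = line_points G l" "x \<in> line_points G l" "y \<in> line_points G l"
      using \<open>x \<noteq> y\<close> ln_obtain by blast
    then show ?thesis using u that unfolding proj_subspaces_def line_points_def by blast
  qed
  then show "u \<subseteq> pts \<and> (\<forall>x\<in>u. \<forall>y\<in>u. x \<noteq> y \<longrightarrow> ln x y \<subseteq> u)"
    using u by (auto simp: proj_subspaces_def)
next
  assume u: "u \<subseteq> pts \<and> (\<forall>x\<in>u. \<forall>y\<in>u. x \<noteq> y \<longrightarrow> ln x y \<subseteq> u)"
  have "line_points G l \<subseteq> u" if "x \<in> u" "y \<in> u" "l \<in> lines G" "x \<noteq> y" "incid G x l" "incid G y l" for x y l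
  proof -
    have "x \<in> line_points G l" "y \<in> line_points G l" using u that by (auto simp: line_points_def)
    then have "ln x y = line_points G l" using ln_line_points that by blast
    then show ?thesis using u that by blast
  qed
  then show "u \<in> S" using u by (auto simp: proj_subspaces_def)
qed

lemma sub_pts: "u \<in> S \<Longrightarrow> u \<subseteq> pts" by (simp add: sub_iff)
lemma sub_ln: "u \<in> S \<Longrightarrow> x \<in> u \<Longrightarrow> y \<in> u \<Longrightarrow> x \<noteq> y \<Longrightarrow> ln x y \<subseteq> u" by (simp add: sub_iff)
lemma empty_sub [simp]: "{} \<in> S" by (simp add: sub_iff)
lemma pts_sub [simp]: "pts \<in> S" by (auto simp: sub_iff dest: ln_sub)
lemma Int_sub [simp]: "u \<in> S \<Longrightarrow> v \<in> S \<Longrightarrow> u \<inter> v \<in> S" by (simp add: sub_iff) blast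
lemma finite_sub: "u \<in> S \<Longrightarrow> finite u" using finite_points finite_subset sub_pts by blast
lemma finite_S [simp]: "finite S"
  by (rule finite_subset[of _ "Pow pts"]) (auto simp: finite_points sub_iff)

text \<open>The Veblen--Young axiom with all degenerate positions of the transversal absorbed: a line
  joining two distinct points on two sides of a triangle always meets the third side.\<close>

lemma pasch:
  assumes P: "c \<in> pts" "a \<in> pts" "b \<in> pts" "c \<noteq> a" "c \<noteq> b" "b \<notin> ln c a"
    and x: "x \<in> ln c a" and s: "s \<in> ln c b" and "x \<noteq> s"
  shows "\<exists>z. z \<in> ln x s \<and> z \<in> ln a b"
proof -
  have ab: "a \<noteq> b" using P ln_mem by blast
  have xs: "x \<in> pts" "s \<in> pts" using x s P ln_sub by blast+
  have mab: "a \<in> ln a b" "b \<in> ln a b" using P ab ln_mem by auto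
  have mxs: "x \<in> ln x s" "s \<in> ln x s" using xs \<open>x \<noteq> s\<close> ln_mem by auto
  have disj: "z = c" if "z \<in> ln c a" "z \<in> ln c b" for z
  proof (rule ccontr)
    assume "z \<noteq> c"
    then have "ln c z = ln c a" "ln c z = ln c b" using that P ln_mem ln_eq by metis+
    then show False using P ln_mem by metis
  qed
  consider "x = c" | "s = c" | "x = a" | "s = b" | "x \<noteq> c" "s \<noteq> c" "x \<noteq> a" "s \<noteq> b" by blast
  then show ?thesis
  proof cases
    case 1
    then have "ln x s = ln c b" using P s \<open>x \<noteq> s\<close> ln_mem ln_eq by metis
    then show ?thesis using P ln_mem mab by metis
  next
    case 2
    then have "ln x s = ln c a" using P x \<open>x \<noteq> s\<close> ln_mem ln_eq by metis
    then show ?thesis using P ln_mem mab by metis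
  next
    case 3 then show ?thesis using mab mxs by blast
  next
    case 4 then show ?thesis using mab mxs by blast
  next
    case 5
    have nc: "c \<notin> ln x s"
    proof
      assume "c \<in> ln x s"
      then have "ln c x = ln x s" using mxs xs \<open>x \<noteq> s\<close> 5 ln_eq by metis
      moreover have "ln c x = ln c a" using x P 5 ln_eq ln_mem by metis
      ultimately show False using disj mxs s 5 by auto
    qed
    have na: "a \<notin> ln x s"
    proof
      assume "a \<in> ln x s"
      then have "ln a x = ln x s" using mxs xs \<open>x \<noteq> s\<close> 5 ln_eq by metis
      moreover have "ln a x = ln c a" using x P 5 ln_eq ln_mem by metis
      ultimately show False using disj mxs s 5 by auto
    qed
    have nb: "b \<notin> ln x s"
    proof
      assume "b \<in> ln x s"
      then have "ln b s = ln x s" using mxs xs \<open>x \<noteq> s\<close> 5 ln_eq by metis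
      moreover have "ln b s = ln c b" using s P 5 ln_eq ln_mem by metis
      ultimately show False using disj mxs x 5 by auto
    qed
    obtain l1 where l1: "l1 \<in> lines G" "ln c a = line_points G l1" using ln_obtain P by metis
    obtain l2 where l2: "l2 \<in> lines G" "ln c b = line_points G l2" using ln_obtain P by metis
    obtain l3 where l3: "l3 \<in> lines G" "ln a b = line_points G l3" using ln_obtain P ab by metis
    obtain m where m: "m \<in> lines G" "ln x s = line_points G m" using ln_obtain xs \<open>x \<noteq> s\<close> by metis
    have inc: "incid G z l1 \<longleftrightarrow> z \<in> ln c a" "incid G z l2 \<longleftrightarrow> z \<in> ln c b"
      "incid G z l3 \<longleftrightarrow> z \<in> ln a b" "incid G z m \<longleftrightarrow> z \<in> ln x s" if "z \<in> pts" for z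
      using l1 l2 l3 m that by (auto simp: line_points_def)
    have "triangle G c a b"
      unfolding triangle_def
    proof (intro conjI notI)
      assume "\<exists>l\<in>lines G. incid G c l \<and> incid G a l \<and> incid G b l"
      then obtain l where "l \<in> lines G" "c \<in> line_points G l" "a \<in> line_points G l" "b \<in> line_points G l"
        using P by (auto simp: line_points_def)
      then show False using P ln_line_points by metis
    qed (use P ab in auto)
    then have "meets G m l3"
    proof (rule veblen_young[where lxy = l1 and lxz = l2])
      show "meets G m l1" using l1 m x mxs by (auto simp: meets_def)
      show "meets G m l2" using l2 m s mxs by (auto simp: meets_def)
    qed (use l1 l2 l3 m P inc[of c] inc[of a] inc[of b] ln_mem[of c a] ln_mem[of c b] mab nc na nb in auto)
    then show ?thesis using m l3 by (auto simp: meets_def)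
  qed
qed

text \<open>For a point \<open>x\<close> outside a subspace \<open>U\<close> this is already the subspace generated by both.\<close>

definition cone :: "'p \<Rightarrow> 'p set \<Rightarrow> 'p set" where
  "cone x U = {x} \<union> (\<Union>y\<in>U. ln x y)"

lemma cone_iff: "p \<in> cone x U \<longleftrightarrow> p = x \<or> (\<exists>y\<in>U. p \<in> ln x y)" by (auto simp: cone_def)

lemma sub_cone:
  assumes "U \<in> S" "x \<in> pts" "x \<notin> U" shows "U \<subseteq> cone x U"
proof
  fix y assume "y \<in> U"
  then have "y \<in> ln x y" using assms ln_mem[of x y] sub_pts by auto
  with \<open>y \<in> U\<close> show "y \<in> cone x U" by (auto simp: cone_iff)
qed

text \<open>Veblen--Young makes the union of lines closed: for \<open>p\<close> on \<open>x y\<close> and \<open>r\<close> on \<open>x z\<close>, the line \<open>p r\<close>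
  meets \<open>y z\<close> and hence \<open>U\<close>, so only lines from a point of the cone to a point of \<open>U\<close> remain; a point \<open>s\<close> of
  such a line is projected from \<open>x\<close> into \<open>U\<close> by a second use of the axiom.\<close>

lemma cone_sub:
  assumes U: "U \<in> S" and x: "x \<in> pts" "x \<notin> U"
  shows "cone x U \<in> S"
proof -
  have ne: "y \<in> pts" "x \<noteq> y" if "y \<in> U" for y using that U x sub_pts by auto
  have pt: "p \<in> pts" if "p \<in> cone x U" for p
    using that ne ln_sub[of x] x by (auto simp: cone_iff)
  have meet: "z = y" if "y \<in> U" "z \<in> U" "z \<in> ln x y" for y z
  proof (rule ccontr)
    assume "z \<noteq> y"
    then have "ln z y = ln x y" using that ne ln_eq ln_mem x by metis
    moreover have "ln z y \<subseteq> U" using that U \<open>z \<noteq> y\<close> sub_ln by blast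
    moreover have "x \<in> ln x y" using ne ln_mem x that by metis
    ultimately show False using x by blast
  qed
  \<comment> \<open>A line through a point of \<open>U\<close> and another point of the cone stays in the cone.\<close>
  have step: "s \<in> cone x U"
    if y: "y \<in> U" and p: "p \<in> ln x y" "p \<noteq> x" and z: "z \<in> U" "z \<noteq> p" and s: "s \<in> ln p z" for p y z s
  proof -
    have pp: "p \<in> pts" "z \<in> pts" "y \<in> pts" using p x ne ln_sub y z by blast+
    consider "p = y" | "z = y" "p \<noteq> y" | "s = x" | "z \<noteq> y" "p \<noteq> y" "s \<noteq> x" by blast
    then show ?thesis
    proof cases
      case 1
      then have "s \<in> U" using sub_ln[OF U] y z s by blast
      then show ?thesis using sub_cone U x by blast
    next
      case 2
      then have "ln p z = ln x y" using ln_eq[of x y p z] ne[OF y] x p ln_mem by auto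
      then show ?thesis using s y by (auto simp: cone_iff)
    next
      case 3 then show ?thesis by (simp add: cone_iff)
    next
      case 4
      have l: "ln p y = ln x y" using ln_eq[of x y p y] ne[OF y] x p ln_mem 4 by auto
      have "z \<notin> ln p y" using l meet y z 4 by auto
      moreover have "x \<in> ln p y" using l ne[OF y] x ln_mem by auto
      ultimately obtain o' where o': "o' \<in> ln x s" "o' \<in> ln y z"
        using pasch[of p y z x s] pp 4 z s by auto
      have "o' \<in> U" using o' sub_ln[OF U] y z 4 by blast
      have "s \<in> pts" using s pp z ln_sub[of p z] by auto
      have "ln x o' = ln x s" using ln_eq[of x s x o'] x \<open>s \<in> pts\<close> 4 o' ln_mem[of x s] \<open>o' \<in> U\<close> by auto
      moreover have "s \<in> ln x s" using ln_mem[of x s] x \<open>s \<in> pts\<close> 4 by auto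
      ultimately show ?thesis using \<open>o' \<in> U\<close> by (auto simp: cone_iff)
    qed
  qed
  have "ln p r \<subseteq> cone x U" if pc: "p \<in> cone x U" and rc: "r \<in> cone x U" and "p \<noteq> r" for p r
  proof
    fix s assume s: "s \<in> ln p r"
    have pr: "p \<in> pts" "r \<in> pts" using pt pc rc by auto
    consider (px) "p = x" | (rx) "r = x" | (other) "p \<noteq> x" "r \<noteq> x" by blast
    then show "s \<in> cone x U"
    proof cases
      case px
      then obtain y where "y \<in> U" "r \<in> ln x y" using rc \<open>p \<noteq> r\<close> by (auto simp: cone_iff)
      moreover then have "ln p r = ln x y" using ln_eq[of x y p r] ne x px \<open>p \<noteq> r\<close> ln_mem[of x y] by auto
      ultimately show ?thesis using s by (auto simp: cone_iff)
    next
      case rx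
      then obtain y where "y \<in> U" "p \<in> ln x y" using pc \<open>p \<noteq> r\<close> by (auto simp: cone_iff)
      moreover then have "ln p r = ln x y" using ln_eq[of x y p r] ne x rx \<open>p \<noteq> r\<close> ln_mem[of x y] by auto
      ultimately show ?thesis using s by (auto simp: cone_iff)
    next
      case other
      then obtain y z where yz: "y \<in> U" "p \<in> ln x y" "z \<in> U" "r \<in> ln x z" using pc rc by (auto simp: cone_iff)
      show ?thesis
      proof (cases "y = z")
        case True
        then have "ln p r = ln x y" using ln_eq[of x y p r] ne x yz \<open>p \<noteq> r\<close> by auto
        then show ?thesis using s yz by (auto simp: cone_iff)
      next
        case False
        have "z \<notin> ln x y" using meet yz False by blast
        then obtain o' where o': "o' \<in> ln p r" "o' \<in> ln y z"
          using pasch[of x y z p r] yz ne x \<open>p \<noteq> r\<close> by auto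
        then have oU: "o' \<in> U" using sub_ln[OF U] yz False by blast
        show ?thesis
        proof (cases "o' = p")
          case False
          then have "ln p o' = ln p r" using ln_eq[of p r p o'] pr \<open>p \<noteq> r\<close> o' ln_mem[of p r] by auto
          then show ?thesis using step[of y p o' s] yz other oU False s by auto
        next
          case True
          then have "ln r o' = ln p r" using ln_eq[of p r r o'] pr \<open>p \<noteq> r\<close> o' ln_mem[of p r] True by auto
          then show ?thesis using step[of z r o' s] yz other oU True \<open>p \<noteq> r\<close> s by auto
        qed
      qed
    qed
  qed
  then show ?thesis using pt by (auto simp: sub_iff)
qed

lemma cone_least: "W \<in> S \<Longrightarrow> U \<subseteq> W \<Longrightarrow> x \<in> W \<Longrightarrow> x \<notin> U \<Longrightarrow> cone x U \<subseteq> W"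
  by (auto simp: cone_iff) (metis sub_ln subsetD)

lemma cone_exchange:
  assumes U: "U \<in> S" and x: "x \<in> pts" "x \<notin> U" and p: "p \<in> cone x U" "p \<notin> U"
  shows "cone p U = cone x U"
proof -
  have pp: "p \<in> pts" using cone_sub[OF U x] p sub_pts by blast
  have "x \<in> cone p U"
  proof (cases "p = x")
    case False
    then obtain y where y: "y \<in> U" "p \<in> ln x y" using p by (auto simp: cone_iff)
    then have yy: "y \<in> pts" "x \<noteq> y" "p \<noteq> y" using U sub_pts x p by auto
    then have "ln p y = ln x y" using ln_eq[of x y p y] x y ln_mem by auto
    then show ?thesis using y ln_mem[of x y] yy x by (auto simp: cone_iff)
  qed (simp add: cone_iff)
  then have "cone x U \<subseteq> cone p U" using cone_least[of "cone p U" U x] cone_sub sub_cone U x pp p by auto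
  moreover have "cone p U \<subseteq> cone x U" using cone_least[of "cone x U" U p] cone_sub sub_cone U x pp p by auto
  ultimately show ?thesis by blast
qed

text \<open>Hyperplanes are described by generation instead of maximality: a point outside together with \<open>H\<close>
  reaches every point of \<open>W\<close> by a single line, which is the form in which intersections can be controlled.\<close>

definition hyp :: "'p set \<Rightarrow> 'p set \<Rightarrow> bool" where
  "hyp H W \<longleftrightarrow> H \<in> S \<and> W \<in> S \<and> H \<subset> W \<and> (\<forall>x\<in>W - H. W = cone x H)"

lemma hyp_cone: "U \<in> S \<Longrightarrow> x \<in> pts \<Longrightarrow> x \<notin> U \<Longrightarrow> hyp U (cone x U)"
  unfolding hyp_def
proof (intro conjI ballI)
  assume a: "U \<in> S" "x \<in> pts" "x \<notin> U"
  show "cone x U \<in> S" using a cone_sub by blast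
  have "x \<in> cone x U" by (simp add: cone_iff)
  then show "U \<subset> cone x U" using a sub_cone by blast
  show "cone x U = cone p U" if "p \<in> cone x U - U" for p using cone_exchange a that by blast
qed

lemma hyp_exists:
  assumes "U \<in> S" "W \<in> S" "U \<subset> W"
  obtains H where "hyp H W" "U \<subseteq> H"
proof -
  let ?A = "{H \<in> S. U \<subseteq> H \<and> H \<subset> W}"
  have "finite ?A" "U \<in> ?A" using assms by auto
  then have "\<exists>H\<in>?A. U \<subseteq> H \<and> (\<forall>K\<in>?A. H \<subseteq> K \<longrightarrow> H = K)"
    by (rule finite_has_maximal2)
  then obtain H where H: "H \<in> ?A" "U \<subseteq> H" "\<forall>K\<in>?A. H \<subseteq> K \<longrightarrow> H = K" by blast
  have "W = cone x H" if "x \<in> W - H" for x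
  proof (rule ccontr)
    assume ne: "W \<noteq> cone x H"
    have x: "x \<in> pts" "x \<notin> H" "H \<in> S" using that assms sub_pts H by auto
    then have "cone x H \<subseteq> W" using cone_least[of W H x] assms H that by auto
    then have "cone x H \<in> ?A" using ne cone_sub[of H x] x sub_cone[of H x] H by auto
    then have "cone x H = H" using H sub_cone[of H x] x by blast
    then show False using x cone_iff[of x x H] by blast
  qed
  then have "hyp H W" using H assms by (auto simp: hyp_def)
  then show ?thesis using that H by blast
qed

text \<open>A line of \<open>W\<close> always meets a hyperplane of \<open>W\<close>; hence intersecting with a hyperplane lowers
  a subspace by at most one step.\<close>

lemma hyp_Int:
  assumes H: "hyp H W" and U: "U \<in> S" "U \<subseteq> W" "\<not> U \<subseteq> H"
  shows "hyp (U \<inter> H) U"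
  unfolding hyp_def
proof (intro conjI ballI)
  have HS: "H \<in> S" "W \<in> S" "H \<subset> W" using H by (auto simp: hyp_def)
  show "U \<inter> H \<in> S" "U \<in> S" "U \<inter> H \<subset> U" using HS U by auto
  fix x assume x: "x \<in> U - U \<inter> H"
  then have xp: "x \<in> pts" "x \<notin> H" using U sub_pts by auto
  have "U \<subseteq> cone x (U \<inter> H)"
  proof
    fix p assume p: "p \<in> U"
    show "p \<in> cone x (U \<inter> H)"
    proof (cases "p = x")
      case False
      have "W = cone x H" using H x U by (auto simp: hyp_def)
      then obtain y where y: "y \<in> H" "p \<in> ln x y" using p U False cone_iff[of p x H] by blast
      have yp: "y \<in> pts" "x \<noteq> y" using y HS sub_pts xp by auto
      then have "ln x p = ln x y" using ln_eq[of x y x p] xp y ln_mem False by auto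
      moreover have "y \<in> ln x y" using yp xp ln_mem by auto
      moreover have "ln x p \<subseteq> U" using sub_ln U p x False by auto
      ultimately show ?thesis using y by (auto simp: cone_iff)
    qed (simp add: cone_iff)
  qed
  moreover have "cone x (U \<inter> H) \<subseteq> U" using cone_least[of U "U \<inter> H" x] U x by auto
  ultimately show "U = cone x (U \<inter> H)" by blast
qed

text \<open>The empty subspace has no chain of nonempty subspaces, so its rank has to be set separately.\<close>

definition rk :: "'p set \<Rightarrow> nat" where "rk U = (if U = {} then 0 else alg_dim G U)"

definition chains :: "'p set \<Rightarrow> 'p set list set" where
  "chains u = {c. c \<noteq> [] \<and> sorted_wrt (\<subset>) c \<and> set c \<subseteq> proj_subspaces G - {{}} \<and> last c = u}"

lemma alg_dim_chains: "alg_dim G u = Max (length ` chains u)"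
  unfolding alg_dim_def chains_def by (rule arg_cong[where f = Max]) blast

lemma finite_chain_lengths: "finite (length ` chains u)"
proof -
  have "length c \<le> card S" if "c \<in> chains u" for c
  proof -
    have "distinct c" using that by (auto simp: chains_def distinct_conv_nth sorted_wrt_iff_nth_less)
        (metis linorder_neqE_nat psubset_eq)
    then have "length c = card (set c)" by (simp add: distinct_card)
    also have "\<dots> \<le> card S" using that by (intro card_mono) (auto simp: chains_def)
    finally show ?thesis .
  qed
  then show ?thesis by (auto intro!: finite_subset[of "length ` chains u" "{..card S}"])
qed

lemma chain_le: "c \<in> chains u \<Longrightarrow> length c \<le> alg_dim G u"
  unfolding alg_dim_chains using finite_chain_lengths by auto

lemma singleton_chain: "u \<in> S \<Longrightarrow> u \<noteq> {} \<Longrightarrow> [u] \<in> chains u" by (auto simp: chains_def)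

lemma alg_dim_attained:
  assumes "u \<in> S" "u \<noteq> {}" obtains c where "c \<in> chains u" "length c = alg_dim G u"
proof -
  have "length ` chains u \<noteq> {}" using singleton_chain assms by auto
  from Max_in[OF finite_chain_lengths this] that show ?thesis by (auto simp: alg_dim_chains)
qed

lemma rk_less:
  assumes "U \<in> S" "W \<in> S" "U \<subset> W" shows "rk U < rk W"
proof (cases "U = {}")
  case True
  then have "W \<noteq> {}" using assms by blast
  then show ?thesis using chain_le[OF singleton_chain[of W]] assms True by (auto simp: rk_def)
next
  case False
  then obtain c where c: "c \<in> chains U" "length c = alg_dim G U" using alg_dim_attained assms by blast
  have "sorted_wrt (\<subset>) (c @ [W])"
  proof -
    have "x \<subset> W" if "x \<in> set c" for x
    proof -
      have "c = butlast c @ [U]" using c append_butlast_last_id[of c] by (auto simp: chains_def)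
      moreover have "sorted_wrt (\<subset>) c" using c by (simp add: chains_def)
      ultimately have "x \<subset> U \<or> x = U" using that by (metis Un_iff empty_iff insert_iff list.set(1) list.simps(15) set_append sorted_wrt_append)
      then show ?thesis using assms by auto
    qed
    then show ?thesis using c by (auto simp: chains_def sorted_wrt_append)
  qed
  then have "c @ [W] \<in> chains W" using c assms by (auto simp: chains_def)
  from chain_le[OF this] show ?thesis using c False assms by (auto simp: rk_def)
qed

lemma rk_mono: "U \<in> S \<Longrightarrow> W \<in> S \<Longrightarrow> U \<subseteq> W \<Longrightarrow> rk U \<le> rk W"
  using rk_less[of U W] by (cases "U = W") (auto simp: psubset_eq)

lemma rk_empty [simp]: "rk {} = 0" by (simp add: rk_def)

lemma rk_eq: "U \<in> S \<Longrightarrow> W \<in> S \<Longrightarrow> U \<subseteq> W \<Longrightarrow> rk U = rk W \<Longrightarrow> U = W"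
  using rk_less[of U W] by auto

lemma rk_zero: "U \<in> S \<Longrightarrow> rk U = 0 \<longleftrightarrow> U = {}"
  using rk_eq[of "{}" U] by auto

text \<open>Drop the last member of a longest chain.\<close>

lemma rk_pred:
  assumes "W \<in> S" "W \<noteq> {}" shows "\<exists>V\<in>S. V \<subset> W \<and> rk W = rk V + 1"
proof -
  obtain c where c: "c \<in> chains W" "length c = alg_dim G W" using alg_dim_attained assms by blast
  then have cW: "c = butlast c @ [W]" using append_butlast_last_id[of c] by (auto simp: chains_def)
  show ?thesis
  proof (cases "butlast c = []")
    case True
    then have "length c = 1" using cW by (metis One_nat_def append_Nil length_Cons list.size(3))
    then have "rk W = 1" using c assms by (simp add: rk_def)
    then show ?thesis using assms by (intro bexI[of _ "{}"]) auto
  next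
    case False
    define V where "V = last (butlast c)"
    have Vc: "V \<in> set (butlast c)" using False by (simp add: V_def)
    have "sorted_wrt (\<subset>) (butlast c @ [W])" using c cW by (simp add: chains_def)
    then have "sorted_wrt (\<subset>) (butlast c)" by (simp add: sorted_wrt_append)
    then have bc: "butlast c \<in> chains V"
      using c False unfolding chains_def V_def by (auto dest: in_set_butlastD)
    have VW: "V \<subset> W" using \<open>sorted_wrt (\<subset>) (butlast c @ [W])\<close> Vc by (simp add: sorted_wrt_append)
    have VS: "V \<in> S" "V \<noteq> {}" using Vc bc by (auto simp: chains_def)
    then have "length c - 1 \<le> rk V" using chain_le[OF bc] by (simp add: rk_def)
    then have "rk W \<le> rk V + 1" using c assms by (simp add: rk_def)
    then show ?thesis using rk_less[of V W] VS VW assms by (intro bexI[of _ V]) auto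
  qed
qed

text \<open>Two hyperplanes of \<open>W\<close> meet in a hyperplane of each of them; by induction they have equal rank,
  and one of them lies above the last but one member of a longest chain.\<close>

lemma rk_hyp: "hyp H W \<Longrightarrow> rk W = rk H + 1"
proof (induction "card W" arbitrary: H W rule: less_induct)
  case less
  then have HW: "H \<in> S" "W \<in> S" "H \<subset> W" by (auto simp: hyp_def)
  obtain V where V: "V \<in> S" "V \<subset> W" "rk W = rk V + 1" using rk_pred[of W] HW by auto
  obtain K where K: "hyp K W" "V \<subseteq> K" using hyp_exists V HW by metis
  then have KS: "K \<in> S" "K \<subset> W" by (auto simp: hyp_def)
  have "rk V \<le> rk K" "rk K < rk W" using rk_mono[of V K] rk_less[of K W] V K KS HW by auto
  then have "rk W = rk K + 1" using V by auto
  moreover have "rk K = rk H"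
  proof (cases "K = H")
    case False
    have "\<not> K \<subseteq> H" "\<not> H \<subseteq> K"
    proof -
      have *: False if ab: "hyp A W" "hyp B W" "A \<subset> B" for A B
      proof -
        obtain x where x: "x \<in> B - A" using ab by auto
        then have "W = cone x A" using ab unfolding hyp_def by blast
        also have "\<dots> \<subseteq> B" using cone_least[of B A x] that x by (auto simp: hyp_def)
        finally show False using that by (auto simp: hyp_def)
      qed
      show "\<not> K \<subseteq> H" "\<not> H \<subseteq> K" using *[of K H] *[of H K] False K less by auto
    qed
    then have "hyp (K \<inter> H) K" "hyp (H \<inter> K) H"
      using hyp_Int[of H W K] hyp_Int[of K W H] less.prems K HW KS by auto
    moreover have "card K < card W" "card H < card W"
      using HW KS finite_sub psubset_card_mono by auto
    ultimately have "rk K = rk (K \<inter> H) + 1" "rk H = rk (H \<inter> K) + 1" using less.hyps by auto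
    then show ?thesis by (simp add: Int_commute)
  qed simp
  ultimately show ?case by simp
qed

lemma rk_cone: "U \<in> S \<Longrightarrow> x \<in> pts \<Longrightarrow> x \<notin> U \<Longrightarrow> rk (cone x U) = rk U + 1"
  using rk_hyp hyp_cone by blast

text \<open>Passing to a hyperplane that contains \<open>U\<close> lowers \<open>W\<close> by one and \<open>V\<close> by at most one.\<close>

lemma rk_Int_ge:
  assumes "U \<in> S" "V \<in> S" "W \<in> S" "U \<subseteq> W" "V \<subseteq> W"
  shows "rk U + rk V \<le> rk W + rk (U \<inter> V)"
  using assms
proof (induction "card W" arbitrary: W V rule: less_induct)
  case less
  show ?case
  proof (cases "U = W")
    case True then show ?thesis using less by (simp add: Int_absorb1)
  next
    case False
    then obtain H where H: "hyp H W" "U \<subseteq> H" using hyp_exists less.prems by (metis psubsetI)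
    then have HS: "H \<in> S" "H \<subset> W" by (auto simp: hyp_def)
    have "card H < card W" using HS less.prems finite_sub psubset_card_mono by blast
    then have "rk U + rk (V \<inter> H) \<le> rk H + rk (U \<inter> (V \<inter> H))" using less.hyps[of H "V \<inter> H"] less.prems HS H by auto
    moreover have "U \<inter> (V \<inter> H) = U \<inter> V" using H by blast
    moreover have "rk V \<le> rk (V \<inter> H) + 1"
    proof (cases "V \<subseteq> H")
      case True then show ?thesis by (simp add: Int_absorb2)
    next
      case False then show ?thesis using rk_hyp[OF hyp_Int[OF H(1)]] less.prems by auto
    qed
    ultimately show ?thesis using rk_hyp[OF H(1)] by simp
  qed
qed

definition jn :: "'p set \<Rightarrow> 'p set \<Rightarrow> 'p set" where "jn U V = \<Inter>{W \<in> S. U \<subseteq> W \<and> V \<subseteq> W}"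

lemma jn_sub [simp]:
  assumes "U \<in> S" "V \<in> S" shows "jn U V \<in> S"
proof -
  have ne: "pts \<in> {W \<in> S. U \<subseteq> W \<and> V \<subseteq> W}" using assms sub_pts by auto
  then have "jn U V \<subseteq> pts" by (auto simp: jn_def)
  moreover have "ln x y \<subseteq> jn U V" if "x \<in> jn U V" "y \<in> jn U V" "x \<noteq> y" for x y
    using that sub_ln unfolding jn_def by blast
  ultimately show ?thesis by (auto simp: sub_iff)
qed

lemma jn_upper1: "U \<subseteq> jn U V" and jn_upper2: "V \<subseteq> jn U V" by (auto simp: jn_def)
lemma jn_least: "W \<in> S \<Longrightarrow> U \<subseteq> W \<Longrightarrow> V \<subseteq> W \<Longrightarrow> jn U V \<subseteq> W" by (auto simp: jn_def)

text \<open>Building \<open>V\<close> up from \<open>U \<inter> V\<close> by cones, each cone costs the join at most one step.\<close>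

lemma rk_join_le:
  assumes "U \<in> S" "V \<in> S"
  shows "\<exists>W\<in>S. U \<subseteq> W \<and> V \<subseteq> W \<and> rk W + rk (U \<inter> V) \<le> rk U + rk V"
  using assms
proof (induction "card V" arbitrary: V rule: less_induct)
  case less
  show ?case
  proof (cases "V \<subseteq> U")
    case True then show ?thesis using less by (intro bexI[of _ U]) (auto simp: Int_absorb1)
  next
    case False
    then obtain H where H: "hyp H V" "U \<inter> V \<subseteq> H" using hyp_exists[of "U \<inter> V" V] less.prems by auto
    then have HS: "H \<in> S" "H \<subset> V" by (auto simp: hyp_def)
    have "card H < card V" using HS less.prems finite_sub psubset_card_mono by blast
    then obtain W where W: "W \<in> S" "U \<subseteq> W" "H \<subseteq> W" "rk W + rk (U \<inter> H) \<le> rk U + rk H"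
      using less.hyps[of H] less.prems HS by auto
    have UH: "U \<inter> H = U \<inter> V" using H HS by blast
    obtain x where x: "x \<in> V - H" using HS by blast
    then have V: "V = cone x H" using H by (auto simp: hyp_def)
    show ?thesis
    proof (cases "x \<in> W")
      case True
      then have "V \<subseteq> W" using V cone_least[of W H x] W x by auto
      then show ?thesis using W UH rk_hyp[OF H(1)] by (intro bexI[of _ W]) auto
    next
      case False
      have xp: "x \<in> pts" using x less.prems sub_pts by blast
      have "cone x H \<subseteq> cone x W" using W by (auto simp: cone_def)
      then show ?thesis using W UH rk_hyp[OF H(1)] V rk_cone[of W x] xp False sub_cone[of W x] cone_sub[of W x]
        by (intro bexI[of _ "cone x W"]) auto
    qed
  qed
qed

lemma rk_modular:
  assumes "U \<in> S" "V \<in> S" shows "rk (jn U V) + rk (U \<inter> V) = rk U + rk V"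
proof (rule antisym)
  show "rk U + rk V \<le> rk (jn U V) + rk (U \<inter> V)" using rk_Int_ge assms jn_upper1 jn_upper2 by simp
  obtain W where W: "W \<in> S" "U \<subseteq> W" "V \<subseteq> W" "rk W + rk (U \<inter> V) \<le> rk U + rk V"
    using rk_join_le assms by blast
  then have "rk (jn U V) \<le> rk W" using rk_mono jn_least assms by simp
  then show "rk (jn U V) + rk (U \<inter> V) \<le> rk U + rk V" using W by simp
qed

end

section \<open>Counting subspaces when the order is one in the field\<close>

locale ordered_geometry = projective_geometry G for G :: "('p, 'l) geometry" +
  fixes q :: nat
  assumes order: "has_order G q"
begin

lemma card_ln: "x \<in> pts \<Longrightarrow> y \<in> pts \<Longrightarrow> x \<noteq> y \<Longrightarrow> card (ln x y) = q + 1"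
  using ln_obtain order by (metis has_order_def)

text \<open>The lines from \<open>x\<close> to the points of \<open>U\<close> share no point except \<open>x\<close>.\<close>

lemma card_cone:
  assumes U: "U \<in> S" and x: "x \<in> pts" "x \<notin> U"
  shows "card (cone x U) = 1 + q * card U"
proof -
  have ne: "y \<in> pts" "x \<noteq> y" if "y \<in> U" for y using that U x sub_pts by auto
  have mem: "x \<in> ln x y" "y \<in> ln x y" "ln x y \<subseteq> pts" if "y \<in> U" for y
    using ne[OF that] ln_mem[of x y] ln_sub[of x y] x by auto
  have c: "card (ln x y - {x}) = q" if "y \<in> U" for y
    using card_ln[of x y] ne[OF that] mem[OF that] x by simp
  have fin: "finite (ln x y - {x})" if "y \<in> U" for y
    using mem[OF that] finite_points finite_subset by blast
  have disj: "(ln x y - {x}) \<inter> (ln x z - {x}) = {}" if yz: "y \<in> U" "z \<in> U" "y \<noteq> z" for y z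
  proof (rule ccontr)
    assume "\<not> ?thesis"
    then obtain p where p: "p \<in> ln x y" "p \<in> ln x z" "p \<noteq> x" by blast
    have "ln x p = ln x y" "ln x p = ln x z"
      using ln_eq[of x y x p] ln_eq[of x z x p] x ne[OF yz(1)] ne[OF yz(2)] p mem[OF yz(1)] mem[OF yz(2)] by auto
    then have "z \<in> ln x y" using mem[OF yz(2)] by auto
    then have "ln y z = ln x y" using ln_eq[of x y y z] x ne[OF yz(1)] mem[OF yz(1)] yz by auto
    moreover have "ln y z \<subseteq> U" using sub_ln U yz by blast
    ultimately show False using mem[OF yz(1)] x by auto
  qed
  have "cone x U = {x} \<union> (\<Union>y\<in>U. ln x y - {x})" by (auto simp: cone_def)
  also have "card \<dots> = card {x} + card (\<Union>y\<in>U. ln x y - {x})"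
    using fin finite_sub[OF U] by (intro card_Un_disjoint) auto
  also have "card (\<Union>y\<in>U. ln x y - {x}) = (\<Sum>y\<in>U. card (ln x y - {x}))"
    using fin finite_sub[OF U] disj by (intro card_UN_disjoint) auto
  also have "\<dots> = q * card U" using c by simp
  finally show ?thesis by simp
qed

lemma card_hyp: "hyp H W \<Longrightarrow> card W = 1 + q * card H"
proof -
  assume H: "hyp H W"
  then obtain x where "x \<in> W - H" by (auto simp: hyp_def)
  with H card_cone[of H x] show ?thesis using sub_pts by (auto simp: hyp_def)
qed

lemma card_sub: "U \<in> S \<Longrightarrow> card U = (\<Sum>i<rk U. q ^ i)"
proof (induction "rk U" arbitrary: U)
  case 0
  then show ?case using rk_zero[of U] by simp
next
  case (Suc r)
  then have "{} \<subset> U" by auto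
  then obtain H where H: "hyp H U" using hyp_exists[of "{}" U] Suc.prems by auto
  then have "rk U = rk H + 1" "H \<in> S" using rk_hyp by (auto simp: hyp_def)
  then have "card U = 1 + q * (\<Sum>i<r. q ^ i)" "rk U = Suc r" using Suc card_hyp[OF H] by auto
  then show ?case by (simp only: sum.lessThan_Suc_shift) (simp add: sum_distrib_left)
qed

lemma card_diff_hyp:
  assumes "hyp H W" shows "card (W - H) = q ^ rk H"
proof -
  have HW: "H \<in> S" "W \<in> S" "H \<subseteq> W" using assms by (auto simp: hyp_def)
  then have "card (W - H) = card W - card H" using finite_sub card_Diff_subset by blast
  then show ?thesis using card_sub[of H] card_sub[of W] HW rk_hyp[OF assms] by simp
qed

lemma cover_cone:
  assumes "K \<in> S" "U \<in> S" "K \<subseteq> U" "rk U = rk K + 1" "p \<in> U" "p \<notin> K"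
  shows "U = cone p K"
proof -
  have p: "p \<in> pts" using assms sub_pts by blast
  show ?thesis using rk_eq[of "cone p K" U] cone_least[of U K p] rk_cone[of K p] cone_sub[of K p] p assms by auto
qed

text \<open>The covers of \<open>K\<close> that leave the hyperplane \<open>H\<close> cut the \<open>q ^ rk H\<close> points outside \<open>H\<close> into
  blocks of size \<open>q ^ rk K\<close>, so their number is a power of \<open>q\<close>.\<close>

lemma card_covers_outside:
  assumes q1: "of_nat q = (1::'k::field)" and H: "hyp H X" and K: "K \<in> S" "K \<subseteq> H"
  shows "of_nat (card {U \<in> S. K \<subseteq> U \<and> U \<subseteq> X \<and> rk U = rk K + 1 \<and> \<not> U \<subseteq> H}) = (1::'k)"
proof -
  define At where "At = {U \<in> S. K \<subseteq> U \<and> U \<subseteq> X \<and> rk U = rk K + 1 \<and> \<not> U \<subseteq> H}"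
  have HX: "H \<in> S" "X \<in> S" "H \<subseteq> X" using H by (auto simp: hyp_def)
  have At: "U = cone p K" if "U \<in> At" "p \<in> U - K" for U p
    using cover_cone[of K U p] that K by (auto simp: At_def)
  have "U - K \<subseteq> X - H" if "U \<in> At" for U
  proof
    fix p assume p: "p \<in> U - K"
    have "p \<notin> H"
    proof
      assume "p \<in> H"
      then have "cone p K \<subseteq> H" using cone_least[of H K p] HX K p by auto
      then show False using At[OF that p] that by (auto simp: At_def)
    qed
    then show "p \<in> X - H" using p that by (auto simp: At_def)
  qed
  moreover have "\<exists>U\<in>At. p \<in> U - K" if p: "p \<in> X - H" for p
  proof
    have pp: "p \<in> pts" "p \<notin> K" using p K HX sub_pts by auto
    show "p \<in> cone p K - K" using pp by (simp add: cone_iff)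
    then show "cone p K \<in> At"
      using pp K p HX rk_cone[of K p] cone_sub[of K p] sub_cone[of K p] cone_least[of X K p] by (auto simp: At_def)
  qed
  ultimately have part: "X - H = (\<Union>U\<in>At. U - K)" by blast
  have fin: "finite At" by (simp add: At_def)
  have "card (X - H) = (\<Sum>U\<in>At. card (U - K))"
    unfolding part
  proof (rule card_UN_disjoint[OF fin])
    show "\<forall>U\<in>At. finite (U - K)" using finite_sub by (auto simp: At_def)
    show "\<forall>U\<in>At. \<forall>V\<in>At. U \<noteq> V \<longrightarrow> (U - K) \<inter> (V - K) = {}" using At by blast
  qed
  also have "\<dots> = (\<Sum>U\<in>At. q ^ rk K)"
  proof (rule sum.cong)
    fix U assume U: "U \<in> At"
    then have "hyp K U" using At K by (auto simp: hyp_def At_def)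
    then show "card (U - K) = q ^ rk K" by (rule card_diff_hyp)
  qed simp
  finally have "q ^ rk H = card At * q ^ rk K" using card_diff_hyp[OF H] by simp
  then have "of_nat q ^ rk H = of_nat (card At) * (of_nat q ^ rk K :: 'k)" by (metis of_nat_mult of_nat_power)
  then show ?thesis using q1 by (simp add: At_def)
qed

definition ivl :: "'p set \<Rightarrow> 'p set \<Rightarrow> nat \<Rightarrow> 'p set set" where
  "ivl A X k = {U \<in> S. A \<subseteq> U \<and> U \<subseteq> X \<and> rk U = rk A + k}"

lemma finite_ivl [simp]: "finite (ivl A X k)" by (simp add: ivl_def)

text \<open>Gaussian binomials become ordinary ones because the Pascal recursion \<open>[r+1, j+1] = [r, j+1] + q ^ (r-j) [r, j]\<close>,
  read off from the traces on a hyperplane, loses its power of \<open>q\<close>.\<close>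

lemma card_ivl:
  assumes q1: "of_nat q = (1::'k::field)" and "A \<in> S" "X \<in> S" "A \<subseteq> X"
  shows "of_nat (card (ivl A X k)) = (of_nat ((rk X - rk A) choose k) :: 'k)"
  using assms(2-)
proof (induction "card X" arbitrary: X k rule: less_induct)
  case less
  have zero: "ivl A X 0 = {A}" using less.prems by (auto simp: ivl_def dest: rk_eq[of A])
  show ?case
  proof (cases "A = X")
    case True
    have "ivl A X k = {}" if "k \<noteq> 0" using that True less.prems rk_mono by (force simp: ivl_def)
    then show ?thesis using True zero by (cases k) auto
  next
    case False
    then obtain H where H: "hyp H X" "A \<subseteq> H" using hyp_exists[of A X] less.prems by auto
    then have HS: "H \<in> S" "H \<subset> X" by (auto simp: hyp_def)
    have cH: "card H < card X" using HS less.prems finite_sub psubset_card_mono by blast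
    have rH: "rk X = rk H + 1" "rk A \<le> rk H" using rk_hyp H rk_mono HS less.prems by auto
    show ?thesis
    proof (cases k)
      case 0 then show ?thesis using zero by simp
    next
      case (Suc j)
      define At where "At K = {U \<in> S. K \<subseteq> U \<and> U \<subseteq> X \<and> rk U = rk K + 1 \<and> \<not> U \<subseteq> H}" for K
      have trace: "U \<inter> H = K" if "K \<in> ivl A H j" "U \<in> At K" for K U
      proof -
        have U: "U \<in> S" "K \<subseteq> U" "U \<subseteq> X" "rk U = rk K + 1" "\<not> U \<subseteq> H" "K \<in> S" "K \<subseteq> H"
          using that by (auto simp: At_def ivl_def)
        then have "rk U = rk (U \<inter> H) + 1" using rk_hyp[OF hyp_Int[OF H(1)]] by blast
        then show ?thesis using rk_eq[of K "U \<inter> H"] U HS by auto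
      qed
      have split: "ivl A X (Suc j) = ivl A H (Suc j) \<union> (\<Union>K\<in>ivl A H j. At K)"
      proof (rule Set.set_eqI, rule iffI)
        fix U assume U: "U \<in> ivl A X (Suc j)"
        show "U \<in> ivl A H (Suc j) \<union> (\<Union>K\<in>ivl A H j. At K)"
        proof (cases "U \<subseteq> H")
          case False
          have "U \<in> S" "U \<subseteq> X" using U by (auto simp: ivl_def)
          then have "rk U = rk (U \<inter> H) + 1" using rk_hyp[OF hyp_Int[OF H(1)]] False by blast
          then have "U \<inter> H \<in> ivl A H j" "U \<in> At (U \<inter> H)" using U H HS False by (auto simp: ivl_def At_def)
          then show ?thesis by blast
        qed (use U in \<open>auto simp: ivl_def\<close>)
      qed (use H HS in \<open>auto simp: ivl_def At_def\<close>)
      have "card (ivl A X (Suc j)) = card (ivl A H (Suc j)) + card (\<Union>K\<in>ivl A H j. At K)"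
        unfolding split by (rule card_Un_disjoint) (auto simp: At_def ivl_def)
      also have "card (\<Union>K\<in>ivl A H j. At K) = (\<Sum>K\<in>ivl A H j. card (At K))"
      proof (rule card_UN_disjoint)
        show "\<forall>K\<in>ivl A H j. finite (At K)" by (simp add: At_def)
        show "\<forall>K\<in>ivl A H j. \<forall>L\<in>ivl A H j. K \<noteq> L \<longrightarrow> At K \<inter> At L = {}" using trace by blast
      qed simp
      finally have "(of_nat (card (ivl A X (Suc j))) :: 'k) =
          of_nat (card (ivl A H (Suc j))) + (\<Sum>K\<in>ivl A H j. of_nat (card (At K)))" by simp
      also have "(\<Sum>K\<in>ivl A H j. of_nat (card (At K)) :: 'k) = (\<Sum>K\<in>ivl A H j. 1)"
        proof (rule sum.cong)
        fix K assume "K \<in> ivl A H j"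
        then show "of_nat (card (At K)) = (1::'k)"
          unfolding At_def by (intro card_covers_outside[OF q1 H(1)]) (auto simp: ivl_def)
      qed simp
      also have "\<dots> = of_nat (card (ivl A H j))" by simp
      finally show ?thesis
        using less.hyps[OF cH less.prems(1) HS(1) H(2)] rH Suc by (simp add: Suc_diff_le)
    qed
  qed
qed

text \<open>The binomial expansion of \<open>(1 - 1) ^ N\<close>: in the field, the Moebius function of the subspace lattice
  takes the same values as that of a Boolean lattice.\<close>

lemma alternating_sum_ivl:
  assumes q1: "of_nat q = (1::'k::field)" and AX: "A \<in> S" "X \<in> S" "A \<subseteq> X"
  shows "(\<Sum>U | U \<in> S \<and> A \<subseteq> U \<and> U \<subseteq> X. (-1) ^ rk U) = (if A = X then (-1) ^ rk A else (0::'k))"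
proof -
  let ?N = "rk X - rk A"
  let ?I = "{U \<in> S. A \<subseteq> U \<and> U \<subseteq> X}"
  have le: "rk A \<le> rk U \<and> rk U \<le> rk X" if "U \<in> ?I" for U using that rk_mono AX by auto
  have "(\<Sum>U\<in>?I. (-1) ^ rk U :: 'k) = (\<Sum>k\<le>?N. \<Sum>U\<in>{U\<in>?I. rk U - rk A = k}. (-1) ^ rk U)"
    using le by (intro sum.group[symmetric]) (auto intro: diff_le_mono)
  also have "\<dots> = (\<Sum>k\<le>?N. (-1) ^ rk A * ((-1) ^ k * of_nat (?N choose k)))"
  proof (rule sum.cong)
    fix k
    have e: "{U\<in>?I. rk U - rk A = k} = ivl A X k" using le by (force simp: ivl_def)
    have "(\<Sum>U\<in>ivl A X k. (-1) ^ rk U :: 'k) = (\<Sum>U\<in>ivl A X k. (-1) ^ rk A * (-1) ^ k)"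
      by (intro sum.cong) (auto simp: ivl_def power_add)
    also have "\<dots> = (-1) ^ rk A * ((-1) ^ k * of_nat (?N choose k))"
      using card_ivl[OF q1 AX] by simp
    finally show "(\<Sum>U\<in>{U\<in>?I. rk U - rk A = k}. (-1) ^ rk U :: 'k) = (-1) ^ rk A * ((-1) ^ k * of_nat (?N choose k))"
      by (simp only: e)
  qed simp
  also have "\<dots> = (-1) ^ rk A * (\<Sum>k\<le>?N. (-1) ^ k * of_nat (?N choose k))" by (simp add: sum_distrib_left)
  also have "\<dots> = (if A = X then (-1) ^ rk A else 0)"
  proof (cases "A = X")
    case False
    then have "0 < ?N" using rk_less[of A X] AX by auto
    then show ?thesis using choose_alternating_sum[of ?N, where 'a = 'k] False by simp
  qed simp
  finally show ?thesis .
qed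

text \<open>Moebius inversion in the subspace lattice, applied to the condition \<open>W \<inter> r = {}\<close>.\<close>

lemma alternating_sum_disjoint:
  assumes q1: "of_nat q = (1::'k::field)" and rX: "r \<in> S" "X \<in> S" "r \<subseteq> X"
  shows "(\<Sum>W | W \<in> S \<and> W \<subseteq> X \<and> W \<inter> r = {}. (-1) ^ rk W) = (of_bool (r = X) :: 'k)"
proof -
  have "(\<Sum>W | W \<in> S \<and> W \<subseteq> X \<and> W \<inter> r = {}. (-1) ^ rk W) =
      (\<Sum>W | W \<in> S \<and> W \<subseteq> X. (-1) ^ rk W * (if W \<inter> r = {} then 1 else 0::'k))"
    by (rule sum.mono_neutral_cong_left) auto
  also have "\<dots> = (\<Sum>W | W \<in> S \<and> W \<subseteq> X. (-1) ^ rk W * (\<Sum>s | s \<in> S \<and> s \<subseteq> W \<inter> r. (-1) ^ rk s))"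
  proof (rule sum.cong)
    fix W assume W: "W \<in> {W \<in> S. W \<subseteq> X}"
    have "(\<Sum>s | s \<in> S \<and> s \<subseteq> W \<inter> r. (-1) ^ rk s :: 'k) = (if {} = W \<inter> r then 1 else 0)"
      using alternating_sum_ivl[OF q1, of "{}" "W \<inter> r"] rX W by auto
    then show "(-1) ^ rk W * (if W \<inter> r = {} then 1 else 0) =
        (-1) ^ rk W * (\<Sum>s | s \<in> S \<and> s \<subseteq> W \<inter> r. (-1) ^ rk s :: 'k)"
      by (simp only: eq_commute[of "{}"])
  qed simp
  also have "\<dots> = (\<Sum>W | W \<in> S \<and> W \<subseteq> X. \<Sum>s | s \<in> S \<and> s \<subseteq> W \<inter> r. (-1) ^ rk W * (-1) ^ rk s)"
    by (simp add: sum_distrib_left)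
  also have "\<dots> = (\<Sum>s | s \<in> S \<and> s \<subseteq> r. \<Sum>W | W \<in> S \<and> s \<subseteq> W \<and> W \<subseteq> X. (-1) ^ rk W * (-1) ^ rk s)"
  proof -
    have "{s \<in> {s \<in> S. s \<subseteq> r}. s \<subseteq> W} = {s \<in> S. s \<subseteq> W \<inter> r}" for W by auto
    moreover have "{W \<in> {W \<in> S. W \<subseteq> X}. s \<subseteq> W} = {W \<in> S. s \<subseteq> W \<and> W \<subseteq> X}" for s by auto
    ultimately show ?thesis
      using sum.swap_restrict[of "{W \<in> S. W \<subseteq> X}" "{s \<in> S. s \<subseteq> r}" "\<lambda>W s. (-1) ^ rk W * (-1) ^ rk s :: 'k" "\<lambda>W s. s \<subseteq> W"]
      by simp
  qed
  also have "\<dots> = (\<Sum>s | s \<in> S \<and> s \<subseteq> r. of_bool (s = X))"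
  proof (rule sum.cong)
    fix s assume s: "s \<in> {s \<in> S. s \<subseteq> r}"
    then have "s \<subseteq> X" using rX by auto
    then have "(\<Sum>W | W \<in> S \<and> s \<subseteq> W \<and> W \<subseteq> X. (-1) ^ rk W * (-1) ^ rk s) = (if s = X then (-1) ^ rk s else 0) * ((-1) ^ rk s :: 'k)"
      unfolding sum_distrib_right[symmetric] using alternating_sum_ivl[OF q1, of s X] s rX by simp
    then show "(\<Sum>W | W \<in> S \<and> s \<subseteq> W \<and> W \<subseteq> X. (-1) ^ rk W * (-1) ^ rk s) = (of_bool (s = X) :: 'k)"
      by (simp add: power_mult_distrib[symmetric])
  qed simp
  also have "\<dots> = of_bool (r = X)"
  proof -
    have "(\<Sum>s | s \<in> S \<and> s \<subseteq> r. of_bool (s = X) :: 'k) = (if X \<subseteq> r then 1 else 0)"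
      using rX by (simp add: of_bool_def)
    then show ?thesis using rX by auto
  qed
  finally show ?thesis .
qed

end

section \<open>The partial product of subspaces\<close>

locale tri_geometry = ordered_geometry G q for G :: "('p, 'l) geometry" and q +
  fixes n :: nat and \<sigma> :: "'p set \<Rightarrow> 'p set" and T :: "('p set \<times> 'p set \<times> 'p set) set"
  assumes n3: "3 \<le> n"
    and dim_pts: "alg_dim G (points G) = n"
    and involution: "type_reversing_involution G n \<sigma>"
    and presentation: "triangle_presentation G n \<sigma> T"
begin

interpretation P: triangle_presentation G n \<sigma> T by (rule presentation)

lemma pts_ne [simp]: "pts \<noteq> {}" "{} \<noteq> pts"
  using non_collinear by (auto simp: triangle_def)

lemma rk_pts [simp]: "rk pts = n" using dim_pts by (simp add: rk_def)

lemma rk_le: "u \<in> S \<Longrightarrow> rk u \<le> n" using rk_mono[of u pts] sub_pts by auto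

lemma rk_full: "u \<in> S \<Longrightarrow> rk u = n \<longleftrightarrow> u = pts" using rk_eq[of u pts] sub_pts by auto

lemma Pi_dim_rk: "1 \<le> k \<Longrightarrow> Pi_dim G k = {u \<in> S. rk u = k}"
  by (auto simp: Pi_dim_def rk_def)

definition PA :: "'p set set" where "PA = {u \<in> S. u \<noteq> {} \<and> u \<noteq> pts}"

lemma PA_rk: "u \<in> PA \<longleftrightarrow> u \<in> S \<and> 1 \<le> rk u \<and> rk u \<le> n - 1"
  using rk_zero[of u] rk_full[of u] rk_le[of u] by (auto simp: PA_def)

lemma Pi_all_PA: "Pi_all G n = PA"
  by (auto simp: Pi_all_def Pi_dim_rk PA_rk)

lemma sigma_PA: "u \<in> PA \<Longrightarrow> \<sigma> u \<in> PA" "u \<in> PA \<Longrightarrow> \<sigma> (\<sigma> u) = u"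
  using involution by (auto simp: type_reversing_involution_def Pi_all_PA)

lemma rk_sigma: "u \<in> PA \<Longrightarrow> rk (\<sigma> u) = n - rk u"
proof -
  assume u: "u \<in> PA"
  then have k: "rk u \<in> {1..n - 1}" by (auto simp: PA_rk)
  then have "\<sigma> ` Pi_dim G (rk u) = Pi_dim G (n - rk u)"
    using involution by (simp add: type_reversing_involution_def)
  moreover have "u \<in> Pi_dim G (rk u)" using u k by (simp add: Pi_dim_rk PA_def)
  ultimately have "\<sigma> u \<in> Pi_dim G (n - rk u)" by blast
  moreover have "1 \<le> n - rk u" using k n3 by auto
  ultimately show ?thesis by (simp add: Pi_dim_rk)
qed

text \<open>With these two extra values, rank \<open>k\<close> is sent to rank \<open>n - k\<close> throughout \<open>0, \<dots>, n\<close>.\<close>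

definition sg :: "'p set \<Rightarrow> 'p set" where
  "sg u = (if u = {} then pts else if u = pts then {} else \<sigma> u)"

lemma sg_PA: "u \<in> PA \<Longrightarrow> sg u = \<sigma> u" by (simp add: sg_def PA_def)
lemma sg_simps [simp]: "sg {} = pts" "sg pts = {}" by (simp_all add: sg_def)

lemma S_cases: "u \<in> S \<Longrightarrow> (u = {} \<Longrightarrow> Q) \<Longrightarrow> (u = pts \<Longrightarrow> Q) \<Longrightarrow> (u \<in> PA \<Longrightarrow> Q) \<Longrightarrow> Q"
  by (auto simp: PA_def)

lemma PA_S: "u \<in> PA \<Longrightarrow> u \<in> S" by (simp add: PA_def)

lemma sg_S [simp]: "u \<in> S \<Longrightarrow> sg u \<in> S"
  by (erule S_cases) (auto simp: sg_PA sigma_PA PA_S)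

lemma sg_sg [simp]: "u \<in> S \<Longrightarrow> sg (sg u) = u"
  by (erule S_cases) (auto simp: sg_PA sigma_PA)

lemma rk_sg: "u \<in> S \<Longrightarrow> rk (sg u) = n - rk u"
  by (erule S_cases) (auto simp: sg_PA rk_sigma)

lemma sg_inj: "u \<in> S \<Longrightarrow> v \<in> S \<Longrightarrow> sg u = sg v \<Longrightarrow> u = v" by (metis sg_sg)

text \<open>\<open>R u v w\<close> says that \<open>w\<close> is the product of \<open>u\<close> and \<open>v\<close>; in the group of the presentation it
  implies the relation \<open>u v = w\<close>, where the empty subspace and the whole space both stand for \<open>1\<close>.
  Admitting these two makes the product a graded partial monoid in which the labels \<open>0\<close> and \<open>n\<close> obey
  the same rules as the others.\<close>

definition R :: "'p set \<Rightarrow> 'p set \<Rightarrow> 'p set \<Rightarrow> bool" where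
  "R u v w \<longleftrightarrow> u \<in> S \<and> v \<in> S \<and> w \<in> S \<and>
     (u = {} \<and> w = v \<or> v = {} \<and> w = u \<or> w = pts \<and> v = sg u \<or>
      u \<in> PA \<and> v \<in> PA \<and> w \<in> PA \<and> rk w = rk u + rk v \<and> (u, v, \<sigma> w) \<in> T)"

lemma R_S: "R u v w \<Longrightarrow> u \<in> S" "R u v w \<Longrightarrow> v \<in> S" "R u v w \<Longrightarrow> w \<in> S" by (auto simp: R_def)

lemma R_rk: "R u v w \<Longrightarrow> rk w = rk u + rk v"
  using rk_le[of u] by (auto simp: R_def rk_sg)

lemma R_empty_left [simp]: "R {} v w \<longleftrightarrow> v \<in> S \<and> w = v" by (auto simp: R_def PA_def)
lemma R_empty_right [simp]: "R u {} w \<longleftrightarrow> u \<in> S \<and> w = u"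
proof
  assume "R u {} w"
  then consider "u \<in> S" "w = u" | "u = {}" "w = {}" | "u \<in> S" "w = pts" "sg u = {}"
    by (auto simp: R_def PA_def)
  then show "u \<in> S \<and> w = u"
  proof cases
    case 3
    then show ?thesis using sg_sg[of u] by simp
  qed auto
qed (auto simp: R_def)

lemma R_sg: "u \<in> S \<Longrightarrow> R u (sg u) pts" by (simp add: R_def)

lemma R_pts_left: "R pts v w \<Longrightarrow> v = {}"
  using R_rk[of pts v w] R_S[of pts v w] rk_le[of w] rk_zero[of v] by auto

lemma R_PA_iff:
  assumes "u \<in> PA" "v \<in> PA"
  shows "R u v w \<longleftrightarrow> w = pts \<and> v = \<sigma> u \<or> w \<in> PA \<and> rk w = rk u + rk v \<and> (u, v, \<sigma> w) \<in> T"
  using assms by (auto simp: R_def PA_S sg_PA) (auto simp: PA_def)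

lemma R_fun:
  assumes "R u v w" "R u v w'" shows "w = w'"
proof (cases "u = {} \<or> v = {}")
  case True then show ?thesis using assms by auto
next
  case False
  then have uv: "u \<in> PA" "v \<in> PA"
    using assms R_pts_left[of v w] R_rk[OF assms(1)] rk_le[of w] rk_zero[of u]
    by (auto simp: PA_def R_S dest: R_pts_left)
  have "w' = pts" if "w = pts" using that R_rk[OF assms(1)] R_rk[OF assms(2)] rk_full R_S[OF assms(2)] by simp
  moreover have "w = pts" if "w' = pts" using that R_rk[OF assms(1)] R_rk[OF assms(2)] rk_full R_S[OF assms(1)] by simp
  moreover have "w = w'" if "w \<noteq> pts" "w' \<noteq> pts"
  proof -
    have "w \<in> PA" "w' \<in> PA" "(u, v, \<sigma> w) \<in> T" "(u, v, \<sigma> w') \<in> T"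
      using that assms R_PA_iff[OF uv] by auto
    then have "\<sigma> w = \<sigma> w'" using P.third_unique by blast
    then show ?thesis using sigma_PA \<open>w \<in> PA\<close> \<open>w' \<in> PA\<close> by metis
  qed
  ultimately show ?thesis by blast
qed

text \<open>Rotating a triangle: \<open>u v = w\<close> is equivalent to \<open>v w\<^sup>-\<^sup>1 = u\<^sup>-\<^sup>1\<close>, and \<open>sg\<close> is inversion.  Through this
  rotation each fact about left factors yields one about right factors.\<close>

lemma R_cyc: "R u v w \<Longrightarrow> R v (sg w) (sg u)"
proof -
  assume r: "R u v w"
  note S = R_S[OF r]
  consider "u = {}" "w = v" | "v = {}" "w = u" | "w = pts" "v = sg u" |
    "u \<in> PA" "v \<in> PA" "w \<in> PA" "rk w = rk u + rk v" "(u, v, \<sigma> w) \<in> T" using r by (auto simp: R_def)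
  then show ?thesis
  proof cases
    case 1 then show ?thesis using S R_sg[of v] by simp
  next
    case 4
    then have "(v, \<sigma> w, u) \<in> T" using P.cyclic by blast
    then have "(v, \<sigma> w, \<sigma> (\<sigma> u)) \<in> T" using sigma_PA 4 by simp
    moreover have "rk (\<sigma> u) = rk v + rk (\<sigma> w)" using 4 rk_sigma[of u] rk_sigma[of w] PA_rk[of w] by auto
    ultimately show ?thesis using 4 sigma_PA S by (auto simp: R_def sg_PA PA_S)
  qed (use S in auto)
qed

text \<open>The dimensions add up to a multiple of \<open>n\<close> lying strictly between \<open>0\<close> and \<open>2 n\<close>, hence to \<open>n\<close>.\<close>

lemma triple_rk:
  assumes "(u, v, \<sigma> w) \<in> T" "u \<in> PA" "v \<in> PA" "w \<in> PA" "rk u + rk v < n"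
  shows "rk w = rk u + rk v"
proof -
  have "[rk u + rk v + rk (\<sigma> w) = 0] (mod n)"
    using P.dim_sum[OF assms(1)] assms sigma_PA by (simp add: rk_def PA_def)
  then have "n dvd rk u + rk v + (n - rk w)" using assms rk_sigma by (simp add: cong_0_iff)
  then obtain k where k: "rk u + rk v + (n - rk w) = n * k" by (auto simp: dvd_def)
  have b: "0 < rk w" "rk w \<le> n - 1" "0 < rk u" using assms PA_rk by (auto simp: Suc_le_eq)
  have "k = 1"
  proof (rule ccontr)
    assume "k \<noteq> 1"
    then consider "k = 0" | "2 \<le> k" by linarith
    then show False
    proof cases
      case 1 then show ?thesis using k b by simp
    next
      case 2
      then have "n * 2 \<le> n * k" by simp
      then show ?thesis using k b assms by linarith
    qed
  qed
  then show ?thesis using k b by simp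
qed

text \<open>A product of proper subspaces exists by the incidence axiom, which allows two inclusions; the one
  with \<open>\<sigma> u\<close> inside \<open>v\<close> is excluded because the ranks would exceed \<open>n\<close>.\<close>

lemma R_ex: "u \<in> S \<Longrightarrow> v \<in> S \<Longrightarrow> (\<exists>w. R u v w) \<longleftrightarrow> v \<subseteq> sg u"
proof
  assume uv: "u \<in> S" "v \<in> S" "\<exists>w. R u v w"
  then obtain w where r: "R u v w" by blast
  consider "u = {}" | "v = {}" | "v = sg u" |
    "u \<in> PA" "v \<in> PA" "w \<in> PA" "rk w = rk u + rk v" "(u, v, \<sigma> w) \<in> T" using r by (auto simp: R_def)
  then show "v \<subseteq> sg u"
  proof cases
    case 4
    have "\<sigma> u \<noteq> v \<and> incident (\<sigma> u) v"
      using P.extends_iff[of u v] 4 by (auto simp: Pi_all_PA)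
    moreover have "\<not> \<sigma> u \<subseteq> v"
      using rk_mono[of "\<sigma> u" v] 4 sigma_PA PA_S rk_sigma[of u] PA_rk[of w] by auto
    ultimately show ?thesis using 4 by (auto simp: incident_def sg_PA)
  qed (use uv sub_pts in auto)
next
  assume uv: "u \<in> S" "v \<in> S" "v \<subseteq> sg u"
  show "\<exists>w. R u v w"
  proof (cases "u = {} \<or> v = {} \<or> v = sg u")
    case True then show ?thesis using uv R_sg by auto
  next
    case False
    then have u: "u \<in> PA" using uv by (auto simp: PA_def)
    then have lt: "rk v < n - rk u" using rk_less[of v "sg u"] uv False rk_sg by auto
    then have v: "v \<in> PA" using uv False by (auto simp: PA_def)
    have "\<sigma> u \<noteq> v \<and> incident (\<sigma> u) v" using uv False u by (auto simp: sg_PA incident_def)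
    then obtain x where x: "(u, v, x) \<in> T" using P.extends_iff[of u v] u v by (auto simp: Pi_all_PA)
    then have xP: "x \<in> PA" using P.subset by (auto simp: Pi_all_PA)
    have "(u, v, \<sigma> (\<sigma> x)) \<in> T" using x xP sigma_PA by simp
    moreover then have "rk (\<sigma> x) = rk u + rk v" using triple_rk[of u v "\<sigma> x"] u v xP sigma_PA lt by auto
    ultimately have "R u v (\<sigma> x)" using u v xP sigma_PA by (auto simp: R_def PA_S)
    then show ?thesis by blast
  qed
qed

text \<open>For proper subspaces this is the exchange axiom for two triangles with a common edge \<open>x\<close>; with an
  empty factor it is trivial, and if the product is the whole space it is a rotation.\<close>

lemma R_assoc:
  assumes "R u v x" "R x w y" shows "\<exists>z. R v w z \<and> R u z y"
proof (cases "u = {} \<or> v = {} \<or> w = {}")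
  case True
  then show ?thesis
  proof (elim disjE)
    assume "u = {}" then show ?thesis using assms R_S[OF assms(2)] by auto
  next
    assume "v = {}" then show ?thesis using assms R_S[OF assms(2)] by (intro exI[of _ w]) auto
  next
    assume "w = {}" then show ?thesis using assms R_S[OF assms(1)] by (intro exI[of _ v]) auto
  qed
next
  case False
  then have "x \<noteq> pts" using R_pts_left[of w y] assms by auto
  then have x: "u \<in> PA" "v \<in> PA" "x \<in> PA" "rk x = rk u + rk v" "(u, v, \<sigma> x) \<in> T"
    using assms(1) False by (auto simp: R_def)
  consider "y = pts" "w = sg x" |
      "w \<in> PA" "y \<in> PA" "rk y = rk x + rk w" "(x, w, \<sigma> y) \<in> T"
    using assms(2) False x by (auto simp: R_def PA_def)
  then show ?thesis
  proof cases
    case 1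
    then have "w \<in> PA" "(v, w, u) \<in> T" using x P.cyclic sigma_PA by (auto simp: sg_PA)
    moreover have "rk (\<sigma> u) = rk v + rk w"
      using x(4) rk_sigma[OF x(1)] rk_sigma[OF x(3)] rk_le[OF PA_S[OF x(3)]] 1 sg_PA[OF x(3)] by simp
    ultimately have "R v w (\<sigma> u)" using x sigma_PA[of u] by (simp add: R_def PA_S)
    moreover have "R u (\<sigma> u) pts" using R_sg[of u] x by (simp add: sg_PA PA_S)
    ultimately show ?thesis using 1 by blast
  next
    case 2
    have yb: "rk y \<le> n - 1" "rk y \<noteq> 0" "n \<noteq> 0" using 2 n3 by (auto simp: PA_rk)
    have "(w, \<sigma> y, \<sigma> (\<sigma> x)) \<in> T" using 2 x P.cyclic sigma_PA by simp
    moreover have "alg_dim G u + alg_dim G v < n" "alg_dim G w + alg_dim G (\<sigma> y) < n"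
    proof -
      have a: "alg_dim G e = rk e" if "e \<in> PA" for e using that by (simp add: rk_def PA_def)
      have "rk x \<noteq> 0" "rk x < n" using x n3 by (auto simp: PA_rk)
      then show "alg_dim G u + alg_dim G v < n" "alg_dim G w + alg_dim G (\<sigma> y) < n"
        using a[of u] a[of v] a[of w] a[of "\<sigma> y"] x 2 sigma_PA(1)[of y] rk_sigma[of y] yb by auto
    qed
    ultimately obtain z where z: "(\<sigma> y, u, z) \<in> T" "(v, w, \<sigma> z) \<in> T"
      using P.exchange[of u v "\<sigma> x" w "\<sigma> y"] x by blast
    have zP: "z \<in> PA" using z P.subset by (auto simp: Pi_all_PA)
    have rz: "rk z = rk v + rk w" using triple_rk[of v w z] z zP x 2 yb by auto
    have "R v w z" using z zP rz x 2 by (simp add: R_def PA_S)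
    moreover have "(u, z, \<sigma> y) \<in> T" using z P.cyclic by blast
    then have "R u z y" using zP rz x 2 by (simp add: R_def PA_S)
    ultimately show ?thesis by blast
  qed
qed

text \<open>The opposite rebracketing is obtained by rotating both triangles.\<close>

lemma R_assoc':
  assumes "R v w z" "R u z y" shows "\<exists>x. R u v x \<and> R x w y"
proof -
  note S = R_S[OF assms(1)] R_S[OF assms(2)]
  obtain x' where x': "R w (sg y) x'" "R v x' (sg u)" using R_assoc[OF assms(1) R_cyc[OF assms(2)]] by blast
  have "x' \<in> S" using x' R_S by blast
  have "R u v (sg x')" using R_cyc[OF R_cyc[OF x'(2)]] S by simp
  moreover have "R (sg x') w y" using R_cyc[OF R_cyc[OF x'(1)]] S
    by (metis R_cyc sg_S sg_sg \<open>x' \<in> S\<close> x'(1))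
  ultimately show ?thesis by blast
qed

lemma R_left_cancel:
  assumes "R u v w" "R u v' w" shows "v = v'"
  using R_fun[OF R_cyc[OF R_cyc[OF assms(1)]] R_cyc[OF R_cyc[OF assms(2)]]] R_S assms by (metis sg_inj)

lemma R_right_cancel:
  assumes "R u v w" "R u' v w" shows "u = u'"
  using R_fun[OF R_cyc[OF assms(1)] R_cyc[OF assms(2)]] R_S assms by (metis sg_inj)

lemma R_cyc_iff: "u \<in> S \<Longrightarrow> v \<in> S \<Longrightarrow> w \<in> S \<Longrightarrow> R v (sg w) (sg u) \<longleftrightarrow> R u v w"
  using R_cyc[of u v w] R_cyc[of v "sg w" "sg u"] R_cyc[of "sg w" u "sg v"] by auto

lemma R_ex_left:
  assumes "v \<in> S" "w \<in> S" shows "(\<exists>u. R u v w) \<longleftrightarrow> sg w \<subseteq> sg v"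
proof -
  have "(\<exists>u. R u v w) \<longleftrightarrow> (\<exists>x. R v (sg w) x)"
    using R_cyc assms R_S R_cyc_iff by (metis sg_sg sg_S)
  then show ?thesis using R_ex[of v "sg w"] assms by simp
qed

text \<open>The left divisors of \<open>w\<close> are exactly the subspaces of \<open>w\<close>: this translates counting
  factorisations into counting subspaces.\<close>

lemma R_ex_right:
  assumes "u \<in> S" "w \<in> S" shows "(\<exists>v. R u v w) \<longleftrightarrow> u \<subseteq> w"
proof -
  have "(\<exists>v. R u v w) \<longleftrightarrow> (\<exists>v. R (sg w) u v)"
    using R_cyc assms R_S R_cyc_iff by (metis sg_sg sg_S)
  then show ?thesis using R_ex[of "sg w" u] assms by simp
qed

lemma R_sub: "R u v w \<Longrightarrow> u \<subseteq> w" using R_ex_right R_S by blast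
lemma R_sub_sg: "R u v w \<Longrightarrow> v \<subseteq> sg u" using R_ex R_S by blast
lemma R_sg_sub: "R u v w \<Longrightarrow> sg w \<subseteq> sg v" using R_ex_left R_S by blast

text \<open>The two ways of passing from \<open>u \<otimes> v\<close> to \<open>u' \<otimes> v'\<close> through one middle vertex.  Either a left
  divisor \<open>x\<close> is split off from \<open>u\<close>, the rest is merged with \<open>v\<close> to \<open>t\<close>, and \<open>t\<close> is split anew; or a left
  divisor \<open>g\<close> is split off from \<open>v\<close> and merged with \<open>u\<close> to \<open>z\<close>, and \<open>z\<close> is split anew.\<close>

definition lower :: "'p set \<Rightarrow> 'p set \<Rightarrow> 'p set \<Rightarrow> 'p set \<Rightarrow> 'p set set" where
  "lower u v u' v' = {x. \<exists>y y' t. R x y u \<and> R x y' u' \<and> R y v t \<and> R y' v' t}"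

definition upper :: "'p set \<Rightarrow> 'p set \<Rightarrow> 'p set \<Rightarrow> 'p set \<Rightarrow> 'p set set" where
  "upper u v u' v' = {z. \<exists>g g' w. R u g z \<and> R u' g' z \<and> R g w v \<and> R g' w v'}"

lemma finite_lower [simp]: "finite (lower u v u' v')"
  by (rule finite_subset[OF _ finite_S]) (auto simp: lower_def R_S)

lemma finite_upper [simp]: "finite (upper u v u' v')"
  by (rule finite_subset[OF _ finite_S]) (auto simp: upper_def R_S)

end

section \<open>Squares of the partial product\<close>

text \<open>The square from the meet \<open>x\<close> of \<open>u\<close> and \<open>u'\<close> to their join \<open>z\<close>: its sides are \<open>x y = u\<close>, \<open>x y' = u'\<close>,
  \<open>u g = z\<close>, \<open>u' g' = z\<close>, and its diagonal is \<open>x l = z\<close>.  It is the universal pair of factorisations: all common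
  left divisors of \<open>u\<close> and \<open>u'\<close> divide \<open>x\<close>, and all common right multiples are multiples of \<open>z\<close>.\<close>

locale square = tri_geometry +
  fixes u u' g g'
  assumes u: "u \<in> S" "u' \<in> S" and g: "R u g (jn u u')" and g': "R u' g' (jn u u')"
begin

abbreviation "x \<equiv> u \<inter> u'"
abbreviation "z \<equiv> jn u u'"

lemma y_exists: "\<exists>y y' l. R x y u \<and> R x y' u' \<and> R y g l \<and> R y' g' l \<and> R x l z"
proof -
  obtain y where y: "R x y u" using R_ex_right[of x u] u by auto
  obtain y' where y': "R x y' u'" using R_ex_right[of x u'] u by auto
  obtain l where l: "R y g l" "R x l z" using R_assoc[OF y g] by blast
  obtain l' where l': "R y' g' l'" "R x l' z" using R_assoc[OF y' g'] by blast
  have "l = l'" using R_left_cancel l l' by blast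
  then show ?thesis using y y' l l' by blast
qed

definition y where "y = (SOME y. R x y u)"
definition y' where "y' = (SOME y. R x y u')"
definition l where "l = (SOME l. R x l z)"

lemma y: "R x y u"
proof -
  have "\<exists>y. R x y u" using y_exists by blast
  then show ?thesis unfolding y_def by (rule someI_ex)
qed

lemma y': "R x y' u'"
proof -
  have "\<exists>y'. R x y' u'" using y_exists by blast
  then show ?thesis unfolding y'_def by (rule someI_ex)
qed

lemma l: "R x l z"
proof -
  have "\<exists>l. R x l z" using y_exists by blast
  then show ?thesis unfolding l_def by (rule someI_ex)
qed

lemma yg: "R y g l" and yg': "R y' g' l" using y_exists y y' l R_left_cancel by metis+

lemma rks: "rk u = rk x + rk y" "rk u' = rk x + rk y'" "rk z = rk x + rk y + rk y'"
  "rk g = rk y'" "rk g' = rk y" "rk l = rk y + rk y'"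
  using R_rk[OF y] R_rk[OF y'] R_rk[OF l] R_rk[OF yg] R_rk[OF yg'] R_rk[OF g] R_rk[OF g'] rk_modular[of u u'] u
  by auto

lemma yS: "y \<in> S" "y' \<in> S" "l \<in> S" "g \<in> S" "g' \<in> S" "x \<in> S" "z \<in> S"
  using R_S y y' l g g' by blast+

text \<open>A common left divisor of \<open>y\<close> and \<open>y'\<close> could be absorbed into the meet \<open>x\<close>.\<close>

lemma y_disjoint: "y \<inter> y' = {}"
proof -
  let ?f = "y \<inter> y'"
  have f: "?f \<in> S" using yS by simp
  obtain y1 where y1: "R ?f y1 y" using R_ex_right[of ?f y] f yS by auto
  obtain y1' where y1': "R ?f y1' y'" using R_ex_right[of ?f y'] f yS by auto
  obtain h where h: "R x ?f h" "R h y1 u" using R_assoc'[OF y1 y] by blast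
  obtain h' where h': "R x ?f h'" "R h' y1' u'" using R_assoc'[OF y1' y'] by blast
  have "h = h'" using R_fun h h' by blast
  then have "h \<subseteq> x" using R_sub h h' by blast
  then have "rk h \<le> rk x" using rk_mono R_S h yS by blast
  then show ?thesis using R_rk[OF h(1)] rk_zero[OF f] by simp
qed

lemma l_join: "l = jn y y'"
proof -
  have "jn y y' \<subseteq> l" using jn_least[of l y y'] R_sub yg yg' yS by blast
  moreover have "rk (jn y y') = rk l" using rk_modular[of y y'] y_disjoint yS rks by simp
  ultimately show ?thesis using rk_eq[of "jn y y'" l] yS by auto
qed

text \<open>A common right divisor of \<open>g\<close> and \<open>g'\<close> could be cancelled from the join \<open>z\<close>.\<close>

lemma sg_l: "sg l = sg g \<inter> sg g'"
proof -
  let ?W = "jn (sg g) (sg g')"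
  let ?f = "sg ?W"
  have W: "?W \<in> S" "?f \<in> S" using yS by auto
  obtain g1 where g1: "R g1 ?f g" using R_ex_left[of ?f g] W yS jn_upper1 by auto
  obtain g1' where g1': "R g1' ?f g'" using R_ex_left[of ?f g'] W yS jn_upper2 by auto
  obtain h where h: "R u g1 h" "R h ?f z" using R_assoc'[OF g1 g] by blast
  obtain h' where h': "R u' g1' h'" "R h' ?f z" using R_assoc'[OF g1' g'] by blast
  have "h = h'" using R_right_cancel h h' by blast
  then have "z \<subseteq> h" using jn_least[of h u u'] R_sub h h' R_S by blast
  then have "rk z \<le> rk h" using rk_mono R_S h yS by blast
  then have "?f = {}" using R_rk[OF h(2)] rk_zero W by simp
  then have "?W = pts" using sg_sg[of ?W] W by simp
  then have "n + rk (sg g \<inter> sg g') = rk (sg g) + rk (sg g')" using rk_modular[of "sg g" "sg g'"] yS by simp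
  then have "rk (sg g \<inter> sg g') = rk (sg l)"
    using rk_sg[of g] rk_sg[of g'] rk_sg[of l] rk_le[of l] rk_le[of g] rk_le[of g'] rks yS by auto
  moreover have "sg l \<subseteq> sg g \<inter> sg g'" using R_sg_sub yg yg' by blast
  ultimately show ?thesis using rk_eq[of "sg l" "sg g \<inter> sg g'"] yS by auto
qed

lemma lower_left_divisor:
  assumes "a \<in> lower u v u' v'"
  shows "\<exists>f t s. R a f x \<and> R y v t \<and> R y' v' t \<and> R f t s"
proof -
  obtain c c' s where c: "R a c u" "R a c' u'" "R c v s" "R c' v' s"
    using assms by (auto simp: lower_def)
  then have "a \<subseteq> x" "a \<in> S" using R_sub R_S by blast+
  then obtain f where f: "R a f x" using R_ex_right[of a x] yS by auto
  obtain c1 where c1: "R f y c1" "R a c1 u" using R_assoc[OF f y] by blast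
  obtain c1' where c1': "R f y' c1'" "R a c1' u'" using R_assoc[OF f y'] by blast
  have e: "c1 = c" "c1' = c'" using R_left_cancel c c1 c1' by blast+
  obtain t where t: "R y v t" "R f t s" using R_assoc[of f y c v s] c1 c e by blast
  obtain t' where t': "R y' v' t'" "R f t' s" using R_assoc[of f y' c' v' s] c1' c e by blast
  have "t = t'" using R_left_cancel t t' by blast
  then show ?thesis using f t t' by blast
qed

text \<open>The common multiple \<open>t\<close> of \<open>y\<close> and \<open>y'\<close> is a multiple of their join \<open>l\<close>; its cofactor \<open>w\<close>
  in \<open>t\<close> satisfies \<open>v = g w\<close> and \<open>v' = g' w\<close>.\<close>

lemma lower_nonempty:
  assumes "a \<in> lower u v u' v'" shows "\<exists>w. R g w v \<and> R g' w v'"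
proof -
  obtain t where t: "R y v t" "R y' v' t" using lower_left_divisor[OF assms] by blast
  then have tS: "t \<in> S" using R_S by blast
  have "l \<subseteq> t" unfolding l_join using jn_least[of t y y'] R_sub t tS by blast
  then obtain w where w: "R l w t" using R_ex_right[of l t] yS tS by auto
  obtain v2 where v2: "R g w v2" "R y v2 t" using R_assoc[OF yg w] by blast
  obtain v3 where v3: "R g' w v3" "R y' v3 t" using R_assoc[OF yg' w] by blast
  have "v2 = v" "v3 = v'" using R_left_cancel t v2 v3 by blast+
  then show ?thesis using v2 v3 by blast
qed

lemma upper_right_divisor:
  assumes "b \<in> upper u v u' v'" shows "\<exists>e w w1. R z e b \<and> R e w w1 \<and> R g w1 v \<and> R g' w1 v'"
proof -
  obtain c c' w where c: "R u c b" "R u' c' b" "R c w v" "R c' w v'"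
    using assms by (auto simp: upper_def)
  then have bS: "b \<in> S" using R_S by blast
  have "z \<subseteq> b" using jn_least[of b u u'] R_sub c bS by blast
  then obtain e where e: "R z e b" using R_ex_right[of z b] yS bS by auto
  obtain c1 where c1: "R g e c1" "R u c1 b" using R_assoc[OF g e] by blast
  obtain c1' where c1': "R g' e c1'" "R u' c1' b" using R_assoc[OF g' e] by blast
  have ee: "c1 = c" "c1' = c'" using R_left_cancel c c1 c1' by blast+
  obtain w1 where w1: "R e w w1" "R g w1 v" using R_assoc[of g e c w v] c1 c ee by blast
  obtain w2 where w2: "R e w w2" "R g' w2 v'" using R_assoc[of g' e c' w v'] c1' c ee by blast
  have "w1 = w2" using R_fun w1 w2 by blast
  then show ?thesis using e w1 w2 by blast
qed

end

text \<open>If there is any middle vertex at all, then \<open>v = g w\<close> and \<open>v' = g' w\<close> for a common \<open>w\<close>.  The lower set is then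
  parametrised by the right divisors \<open>f\<close> of \<open>x\<close> with \<open>sg x\<close> and \<open>t\<close> inside \<open>sg f\<close>, and the upper set
  by the left divisors of \<open>w\<close> inside \<open>sg z\<close>; both are intervals of the subspace lattice.\<close>

locale filled_square = square +
  fixes v v' w
  assumes w: "R g w v" "R g' w v'"
begin

definition t where "t = (SOME t. R l w t)"

lemma wS: "w \<in> S" "v \<in> S" "v' \<in> S" using w R_S by blast+

lemma t: "R l w t"
proof -
  have "w \<subseteq> sg l" unfolding sg_l using R_sub_sg w by blast
  then have "\<exists>t. R l w t" using R_ex[of l w] yS wS by auto
  then show ?thesis unfolding t_def by (rule someI_ex)
qed

lemma yt: "R y v t" "R y' v' t"
proof -
  obtain v2 where v2: "R g w v2" "R y v2 t" using R_assoc[OF yg t] by blast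
  obtain v3 where v3: "R g' w v3" "R y' v3 t" using R_assoc[OF yg' t] by blast
  have "v2 = v" "v3 = v'" using R_fun w v2 v3 by blast+
  then show "R y v t" "R y' v' t" using v2 v3 by auto
qed

lemma tS: "t \<in> S" using t R_S by blast

lemma lower_iff: "a \<in> lower u v u' v' \<longleftrightarrow> (\<exists>f s. R a f x \<and> R f t s)"
proof
  assume "a \<in> lower u v u' v'"
  then obtain f t' s where "R a f x" "R y v t'" "R f t' s" using lower_left_divisor by blast
  then show "\<exists>f s. R a f x \<and> R f t s" using R_fun yt by blast
next
  assume "\<exists>f s. R a f x \<and> R f t s"
  then obtain f s where f: "R a f x" "R f t s" by blast
  obtain c1 where c1: "R f y c1" "R a c1 u" using R_assoc[OF f(1) y] by blast
  obtain c1' where c1': "R f y' c1'" "R a c1' u'" using R_assoc[OF f(1) y'] by blast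
  obtain c2 where c2: "R f y c2" "R c2 v s" using R_assoc'[OF yt(1) f(2)] by blast
  obtain c2' where c2': "R f y' c2'" "R c2' v' s" using R_assoc'[OF yt(2) f(2)] by blast
  have "c1 = c2" "c1' = c2'" using R_fun c1 c2 c1' c2' by blast+
  then show "a \<in> lower u v u' v'" using c1 c1' c2 c2' by (auto simp: lower_def)
qed

lemma upper_iff: "b \<in> upper u v u' v' \<longleftrightarrow> (\<exists>e. R z e b \<and> e \<subseteq> w)"
proof
  assume "b \<in> upper u v u' v'"
  then obtain e w0 w1 where "R z e b" "R e w0 w1" "R g w1 v" using upper_right_divisor by blast
  then show "\<exists>e. R z e b \<and> e \<subseteq> w" using R_left_cancel w R_sub by blast
next
  assume "\<exists>e. R z e b \<and> e \<subseteq> w"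
  then obtain e where e: "R z e b" "e \<subseteq> w" by blast
  then obtain w0 where w0: "R e w0 w" using R_ex_right[of e w] R_S wS by blast
  obtain c where c: "R g e c" "R c w0 v" using R_assoc'[OF w0 w(1)] by blast
  obtain c' where c': "R g' e c'" "R c' w0 v'" using R_assoc'[OF w0 w(2)] by blast
  obtain c1 where c1: "R g e c1" "R u c1 b" using R_assoc[OF g e(1)] by blast
  obtain c1' where c1': "R g' e c1'" "R u' c1' b" using R_assoc[OF g' e(1)] by blast
  have "c1 = c" "c1' = c'" using R_fun c1 c c1' c' by blast+
  then show "b \<in> upper u v u' v'" using c c' c1 c1' by (auto simp: upper_def)
qed

text \<open>The lengths of the two intervals: from the join of \<open>sg x\<close> and \<open>t\<close> up to the whole space, and from
  the empty subspace up to \<open>w \<inter> sg z\<close>.\<close>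

definition al where "al = n - rk (jn (sg x) t)"
definition be where "be = rk (w \<inter> sg z)"

text \<open>Left multiplication by \<open>l\<close> identifies the subspaces of \<open>w \<inter> sg z\<close> with the part of \<open>sg x \<inter> t\<close> above \<open>l\<close>.\<close>

lemma rk_meet: "rk (sg x \<inter> t) = rk l + be"
proof (rule antisym)
  let ?r = "sg x \<inter> t" and ?e0 = "w \<inter> sg z"
  have rS: "?r \<in> S" "?e0 \<in> S" using yS tS wS by auto
  have "l \<subseteq> ?r" using R_sub_sg[OF l] R_sub[OF t] by blast
  then obtain e where e: "R l e ?r" using R_ex_right[of l ?r] yS rS by auto
  obtain f where f: "R ?r f t" using R_ex_right[of ?r t] rS tS by auto
  obtain e2 where e2: "R e f e2" "R l e2 t" using R_assoc[OF e f] by blast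
  then have "e2 = w" using R_left_cancel t by blast
  then have ew: "e \<subseteq> w" using e2 R_sub by blast
  obtain s where s: "R x ?r s" using R_ex[of x ?r] yS rS by auto
  obtain z2 where z2: "R x l z2" "R z2 e s" using R_assoc'[OF e s] by blast
  then have "z2 = z" using R_fun l by blast
  then have "e \<subseteq> sg z" using z2 R_sub_sg by blast
  then have "rk e \<le> rk ?e0" using rk_mono[of e ?e0] ew rS R_S[OF e] by auto
  then show "rk ?r \<le> rk l + be" using R_rk[OF e] by (simp add: be_def)
  obtain s0 where s0: "R z ?e0 s0" using R_ex[of z ?e0] yS rS by auto
  obtain r0 where r0: "R l ?e0 r0" "R x r0 s0" using R_assoc[OF l s0] by blast
  obtain f0 where f0: "R ?e0 f0 w" using R_ex_right[of ?e0 w] rS wS by auto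
  obtain r1 where r1: "R l ?e0 r1" "R r1 f0 t" using R_assoc'[OF f0 t] by blast
  have "r1 = r0" using R_fun r0 r1 by blast
  then have "r0 \<subseteq> ?r" using R_sub_sg r0 R_sub r1 by blast
  then have "rk r0 \<le> rk ?r" using rk_mono R_S r0 rS by blast
  then show "rk l + be \<le> rk ?r" using R_rk[OF r0(1)] by (simp add: be_def)
qed

text \<open>By the modular law the difference of the two lengths depends on the ranks of \<open>u'\<close> and \<open>v\<close> only;
  up to sign, this difference is the upper index of the binomials in the square switches.\<close>

lemma dims: "al + rk w = rk x + be" "al \<le> rk x" "al + rk v = rk u' + be"
proof -
  have m: "rk (jn (sg x) t) + (rk l + be) = (n - rk x) + (rk l + rk w)"
    using rk_modular[of "sg x" t] rk_meet R_rk[OF t] rk_sg[of x] yS tS by simp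
  have "rk (jn (sg x) t) \<le> n" "rk x \<le> n" using rk_le yS tS by auto
  then show *: "al + rk w = rk x + be" using m by (simp add: al_def)
  have "be \<le> rk w" unfolding be_def using rk_mono wS yS by auto
  then show "al \<le> rk x" using * by simp
  show "al + rk v = rk u' + be" using * R_rk[OF w(1)] rks by simp
qed

text \<open>Writing \<open>x = a f\<close>, the map from \<open>a\<close> to \<open>sg f\<close> is a bijection onto a level of the first interval.\<close>

lemma card_lower:
  assumes q1: "of_nat q = (1::'k::field)"
  shows "of_nat (card {a \<in> lower u v u' v'. rk a = k}) =
    (if k \<le> rk x then of_nat (al choose (rk x - k)) else (0::'k))"
proof (cases "k \<le> rk x")
  case False
  have "rk a \<le> rk x" if "a \<in> lower u v u' v'" for a
    using that R_rk lower_iff by fastforce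
  then have "card {a \<in> lower u v u' v'. rk a = k} = 0" using False by auto
  then show ?thesis by (simp only: False if_False of_nat_0)
next
  case True
  let ?Q = "jn (sg x) t" and ?m = "n - (rk x - k)"
  let ?h = "\<lambda>a. sg (THE f. R a f x)"
  have QS: "?Q \<in> S" "rk ?Q \<le> n" using yS tS rk_le by auto
  have h: "?h a = sg f" if "R a f x" for a f
  proof -
    have "(THE f. R a f x) = f"
    proof (rule the_equality)
      show "R a f x" by (rule that)
      show "f' = f" if f': "R a f' x" for f' using R_left_cancel[OF f' \<open>R a f x\<close>] .
    qed
    then show ?thesis by simp
  qed
  have "bij_betw ?h {a \<in> lower u v u' v'. rk a = k} {F \<in> S. ?Q \<subseteq> F \<and> rk F = ?m}"
  proof (rule bij_betw_imageI)
    show "inj_on ?h {a \<in> lower u v u' v'. rk a = k}"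
    proof (rule inj_onI)
      fix a a' assume a: "a \<in> {a \<in> lower u v u' v'. rk a = k}" "a' \<in> {a \<in> lower u v u' v'. rk a = k}" "?h a = ?h a'"
      obtain f f' where f: "R a f x" "R a' f' x" using a lower_iff by blast
      then have "sg f = sg f'" using a h by simp
      then have "f = f'" using sg_inj R_S f by blast
      then show "a = a'" using R_right_cancel f by blast
    qed
    show "?h ` {a \<in> lower u v u' v'. rk a = k} = {F \<in> S. ?Q \<subseteq> F \<and> rk F = ?m}" (is "?L = ?M")
    proof (rule subset_antisym; rule subsetI)
      fix F assume "F \<in> ?L"
      then obtain a where a: "a \<in> lower u v u' v'" "rk a = k" "F = ?h a" by blast
      then obtain f s where f: "R a f x" "R f t s" using lower_iff by blast
      then have F: "F = sg f" using a h by simp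
      have fS: "f \<in> S" using R_S f by blast
      have "?Q \<subseteq> F" unfolding F using jn_least[of "sg f" "sg x" t] R_sg_sub[OF f(1)] R_sub_sg[OF f(2)] fS by simp
      moreover have "rk F = ?m" using F fS rk_sg R_rk[OF f(1)] a by simp
      ultimately show "F \<in> ?M" using F fS by simp
    next
      fix F assume F: "F \<in> ?M"
      let ?f = "sg F"
      have fS: "?f \<in> S" "sg ?f = F" using F by auto
      have sub: "sg x \<subseteq> F" "t \<subseteq> F" using F jn_upper1 jn_upper2 by blast+
      obtain a where a: "R a ?f x" using R_ex_left[of ?f x] fS yS sub by auto
      obtain s where s: "R ?f t s" using R_ex[of ?f t] fS tS sub by auto
      have "rk ?f = rk x - k" using rk_sg[of F] F True rk_le[of x] yS by auto
      then have "rk a = k" using R_rk[OF a] True by simp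
      moreover have "a \<in> lower u v u' v'" using a s lower_iff by blast
      moreover have "F = ?h a" using h[OF a] fS by simp
      ultimately show "F \<in> ?L" by blast
    qed
  qed
  then have c: "card {a \<in> lower u v u' v'. rk a = k} = card {F \<in> S. ?Q \<subseteq> F \<and> rk F = ?m}"
    by (rule bij_betw_same_card)
  show ?thesis
  proof (cases "rk x - k \<le> al")
    case T: True
    have "{F \<in> S. ?Q \<subseteq> F \<and> rk F = ?m} = ivl ?Q pts (al - (rk x - k))"
      using T QS sub_pts by (auto simp: ivl_def al_def)
    then show ?thesis using c card_ivl[OF q1, of ?Q pts "al - (rk x - k)"] QS sub_pts True T
      binomial_symmetric[OF T] by (simp add: al_def)
  next
    case F: False
    have "?m < rk ?Q" using F QS rk_le[of x] yS by (simp add: al_def)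
    moreover have "rk ?Q \<le> rk F" if "F \<in> S" "?Q \<subseteq> F" for F using rk_mono QS that by blast
    ultimately have c0: "card {F \<in> S. ?Q \<subseteq> F \<and> rk F = ?m} = 0" by fastforce
    have "al choose (rk x - k) = 0" using F by simp
    then show ?thesis by (simp only: c c0 True if_True)
  qed
qed

text \<open>Writing \<open>b = z e\<close>, the map from \<open>b\<close> to \<open>e\<close> is a bijection onto a level of the second interval.\<close>

lemma card_upper:
  assumes q1: "of_nat q = (1::'k::field)"
  shows "of_nat (card {b \<in> upper u v u' v'. rk b = k}) =
    (if rk z \<le> k then of_nat (be choose (k - rk z)) else (0::'k))"
proof (cases "rk z \<le> k")
  case False
  have "rk z \<le> rk b" if "b \<in> upper u v u' v'" for b
    using that R_rk upper_iff by fastforce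
  then have "card {b \<in> upper u v u' v'. rk b = k} = 0" using False by auto
  then show ?thesis by (simp only: False if_False of_nat_0)
next
  case True
  let ?r = "w \<inter> sg z"
  have rS: "?r \<in> S" using wS yS by simp
  have "bij_betw (\<lambda>b. THE e. R z e b) {b \<in> upper u v u' v'. rk b = k} (ivl {} ?r (k - rk z))"
  proof (rule bij_betw_imageI)
    have h: "(THE e. R z e b) = e" if e: "R z e b" for b e
    proof (rule the_equality)
      show "R z e b" by (rule e)
      show "e' = e" if e': "R z e' b" for e' using R_left_cancel[OF e' e] .
    qed
    show "inj_on (\<lambda>b. THE e. R z e b) {b \<in> upper u v u' v'. rk b = k}"
    proof (rule inj_onI)
      fix b b' assume b: "b \<in> {b \<in> upper u v u' v'. rk b = k}" "b' \<in> {b \<in> upper u v u' v'. rk b = k}"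
        "(THE e. R z e b) = (THE e. R z e b')"
      obtain e e' where e: "R z e b" "R z e' b'" using b upper_iff by blast
      then have "e = e'" using b h by simp
      then show "b = b'" using R_fun e by blast
    qed
    show "(\<lambda>b. THE e. R z e b) ` {b \<in> upper u v u' v'. rk b = k} = ivl {} ?r (k - rk z)" (is "?L = ?M")
    proof (rule subset_antisym; rule subsetI)
      fix e assume "e \<in> ?L"
      then obtain b where b: "b \<in> upper u v u' v'" "rk b = k" "e = (THE e. R z e b)" by blast
      then obtain e' where e': "R z e' b" "e' \<subseteq> w" using upper_iff by blast
      then have "e' = e" using h b by simp
      then show "e \<in> ?M" using e' R_rk[OF e'(1)] b R_sub_sg[OF e'(1)] R_S[OF e'(1)] by (simp add: ivl_def)
    next
      fix e assume e: "e \<in> ?M"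
      then have eS: "e \<in> S" "e \<subseteq> w" "e \<subseteq> sg z" "rk e = k - rk z" by (auto simp: ivl_def)
      obtain b where b: "R z e b" using R_ex[of z e] yS eS by auto
      then have "b \<in> upper u v u' v'" using upper_iff eS by blast
      moreover have "rk b = k" using R_rk[OF b] eS True by simp
      ultimately show "e \<in> ?L" using h[OF b] by (intro image_eqI[of _ _ b]) auto
    qed
  qed
  then have "card {b \<in> upper u v u' v'. rk b = k} = card (ivl {} ?r (k - rk z))"
    by (rule bij_betw_same_card)
  then show ?thesis using card_ivl[OF q1, of "{}" ?r "k - rk z"] rS True by (simp add: be_def)
qed

end

section \<open>Binomial identities\<close>

text \<open>Identities between integer binomials are checked over the rationals, where they are instances of
  generalised binomial coefficients.\<close>

lemma of_int_int_binom: "(of_int (int_binom m t) :: rat) = of_int m gchoose t"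
  unfolding of_int_gbinomial[symmetric] by (simp add: int_binom_def gbinomial_prod_rev atLeast0LessThan)

lemma int_binom_nat: "int_binom (int k) t = int (k choose t)"
proof -
  have "(of_int (int_binom (int k) t) :: rat) = of_int (int (k choose t))"
    by (simp add: of_int_int_binom binomial_gbinomial)
  then show ?thesis by (simp only: of_int_eq_iff)
qed

lemma int_binom_neg: "int_binom (- int (Suc s)) j = (-1) ^ j * int ((s + j) choose s)"
proof -
  have "(of_int (int_binom (- int (Suc s)) j) :: rat) = (-1) ^ j * (of_nat (s + j) gchoose j)"
    unfolding of_int_int_binom by (subst gbinomial_negated_upper) (simp add: algebra_simps)
  also have "\<dots> = of_int ((-1) ^ j * int ((s + j) choose j))" by (simp add: binomial_gbinomial)
  also have "(s + j) choose j = (s + j) choose s" using binomial_symmetric[of s "s + j"] by simp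
  finally show ?thesis by (simp only: of_int_eq_iff)
qed

lemma vandermonde_int: "(\<Sum>k\<le>N. int_binom a k * int_binom b (N - k)) = int_binom (a + b) N"
proof -
  have "of_int (\<Sum>k\<le>N. int_binom a k * int_binom b (N - k)) = (of_int (int_binom (a + b) N) :: rat)"
    using gbinomial_Vandermonde[of "of_int a :: rat" "of_int b" N] by (simp add: of_int_int_binom atLeast0AtMost)
  then show ?thesis by (simp only: of_int_eq_iff)
qed

text \<open>The Vandermonde convolution in the shape of a square switch: only the terms with \<open>t \<le> N\<close>
  contribute, so the range of summation may be any interval reaching at least up to \<open>N\<close>.\<close>

lemma vandermonde_switch:
  fixes N M :: int
  assumes "N \<le> M" and m: "m = int al - int be"
  shows "(\<Sum>t\<in>{0..M}. of_int (int_binom m (nat t)) * (if t \<le> N then of_nat (be choose nat (N - t)) else 0)) =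
    (if 0 \<le> N then of_nat (al choose nat N) else (0::'k::field))"
proof (cases "0 \<le> N")
  case False
  then show ?thesis by (auto intro!: sum.neutral)
next
  case True
  have "(\<Sum>t\<in>{0..M}. of_int (int_binom m (nat t)) * (if t \<le> N then of_nat (be choose nat (N - t)) else 0)) =
      (\<Sum>t\<in>{0..N}. of_int (int_binom m (nat t)) * (of_nat (be choose nat (N - t)) :: 'k))"
    using assms(1) by (intro sum.mono_neutral_cong_right) auto
  also have "\<dots> = (\<Sum>k\<le>nat N. of_int (int_binom m k) * of_nat (be choose (nat N - k)))"
    using True by (intro sum.reindex_bij_witness[of _ int nat]) (auto simp: nat_diff_distrib)
  also have "\<dots> = of_int (\<Sum>k\<le>nat N. int_binom m k * int_binom (int be) (nat N - k))"
    by (simp add: int_binom_nat)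
  also have "\<dots> = of_nat (al choose nat N)"
    unfolding vandermonde_int m by (simp add: int_binom_nat)
  finally show ?thesis using True by simp
qed

text \<open>After reflecting the first binomial, this is the Vandermonde convolution for the upper indices
  \<open>- (s + 1)\<close> and \<open>s + be\<close>, whose sum \<open>be - 1\<close> lies in \<open>{0..<i - s}\<close> unless \<open>be = 0\<close>.\<close>

lemma alternating_vandermonde:
  assumes "s + be \<le> i"
  shows "(\<Sum>k\<le>i. (-1) ^ (k - s) * int (k choose s) * int ((s + be) choose (i - k))) =
    (if be = 0 then (-1) ^ (i - s) else 0)"
proof -
  have "(\<Sum>k\<le>i. (-1) ^ (k - s) * int (k choose s) * int ((s + be) choose (i - k))) =
      (\<Sum>k\<in>{s..i}. (-1) ^ (k - s) * int (k choose s) * int ((s + be) choose (i - k)))"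
    by (intro sum.mono_neutral_right) auto
  also have "\<dots> = (\<Sum>j\<le>i - s. (-1) ^ j * int ((s + j) choose s) * int ((s + be) choose (i - s - j)))"
    using assms by (intro sum.reindex_bij_witness[of _ "\<lambda>j. s + j" "\<lambda>k. k - s"]) auto
  also have "\<dots> = (\<Sum>j\<le>i - s. int_binom (- int (Suc s)) j * int_binom (int (s + be)) (i - s - j))"
    by (simp only: int_binom_neg int_binom_nat)
  also have "\<dots> = int_binom (int be - 1) (i - s)"
    unfolding vandermonde_int by (simp add: algebra_simps)
  also have "\<dots> = (if be = 0 then (-1) ^ (i - s) else 0)"
  proof (cases be)
    case 0
    then show ?thesis using int_binom_neg[of 0 "i - s"] by simp
  next
    case (Suc b)
    then show ?thesis using int_binom_nat[of b "i - s"] assms by simp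
  qed
  finally show ?thesis .
qed


section \<open>Square switch numbers and the bialgebra identity\<close>

context tri_geometry
begin

lemma square_exists:
  assumes "u \<in> S" "u' \<in> S"
  obtains g g' where "square G q n \<sigma> T u u' g g'"
proof -
  have z: "jn u u' \<in> S" using assms by simp
  obtain g where g: "R u g (jn u u')" using R_ex_right[of u "jn u u'"] assms z jn_upper1 by auto
  obtain g' where g': "R u' g' (jn u u')" using R_ex_right[of u' "jn u u'"] assms z jn_upper2 by auto
  show ?thesis by (rule that, unfold_locales) (use assms g g' in auto)
qed

text \<open>The binomial counts of both sets of middle vertices with integer ranks, in a shape that admits the
  Vandermonde convolution; in the empty case both sides of a switch vanish.\<close>

lemma square_counts:
  assumes q1: "of_nat q = (1::'k::field)" and uv: "u \<in> S" "v \<in> S" "u' \<in> S" "v' \<in> S"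
  obtains (empty) "lower u v u' v' = {}" "upper u v u' v' = {}"
  | (filled) al be :: nat and i :: int where
      "int al - int be = int (rk u') - int (rk v)" "int al \<le> i" "i \<le> int (rk u)" "i \<le> int (rk u')"
      "\<And>e. of_nat (card {x \<in> lower u v u' v'. int (rk x) = e}) =
         (if 0 \<le> i - e then of_nat (al choose nat (i - e)) else (0::'k))"
      "\<And>e. of_nat (card {z \<in> upper u v u' v'. int (rk z) = e}) =
         (if int (rk u) + int (rk u') - i \<le> e then of_nat (be choose nat (e - (int (rk u) + int (rk u') - i))) else (0::'k))"
proof -
  obtain g g' where "square G q n \<sigma> T u u' g g'" using square_exists uv by blast
  then interpret sq: square G q n \<sigma> T u u' g g' .
  show ?thesis
  proof (cases "\<exists>w. R g w v \<and> R g' w v'")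
    case False
    then show ?thesis using sq.lower_nonempty sq.upper_right_divisor by (intro empty) blast+
  next
    case True
    then obtain w where "R g w v" "R g' w v'" by blast
    then interpret f: filled_square G q n \<sigma> T u u' g g' v v' w by unfold_locales
    let ?i = "int (rk (u \<inter> u'))"
    have z: "int (rk (jn u u')) = int (rk u) + int (rk u') - ?i" using rk_modular[of u u'] uv by simp
    show ?thesis
    proof (rule filled[of f.al f.be ?i])
      show "int f.al - int f.be = int (rk u') - int (rk v)" using f.dims by linarith
      show "int f.al \<le> ?i" using f.dims by simp
      show "?i \<le> int (rk u)" "?i \<le> int (rk u')" using rk_mono uv by auto
      show "of_nat (card {x \<in> lower u v u' v'. int (rk x) = e}) =
         (if 0 \<le> ?i - e then of_nat (f.al choose nat (?i - e)) else (0::'k))" for e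
      proof (cases "0 \<le> e")
        case True
        then have "{x \<in> lower u v u' v'. int (rk x) = e} = {x \<in> lower u v u' v'. rk x = nat e}" by auto
        moreover have "nat (?i - e) = rk (u \<inter> u') - nat e" using True by simp
        ultimately show ?thesis using f.card_lower[OF q1, of "nat e"] True by (auto simp: le_nat_iff)
      next
        case False
        then have c0: "card {x \<in> lower u v u' v'. int (rk x) = e} = 0" by auto
        have "f.al < nat (?i - e)" using f.dims False by simp
        then have c1: "f.al choose nat (?i - e) = 0" by simp
        show ?thesis by (simp only: c0 c1 of_nat_0 if_cancel)
      qed
      show "of_nat (card {z \<in> upper u v u' v'. int (rk z) = e}) =
         (if int (rk u) + int (rk u') - ?i \<le> e then of_nat (f.be choose nat (e - (int (rk u) + int (rk u') - ?i))) else (0::'k))" for e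
      proof (cases "0 \<le> e")
        case True
        then have "{x \<in> upper u v u' v'. int (rk x) = e} = {x \<in> upper u v u' v'. rk x = nat e}" by auto
        moreover have "nat (e - int (rk (jn u u'))) = nat e - rk (jn u u')" using True by simp
        ultimately show ?thesis unfolding z[symmetric] using f.card_upper[OF q1, of "nat e"] True by (auto simp: nat_le_iff le_nat_iff)
      next
        case False
        then have "card {x \<in> upper u v u' v'. int (rk x) = e} = 0" by auto
        then show ?thesis unfolding z[symmetric] using False by (simp only: of_nat_0) auto
      qed
    qed
  qed
qed

text \<open>Vandermonde for \<open>al = (al - be) + be\<close>, where \<open>al - be = a - b + c - d\<close> is determined by the labels.
  The other switch uses \<open>be = (be - al) + al\<close>.\<close>

lemma switch_lower_upper:
  assumes q1: "of_nat q = (1::'k::field)" and uv: "u \<in> S" "v \<in> S" "u' \<in> S" "v' \<in> S"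
    and rk: "int (rk u) = a" "int (rk v) = b" "int (rk u') = a + c - d"
  shows "of_nat (card {x \<in> lower u v u' v'. int (rk x) = a - d}) =
    (\<Sum>t\<in>{0..min c d}. of_int (int_binom (a - b + c - d) (nat t)) *
       (of_nat (card {z \<in> upper u v u' v'. int (rk z) = a + c - t}) :: 'k))"
  using q1 uv
proof (cases rule: square_counts)
  case empty then show ?thesis by simp
next
  case (filled al be i)
  have "(\<Sum>t\<in>{0..min c d}. of_int (int_binom (a - b + c - d) (nat t)) *
      (if t \<le> i - (a - d) then of_nat (be choose nat (i - (a - d) - t)) else 0)) =
      (if 0 \<le> i - (a - d) then of_nat (al choose nat (i - (a - d))) else (0::'k))"
    using filled rk by (intro vandermonde_switch) auto
  moreover have "of_nat (card {z \<in> upper u v u' v'. int (rk z) = a + c - t}) =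
      (if t \<le> i - (a - d) then of_nat (be choose nat (i - (a - d) - t)) else (0::'k))" for t
  proof -
    have "int (rk u) + int (rk u') - i \<le> a + c - t \<longleftrightarrow> t \<le> i - (a - d)"
      "a + c - t - (int (rk u) + int (rk u') - i) = i - (a - d) - t" using rk by auto
    then show ?thesis unfolding filled(6) by (simp only:)
  qed
  ultimately show ?thesis unfolding filled(5) by (simp only:)
qed

lemma switch_upper_lower:
  assumes q1: "of_nat q = (1::'k::field)" and uv: "u \<in> S" "v \<in> S" "u' \<in> S" "v' \<in> S"
    and rk: "int (rk u) = a" "int (rk v) = b" "int (rk u') = a + c - d"
  shows "of_nat (card {z \<in> upper u v u' v'. int (rk z) = a + c}) =
    (\<Sum>t\<in>{0..min c d}. of_int (int_binom (b - a + d - c) (nat t)) *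
       (of_nat (card {x \<in> lower u v u' v'. int (rk x) = a - d + t}) :: 'k))"
  using q1 uv
proof (cases rule: square_counts)
  case empty then show ?thesis by simp
next
  case (filled al be i)
  have "(\<Sum>t\<in>{0..min c d}. of_int (int_binom (b - a + d - c) (nat t)) *
      (if t \<le> i - (a - d) then of_nat (al choose nat (i - (a - d) - t)) else 0)) =
      (if 0 \<le> i - (a - d) then of_nat (be choose nat (i - (a - d))) else (0::'k))"
    using filled rk by (intro vandermonde_switch) auto
  moreover have "of_nat (card {x \<in> lower u v u' v'. int (rk x) = a - d + t}) =
      (if t \<le> i - (a - d) then of_nat (al choose nat (i - (a - d) - t)) else (0::'k))" for t
  proof -
    have "0 \<le> i - (a - d + t) \<longleftrightarrow> t \<le> i - (a - d)" "i - (a - d + t) = i - (a - d) - t" by auto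
    then show ?thesis unfolding filled(5) by (simp only:)
  qed
  moreover have "int (rk u) + int (rk u') - i \<le> a + c \<longleftrightarrow> 0 \<le> i - (a - d)"
      "a + c - (int (rk u) + int (rk u') - i) = i - (a - d)" using rk by auto
  ultimately show ?thesis unfolding filled(6) by (simp only:)
qed

text \<open>The coefficient of the crossing from \<open>u \<otimes> v\<close> to \<open>u' \<otimes> v'\<close>: in its expression as an alternating sum
  of ladders, the ladder with parameter \<open>t\<close> has one path for each lower vertex of rank \<open>t\<close>.\<close>

definition cross :: "'p set \<Rightarrow> 'p set \<Rightarrow> 'p set \<Rightarrow> 'p set \<Rightarrow> 'k::field" where
  "cross u v u' v' = (\<Sum>x\<in>lower u v u' v'. (-1) ^ rk x)"

lemma R_the: "R p x h \<Longrightarrow> (THE h. R p x h) = h"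
  using R_fun by (intro the_equality) auto

lemma R_the_right: "R p x h \<Longrightarrow> (THE x. R p x h) = x"
  using R_left_cancel by (intro the_equality) auto

text \<open>Left multiplication by \<open>p\<close> identifies the lower vertices of \<open>y\<close> and \<open>y'\<close> with those of \<open>u\<close> and \<open>u'\<close>
  that have \<open>p\<close> as a divisor.\<close>

lemma cross_translate:
  assumes py: "R p y u" "R p y' u'"
  shows "cross y e y' e' = (\<Sum>h | h \<in> lower u e u' e' \<and> p \<subseteq> h. (-1) ^ (rk h - rk p) :: 'k::field)"
proof -
  have a: "\<exists>h. R p x h \<and> h \<in> lower u e u' e'" if x: "x \<in> lower y e y' e'" for x
  proof -
    obtain f f' t where f: "R x f y" "R x f' y'" "R f e t" "R f' e' t" using x by (auto simp: lower_def)
    obtain h where h: "R p x h" "R h f u" using R_assoc'[OF f(1) py(1)] by blast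
    obtain h' where h': "R p x h'" "R h' f' u'" using R_assoc'[OF f(2) py(2)] by blast
    have "h = h'" using R_fun h h' by blast
    then show ?thesis using h h' f by (auto simp: lower_def)
  qed
  have b: "\<exists>x. R p x h \<and> x \<in> lower y e y' e'" if h: "h \<in> lower u e u' e'" "p \<subseteq> h" for h
  proof -
    obtain f f' t where f: "R h f u" "R h f' u'" "R f e t" "R f' e' t" using h by (auto simp: lower_def)
    obtain x where x: "R p x h" using R_ex_right[of p h] R_S[OF py(1)] R_S[OF f(1)] h by auto
    obtain y2 where y2: "R x f y2" "R p y2 u" using R_assoc[OF x f(1)] by blast
    obtain y3 where y3: "R x f' y3" "R p y3 u'" using R_assoc[OF x f(2)] by blast
    have "y2 = y" "y3 = y'" using R_left_cancel py y2 y3 by blast+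
    then show ?thesis using x y2 y3 f by (auto simp: lower_def)
  qed
  show ?thesis
    unfolding cross_def
  proof (rule sum.reindex_bij_witness[of _ "\<lambda>h. THE x. R p x h" "\<lambda>x. THE h. R p x h"])
    fix x assume "x \<in> lower y e y' e'"
    then obtain h where h: "R p x h" "h \<in> lower u e u' e'" using a by blast
    show "(THE x'. R p x' (THE h. R p x h)) = x" using R_the[OF h(1)] R_the_right[OF h(1)] by simp
    show "(THE h. R p x h) \<in> {h. h \<in> lower u e u' e' \<and> p \<subseteq> h}" using R_the[OF h(1)] h R_sub[OF h(1)] by simp
    show "(-1) ^ (rk (THE h. R p x h) - rk p) = ((-1) ^ rk x :: 'k)" using R_the[OF h(1)] R_rk[OF h(1)] by simp
  next
    fix h assume "h \<in> {h. h \<in> lower u e u' e' \<and> p \<subseteq> h}"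
    then obtain x where x: "R p x h" "x \<in> lower y e y' e'" using b by blast
    show "(THE h'. R p (THE x. R p x h) h') = h" using R_the[OF x(1)] R_the_right[OF x(1)] by simp
    show "(THE x. R p x h) \<in> lower y e y' e'" using R_the_right[OF x(1)] x by simp
  qed
qed

text \<open>Interchanging the sums over \<open>p\<close> and over lower vertices: the number of left divisors of
  rank \<open>s\<close> of a vertex \<open>h\<close> is \<open>rk h choose s\<close> in the field.\<close>

lemma sum_cross_left:
  assumes q1: "of_nat q = (1::'k::field)" and uv: "u \<in> S" "u' \<in> S"
  shows "(\<Sum>p | p \<in> S \<and> rk p = s. \<Sum>y\<in>S. \<Sum>y'\<in>S. of_bool (R p y u) * of_bool (R p y' u') * cross y e y' e') =
    (\<Sum>h\<in>lower u e u' e'. (-1) ^ (rk h - s) * (of_nat (rk h choose s) :: 'k))"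
proof -
  have inner: "(\<Sum>y\<in>S. \<Sum>y'\<in>S. of_bool (R p y u) * of_bool (R p y' u') * cross y e y' e') =
      (\<Sum>h | h \<in> lower u e u' e' \<and> p \<subseteq> h. (-1) ^ (rk h - s) :: 'k)" if p: "p \<in> S" "rk p = s" for p
  proof (cases "\<exists>y y'. R p y u \<and> R p y' u'")
    case True
    then obtain y0 y0' where y0: "R p y0 u" "R p y0' u'" by blast
    have "R p y u \<longleftrightarrow> y = y0" "R p y u' \<longleftrightarrow> y = y0'" for y using R_left_cancel y0 by blast+
    then have "(\<Sum>y\<in>S. \<Sum>y'\<in>S. of_bool (R p y u) * of_bool (R p y' u') * cross y e y' e') =
        (\<Sum>y\<in>S. if y = y0 then \<Sum>y'\<in>S. if y' = y0' then cross y0 e y0' e' else 0 else (0::'k))"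
      by (intro sum.cong) (auto intro!: sum.cong)
    also have "\<dots> = cross y0 e y0' e'" using R_S[OF y0(1)] R_S[OF y0(2)] by simp
    finally show ?thesis by (simp only: cross_translate[OF y0] p(2))
  next
    case False
    have "{h. h \<in> lower u e u' e' \<and> p \<subseteq> h} = {}"
    proof (rule ccontr)
      assume "\<not> ?thesis"
      then obtain h where h: "h \<in> lower u e u' e'" "p \<subseteq> h" by blast
      then have "p \<subseteq> u" "p \<subseteq> u'" using R_sub by (auto simp: lower_def) blast+
      then show False using False R_ex_right[of p u] R_ex_right[of p u'] p uv by auto
    qed
    moreover have "of_bool (R p y u) * of_bool (R p y' u') * cross y e y' e' = (0::'k)" for y y'
      using False by auto
    ultimately show ?thesis by (simp only: sum.empty sum.neutral_const)
  qed
  have "(\<Sum>p | p \<in> S \<and> rk p = s. \<Sum>y\<in>S. \<Sum>y'\<in>S. of_bool (R p y u) * of_bool (R p y' u') * cross y e y' e') =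
      (\<Sum>p | p \<in> S \<and> rk p = s. \<Sum>h | h \<in> lower u e u' e' \<and> p \<subseteq> h. (-1) ^ (rk h - s) :: 'k)"
    by (rule sum.cong) (use inner in auto)
  also have "\<dots> = (\<Sum>h\<in>lower u e u' e'. \<Sum>p | p \<in> {p. p \<in> S \<and> rk p = s} \<and> p \<subseteq> h. (-1) ^ (rk h - s))"
    using sum.swap_restrict[of "{p. p \<in> S \<and> rk p = s}" "lower u e u' e'" "\<lambda>p h. (-1) ^ (rk h - s) :: 'k" "\<lambda>p h. p \<subseteq> h"]
    by simp
  also have "\<dots> = (\<Sum>h\<in>lower u e u' e'. (-1) ^ (rk h - s) * of_nat (rk h choose s))"
  proof (rule sum.cong)
    fix h assume "h \<in> lower u e u' e'"
    then have hS: "h \<in> S" using R_S by (auto simp: lower_def)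
    have "{p. p \<in> {p. p \<in> S \<and> rk p = s} \<and> p \<subseteq> h} = ivl {} h s" by (auto simp: ivl_def)
    then show "(\<Sum>p | p \<in> {p. p \<in> S \<and> rk p = s} \<and> p \<subseteq> h. (-1) ^ (rk h - s) :: 'k) = (-1) ^ (rk h - s) * of_nat (rk h choose s)"
      using card_ivl[OF q1, of "{}" h s] hS by simp
  qed simp
  finally show ?thesis .
qed

lemma lower_pts_right: "R u v' pts \<Longrightarrow> lower u pts pts w' = (if w' = u then {u} else {})"
proof -
  assume uv: "R u v' pts"
  have uS: "u \<in> S" using R_S uv by blast
  have "x = u \<and> w' = u" if "R x y u" "R x y' pts" "R y pts t" "R y' w' t" for x y y' t
  proof -
    have "y = {}" using R_rk[OF that(3)] R_S[OF that(3)] rk_le[of t] rk_zero[of y] by simp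
    then have "x = u" "t = pts" using that by auto
    have "y' = sg u" using R_left_cancel that(2) R_sg[OF uS] \<open>x = u\<close> by blast
    then have "w' = u" using R_left_cancel[of y' w' pts u] that(4) R_sg[of "sg u"] uS \<open>t = pts\<close> by simp
    then show ?thesis using \<open>x = u\<close> by simp
  qed
  then have "lower u pts pts w' \<subseteq> {x. x = u \<and> w' = u}" by (auto simp: lower_def)
  moreover have "u \<in> lower u pts pts u"
  proof -
    have "R u {} u" "R u (sg u) pts" "R {} pts pts" "R (sg u) u pts"
      using R_sg[OF uS] R_sg[of "sg u"] uS by auto
    then show ?thesis unfolding lower_def by blast
  qed
  ultimately show ?thesis by auto
qed

lemma cross_pts_right:
  assumes "u \<in> S" "w' \<in> S" shows "cross u pts pts w' = (if w' = u then (-1) ^ rk u else (0::'k::field))"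
  using lower_pts_right[OF R_sg[OF assms(1)], of w'] by (simp add: cross_def)

lemma cross_pts_left:
  assumes vS: "v \<in> S" and wS: "w' \<in> S" shows "cross pts v w' pts = (if w' = v then (-1) ^ rk v else (0::'k::field))"
proof -
  have "x = v \<and> w' = v" if "R x y pts" "R x y' w'" "R y v t" "R y' pts t" for x y y' t
  proof -
    have "y' = {}" using R_rk[OF that(4)] R_S[OF that(4)] rk_le[of t] rk_zero[of y'] by simp
    then have "x = w'" "t = pts" using that by auto
    have yS: "y \<in> S" using R_S that by blast
    have "v = sg y" using R_left_cancel that(3) R_sg[OF yS] \<open>t = pts\<close> by blast
    moreover have "y = sg x" using R_left_cancel[OF that(1)] R_sg R_S that(1) by blast
    ultimately show ?thesis using \<open>x = w'\<close> wS by simp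
  qed
  then have "lower pts v w' pts \<subseteq> {x. x = v \<and> w' = v}" by (auto simp: lower_def)
  moreover have "v \<in> lower pts v v pts"
  proof -
    have "R v {} v" "R v (sg v) pts" "R {} pts pts" "R (sg v) v pts"
      using R_sg[OF vS] R_sg[of "sg v"] vS by auto
    then show ?thesis unfolding lower_def by blast
  qed
  ultimately have "lower pts v w' pts = (if w' = v then {v} else {})" by auto
  then show ?thesis by (simp add: cross_def)
qed

end

text \<open>The rank condition forces \<open>al = s + be\<close>, so the counts of lower vertices turn the left hand side
  into the alternating Vandermonde sum; the latter is nonzero only for \<open>be = 0\<close>.\<close>

lemma (in square) alternating_lower:
  assumes q1: "of_nat q = (1::'k::field)" and s: "rk e + s = rk u'"
  shows "(\<Sum>h\<in>lower u e u' e'. (-1) ^ (rk h - s) * (of_nat (rk h choose s) :: 'k)) =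
    (if \<exists>w1. R g w1 e \<and> R g' w1 e' \<and> w1 \<inter> sg z = {} then (-1) ^ (rk x - s) else 0)"
proof (cases "\<exists>w1. R g w1 e \<and> R g' w1 e'")
  case False
  then have "lower u e u' e' = {}" using lower_nonempty by blast
  then show ?thesis using False by auto
next
  case True
  then obtain w1 where w1: "R g w1 e" "R g' w1 e'" by blast
  then interpret f: filled_square G q n \<sigma> T u u' g g' e e' w1 by unfold_locales
  have al: "f.al = s + f.be" using f.dims s by linarith
  have le: "rk h \<le> rk x" if "h \<in> lower u e u' e'" for h using that f.lower_iff R_rk by fastforce
  have "(\<Sum>h\<in>lower u e u' e'. (-1) ^ (rk h - s) * (of_nat (rk h choose s) :: 'k)) =
      (\<Sum>k\<le>rk x. \<Sum>h | h \<in> lower u e u' e' \<and> rk h = k. (-1) ^ (rk h - s) * of_nat (rk h choose s))"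
    using le by (intro sum.group[symmetric]) auto
  also have "\<dots> = (\<Sum>k\<le>rk x. (-1) ^ (k - s) * of_nat (k choose s) * of_nat ((s + f.be) choose (rk x - k)))"
  proof (rule sum.cong)
    fix k assume k: "k \<in> {..rk x}"
    have "(\<Sum>h | h \<in> lower u e u' e' \<and> rk h = k. (-1) ^ (rk h - s) * (of_nat (rk h choose s) :: 'k)) =
        (\<Sum>h | h \<in> lower u e u' e' \<and> rk h = k. (-1) ^ (k - s) * of_nat (k choose s))"
      by (intro sum.cong) auto
    also have "\<dots> = (-1) ^ (k - s) * of_nat (k choose s) * of_nat (card {h \<in> lower u e u' e'. rk h = k})" by simp
    also have "of_nat (card {h \<in> lower u e u' e'. rk h = k}) = (of_nat ((s + f.be) choose (rk x - k)) :: 'k)"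
      unfolding f.card_lower[OF q1] using k al by simp
    finally show "(\<Sum>h | h \<in> lower u e u' e' \<and> rk h = k. (-1) ^ (rk h - s) * (of_nat (rk h choose s) :: 'k)) =
      (-1) ^ (k - s) * of_nat (k choose s) * of_nat ((s + f.be) choose (rk x - k))" .
  qed simp
  also have "\<dots> = of_int (\<Sum>k\<le>rk x. (-1) ^ (k - s) * int (k choose s) * int ((s + f.be) choose (rk x - k)))"
    by simp
  also have "\<dots> = (if f.be = 0 then (-1) ^ (rk x - s) else 0)"
    by (subst alternating_vandermonde) (use f.dims al in auto)
  also have "f.be = 0 \<longleftrightarrow> w1 \<inter> sg z = {}" unfolding f.be_def using rk_zero f.wS yS by simp
  also have "w1 \<inter> sg z = {} \<longleftrightarrow> (\<exists>w1. R g w1 e \<and> R g' w1 e' \<and> w1 \<inter> sg z = {})"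
    using w1 R_left_cancel by metis
  finally show ?thesis .
qed

context tri_geometry
begin

text \<open>The terms of the bialgebra sum are indexed by a left factor \<open>p\<close> common to \<open>u\<close>, \<open>u'\<close>
  and a right factor \<open>w\<close> common to \<open>v\<close>, \<open>v'\<close>.  For fixed \<open>w\<close> the sum over \<open>p\<close> collapses to a single sign,
  and the remaining sum over \<open>w\<close> is a Moebius sum over left divisors of the filler \<open>\<omega>\<close> of the square.\<close>

lemma bialgebra_sum:
  assumes q1: "of_nat q = (1::'k::field)" and uv: "u \<in> S" "v \<in> S" "u' \<in> S" "v' \<in> S"
    and rks: "rk u + rk v = rk u' + rk v'"
  shows "(\<Sum>w\<in>S. \<Sum>p | p \<in> S \<and> rk p + rk v = rk w + rk u'. \<Sum>e\<in>S. \<Sum>e'\<in>S. \<Sum>y\<in>S. \<Sum>y'\<in>S.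
      of_bool (R e w v) * of_bool (R e' w v') * (of_bool (R p y u) * of_bool (R p y' u') * cross y e y' e')) =
    (of_bool (\<exists>t. R u v t \<and> R u' v' t) :: 'k)"
proof -
  obtain g g' where "square G q n \<sigma> T u u' g g'" using square_exists uv by blast
  then interpret sq: square G q n \<sigma> T u u' g g' .
  let ?z = "jn u u'"
  \<comment> \<open>For fixed \<open>w\<close>, with cofactors \<open>e\<close> in \<open>v\<close> and \<open>e'\<close> in \<open>v'\<close>, the sum over \<open>p\<close> is the sign of the \<open>w1\<close>
    with \<open>e = g w1\<close> and \<open>e' = g' w1\<close>, provided that this \<open>w1\<close> exists and meets \<open>sg z\<close> trivially.\<close>
  define good where "good w w1 \<longleftrightarrow> (\<exists>e e'. R e w v \<and> R e' w v' \<and> R g w1 e \<and> R g' w1 e') \<and> w1 \<inter> sg ?z = {}" for w w1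
  have good_unique: "w1 = w2" if "good w w1" "good w w2" for w w1 w2
    using that R_left_cancel R_right_cancel unfolding good_def by metis
  have inner: "(\<Sum>p | p \<in> S \<and> rk p + rk v = rk w + rk u'. \<Sum>e\<in>S. \<Sum>e'\<in>S. \<Sum>y\<in>S. \<Sum>y'\<in>S.
      of_bool (R e w v) * of_bool (R e' w v') * (of_bool (R p y u) * of_bool (R p y' u') * cross y e y' e')) =
      (\<Sum>w1 | w1 \<in> S \<and> good w w1. (-1) ^ rk w1 :: 'k)" if wS: "w \<in> S" for w
  proof (cases "\<exists>e e'. R e w v \<and> R e' w v'")
    case False
    then have "of_bool (R e w v) * of_bool (R e' w v') * x = (0::'k)" for e e' x by auto
    moreover have "{w1. w1 \<in> S \<and> good w w1} = {}" using False by (auto simp: good_def)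
    ultimately show ?thesis by (simp only: sum.neutral_const sum.empty)
  next
    case True
    then obtain e e' where e: "R e w v" "R e' w v'" by blast
    have eS: "e \<in> S" "e' \<in> S" using e R_S by blast+
    have ee: "R f w v \<longleftrightarrow> f = e" "R f w v' \<longleftrightarrow> f = e'" for f using R_right_cancel e by blast+
    have gd: "good w w1 \<longleftrightarrow> R g w1 e \<and> R g' w1 e' \<and> w1 \<inter> sg ?z = {}" for w1
      unfolding good_def using ee by auto
    have collapse: "(\<Sum>f\<in>S. \<Sum>f'\<in>S. \<Sum>y\<in>S. \<Sum>y'\<in>S.
        of_bool (R f w v) * of_bool (R f' w v') * (of_bool (R p y u) * of_bool (R p y' u') * cross y f y' f')) =
        (\<Sum>y\<in>S. \<Sum>y'\<in>S. of_bool (R p y u) * of_bool (R p y' u') * cross y e y' e' :: 'k)" for p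
    proof -
      have "(\<Sum>y\<in>S. \<Sum>y'\<in>S.
          of_bool (R f w v) * of_bool (R f' w v') * (of_bool (R p y u) * of_bool (R p y' u') * cross y f y' f')) =
          (if f = e then if f' = e' then
            (\<Sum>y\<in>S. \<Sum>y'\<in>S. of_bool (R p y u) * of_bool (R p y' u') * cross y e y' e' :: 'k) else 0 else 0)" for f f'
        by (cases "f = e"; cases "f' = e'") (simp_all add: ee)
      then have "(\<Sum>f\<in>S. \<Sum>f'\<in>S. \<Sum>y\<in>S. \<Sum>y'\<in>S.
        of_bool (R f w v) * of_bool (R f' w v') * (of_bool (R p y u) * of_bool (R p y' u') * cross y f y' f')) =
        (\<Sum>f\<in>S. \<Sum>f'\<in>S. if f = e then if f' = e' then
          (\<Sum>y\<in>S. \<Sum>y'\<in>S. of_bool (R p y u) * of_bool (R p y' u') * cross y e y' e' :: 'k) else 0 else 0)"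
        by (simp only:)
      also have "\<dots> = (\<Sum>f\<in>S. if f = e then \<Sum>f'\<in>S. if f' = e' then
          (\<Sum>y\<in>S. \<Sum>y'\<in>S. of_bool (R p y u) * of_bool (R p y' u') * cross y e y' e' :: 'k) else 0 else 0)"
        by (rule sum.cong[OF HOL.refl]) simp
      finally show ?thesis using eS by simp
    qed
    show ?thesis
    proof (cases "rk v \<le> rk w + rk u'")
      case True
      define s where "s = rk w + rk u' - rk v"
      have s: "rk e + s = rk u'" using True R_rk[OF e(1)] by (simp add: s_def)
      have ps: "{p. p \<in> S \<and> rk p + rk v = rk w + rk u'} = {p. p \<in> S \<and> rk p = s}"
        using True by (auto simp: s_def)
      have "(\<Sum>p | p \<in> S \<and> rk p + rk v = rk w + rk u'. \<Sum>f\<in>S. \<Sum>f'\<in>S. \<Sum>y\<in>S. \<Sum>y'\<in>S.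
        of_bool (R f w v) * of_bool (R f' w v') * (of_bool (R p y u) * of_bool (R p y' u') * cross y f y' f')) =
        (if \<exists>w1. R g w1 e \<and> R g' w1 e' \<and> w1 \<inter> sg ?z = {} then (-1) ^ (rk (u \<inter> u') - s) else (0::'k))"
        unfolding collapse ps sum_cross_left[OF q1 uv(1,3)] using sq.alternating_lower[OF q1 s] by simp
      also have "\<dots> = (\<Sum>w1 | w1 \<in> S \<and> good w w1. (-1) ^ rk w1)"
      proof (cases "\<exists>w1. good w w1")
        case False
        then have "{w1. w1 \<in> S \<and> good w w1} = {}" by auto
        moreover have "\<not> (\<exists>w1. R g w1 e \<and> R g' w1 e' \<and> w1 \<inter> sg ?z = {})" using False gd by blast
        ultimately show ?thesis by (simp only: if_False sum.empty)
      next
        case ex: True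
        then obtain w1 where w1: "good w w1" by blast
        then have "R g w1 e" using gd by blast
        then have "rk w1 = rk (u \<inter> u') - s" "w1 \<in> S" using R_rk[of g w1 e] s sq.rks R_S by auto
        moreover then have "{w1. w1 \<in> S \<and> good w w1} = {w1}" using good_unique w1 by auto
        ultimately show ?thesis using w1 gd by auto
      qed
      finally show ?thesis .
    next
      case False
      then have "{p. p \<in> S \<and> rk p + rk v = rk w + rk u'} = {}" by auto
      moreover have "{w1. w1 \<in> S \<and> good w w1} = {}"
      proof (rule ccontr)
        assume "\<not> ?thesis"
        then obtain w1 where w1: "R g w1 e" "R g' w1 e'" "w1 \<inter> sg ?z = {}" using gd by blast
        then interpret f: filled_square G q n \<sigma> T u u' g g' e e' w1 by unfold_locales
        have "f.be = 0" using w1 by (simp add: f.be_def)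
        then show False using f.dims(3) R_rk[OF e(1)] False by simp
      qed
      ultimately show ?thesis by (simp only: sum.empty)
    qed
  qed
  have "(\<Sum>w\<in>S. \<Sum>p | p \<in> S \<and> rk p + rk v = rk w + rk u'. \<Sum>e\<in>S. \<Sum>e'\<in>S. \<Sum>y\<in>S. \<Sum>y'\<in>S.
      of_bool (R e w v) * of_bool (R e' w v') * (of_bool (R p y u) * of_bool (R p y' u') * cross y e y' e')) =
      (\<Sum>w\<in>S. \<Sum>w1 | w1 \<in> S \<and> good w w1. (-1) ^ rk w1 :: 'k)"
    by (rule sum.cong) (use inner in auto)
  also have "\<dots> = (\<Sum>w1\<in>S. \<Sum>w | w \<in> S \<and> good w w1. (-1) ^ rk w1)"
    by (rule sum.swap_restrict) simp_all
  also have "\<dots> = of_bool (\<exists>t. R u v t \<and> R u' v' t)"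
  proof (cases "\<exists>\<omega>. R g \<omega> v \<and> R g' \<omega> v'")
    case False
    have "\<not> good w w1" for w w1
    proof
      assume "good w w1"
      then obtain e e' where e: "R e w v" "R e' w v'" "R g w1 e" "R g' w1 e'" by (auto simp: good_def)
      obtain o1 where o1: "R w1 w o1" "R g o1 v" using R_assoc[OF e(3,1)] by blast
      obtain o2 where o2: "R w1 w o2" "R g' o2 v'" using R_assoc[OF e(4,2)] by blast
      show False using False R_fun o1 o2 by blast
    qed
    moreover have "\<not> (\<exists>t. R u v t \<and> R u' v' t)"
    proof
      assume "\<exists>t. R u v t \<and> R u' v' t"
      then obtain t where "R u v t" "R u' v' t" by blast
      then have "{} \<in> lower u v u' v'" using uv by (auto simp: lower_def)
      then show False using sq.lower_nonempty False by blast
    qed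
    ultimately show ?thesis by simp
  next
    case True
    then obtain \<omega> where \<omega>: "R g \<omega> v" "R g' \<omega> v'" by blast
    have \<omega>S: "\<omega> \<in> S" using R_S \<omega> by blast
    \<comment> \<open>Since \<open>g w1 w = e w = v\<close>, the admissible \<open>w1\<close> are left divisors of \<open>\<omega>\<close>.\<close>
    have good: "good w w1 \<longleftrightarrow> R w1 w \<omega> \<and> w1 \<inter> sg ?z = {}" for w w1
    proof
      assume gd: "good w w1"
      then obtain e e' where e: "R e w v" "R g w1 e" by (auto simp: good_def)
      obtain o1 where o1: "R w1 w o1" "R g o1 v" using R_assoc[OF e(2,1)] by blast
      then have "o1 = \<omega>" using R_left_cancel \<omega> by blast
      then show "R w1 w \<omega> \<and> w1 \<inter> sg ?z = {}" using o1 gd by (simp add: good_def)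
    next
      assume r: "R w1 w \<omega> \<and> w1 \<inter> sg ?z = {}"
      obtain e where e: "R g w1 e" "R e w v" using R_assoc'[of w1 w \<omega> g v] r \<omega> by blast
      obtain e' where e': "R g' w1 e'" "R e' w v'" using R_assoc'[of w1 w \<omega> g' v'] r \<omega> by blast
      show "good w w1" using e e' r by (auto simp: good_def)
    qed
    have "(\<Sum>w | w \<in> S \<and> good w w1. (-1) ^ rk w1 :: 'k) = (if w1 \<subseteq> \<omega> \<and> w1 \<inter> sg ?z = {} then (-1) ^ rk w1 else 0)"
      if w1S: "w1 \<in> S" for w1
    proof (cases "w1 \<subseteq> \<omega> \<and> w1 \<inter> sg ?z = {}")
      case True
      then obtain w where w: "R w1 w \<omega>" using R_ex_right[of w1 \<omega>] w1S \<omega>S by auto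
      have "w2 = w" if "good w2 w1" for w2 using that good R_left_cancel[OF _ w] by blast
      moreover have "good w w1" "w \<in> S" using good w True R_S by auto
      ultimately have "{w. w \<in> S \<and> good w w1} = {w}" by blast
      then show ?thesis using True by simp
    next
      case False
      then have "{w. w \<in> S \<and> good w w1} = {}" using good R_sub by auto
      then show ?thesis by (simp only: False if_False sum.empty)
    qed
    then have "(\<Sum>w1\<in>S. \<Sum>w | w \<in> S \<and> good w w1. (-1) ^ rk w1 :: 'k) =
        (\<Sum>w1\<in>S. if w1 \<subseteq> \<omega> \<and> w1 \<inter> sg ?z = {} then (-1) ^ rk w1 else 0)" by (rule sum.cong[OF HOL.refl])
    also have "\<dots> = (\<Sum>w1 | w1 \<in> S \<and> w1 \<subseteq> \<omega> \<and> w1 \<inter> sg ?z = {}. (-1) ^ rk w1)"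
      by (rule sum.mono_neutral_cong_right) auto
    also have "\<dots> = (\<Sum>w1 | w1 \<in> S \<and> w1 \<subseteq> \<omega> \<and> w1 \<inter> (\<omega> \<inter> sg ?z) = {}. (-1) ^ rk w1)"
      by (rule sum.cong) auto
    also have "\<dots> = of_bool (\<omega> \<inter> sg ?z = \<omega>)"
      using alternating_sum_disjoint[OF q1, of "\<omega> \<inter> sg ?z" \<omega>] \<omega>S uv by simp
    also have "\<omega> \<inter> sg ?z = \<omega> \<longleftrightarrow> (\<exists>t. R u v t \<and> R u' v' t)"
    proof
      assume "\<omega> \<inter> sg ?z = \<omega>"
      then obtain t where t: "R ?z \<omega> t" using R_ex[of ?z \<omega>] \<omega>S uv by auto
      obtain v1 where v1: "R g \<omega> v1" "R u v1 t" using R_assoc[OF sq.g t] by blast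
      obtain v2 where v2: "R g' \<omega> v2" "R u' v2 t" using R_assoc[OF sq.g' t] by blast
      have "v1 = v" "v2 = v'" using R_fun \<omega> v1 v2 by blast+
      then show "\<exists>t. R u v t \<and> R u' v' t" using v1 v2 by blast
    next
      assume "\<exists>t. R u v t \<and> R u' v' t"
      then obtain t where t: "R u v t" "R u' v' t" by blast
      obtain z2 where z2: "R u g z2" "R z2 \<omega> t" using R_assoc'[OF \<omega>(1) t(1)] by blast
      have "z2 = ?z" using R_fun z2 sq.g by blast
      then show "\<omega> \<inter> sg ?z = \<omega>" using R_sub_sg z2 by blast
    qed
    finally show ?thesis .
  qed
  finally show ?thesis .
qed

end

section \<open>Matrices between coordinate spaces\<close>

lemma sum_fun_apply: "(\<Sum>i\<in>I. f i) j = (\<Sum>i\<in>I. f i j)" for f :: "'i \<Rightarrow> 'j \<Rightarrow> 'k::comm_monoid_add"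
  by (induction I rule: infinite_finite_induct) auto

text \<open>Every space that occurs below is a coordinate space of this kind, so that its linear maps are
  matrices.\<close>

definition fsp :: "'i set \<Rightarrow> ('i \<Rightarrow> 'k::field) set" where "fsp I = {x. \<forall>i. i \<notin> I \<longrightarrow> x i = 0}"

lemma subspace_fsp [simp]: "fvs.subspace (fsp I)"
  by (auto simp: fvs.subspace_def fsp_def vscale_def)

lemma ivec_fsp [simp]: "ivec i \<in> fsp I \<longleftrightarrow> i \<in> I"
  by (auto simp: fsp_def ivec_def)

lemma fsp_expand:
  assumes "finite I" "x \<in> fsp I" shows "x = (\<Sum>i\<in>I. vscale (x i) (ivec i))"
proof
  fix j
  have "(\<Sum>i\<in>I. vscale (x i) (ivec i)) j = (\<Sum>i\<in>I. if j = i then x j else 0)"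
    unfolding sum_fun_apply by (intro sum.cong) (auto simp: vscale_def ivec_def)
  then show "x j = (\<Sum>i\<in>I. vscale (x i) (ivec i)) j" using assms by (auto simp: fsp_def)
qed

lemma span_ivec:
  fixes I :: "'b index set"
  assumes "finite I" shows "fvs.span (ivec ` I) = (fsp I :: ('b, 'k::field) vec set)"
proof
  show "fvs.span (ivec ` I) \<subseteq> (fsp I :: ('b, 'k) vec set)" by (rule fvs.span_minimal) auto
  show "(fsp I :: ('b, 'k) vec set) \<subseteq> fvs.span (ivec ` I)"
  proof
    fix x :: "('b, 'k) vec" assume "x \<in> fsp I"
    then have "x = (\<Sum>i\<in>I. vscale (x i) (ivec i))" using fsp_expand assms by blast
    moreover have "(\<Sum>i\<in>I. vscale (x i) (ivec i)) \<in> fvs.span (ivec ` I)"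
      by (intro fvs.span_sum fvs.span_scale fvs.span_base) auto
    ultimately show "x \<in> fvs.span (ivec ` I)" by simp
  qed
qed

lemma lin_on_expand:
  fixes x :: "('b, 'k::field) vec"
  assumes "finite I" "lin_on (fsp I) f" "x \<in> fsp I"
  shows "f x = (\<Sum>i\<in>I. vscale (x i) (f (ivec i)))"
proof -
  have add: "f (a + b) = f a + f b" if "a \<in> fsp I" "b \<in> fsp I" for a b using assms(2) that by (simp add: lin_on_def)
  have scale: "f (vscale c a) = vscale c (f a)" if "a \<in> fsp I" for a c using assms(2) that by (simp add: lin_on_def)
  have sub: "(\<Sum>i\<in>K. vscale (x i) (ivec i)) \<in> fsp I" if "K \<subseteq> I" for K
    using that by (intro fvs.subspace_sum subspace_fsp fvs.subspace_scale) auto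
  have zero: "f 0 = 0"
  proof -
    have "vscale 0 (0 :: ('b, 'k) vec) = 0" by (simp add: vscale_def fun_eq_iff)
    moreover have "(0 :: ('b, 'k) vec) \<in> fsp I" by (simp add: fsp_def)
    ultimately have "f 0 = vscale 0 (f 0)" using scale by metis
    then show ?thesis by (simp add: vscale_def fun_eq_iff)
  qed
  have "f (\<Sum>i\<in>K. vscale (x i) (ivec i)) = (\<Sum>i\<in>K. vscale (x i) (f (ivec i)))" if "K \<subseteq> I" "finite K" for K
    using that(2,1)
  proof (induction K rule: finite_induct)
    case empty then show ?case by (simp only: sum.empty zero)
  next
    case (insert k K)
    then have "vscale (x k) (ivec k) \<in> fsp I" by (intro fvs.subspace_scale subspace_fsp) auto
    moreover have "f (\<Sum>i\<in>K. vscale (x i) (ivec i)) = (\<Sum>i\<in>K. vscale (x i) (f (ivec i)))" using insert by blast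
    moreover have "(\<Sum>i\<in>K. vscale (x i) (ivec i)) \<in> fsp I" "k \<in> I" using insert.prems by (auto intro: sub)
    ultimately show ?case by (simp only: sum.insert[OF insert.hyps] add scale ivec_fsp)
  qed
  then have "f (\<Sum>i\<in>I. vscale (x i) (ivec i)) = (\<Sum>i\<in>I. vscale (x i) (f (ivec i)))" using assms by simp
  then show ?thesis using fsp_expand[OF assms(1,3)] by simp
qed

definition ipairs :: "'b index set \<Rightarrow> 'b index set \<Rightarrow> 'b index set" where
  "ipairs I J = {Ipair i j | i j. i \<in> I \<and> j \<in> J}"

lemma finite_ipairs: "finite I \<Longrightarrow> finite J \<Longrightarrow> finite (ipairs I J)"
  unfolding ipairs_def by (simp add: finite_image_set2)

lemma tensor_vec_ivec: "tensor_vec (ivec s) (ivec t) = ivec (Ipair s t)"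
  by (auto simp: tensor_vec_def ivec_def fun_eq_iff split: index.split)

lemma tensor_vec_fsp: "v \<in> fsp I \<Longrightarrow> w \<in> fsp J \<Longrightarrow> tensor_vec v w \<in> fsp (ipairs I J)"
  by (auto simp: fsp_def tensor_vec_def ipairs_def split: index.split)

lemma tensor_space_fsp:
  fixes I J :: "'b index set"
  assumes "finite I" "finite J"
  shows "tensor_space (fsp I) (fsp J) = (fsp (ipairs I J) :: ('b, 'k::field) vec set)"
proof
  show "tensor_space (fsp I) (fsp J) \<subseteq> (fsp (ipairs I J) :: ('b, 'k) vec set)"
    unfolding tensor_space_def by (rule fvs.span_minimal) (auto intro: tensor_vec_fsp)
  have "ivec ` ipairs I J \<subseteq> {tensor_vec v w | v w. v \<in> fsp I \<and> w \<in> (fsp J :: ('b, 'k) vec set)}"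
  proof
    fix x :: "('b, 'k) vec" assume "x \<in> ivec ` ipairs I J"
    then obtain i j where ij: "x = ivec (Ipair i j)" "i \<in> I" "j \<in> J" by (auto simp: ipairs_def)
    have "tensor_vec (ivec i) (ivec j) \<in> {tensor_vec v w | v w. v \<in> fsp I \<and> w \<in> (fsp J :: ('b, 'k) vec set)}"
      using ij(2,3) ivec_fsp by blast
    then show "x \<in> {tensor_vec v w | v w. v \<in> fsp I \<and> w \<in> (fsp J :: ('b, 'k) vec set)}"
      by (simp only: ij tensor_vec_ivec)
  qed
  then have "fvs.span (ivec ` ipairs I J) \<subseteq> (tensor_space (fsp I) (fsp J) :: ('b, 'k) vec set)"
    unfolding tensor_space_def by (rule fvs.span_mono)
  then show "(fsp (ipairs I J) :: ('b, 'k) vec set) \<subseteq> tensor_space (fsp I) (fsp J)"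
    by (simp only: span_ivec[OF finite_ipairs[OF assms]])
qed

text \<open>A shape is a bracketing of labels; it determines an iterated tensor product.  The basis of that
  space is described by a plain list of subspaces, whatever the bracketing, so that associators and
  unitors become identity matrices.  The label \<open>0\<close> still occupies a place in the list, whereas the unit
  object does not.\<close>

datatype shape = Unit | Leaf int | Node shape shape

primrec slen :: "shape \<Rightarrow> nat" where
  "slen Unit = 0" | "slen (Leaf a) = 1" | "slen (Node s t) = slen s + slen t"

type_synonym ('p, 'k) lmat = "'p set list \<Rightarrow> 'p set list \<Rightarrow> 'k"

definition idm :: "('p, 'k::field) lmat" where "idm ws us = of_bool (ws = us)"

text \<open>The Kronecker product; \<open>l'\<close> and \<open>l\<close> tell where the row and the column index are to be cut.\<close>

definition tmat :: "nat \<Rightarrow> nat \<Rightarrow> ('p, 'k::field) lmat \<Rightarrow> ('p, 'k) lmat \<Rightarrow> ('p, 'k) lmat" where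
  "tmat l' l A C ws us = A (take l' ws) (take l us) * C (drop l' ws) (drop l us)"

definition mmul :: "'p set list set \<Rightarrow> ('p, 'k::field) lmat \<Rightarrow> ('p, 'k) lmat \<Rightarrow> ('p, 'k) lmat" where
  "mmul M D A ws us = (\<Sum>vs\<in>M. D ws vs * A vs us)"

context tri_geometry
begin

definition P :: "int \<Rightarrow> 'p set set" where "P a = {u \<in> S. int (rk u) = a}"

lemma finite_P [simp]: "finite (P a)" by (simp add: P_def)
lemma P_S: "u \<in> P a \<Longrightarrow> u \<in> S" by (simp add: P_def)
lemma P_0 [simp]: "P 0 = {{}}" using rk_zero by (auto simp: P_def)
lemma P_n [simp]: "P (int n) = {pts}" using rk_full by (auto simp: P_def)
lemma P_out: "\<not> (0 \<le> a \<and> a \<le> int n) \<Longrightarrow> P a = {}" using rk_le by (force simp: P_def)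

primrec B :: "shape \<Rightarrow> 'p set list set" where
  "B Unit = {[]}" | "B (Leaf a) = (\<lambda>u. [u]) ` P a" | "B (Node s t) = {xs @ ys | xs ys. xs \<in> B s \<and> ys \<in> B t}"

text \<open>The index of a basis vector.  For the labels \<open>0\<close> and \<open>n\<close> the space is the unit object, whose only
  basis vector is indexed by \<open>Iunit\<close> and not by the subspace.\<close>

primrec enc :: "shape \<Rightarrow> 'p set list \<Rightarrow> 'p set index" where
  "enc Unit us = Iunit"
| "enc (Leaf a) us = (if a = 0 \<or> a = int n then Iunit else Ibas (hd us))"
| "enc (Node s t) us = Ipair (enc s (take (slen s) us)) (enc t (drop (slen s) us))"

lemma B_length: "us \<in> B s \<Longrightarrow> length us = slen s"
  by (induction s arbitrary: us) auto

lemma B_append [simp]: "xs \<in> B s \<Longrightarrow> enc (Node s t) (xs @ ys) = Ipair (enc s xs) (enc t ys)"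
  by (simp add: B_length)

lemma B_Node_iff: "us \<in> B (Node s t) \<longleftrightarrow> take (slen s) us \<in> B s \<and> drop (slen s) us \<in> B t"
proof
  assume "us \<in> B (Node s t)"
  then show "take (slen s) us \<in> B s \<and> drop (slen s) us \<in> B t" using B_length by auto
next
  assume "take (slen s) us \<in> B s \<and> drop (slen s) us \<in> B t"
  then show "us \<in> B (Node s t)" by simp (metis append_take_drop_id)
qed

lemma sum_B_Node: "sum f (B (Node s t)) = (\<Sum>xs\<in>B s. \<Sum>ys\<in>B t. f (xs @ ys))"
proof -
  have e: "B (Node s t) = (\<lambda>(xs, ys). xs @ ys) ` (B s \<times> B t)" by auto
  have "inj_on (\<lambda>(xs, ys). xs @ ys) (B s \<times> B t)" using B_length by (auto simp: inj_on_def)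
  then have "sum f (B (Node s t)) = sum (f \<circ> (\<lambda>(xs, ys). xs @ ys)) (B s \<times> B t)"
    unfolding e by (rule sum.reindex)
  then show ?thesis by (simp add: sum.cartesian_product comp_def split_def)
qed

lemma sum_B_Leaf: "sum f (B (Leaf a)) = (\<Sum>u\<in>P a. f [u])"
  by (simp add: sum.reindex inj_on_def)

lemma finite_B [simp]: "finite (B s)"
proof (induction s)
  case (Node s t)
  then show ?case by (simp add: finite_image_set2)
qed auto

lemma inj_enc: "inj_on (enc s) (B s)"
proof (induction s)
  case (Leaf a)
  show ?case
  proof (cases "a = 0 \<or> a = int n")
    case True then show ?thesis by (auto simp: inj_on_def)
  qed (auto simp: inj_on_def)
next
  case (Node s t)
  show ?case
  proof (rule inj_onI)
    fix us vs assume "us \<in> B (Node s t)" "vs \<in> B (Node s t)" and e: "enc (Node s t) us = enc (Node s t) vs"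
    then have m: "take (slen s) us \<in> B s" "drop (slen s) us \<in> B t" "take (slen s) vs \<in> B s" "drop (slen s) vs \<in> B t"
      unfolding B_Node_iff by auto
    have "take (slen s) us = take (slen s) vs" using e m inj_onD[OF Node.IH(1)] by simp
    moreover have "drop (slen s) us = drop (slen s) vs" using e m inj_onD[OF Node.IH(2)] by simp
    ultimately show "us = vs" by (metis append_take_drop_id)
  qed
qed auto

definition spc :: "shape \<Rightarrow> ('p set, 'k::field) vec set" where "spc s = fsp (enc s ` B s)"

lemma enc_Node: "enc (Node s t) ` B (Node s t) = ipairs (enc s ` B s) (enc t ` B t)"
proof (rule subset_antisym; rule subsetI)
  fix i assume "i \<in> enc (Node s t) ` B (Node s t)"
  then show "i \<in> ipairs (enc s ` B s) (enc t ` B t)" by (fastforce simp: ipairs_def B_length)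
next
  fix i assume "i \<in> ipairs (enc s ` B s) (enc t ` B t)"
  then obtain xs ys where "xs \<in> B s" "ys \<in> B t" "i = Ipair (enc s xs) (enc t ys)" by (auto simp: ipairs_def)
  then have "i = enc (Node s t) (xs @ ys)" "xs @ ys \<in> B (Node s t)" by (auto simp: B_length)
  then show "i \<in> enc (Node s t) ` B (Node s t)" by blast
qed

lemma spc_add [simp]: "x \<in> spc s \<Longrightarrow> y \<in> spc s \<Longrightarrow> x + y \<in> spc s"
  unfolding spc_def by (rule fvs.subspace_add[OF subspace_fsp])

lemma spc_scale [simp]: "x \<in> spc s \<Longrightarrow> vscale c x \<in> spc s"
  unfolding spc_def by (rule fvs.subspace_scale[OF subspace_fsp])

lemma tensor_space_spc: "tensor_space (spc s) (spc t) = spc (Node s t)"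
  unfolding spc_def enc_Node by (rule tensor_space_fsp) auto

lemma spc_eqI:
  assumes "x \<in> spc s" "y \<in> spc s" "\<And>us. us \<in> B s \<Longrightarrow> x (enc s us) = y (enc s us)"
  shows "x = y"
proof
  fix i
  show "x i = y i" using assms by (cases "i \<in> enc s ` B s") (auto simp: spc_def fsp_def)
qed

text \<open>The linear map with matrix \<open>A\<close>; it is defined on all vectors, and morphisms use its restriction to
  \<open>spc s\<close>.\<close>

definition lact :: "shape \<Rightarrow> shape \<Rightarrow> ('p, 'k::field) lmat \<Rightarrow> ('p set, 'k) vec \<Rightarrow> ('p set, 'k) vec" where
  "lact s s' A x = (\<Sum>ws\<in>B s'. vscale (\<Sum>us\<in>B s. A ws us * x (enc s us)) (ivec (enc s' ws)))"

lemma lact_spc [simp]: "lact s s' A x \<in> spc s'"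
  unfolding lact_def spc_def by (intro fvs.subspace_sum subspace_fsp fvs.subspace_scale) auto

lemma lact_enc:
  assumes "ws \<in> B s'" shows "lact s s' A x (enc s' ws) = (\<Sum>us\<in>B s. A ws us * x (enc s us))"
proof -
  have "lact s s' A x (enc s' ws) = (\<Sum>vs\<in>B s'. if vs = ws then \<Sum>us\<in>B s. A vs us * x (enc s us) else 0)"
    unfolding lact_def sum_fun_apply
  proof (rule sum.cong)
    fix vs assume "vs \<in> B s'"
    then have "enc s' ws = enc s' vs \<longleftrightarrow> vs = ws" using assms inj_enc[of s'] by (auto dest: inj_onD)
    then show "vscale (\<Sum>us\<in>B s. A vs us * x (enc s us)) (ivec (enc s' vs)) (enc s' ws) =
        (if vs = ws then \<Sum>us\<in>B s. A vs us * x (enc s us) else 0)"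
      by (simp add: vscale_def ivec_def)
  qed simp
  then show ?thesis using assms by simp
qed

lemma lact_cong: "(\<And>ws us. ws \<in> B s' \<Longrightarrow> us \<in> B s \<Longrightarrow> A ws us = D ws us) \<Longrightarrow> lact s s' A = lact s s' D"
  unfolding lact_def by (intro HOL.ext) simp

lemma lin_lact: "lin_on V (lact s s' A)"
  unfolding lin_on_def
proof (intro conjI ballI allI)
  show "lact s s' A (x + y) = lact s s' A x + lact s s' A y" for x y
  proof (rule spc_eqI[of _ s'])
    show "lact s s' A x + lact s s' A y \<in> spc s'" by simp
  qed (simp_all add: lact_enc distrib_left sum.distrib)
  show "lact s s' A (vscale c x) = vscale c (lact s s' A x)" for c x
  proof (rule spc_eqI[of _ s'])
    show "vscale c (lact s s' A x) \<in> spc s'" by simp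
  qed (simp_all add: lact_enc vscale_def sum_distrib_left mult.left_commute)
qed

lemma lin_on_restrict: "fvs.subspace V \<Longrightarrow> lin_on V f \<Longrightarrow> lin_on V (restrict f V)"
  by (auto simp: lin_on_def fvs.subspace_add fvs.subspace_scale)

lemma lact_comp: "lact s' s'' D (lact s s' A x) = lact s s'' (mmul (B s') D A) x"
proof (rule spc_eqI[of _ s''])
  fix ws assume ws: "ws \<in> B s''"
  have "lact s' s'' D (lact s s' A x) (enc s'' ws) = (\<Sum>vs\<in>B s'. \<Sum>us\<in>B s. D ws vs * A vs us * x (enc s us))"
    using ws by (simp add: lact_enc sum_distrib_left mult.assoc)
  also have "\<dots> = (\<Sum>us\<in>B s. \<Sum>vs\<in>B s'. D ws vs * A vs us * x (enc s us))" by (rule sum.swap)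
  also have "\<dots> = lact s s'' (mmul (B s') D A) x (enc s'' ws)"
    using ws by (simp add: lact_enc mmul_def sum_distrib_right)
  finally show "lact s' s'' D (lact s s' A x) (enc s'' ws) = lact s s'' (mmul (B s') D A) x (enc s'' ws)" .
qed simp_all

lemma lact_tensor:
  assumes "v \<in> spc s" "w \<in> spc t"
  shows "lact (Node s t) (Node s' t') (tmat (slen s') (slen s) A C) (tensor_vec v w) =
    tensor_vec (lact s s' A v) (lact t t' C w)"
proof (rule spc_eqI[of _ "Node s' t'"])
  show "tensor_vec (lact s s' A v) (lact t t' C w) \<in> spc (Node s' t')"
    unfolding tensor_space_spc[symmetric] tensor_space_def by (rule fvs.span_base) (use lact_spc in blast)
  fix ws assume "ws \<in> B (Node s' t')"
  then obtain xs ys where ws: "ws = xs @ ys" "xs \<in> B s'" "ys \<in> B t'" by auto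
  have "lact (Node s t) (Node s' t') (tmat (slen s') (slen s) A C) (tensor_vec v w) (enc (Node s' t') ws) =
      (\<Sum>us\<in>B s. \<Sum>vs\<in>B t. A xs us * C ys vs * (v (enc s us) * w (enc t vs)))"
    unfolding lact_enc[OF \<open>ws \<in> B (Node s' t')\<close>] sum_B_Node
    using ws by (intro sum.cong) (auto simp: tmat_def B_length tensor_vec_def)
  also have "\<dots> = (\<Sum>us\<in>B s. A xs us * v (enc s us)) * (\<Sum>vs\<in>B t. C ys vs * w (enc t vs))"
    by (simp add: sum_product mult_ac)
  also have "\<dots> = tensor_vec (lact s s' A v) (lact t t' C w) (enc (Node s' t') ws)"
    using ws by (simp add: tensor_vec_def lact_enc B_length)
  finally show "lact (Node s t) (Node s' t') (tmat (slen s') (slen s) A C) (tensor_vec v w) (enc (Node s' t') ws) =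
      tensor_vec (lact s s' A v) (lact t t' C w) (enc (Node s' t') ws)" .
qed simp

text \<open>A linear map on a tensor product is determined by its values on products of basis vectors, which
  are again basis vectors; this gives the uniqueness required by the definite description.\<close>

lemma tensor_map_lact:
  fixes A C :: "('p, 'k::field) lmat"
  shows "tensor_map (spc s) (spc t) (restrict (lact s s' A) (spc s)) (restrict (lact t t' C) (spc t)) =
    restrict (lact (Node s t) (Node s' t') (tmat (slen s') (slen s) A C)) (spc (Node s t))"
  unfolding tensor_map_def tensor_space_spc
proof (rule the_equality)
  let ?L = "lact (Node s t) (Node s' t') (tmat (slen s') (slen s) A C)"
  have sub: "fvs.subspace (spc (Node s t) :: ('p set, 'k) vec set)" by (simp add: spc_def)
  have tv: "tensor_vec v w \<in> spc (Node s t)" if "v \<in> spc s" "w \<in> spc t" for v w :: "('p set, 'k) vec"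
    unfolding tensor_space_spc[symmetric] tensor_space_def by (rule fvs.span_base) (use that in blast)
  show P: "restrict ?L (spc (Node s t)) \<in> extensional (spc (Node s t)) \<and>
      lin_on (spc (Node s t)) (restrict ?L (spc (Node s t))) \<and>
      (\<forall>v\<in>spc s. \<forall>w\<in>spc t. restrict ?L (spc (Node s t)) (tensor_vec v w) =
        tensor_vec (restrict (lact s s' A) (spc s) v) (restrict (lact t t' C) (spc t) w))"
    using lin_on_restrict[OF sub lin_lact] tv by (auto simp: lact_tensor simp del: B.simps enc.simps)
  fix h assume h: "h \<in> extensional (spc (Node s t)) \<and> lin_on (spc (Node s t)) h \<and>
      (\<forall>v\<in>spc s. \<forall>w\<in>spc t. h (tensor_vec v w) =
        tensor_vec (restrict (lact s s' A) (spc s) v) (restrict (lact t t' C) (spc t) w))"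
  let ?I = "enc (Node s t) ` B (Node s t)"
  have fin: "finite ?I" by (rule finite_imageI[OF finite_B])
  show "h = restrict ?L (spc (Node s t))"
  proof (rule extensionalityI[of _ "spc (Node s t)"])
    fix x :: "('p set, 'k) vec" assume x: "x \<in> spc (Node s t)"
    have basis: "h (ivec i) = restrict ?L (spc (Node s t)) (ivec i)" if "i \<in> ?I" for i
    proof -
      obtain xs ys where i: "xs \<in> B s" "ys \<in> B t" "i = Ipair (enc s xs) (enc t ys)"
        using \<open>i \<in> ?I\<close> unfolding enc_Node by (auto simp: ipairs_def)
      have "ivec (enc s xs) \<in> spc s" "ivec (enc t ys) \<in> spc t" using i by (auto simp: spc_def)
      then show ?thesis unfolding i tensor_vec_ivec[symmetric] using h P by metis
    qed
    have "h x = (\<Sum>i\<in>?I. vscale (x i) (h (ivec i)))"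
      by (rule lin_on_expand[OF fin]) (use h x in \<open>auto simp: spc_def\<close>)
    also have "\<dots> = (\<Sum>i\<in>?I. vscale (x i) (restrict ?L (spc (Node s t)) (ivec i)))" using basis by simp
    also have "\<dots> = restrict ?L (spc (Node s t)) x"
    proof (rule lin_on_expand[OF fin, symmetric])
      show "lin_on (fsp ?I) (restrict ?L (spc (Node s t)))" using P unfolding spc_def by blast
      show "x \<in> fsp ?I" using x unfolding spc_def .
    qed
    finally show "h x = restrict ?L (spc (Node s t)) x" .
  qed (use h in auto)
qed

lemma lact_idm:
  assumes "B s = B s'" "ws \<in> B s'" shows "lact s s' idm x (enc s' ws) = x (enc s ws)"
  using assms by (simp add: lact_enc idm_def)

end

text \<open>The two categories of interest at once: a category of spaces with structure in which every shape
  has an object \<open>ob s\<close> with total space \<open>spc s\<close>, and in which a matrix between shapes is a morphism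
  as soon as it respects the degrees.\<close>

locale shaped_category = tri_geometry G q n \<sigma> T
  for G :: "('p, 'l) geometry" and q n \<sigma> T +
  fixes obs :: "'o set" and U :: "'o \<Rightarrow> ('p set, 'k::field) vec set"
    and pres :: "'o \<Rightarrow> (('p set, 'k) vec \<Rightarrow> ('p set, 'k) vec) \<Rightarrow> 'o \<Rightarrow> bool"
    and ten :: "'o \<Rightarrow> 'o \<Rightarrow> 'o" and un :: 'o and ob :: "shape \<Rightarrow> 'o"
    and deg :: "'p set list \<Rightarrow> 'd"
  assumes U_ob [simp]: "U (ob s) = spc s" and ten_ob [simp]: "ten (ob s) (ob t) = ob (Node s t)"
    and un_ob: "un = ob Unit" and ob_obs: "ob s \<in> obs"
    and pres_lact: "(\<And>us ws. us \<in> B s \<Longrightarrow> ws \<in> B s' \<Longrightarrow> A ws us \<noteq> 0 \<Longrightarrow> deg us = deg ws)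
      \<Longrightarrow> pres (ob s) (restrict (lact s s' A) (spc s)) (ob s')"
begin

abbreviation "CC \<equiv> vec_cat obs U pres ten un"

definition mat :: "shape \<Rightarrow> shape \<Rightarrow> ('p, 'k) lmat \<Rightarrow> ('o, ('p set, 'k) vec) arrow" where
  "mat s s' A = Arr (ob s) (restrict (lact s s' A) (spc s)) (ob s')"

lemma mat_sel [simp]: "src (mat s s' A) = ob s" "tgt (mat s s' A) = ob s'"
  "act (mat s s' A) = restrict (lact s s' A) (spc s)" by (simp_all add: mat_def)

lemma mat_cong: "(\<And>ws us. ws \<in> B s' \<Longrightarrow> us \<in> B s \<Longrightarrow> A ws us = D ws us) \<Longrightarrow> mat s s' A = mat s s' D"
  unfolding mat_def using lact_cong[of s' s A D] by simp

lemma mat_hom: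
  assumes "\<And>us ws. us \<in> B s \<Longrightarrow> ws \<in> B s' \<Longrightarrow> A ws us \<noteq> 0 \<Longrightarrow> deg us = deg ws"
  shows "mat s s' A \<in> Hom CC (ob s) (ob s')"
  using pres_lact[OF assms] lin_on_restrict[OF _ lin_lact, of "spc s" s s' A]
  by (auto simp: vec_cat_def Let_def mat_def spc_def)

lemma mat_comp: "Cmp CC (mat s' s'' D) (mat s s' A) = mat s s'' (mmul (B s') D A)"
  by (auto simp: vec_cat_def Let_def mat_def lact_comp intro!: restrict_ext)

lemma mat_tens: "Tmor CC (mat s s' A) (mat t t' C) = mat (Node s t) (Node s' t') (tmat (slen s') (slen s) A C)"
  by (simp add: vec_cat_def Let_def mat_def tensor_map_lact)

lemma mat_id: "Idn CC (ob s) = mat s s idm"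
proof -
  have "lact s s idm x = x" if "x \<in> spc s" for x :: "('p set, 'k) vec"
    by (rule spc_eqI[of _ s]) (use that in \<open>auto simp: lact_idm\<close>)
  then show ?thesis by (auto simp: vec_cat_def Let_def mat_def intro!: restrict_ext)
qed

lemma mat_zero: "Zero CC (ob s) (ob s') = mat s s' (\<lambda>_ _. 0)"
proof -
  have "lact s s' (\<lambda>_ _. 0) x = 0" for x :: "('p set, 'k) vec"
    by (simp add: lact_def vscale_def fun_eq_iff sum_fun_apply)
  then show ?thesis by (auto simp: vec_cat_def Let_def mat_def intro!: restrict_ext)
qed

lemma mat_add: "Add CC (mat s s' A) (mat s s' D) = mat s s' (\<lambda>ws us. A ws us + D ws us)"
proof -
  have "lact s s' (\<lambda>ws us. A ws us + D ws us) x = lact s s' A x + lact s s' D x" for x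
    by (rule spc_eqI[of _ s']) (simp_all add: lact_enc distrib_right sum.distrib)
  then show ?thesis by (auto simp: vec_cat_def Let_def mat_def intro!: restrict_ext)
qed

lemma mat_smul: "Smul CC c (mat s s' A) = mat s s' (\<lambda>ws us. c * A ws us)"
proof -
  have "lact s s' (\<lambda>ws us. c * A ws us) x = vscale c (lact s s' A x)" for x
    by (rule spc_eqI[of _ s']) (simp_all add: lact_enc, simp add: vscale_def lact_enc sum_distrib_left mult.assoc)
  then show ?thesis by (auto simp: vec_cat_def Let_def mat_def intro!: restrict_ext)
qed

lemma B_assoc: "B (Node (Node s t) r) = B (Node s (Node t r))"
  by auto (metis append.assoc)+

lemma mat_assoc:
  "Assoc CC (ob s) (ob t) (ob r) = mat (Node (Node s t) r) (Node s (Node t r)) idm" (is ?A)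
  "Assoc' CC (ob s) (ob t) (ob r) = mat (Node s (Node t r)) (Node (Node s t) r) idm" (is ?B)
proof -
  let ?L = "Node (Node s t) r" and ?R = "Node s (Node t r)"
  have zero: "x i = 0" if "x \<in> spc p" "i \<notin> enc p ` B p" for x :: "('p set, 'k) vec" and i p
    using that by (simp add: spc_def fsp_def)
  have e: "enc ?L us = Ipair (Ipair i j) k \<longleftrightarrow> enc ?R us = Ipair i (Ipair j k)" if "us \<in> B ?R" for us i j k
    using that by (auto simp: B_length add.commute drop_take)
  have "lact ?L ?R idm x = reassoc x" if x: "x \<in> spc ?L" for x :: "('p set, 'k) vec"
  proof (rule spc_eqI[of _ ?R])
    show "reassoc x \<in> spc ?R"
      unfolding spc_def fsp_def
    proof (intro CollectI allI impI)
      fix i assume i: "i \<notin> enc ?R ` B ?R"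
      show "reassoc x i = 0"
      proof (cases "\<exists>a b c. i = Ipair a (Ipair b c)")
        case True
        then obtain a b c where abc: "i = Ipair a (Ipair b c)" by blast
        then have "Ipair (Ipair a b) c \<notin> enc ?L ` B ?L" using i unfolding enc_Node by (auto simp: ipairs_def)
        then show ?thesis using zero[OF x] abc by (simp add: reassoc_def)
      qed (auto simp: reassoc_def split: index.split)
    qed
    fix us assume us: "us \<in> B ?R"
    then have "lact ?L ?R idm x (enc ?R us) = x (enc ?L us)" by (intro lact_idm B_assoc)
    also have "\<dots> = reassoc x (enc ?R us)"
      using us by (auto simp: reassoc_def B_length add.commute drop_take)
    finally show "lact ?L ?R idm x (enc ?R us) = reassoc x (enc ?R us)" .
  qed simp
  then show ?A by (auto simp: vec_cat_def Let_def mat_def intro!: restrict_ext)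
  have "lact ?R ?L idm x = reassoc' x" if x: "x \<in> spc ?R" for x :: "('p set, 'k) vec"
  proof (rule spc_eqI[of _ ?L])
    show "reassoc' x \<in> spc ?L"
      unfolding spc_def fsp_def
    proof (intro CollectI allI impI)
      fix i assume i: "i \<notin> enc ?L ` B ?L"
      show "reassoc' x i = 0"
      proof (cases "\<exists>a b c. i = Ipair (Ipair a b) c")
        case True
        then obtain a b c where abc: "i = Ipair (Ipair a b) c" by blast
        then have "Ipair a (Ipair b c) \<notin> enc ?R ` B ?R" using i unfolding enc_Node by (auto simp: ipairs_def)
        then show ?thesis using zero[OF x] abc by (simp add: reassoc'_def)
      qed (auto simp: reassoc'_def split: index.split)
    qed
    fix us assume us: "us \<in> B ?L"
    then have "lact ?R ?L idm x (enc ?L us) = x (enc ?R us)" by (intro lact_idm B_assoc[symmetric])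
    also have "\<dots> = reassoc' x (enc ?L us)"
      using us by (auto simp: reassoc'_def B_length add.commute drop_take)
    finally show "lact ?R ?L idm x (enc ?L us) = reassoc' x (enc ?L us)" .
  qed simp
  then show ?B by (auto simp: vec_cat_def Let_def mat_def intro!: restrict_ext)
qed

lemma B_Unit: "B (Node Unit s) = B s" "B (Node s Unit) = B s" by auto

lemma mat_unitors:
  "Lun CC (ob s) = mat (Node Unit s) s idm" "Run CC (ob s) = mat (Node s Unit) s idm"
  "Lun' CC (ob s) = mat s (Node Unit s) idm" "Run' CC (ob s) = mat s (Node s Unit) idm"
proof -
  have zero: "x i = 0" if "x \<in> spc p" "i \<notin> enc p ` B p" for x :: "('p set, 'k) vec" and i p
    using that by (simp add: spc_def fsp_def)
  have one: "one_vec \<in> spc Unit" by (simp add: spc_def)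
  have "lact (Node Unit s) s idm x = (\<lambda>i. x (Ipair Iunit i))" if x: "x \<in> spc (Node Unit s)" for x :: "('p set, 'k) vec"
  proof (rule spc_eqI[of _ s])
    show "(\<lambda>i. x (Ipair Iunit i)) \<in> spc s"
      using x unfolding spc_def enc_Node by (auto simp: fsp_def ipairs_def)
  qed (simp_all only: lact_spc lact_idm[OF B_Unit(1)], simp)
  then show "Lun CC (ob s) = mat (Node Unit s) s idm"
    by (auto simp: vec_cat_def Let_def mat_def un_ob intro!: restrict_ext)
  have "lact (Node s Unit) s idm x = (\<lambda>i. x (Ipair i Iunit))" if x: "x \<in> spc (Node s Unit)" for x :: "('p set, 'k) vec"
  proof (rule spc_eqI[of _ s])
    show "(\<lambda>i. x (Ipair i Iunit)) \<in> spc s"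
      using x unfolding spc_def enc_Node by (auto simp: fsp_def ipairs_def)
  qed (simp_all only: lact_spc lact_idm[OF B_Unit(2)], simp add: B_length)
  then show "Run CC (ob s) = mat (Node s Unit) s idm"
    by (auto simp: vec_cat_def Let_def mat_def un_ob intro!: restrict_ext)
  have "lact s (Node Unit s) idm x = tensor_vec one_vec x" if x: "x \<in> spc s" for x :: "('p set, 'k) vec"
  proof (rule spc_eqI[of _ "Node Unit s"])
    show "tensor_vec one_vec x \<in> spc (Node Unit s)"
      using tensor_vec_fsp[of one_vec "enc Unit ` B Unit" x] x by (simp only: spc_def enc_Node) simp
  qed (simp_all only: lact_spc lact_idm[OF B_Unit(1)[symmetric]], simp add: tensor_vec_def ivec_def)
  then show "Lun' CC (ob s) = mat s (Node Unit s) idm"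
    by (auto simp: vec_cat_def Let_def mat_def un_ob intro!: restrict_ext)
  have "lact s (Node s Unit) idm x = tensor_vec x one_vec" if x: "x \<in> spc s" for x :: "('p set, 'k) vec"
  proof (rule spc_eqI[of _ "Node s Unit"])
    show "tensor_vec x one_vec \<in> spc (Node s Unit)"
      using tensor_vec_fsp[of x "enc s ` B s" one_vec "enc Unit ` B Unit"] x by (simp only: spc_def enc_Node) simp
  qed (simp_all only: lact_spc lact_idm[OF B_Unit(2)[symmetric]], simp add: tensor_vec_def ivec_def B_length)
  then show "Run' CC (ob s) = mat s (Node s Unit) idm"
    by (auto simp: vec_cat_def Let_def mat_def un_ob intro!: restrict_ext)
qed

lemma mat_fields [simp]: "Ob CC = obs" "Uob CC = ob Unit" "Tob CC (ob s) (ob t) = ob (Node s t)"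
  by (simp_all add: vec_cat_def Let_def un_ob)

end

section \<open>The web relations as matrix identities\<close>

definition (in tri_geometry) merge_mat :: "('p, 'k::field) lmat" where
  "merge_mat ws us = of_bool (R (us ! 0) (us ! 1) (ws ! 0))"

definition (in tri_geometry) split_mat :: "('p, 'k::field) lmat" where
  "split_mat ws us = of_bool (R (ws ! 0) (ws ! 1) (us ! 0))"

text \<open>Sums of truth values are evaluated by the uniqueness of a vertex, before the simplifier can turn
  them into cardinalities.\<close>

declare sum_mult_of_bool_eq [simp del] sum_of_bool_mult_eq [simp del] sum_of_bool_eq [simp del]

text \<open>By cancellation in the partial product, the intermediate vertices of a path are mostly determined
  by the others, so that the sum over such a vertex records its existence only.\<close>

lemma sum_of_bool_unique:
  assumes "finite A" "\<And>x y. x \<in> A \<Longrightarrow> y \<in> A \<Longrightarrow> Q x \<Longrightarrow> Q y \<Longrightarrow> x = y"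
  shows "(\<Sum>x\<in>A. of_bool (Q x)) = (of_bool (\<exists>x\<in>A. Q x) :: 'k::field)"
proof (cases "\<exists>x\<in>A. Q x")
  case True
  then obtain x where x: "x \<in> A" "Q x" by blast
  have "(\<Sum>y\<in>A. of_bool (Q y)) = (\<Sum>y\<in>A. if y = x then 1 else (0::'k))"
    using assms(2) x by (intro sum.cong) auto
  then show ?thesis using x assms(1) by auto
qed auto

context tri_geometry
begin

lemma B_single [simp]: "[u] \<in> B (Leaf a) \<longleftrightarrow> u \<in> P a" by auto

lemma B_nil [simp]: "us \<in> B Unit \<longleftrightarrow> us = []" by auto

lemma B_pair_cases: "us \<in> B (Node (Leaf a) (Leaf b)) \<Longrightarrow> \<exists>u\<in>P a. \<exists>v\<in>P b. us = [u, v]" by auto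

text \<open>Composites are evaluated one row at a time, starting with the factor applied last; when that factor
  is the identity on one side, the summation over this side disappears.\<close>

lemma row_right_id:
  assumes "drop l' ws \<in> B r" "slen s = l"
  shows "mmul (B (Node s r)) (tmat l' l A idm) X ws us = (\<Sum>vs\<in>B s. A (take l' ws) vs * X (vs @ drop l' ws) us)"
proof -
  have "mmul (B (Node s r)) (tmat l' l A idm) X ws us =
      (\<Sum>vs\<in>B s. \<Sum>rs\<in>B r. if rs = drop l' ws then A (take l' ws) vs * X (vs @ rs) us else 0)"
    unfolding mmul_def sum_B_Node assms(2)[symmetric] by (intro sum.cong) (auto simp: tmat_def idm_def B_length)
  then show ?thesis using assms by simp
qed

lemma row_left_id:
  assumes "take l ws \<in> B r" "slen r = l"
  shows "mmul (B (Node r s)) (tmat l l idm A) X ws us = (\<Sum>vs\<in>B s. A (drop l ws) vs * X (take l ws @ vs) us)"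
proof -
  have "mmul (B (Node r s)) (tmat l l idm A) X ws us =
      (\<Sum>rs\<in>B r. if rs = take l ws then \<Sum>vs\<in>B s. A (drop l ws) vs * X (rs @ vs) us else 0)"
    unfolding mmul_def sum_B_Node assms(2)[symmetric] by (intro sum.cong) (auto simp: tmat_def idm_def B_length)
  then show ?thesis using assms by simp
qed

lemma row_id: "ws \<in> B s \<Longrightarrow> mmul (B s) idm X ws us = X ws us"
  by (simp add: mmul_def idm_def of_bool_def if_distrib if_distribR cong: if_cong)

lemma col_id: "us \<in> B s \<Longrightarrow> mmul (B s) X idm ws us = X ws us"
  by (simp add: mmul_def idm_def of_bool_def if_distrib if_distribR cong: if_cong)

lemmas row_simps = row_right_id row_left_id row_id B_Node_iff sum_B_Node sum_B_Leaf

lemma P_rank: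
  assumes "R u v w" shows "u \<in> P a \<Longrightarrow> w \<in> P (a + b) \<Longrightarrow> v \<in> P b" "u \<in> P a \<Longrightarrow> v \<in> P b \<Longrightarrow> w \<in> P (a + b)"
    "v \<in> P b \<Longrightarrow> w \<in> P (a + b) \<Longrightarrow> u \<in> P a"
  using R_rk[OF assms] R_S[OF assms] by (auto simp: P_def)

text \<open>The entry of the first kind of ladder: once the vertex \<open>x\<close> is chosen, cancellation leaves at most one
  choice for all other labels.\<close>

lemma lower_sum:
  assumes uv: "u \<in> P a" "v \<in> P b" "u' \<in> P a'" "v' \<in> P b'"
    and labels: "a = p + d" "a' = p + c" "e = d + b" "e = c + b'"
  shows "(\<Sum>x\<in>P p. \<Sum>y'\<in>P c. of_bool (R x y' u') * (\<Sum>t\<in>P e. of_bool (R y' v' t) *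
      (\<Sum>y\<in>P d. \<Sum>v0\<in>P b. of_bool (R y v0 t) * (of_bool (R x y u) * of_bool (v0 = v))))) =
    (of_nat (card {x \<in> lower u v u' v'. int (rk x) = p}) :: 'k::field)"
proof -
  have 1: "(\<Sum>v0\<in>P b. of_bool (R y v0 t) * (of_bool (R x y u) * of_bool (v0 = v))) =
      (of_bool (R x y u \<and> R y v t) :: 'k)" for x y t
  proof -
    have "(\<Sum>v0\<in>P b. of_bool (R y v0 t) * (of_bool (R x y u) * of_bool (v0 = v))) =
        (\<Sum>v0\<in>P b. if v0 = v then of_bool (R x y u \<and> R y v t) else (0::'k))"
      by (intro sum.cong) auto
    then show ?thesis using assms by simp
  qed
  have 2: "(\<Sum>y\<in>P d. of_bool (R x y u \<and> R y v t)) = (of_bool (\<exists>y\<in>P d. R x y u \<and> R y v t) :: 'k)" for x t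
    by (rule sum_of_bool_unique[OF finite_P]) (metis R_left_cancel)
  have 3: "(\<Sum>t\<in>P e. of_bool (R y' v' t) * of_bool (\<exists>y\<in>P d. R x y u \<and> R y v t)) =
      (of_bool (\<exists>t\<in>P e. R y' v' t \<and> (\<exists>y\<in>P d. R x y u \<and> R y v t)) :: 'k)" for x y'
    unfolding of_bool_conj[symmetric] by (rule sum_of_bool_unique[OF finite_P]) (metis R_fun)
  have 4: "(\<Sum>y'\<in>P c. of_bool (R x y' u') * of_bool (\<exists>t\<in>P e. R y' v' t \<and> (\<exists>y\<in>P d. R x y u \<and> R y v t))) =
      (of_bool (\<exists>y'\<in>P c. R x y' u' \<and> (\<exists>t\<in>P e. R y' v' t \<and> (\<exists>y\<in>P d. R x y u \<and> R y v t))) :: 'k)" for x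
    unfolding of_bool_conj[symmetric] by (rule sum_of_bool_unique[OF finite_P]) (metis R_left_cancel)
  have 5: "(\<exists>y'\<in>P c. R x y' u' \<and> (\<exists>t\<in>P e. R y' v' t \<and> (\<exists>y\<in>P d. R x y u \<and> R y v t))) \<longleftrightarrow> x \<in> lower u v u' v'"
    if x: "x \<in> P p" for x
  proof
    assume "x \<in> lower u v u' v'"
    then obtain y y' t where y: "R x y u" "R x y' u'" "R y v t" "R y' v' t" by (auto simp: lower_def)
    then have "y \<in> P d" "y' \<in> P c" using P_rank uv labels x by metis+
    moreover then have "t \<in> P e" using P_rank(2)[of y v t d b] y uv labels by blast
    ultimately show "\<exists>y'\<in>P c. R x y' u' \<and> (\<exists>t\<in>P e. R y' v' t \<and> (\<exists>y\<in>P d. R x y u \<and> R y v t))"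
      using y by blast
  qed (auto simp: lower_def)
  have "lower u v u' v' \<subseteq> S" using R_S by (auto simp: lower_def)
  then have 6: "{x \<in> P p. x \<in> lower u v u' v'} = {x \<in> lower u v u' v'. int (rk x) = p}" by (auto simp: P_def)
  have "(\<Sum>x\<in>P p. of_bool (x \<in> lower u v u' v')) = (of_nat (card {x \<in> P p. x \<in> lower u v u' v'}) :: 'k)"
    by (simp add: sum_of_bool_eq Int_def)
  then show ?thesis unfolding 1 2 3 4 6[symmetric] by (simp add: 5 cong: sum.cong_simp)
qed

text \<open>The entry of the second kind of ladder, where \<open>z\<close> determines the other labels.\<close>

lemma upper_sum:
  assumes uv: "u \<in> P a" "v \<in> P b" "u' \<in> P a'" "v' \<in> P b'"
    and labels: "z0 = a + c" "z0 = a' + d" "b = c + e" "b' = d + e"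
  shows "(\<Sum>g'\<in>P d. \<Sum>w\<in>P e. of_bool (R g' w v') * (\<Sum>z\<in>P z0. of_bool (R u' g' z) *
      (\<Sum>u0\<in>P a. \<Sum>g\<in>P c. of_bool (R u0 g z) * (of_bool (u0 = u) * of_bool (R g w v))))) =
    (of_nat (card {z \<in> upper u v u' v'. int (rk z) = z0}) :: 'k::field)"
proof -
  have 1: "(\<Sum>u0\<in>P a. \<Sum>g\<in>P c. of_bool (R u0 g z) * (of_bool (u0 = u) * of_bool (R g w v))) =
      (of_bool (\<exists>g\<in>P c. R u g z \<and> R g w v) :: 'k)" for z w
  proof -
    have "(\<Sum>u0\<in>P a. \<Sum>g\<in>P c. of_bool (R u0 g z) * (of_bool (u0 = u) * of_bool (R g w v))) =
        (\<Sum>u0\<in>P a. if u0 = u then \<Sum>g\<in>P c. of_bool (R u g z \<and> R g w v) else (0::'k))"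
      by (rule sum.cong[OF HOL.refl]) (simp add: of_bool_conj)
    also have "\<dots> = (\<Sum>g\<in>P c. of_bool (R u g z \<and> R g w v))" using assms by simp
    also have "\<dots> = of_bool (\<exists>g\<in>P c. R u g z \<and> R g w v)"
      by (rule sum_of_bool_unique[OF finite_P]) (metis R_left_cancel)
    finally show ?thesis .
  qed
  have "(\<Sum>g'\<in>P d. \<Sum>w\<in>P e. of_bool (R g' w v') * (\<Sum>z\<in>P z0. of_bool (R u' g' z) *
      of_bool (\<exists>g\<in>P c. R u g z \<and> R g w v))) =
      (\<Sum>g'\<in>P d. \<Sum>w\<in>P e. \<Sum>z\<in>P z0. of_bool (R g' w v' \<and> R u' g' z \<and> (\<exists>g\<in>P c. R u g z \<and> R g w v)) :: 'k)"
    by (simp add: sum_distrib_left of_bool_conj)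
  also have "\<dots> = (\<Sum>g'\<in>P d. \<Sum>z\<in>P z0. \<Sum>w\<in>P e. of_bool (R g' w v' \<and> R u' g' z \<and> (\<exists>g\<in>P c. R u g z \<and> R g w v)))"
    by (intro sum.cong sum.swap HOL.refl)
  also have "\<dots> = (\<Sum>z\<in>P z0. \<Sum>g'\<in>P d. \<Sum>w\<in>P e. of_bool (R g' w v' \<and> R u' g' z \<and> (\<exists>g\<in>P c. R u g z \<and> R g w v)))"
    by (rule sum.swap)
  also have "\<dots> = (\<Sum>z\<in>P z0. of_bool (z \<in> upper u v u' v'))"
  proof (rule sum.cong)
    fix z assume z: "z \<in> P z0"
    have "(\<Sum>g'\<in>P d. \<Sum>w\<in>P e. of_bool (R g' w v' \<and> R u' g' z \<and> (\<exists>g\<in>P c. R u g z \<and> R g w v)) :: 'k) =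
        (\<Sum>g'\<in>P d. of_bool (\<exists>w\<in>P e. R g' w v' \<and> R u' g' z \<and> (\<exists>g\<in>P c. R u g z \<and> R g w v)))"
      by (intro sum.cong[OF HOL.refl] sum_of_bool_unique[OF finite_P]) (metis R_left_cancel)
    also have "\<dots> = of_bool (\<exists>g'\<in>P d. \<exists>w\<in>P e. R g' w v' \<and> R u' g' z \<and> (\<exists>g\<in>P c. R u g z \<and> R g w v))"
      by (rule sum_of_bool_unique[OF finite_P]) (metis R_left_cancel)
    also have "(\<exists>g'\<in>P d. \<exists>w\<in>P e. R g' w v' \<and> R u' g' z \<and> (\<exists>g\<in>P c. R u g z \<and> R g w v)) \<longleftrightarrow> z \<in> upper u v u' v'"
    proof
      assume "z \<in> upper u v u' v'"
      then obtain g g' w where g: "R u g z" "R u' g' z" "R g w v" "R g' w v'" by (auto simp: upper_def)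
      then have "g \<in> P c" using P_rank(1) uv labels z by metis
      have "g' \<in> P d" using P_rank(1) uv labels z g by metis
      have "w \<in> P e" using P_rank(1) uv labels \<open>g \<in> P c\<close> g by metis
      then show "\<exists>g'\<in>P d. \<exists>w\<in>P e. R g' w v' \<and> R u' g' z \<and> (\<exists>g\<in>P c. R u g z \<and> R g w v)"
        using g \<open>g \<in> P c\<close> \<open>g' \<in> P d\<close> by blast
    qed (auto simp: upper_def)
    finally show "(\<Sum>g'\<in>P d. \<Sum>w\<in>P e. of_bool (R g' w v' \<and> R u' g' z \<and> (\<exists>g\<in>P c. R u g z \<and> R g w v)) :: 'k) =
      of_bool (z \<in> upper u v u' v')" .
  qed simp
  also have "\<dots> = of_nat (card {z \<in> P z0. z \<in> upper u v u' v'})" by (simp add: sum_of_bool_eq Int_def)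
  also have "{z \<in> P z0. z \<in> upper u v u' v'} = {z \<in> upper u v u' v'. int (rk z) = z0}"
    using R_S by (auto simp: P_def upper_def)
  finally show ?thesis unfolding 1 .
qed

lemma merge_assoc_sum:
  assumes "y \<in> P (a + b + c)" "u \<in> P a" "v \<in> P b" "w \<in> P c"
  shows "(\<Sum>x\<in>P (a + b). \<Sum>w'\<in>P c. of_bool (R x w' y) * (of_bool (R u v x) * of_bool (w' = w))) =
      (\<Sum>u'\<in>P a. \<Sum>z\<in>P (b + c). of_bool (R u' z y) * (of_bool (u' = u) * (of_bool (R v w z) :: 'k::field)))"
proof -
  have "(\<Sum>x\<in>P (a + b). \<Sum>w'\<in>P c. of_bool (R x w' y) * (of_bool (R u v x) * of_bool (w' = w))) =
      (\<Sum>x\<in>P (a + b). \<Sum>w'\<in>P c. if w' = w then of_bool (R u v x \<and> R x w y) else (0::'k))"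
    by (intro sum.cong) auto
  also have "\<dots> = (\<Sum>x\<in>P (a + b). of_bool (R u v x \<and> R x w y))" using assms by simp
  also have "\<dots> = of_bool (\<exists>x\<in>P (a + b). R u v x \<and> R x w y)"
    by (rule sum_of_bool_unique[OF finite_P]) (metis R_fun)
  also have "(\<exists>x\<in>P (a + b). R u v x \<and> R x w y) \<longleftrightarrow> (\<exists>z\<in>P (b + c). R v w z \<and> R u z y)"
    using R_assoc R_assoc' P_rank(2) assms by meson
  also have "of_bool (\<exists>z\<in>P (b + c). R v w z \<and> R u z y) = (\<Sum>z\<in>P (b + c). of_bool (R v w z \<and> R u z y) :: 'k)"
    by (rule sum_of_bool_unique[OF finite_P, symmetric]) (metis R_fun)
  also have "\<dots> = (\<Sum>u'\<in>P a. if u' = u then \<Sum>z\<in>P (b + c). of_bool (R v w z \<and> R u z y) else 0)" using assms by simp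
  also have "\<dots> = (\<Sum>u'\<in>P a. \<Sum>z\<in>P (b + c). of_bool (R u' z y) * (of_bool (u' = u) * of_bool (R v w z)))"
    by (rule sum.cong[OF HOL.refl]) (simp add: of_bool_conj mult.commute)
  finally show ?thesis .
qed

lemma split_coassoc_sum:
  assumes "y \<in> P (a + b + c)" "u \<in> P a" "v \<in> P b" "w \<in> P c"
  shows "(\<Sum>x\<in>P (a + b). of_bool (R u v x) * of_bool (R x w y)) =
      (\<Sum>z\<in>P (b + c). of_bool (R v w z) * (of_bool (R u z y) :: 'k::field))"
proof -
  have "(\<Sum>x\<in>P (a + b). of_bool (R u v x \<and> R x w y)) = (of_bool (\<exists>x\<in>P (a + b). R u v x \<and> R x w y) :: 'k)"
    by (rule sum_of_bool_unique[OF finite_P]) (metis R_fun)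
  also have "(\<exists>x\<in>P (a + b). R u v x \<and> R x w y) \<longleftrightarrow> (\<exists>z\<in>P (b + c). R v w z \<and> R u z y)"
    using R_assoc R_assoc' P_rank(2) assms by meson
  also have "of_bool (\<exists>z\<in>P (b + c). R v w z \<and> R u z y) = (\<Sum>z\<in>P (b + c). of_bool (R v w z \<and> R u z y) :: 'k)"
    by (rule sum_of_bool_unique[OF finite_P, symmetric]) (metis R_fun)
  finally show ?thesis by (simp add: of_bool_conj)
qed

text \<open>The factorisations of \<open>w\<close> with left factor of rank \<open>a\<close> are its subspaces of rank \<open>a\<close>.\<close>

lemma bigon_sum:
  assumes q1: "of_nat q = (1::'k::field)" and w: "w \<in> P (int (a + b))" "w' \<in> P (int (a + b))"
  shows "(\<Sum>u\<in>P (int a). \<Sum>v\<in>P (int b). of_bool (R u v w') * of_bool (R u v w)) =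
    (of_nat ((a + b) choose a) * of_bool (w' = w) :: 'k)"
proof (cases "w' = w")
  case False
  have zero: "of_bool (R u v w') * of_bool (R u v w) = (0::'k)" for u v using False R_fun by auto
  show ?thesis unfolding zero using False by simp
next
  case True
  have wS: "w \<in> S" "rk w = a + b" using w by (auto simp: P_def)
  have "(\<Sum>u\<in>P (int a). \<Sum>v\<in>P (int b). of_bool (R u v w') * of_bool (R u v w)) =
      (\<Sum>u\<in>P (int a). of_bool (\<exists>v\<in>P (int b). R u v w) :: 'k)"
  proof (rule sum.cong[OF HOL.refl])
    fix u
    have "of_bool (R u v w') * of_bool (R u v w) = (of_bool (R u v w) :: 'k)" for v using True by simp
    moreover have "(\<Sum>v\<in>P (int b). of_bool (R u v w)) = (of_bool (\<exists>v\<in>P (int b). R u v w) :: 'k)"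
      by (rule sum_of_bool_unique[OF finite_P]) (metis R_left_cancel)
    ultimately show "(\<Sum>v\<in>P (int b). of_bool (R u v w') * of_bool (R u v w)) = (of_bool (\<exists>v\<in>P (int b). R u v w) :: 'k)"
      by (simp only:)
  qed
  also have "\<dots> = (\<Sum>u\<in>P (int a). of_bool (u \<subseteq> w))"
  proof (rule sum.cong[OF HOL.refl])
    fix u assume u: "u \<in> P (int a)"
    have "(\<exists>v\<in>P (int b). R u v w) \<longleftrightarrow> (\<exists>v. R u v w)" using P_rank(1)[of u _ w "int a" "int b"] u w by auto
    then show "(of_bool (\<exists>v\<in>P (int b). R u v w) :: 'k) = of_bool (u \<subseteq> w)"
      using R_ex_right[of u w] u w P_S by simp
  qed
  also have "\<dots> = of_nat (card {u \<in> P (int a). u \<subseteq> w})" by (simp add: sum_of_bool_eq Int_def)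
  also have "{u \<in> P (int a). u \<subseteq> w} = ivl {} w a" by (auto simp: ivl_def P_def)
  also have "of_nat (card (ivl {} w a)) = (of_nat ((a + b) choose a) :: 'k)"
    using card_ivl[OF q1, of "{}" w a] wS by simp
  finally show ?thesis using True by simp
qed

text \<open>The only vertex that multiplies with \<open>u\<close> to the whole space is \<open>sg u\<close>.\<close>

lemma zigzag_sum1:
  assumes "u \<in> P a" "u' \<in> P a"
  shows "(\<Sum>x\<in>P a. \<Sum>y\<in>P (int n - a). of_bool (R x y pts) * (of_bool (R y u' pts) * of_bool (x = u))) = (of_bool (u' = u) :: 'k::field)"
proof -
  have uS: "u \<in> S" "u' \<in> S" using assms by (auto simp: P_def)
  have r: "sg u \<in> P (int n - a)" using assms rk_sg[of u] rk_le[of u] by (auto simp: P_def)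
  have "(\<Sum>x\<in>P a. \<Sum>y\<in>P (int n - a). of_bool (R x y pts) * (of_bool (R y u' pts) * of_bool (x = u))) =
      (\<Sum>x\<in>P a. if x = u then \<Sum>y\<in>P (int n - a). of_bool (R u y pts \<and> R y u' pts) else (0::'k))"
    by (rule sum.cong[OF HOL.refl]) (simp add: of_bool_conj)
  also have "\<dots> = (\<Sum>y\<in>P (int n - a). of_bool (R u y pts \<and> R y u' pts))" using assms by simp
  also have "\<dots> = of_bool (\<exists>y\<in>P (int n - a). R u y pts \<and> R y u' pts)"
    by (rule sum_of_bool_unique[OF finite_P]) (metis R_left_cancel)
  also have "(\<exists>y\<in>P (int n - a). R u y pts \<and> R y u' pts) \<longleftrightarrow> u' = u"
    using R_sg[of u] R_sg[of "sg u"] uS r R_left_cancel by (metis sg_S sg_sg)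
  finally show ?thesis .
qed

lemma zigzag_sum2:
  assumes "u \<in> P a" "u' \<in> P a"
  shows "(\<Sum>y\<in>P (int n - a). \<Sum>x\<in>P a. of_bool (R y x pts) * (of_bool (R u' y pts) * of_bool (x = u))) = (of_bool (u' = u) :: 'k::field)"
proof -
  have uS: "u \<in> S" "u' \<in> S" using assms by (auto simp: P_def)
  have r: "sg u' \<in> P (int n - a)" using assms rk_sg[of u'] rk_le[of u'] by (auto simp: P_def)
  have "(\<Sum>y\<in>P (int n - a). \<Sum>x\<in>P a. of_bool (R y x pts) * (of_bool (R u' y pts) * of_bool (x = u))) =
      (\<Sum>y\<in>P (int n - a). \<Sum>x\<in>P a. if x = u then of_bool (R u' y pts \<and> R y u pts) else (0::'k))"
    by (intro sum.cong) auto
  also have "\<dots> = (\<Sum>y\<in>P (int n - a). of_bool (R u' y pts \<and> R y u pts))" using assms by simp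
  also have "\<dots> = of_bool (\<exists>y\<in>P (int n - a). R u' y pts \<and> R y u pts)"
    by (rule sum_of_bool_unique[OF finite_P]) (metis R_left_cancel)
  also have "(\<exists>y\<in>P (int n - a). R u' y pts \<and> R y u pts) \<longleftrightarrow> u' = u"
    using R_sg[of u'] R_sg[of "sg u'"] uS r R_left_cancel by (metis sg_S sg_sg)
  finally show ?thesis .
qed

end

context shaped_category
begin

abbreviation "merge a b c \<equiv> mat (Node (Leaf a) (Leaf b)) (Leaf c) merge_mat"
abbreviation "split a b c \<equiv> mat (Leaf c) (Node (Leaf a) (Leaf b)) split_mat"

lemmas mat_simps = mat_id mat_tens mat_assoc mat_unitors mat_comp

lemma ladder_lower:
  assumes "a = p + d" "a' = p + c" "e = d + b" "e = c + b'"
  shows "Cmp CC (Tmor CC (merge p c a') (Idn CC (ob (Leaf b')))) (Cmp CC (Assoc' CC (ob (Leaf p)) (ob (Leaf c)) (ob (Leaf b')))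
    (Cmp CC (Tmor CC (Idn CC (ob (Leaf p))) (split c b' e)) (Cmp CC (Tmor CC (Idn CC (ob (Leaf p))) (merge d b e))
    (Cmp CC (Assoc CC (ob (Leaf p)) (ob (Leaf d)) (ob (Leaf b))) (Tmor CC (split p d a) (Idn CC (ob (Leaf b)))))))) =
    mat (Node (Leaf a) (Leaf b)) (Node (Leaf a') (Leaf b'))
      (\<lambda>ws us. of_nat (card {x \<in> lower (us ! 0) (us ! 1) (ws ! 0) (ws ! 1). int (rk x) = p}))"
  unfolding mat_simps
proof (rule mat_cong, goal_cases)
  case (1 ws us)
  then obtain u v u' v' where w: "ws = [u', v']" "us = [u, v]"
    "u' \<in> P a'" "v' \<in> P b'" "u \<in> P a" "v \<in> P b" using B_pair_cases by metis
  note count = lower_sum[OF w(5,6,3,4) assms, where 'k = 'k, symmetric]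
  show ?case unfolding w(1,2) using w(3-6)
    by (simp add: count row_simps merge_mat_def split_mat_def tmat_def idm_def del: B.simps cong: sum.cong_simp)
qed

lemma ladder_upper:
  assumes "z = a + c" "z = a' + d" "b = c + e" "b' = d + e"
  shows "Cmp CC (Tmor CC (Idn CC (ob (Leaf a'))) (merge d e b')) (Cmp CC (Assoc CC (ob (Leaf a')) (ob (Leaf d)) (ob (Leaf e)))
    (Cmp CC (Tmor CC (split a' d z) (Idn CC (ob (Leaf e)))) (Cmp CC (Tmor CC (merge a c z) (Idn CC (ob (Leaf e))))
    (Cmp CC (Assoc' CC (ob (Leaf a)) (ob (Leaf c)) (ob (Leaf e))) (Tmor CC (Idn CC (ob (Leaf a))) (split c e b)))))) =
    mat (Node (Leaf a) (Leaf b)) (Node (Leaf a') (Leaf b'))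
      (\<lambda>ws us. of_nat (card {x \<in> upper (us ! 0) (us ! 1) (ws ! 0) (ws ! 1). int (rk x) = z}))"
  unfolding mat_simps
proof (rule mat_cong, goal_cases)
  case (1 ws us)
  then obtain u v u' v' where w: "ws = [u', v']" "us = [u, v]"
    "u' \<in> P a'" "v' \<in> P b'" "u \<in> P a" "v \<in> P b" using B_pair_cases by metis
  note count = upper_sum[OF w(5,6,3,4) assms, where 'k = 'k, symmetric]
  show ?case unfolding w(1,2) using w(3-6)
    by (simp add: count row_simps merge_mat_def split_mat_def tmat_def idm_def del: B.simps cong: sum.cong_simp)
qed

lemma hom_sum_mat:
  assumes "distinct ts"
  shows "hom_sum CC (ob s) (ob s') (\<lambda>t. mat s s' (A t)) ts = mat s s' (\<lambda>ws us. \<Sum>t\<in>set ts. A t ws us)"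
  using assms
proof (induction ts)
  case Nil then show ?case by (simp add: hom_sum_def mat_zero)
next
  case (Cons t ts)
  then have "hom_sum CC (ob s) (ob s') (\<lambda>t. mat s s' (A t)) (t # ts) =
      Add CC (mat s s' (A t)) (mat s s' (\<lambda>ws us. \<Sum>t\<in>set ts. A t ws us))" by (simp add: hom_sum_def)
  then show ?case using Cons by (simp add: mat_add)
qed

lemma merge_assoc:
  assumes "e = a + b" "f = b + c" "d = a + b + c"
  shows "Cmp CC (merge e c d) (Tmor CC (merge a b e) (Idn CC (ob (Leaf c)))) =
   Cmp CC (merge a f d) (Cmp CC (Tmor CC (Idn CC (ob (Leaf a))) (merge b c f))
     (Assoc CC (ob (Leaf a)) (ob (Leaf b)) (ob (Leaf c))))"
  unfolding mat_simps assms
proof (rule mat_cong, goal_cases)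
  case (1 ws us)
  then obtain y u v w where w: "ws = [y]" "us = [u, v, w]" "y \<in> P (a + b + c)" "u \<in> P a" "v \<in> P b" "w \<in> P c" by auto
  show ?case unfolding w(1,2) mmul_def[of _ "merge_mat"]
    by (simp add: w(3-6) col_id sum_B_Node sum_B_Leaf B_Node_iff merge_mat_def tmat_def[of _ _ "merge_mat"] tmat_def[of _ _ idm]
        idm_def[of "[_]"] del: B.simps cong: sum.cong_simp) (rule merge_assoc_sum[OF w(3-6)])
qed

lemma split_coassoc:
  assumes "e = a + b" "f = b + c" "d = a + b + c"
  shows "Cmp CC (Assoc CC (ob (Leaf a)) (ob (Leaf b)) (ob (Leaf c)))
      (Cmp CC (Tmor CC (split a b e) (Idn CC (ob (Leaf c)))) (split e c d)) =
    Cmp CC (Tmor CC (Idn CC (ob (Leaf a))) (split b c f)) (split a f d)"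
  unfolding mat_simps assms
proof (rule mat_cong, goal_cases)
  case (1 ws us)
  then obtain y u v w where w: "us = [y]" "ws = [u, v, w]" "y \<in> P (a + b + c)" "u \<in> P a" "v \<in> P b" "w \<in> P c" by auto
  show ?case unfolding w(1,2)
    by (simp add: w(3-6) row_simps split_mat_def del: B.simps cong: sum.cong_simp) (rule split_coassoc_sum[OF w(3-6)])
qed

lemma bigon:
  assumes q1: "of_nat q = (1::'k)"
  shows "Cmp CC (merge (int a) (int b) (int (a + b))) (split (int a) (int b) (int (a + b))) =
    Smul CC (of_nat ((a + b) choose a)) (Idn CC (ob (Leaf (int (a + b)))))"
  unfolding mat_simps mat_smul
proof (rule mat_cong, goal_cases)
  case (1 ws us)
  then obtain w' w where w: "ws = [w']" "us = [w]" "w \<in> P (int (a + b))" "w' \<in> P (int (a + b))" by auto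
  show ?case unfolding w(1,2) mmul_def sum_B_Node sum_B_Leaf using bigon_sum[OF q1 w(3,4)]
    by (simp add: merge_mat_def split_mat_def idm_def)
qed

abbreviation "ev \<equiv> mat (Leaf (int n)) Unit (\<lambda>_ _. 1)"
abbreviation "coev \<equiv> mat Unit (Leaf (int n)) (\<lambda>_ _. 1)"

lemma zigzag1:
  "Idn CC (ob (Leaf a)) = Cmp CC (Lun CC (ob (Leaf a))) (Cmp CC (Tmor CC ev (Idn CC (ob (Leaf a))))
    (Cmp CC (Tmor CC (merge a (int n - a) (int n)) (Idn CC (ob (Leaf a))))
    (Cmp CC (Assoc' CC (ob (Leaf a)) (ob (Leaf (int n - a))) (ob (Leaf a)))
    (Cmp CC (Tmor CC (Idn CC (ob (Leaf a))) (split (int n - a) a (int n)))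
    (Cmp CC (Tmor CC (Idn CC (ob (Leaf a))) coev) (Run' CC (ob (Leaf a))))))))"
  unfolding mat_simps
proof (rule mat_cong, goal_cases)
  case (1 ws us)
  then obtain u' u where w: "ws = [u']" "us = [u]" "u \<in> P a" "u' \<in> P a" by auto
  show ?case unfolding w(1,2)
    by (simp add: w(3,4) row_simps zigzag_sum1[OF w(3,4)] merge_mat_def split_mat_def idm_def[of "[_]"] del: B.simps(2,3) cong: sum.cong_simp)
qed

lemma zigzag2:
  "Idn CC (ob (Leaf a)) = Cmp CC (Run CC (ob (Leaf a))) (Cmp CC (Tmor CC (Idn CC (ob (Leaf a))) ev)
    (Cmp CC (Tmor CC (Idn CC (ob (Leaf a))) (merge (int n - a) a (int n)))
    (Cmp CC (Assoc CC (ob (Leaf a)) (ob (Leaf (int n - a))) (ob (Leaf a)))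
    (Cmp CC (Tmor CC (split a (int n - a) (int n)) (Idn CC (ob (Leaf a))))
    (Cmp CC (Tmor CC coev (Idn CC (ob (Leaf a)))) (Lun' CC (ob (Leaf a))))))))"
  unfolding mat_simps
proof (rule mat_cong, goal_cases)
  case (1 ws us)
  then obtain u' u where w: "ws = [u']" "us = [u]" "u \<in> P a" "u' \<in> P a" by auto
  show ?case unfolding w(1,2)
    by (simp add: w(3,4) row_simps zigzag_sum2[OF w(3,4)] merge_mat_def split_mat_def idm_def[of "[_]"] del: B.simps(2,3) cong: sum.cong_simp)
qed

lemma first_square_switch:
  assumes q1: "of_nat q = (1::'k)" and nn: "0 \<le> c" "0 \<le> d"
  shows "Cmp CC (Tmor CC (merge (a - d) c (a + c - d)) (Idn CC (ob (Leaf (b + d - c))))) (Cmp CC (Assoc' CC (ob (Leaf (a - d))) (ob (Leaf c)) (ob (Leaf (b + d - c))))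
      (Cmp CC (Tmor CC (Idn CC (ob (Leaf (a - d)))) (split c (b + d - c) (d + b))) (Cmp CC (Tmor CC (Idn CC (ob (Leaf (a - d)))) (merge d b (d + b)))
      (Cmp CC (Assoc CC (ob (Leaf (a - d))) (ob (Leaf d)) (ob (Leaf b))) (Tmor CC (split (a - d) d a) (Idn CC (ob (Leaf b)))))))) =
    hom_sum CC (ob (Node (Leaf a) (Leaf b))) (ob (Node (Leaf (a + c - d)) (Leaf (b + d - c))))
      (\<lambda>t. Smul CC (of_int (int_binom (a - b + c - d) (nat t)))
        (Cmp CC (Tmor CC (Idn CC (ob (Leaf (a + c - d)))) (merge (d - t) (b - c + t) (b + d - c)))
        (Cmp CC (Assoc CC (ob (Leaf (a + c - d))) (ob (Leaf (d - t))) (ob (Leaf (b - c + t))))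
        (Cmp CC (Tmor CC (split (a + c - d) (d - t) (a + c - t)) (Idn CC (ob (Leaf (b - c + t)))))
        (Cmp CC (Tmor CC (merge a (c - t) (a + c - t)) (Idn CC (ob (Leaf (b - c + t)))))
        (Cmp CC (Assoc' CC (ob (Leaf a)) (ob (Leaf (c - t))) (ob (Leaf (b - c + t))))
          (Tmor CC (Idn CC (ob (Leaf a))) (split (c - t) (b - c + t) b)))))))) [0..min c d]"
proof -
  have l: "a = (a - d) + d" "a + c - d = (a - d) + c" "d + b = d + b" "d + b = c + (b + d - c)" by auto
  have u: "a + c - t = a + (c - t)" "a + c - t = (a + c - d) + (d - t)" "b = (c - t) + (b - c + t)"
    "b + d - c = (d - t) + (b - c + t)" for t by auto
  show ?thesis
    unfolding ladder_lower[OF l] ladder_upper[OF u] mat_smul hom_sum_mat[OF distinct_upto]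
  proof (rule mat_cong, goal_cases)
    case (1 ws us)
    then obtain u v u' v' where w: "ws = [u', v']" "us = [u, v]"
      "u' \<in> P (a + c - d)" "v' \<in> P (b + d - c)" "u \<in> P a" "v \<in> P b" using B_pair_cases by metis
    show ?case unfolding w(1,2)
      using switch_lower_upper[OF q1, of u v u' v' a b c d] w by (simp add: P_def)
  qed
qed

lemma second_square_switch:
  assumes q1: "of_nat q = (1::'k)" and nn: "0 \<le> c" "0 \<le> d"
  shows "Cmp CC (Tmor CC (Idn CC (ob (Leaf (a + c - d)))) (merge d (b - c) (b + d - c)))
      (Cmp CC (Assoc CC (ob (Leaf (a + c - d))) (ob (Leaf d)) (ob (Leaf (b - c))))
      (Cmp CC (Tmor CC (split (a + c - d) d (a + c)) (Idn CC (ob (Leaf (b - c)))))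
      (Cmp CC (Tmor CC (merge a c (a + c)) (Idn CC (ob (Leaf (b - c)))))
      (Cmp CC (Assoc' CC (ob (Leaf a)) (ob (Leaf c)) (ob (Leaf (b - c))))
        (Tmor CC (Idn CC (ob (Leaf a))) (split c (b - c) b)))))) =
    hom_sum CC (ob (Node (Leaf a) (Leaf b))) (ob (Node (Leaf (a + c - d)) (Leaf (b + d - c))))
      (\<lambda>t. Smul CC (of_int (int_binom (b - a + d - c) (nat t)))
        (Cmp CC (Tmor CC (merge (a - d + t) (c - t) (a + c - d)) (Idn CC (ob (Leaf (b + d - c)))))
        (Cmp CC (Assoc' CC (ob (Leaf (a - d + t))) (ob (Leaf (c - t))) (ob (Leaf (b + d - c))))
        (Cmp CC (Tmor CC (Idn CC (ob (Leaf (a - d + t)))) (split (c - t) (b + d - c) (d - t + b)))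
        (Cmp CC (Tmor CC (Idn CC (ob (Leaf (a - d + t)))) (merge (d - t) b (d - t + b)))
        (Cmp CC (Assoc CC (ob (Leaf (a - d + t))) (ob (Leaf (d - t))) (ob (Leaf b)))
          (Tmor CC (split (a - d + t) (d - t) a) (Idn CC (ob (Leaf b)))))))))) [0..min c d]"
proof -
  have u: "a + c = a + c" "a + c = (a + c - d) + d" "b = c + (b - c)" "b + d - c = d + (b - c)" by auto
  have l: "a = (a - d + t) + (d - t)" "a + c - d = (a - d + t) + (c - t)" "d - t + b = (d - t) + b"
    "d - t + b = (c - t) + (b + d - c)" for t by auto
  show ?thesis
    unfolding ladder_lower[OF l] ladder_upper[OF u] mat_smul hom_sum_mat[OF distinct_upto]
  proof (rule mat_cong, goal_cases)
    case (1 ws us)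
    then obtain u v u' v' where w: "ws = [u', v']" "us = [u, v]"
      "u' \<in> P (a + c - d)" "v' \<in> P (b + d - c)" "u \<in> P a" "v \<in> P b" using B_pair_cases by metis
    show ?case unfolding w(1,2)
      using switch_upper_lower[OF q1, of u v u' v' a b c d] w by (simp add: P_def)
  qed
qed

end

section \<open>Graded and ungraded spaces\<close>

lemma fsp_empty [simp]: "fsp {} = {0}" by (auto simp: fsp_def fun_eq_iff)

lemma fsp_mono: "I \<subseteq> J \<Longrightarrow> fsp I \<subseteq> fsp J" by (auto simp: fsp_def)

lemma span_UN_fsp:
  assumes "finite I" "\<And>g. K g \<subseteq> I" "I \<subseteq> (\<Union>g\<in>A. K g)"
  shows "fvs.span (\<Union>g\<in>A. fsp (K g)) = (fsp I :: ('b, 'k::field) vec set)"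
proof
  show "fvs.span (\<Union>g\<in>A. fsp (K g)) \<subseteq> (fsp I :: ('b, 'k) vec set)"
    using fsp_mono[OF assms(2)] by (intro fvs.span_minimal) auto
  have "ivec ` I \<subseteq> (\<Union>g\<in>A. fsp (K g) :: ('b, 'k) vec set)" using assms(3) by force
  then have "fvs.span (ivec ` I) \<subseteq> fvs.span (\<Union>g\<in>A. fsp (K g) :: ('b, 'k) vec set)" by (rule fvs.span_mono)
  then show "(fsp I :: ('b, 'k) vec set) \<subseteq> fvs.span (\<Union>g\<in>A. fsp (K g))" by (simp only: span_ivec[OF assms(1)])
qed

context tri_geometry
begin

abbreviation "\<Gamma>\<^sub>T \<equiv> tri_group G n \<sigma> T"
abbreviation "gen \<equiv> tri_gen G n \<sigma> T"

lemma group_tri: "group \<Gamma>\<^sub>T" unfolding tri_group_def by (rule group_presented_group)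

interpretation Gr: group \<Gamma>\<^sub>T by (rule group_tri)

lemma gwords_PA: "w \<in> gwords (Pi_all G n) \<longleftrightarrow> fst ` set w \<subseteq> PA" by (simp add: gwords_def Pi_all_PA)

lemma gen_carrier: "u \<in> PA \<Longrightarrow> gen u \<in> carrier \<Gamma>\<^sub>T"
  by (simp add: tri_gen_def tri_group_def presented_group_def gwords_PA)

lemma gen_relator:
  assumes "r \<in> tri_relators G n \<sigma> T" "fst ` set r \<subseteq> PA"
  shows "pres_class (Pi_all G n) (tri_relators G n \<sigma> T) r = \<one>\<^bsub>\<Gamma>\<^sub>T\<^esub>"
  using pres_class_eq[OF pres_eq.relator[of "[]" "Pi_all G n" "[]" r "tri_relators G n \<sigma> T"]] assms
  by (simp add: gwords_PA tri_group_def presented_group_def)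

lemma gen_sigma: "u \<in> PA \<Longrightarrow> gen u \<otimes>\<^bsub>\<Gamma>\<^sub>T\<^esub> gen (\<sigma> u) = \<one>\<^bsub>\<Gamma>\<^sub>T\<^esub>"
proof -
  assume u: "u \<in> PA"
  have "gen u \<otimes>\<^bsub>\<Gamma>\<^sub>T\<^esub> gen (\<sigma> u) = pres_class (Pi_all G n) (tri_relators G n \<sigma> T) [(u, True), (\<sigma> u, True)]"
    using u sigma_PA by (simp add: tri_gen_def tri_group_def presented_group_mult gwords_PA)
  also have "\<dots> = \<one>\<^bsub>\<Gamma>\<^sub>T\<^esub>"
    using u sigma_PA by (intro gen_relator) (auto simp: tri_relators_def Pi_all_PA)
  finally show ?thesis .
qed

lemma gen_triple:
  assumes "(u, v, w) \<in> T" "u \<in> PA" "v \<in> PA" "w \<in> PA"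
  shows "gen u \<otimes>\<^bsub>\<Gamma>\<^sub>T\<^esub> gen v \<otimes>\<^bsub>\<Gamma>\<^sub>T\<^esub> gen w = \<one>\<^bsub>\<Gamma>\<^sub>T\<^esub>"
proof -
  have "gen u \<otimes>\<^bsub>\<Gamma>\<^sub>T\<^esub> gen v \<otimes>\<^bsub>\<Gamma>\<^sub>T\<^esub> gen w =
      pres_class (Pi_all G n) (tri_relators G n \<sigma> T) [(u, True), (v, True), (w, True)]"
    using assms by (simp add: tri_gen_def tri_group_def presented_group_mult gwords_PA)
  also have "\<dots> = \<one>\<^bsub>\<Gamma>\<^sub>T\<^esub>"
    using assms by (intro gen_relator) (auto simp: tri_relators_def)
  finally show ?thesis .
qed

definition dg :: "'p set \<Rightarrow> 'p tri_elem" where "dg u = (if u \<in> PA then gen u else \<one>\<^bsub>\<Gamma>\<^sub>T\<^esub>)"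

lemma dg_carrier [simp]: "dg u \<in> carrier \<Gamma>\<^sub>T" by (simp add: dg_def gen_carrier)

lemma dg_simps [simp]: "dg {} = \<one>\<^bsub>\<Gamma>\<^sub>T\<^esub>" "dg pts = \<one>\<^bsub>\<Gamma>\<^sub>T\<^esub>" by (simp_all add: dg_def PA_def)

lemma dg_sg: "u \<in> S \<Longrightarrow> dg u \<otimes>\<^bsub>\<Gamma>\<^sub>T\<^esub> dg (sg u) = \<one>\<^bsub>\<Gamma>\<^sub>T\<^esub>"
  by (erule S_cases) (simp, simp, simp add: sg_PA dg_def sigma_PA gen_sigma)

lemma dg_R: "R u v w \<Longrightarrow> dg u \<otimes>\<^bsub>\<Gamma>\<^sub>T\<^esub> dg v = dg w"
proof -
  assume r: "R u v w"
  then consider "u = {}" "w = v" | "v = {}" "w = u" | "w = pts" "v = sg u" "u \<in> S" |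
    "u \<in> PA" "v \<in> PA" "w \<in> PA" "(u, v, \<sigma> w) \<in> T" by (auto simp: R_def)
  then show ?thesis
  proof cases
    case 4
    then have "dg u \<otimes>\<^bsub>\<Gamma>\<^sub>T\<^esub> dg v \<otimes>\<^bsub>\<Gamma>\<^sub>T\<^esub> dg (\<sigma> w) = dg w \<otimes>\<^bsub>\<Gamma>\<^sub>T\<^esub> dg (\<sigma> w)"
      using gen_triple[of u v "\<sigma> w"] gen_sigma[of w] sigma_PA by (simp add: dg_def)
    then show ?thesis using Gr.right_cancel[of "dg (\<sigma> w)" "dg u \<otimes>\<^bsub>\<Gamma>\<^sub>T\<^esub> dg v" "dg w"] by simp
  qed (auto simp: dg_sg)
qed

primrec dgl :: "'p set list \<Rightarrow> 'p tri_elem" where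
  "dgl [] = \<one>\<^bsub>\<Gamma>\<^sub>T\<^esub>" | "dgl (u # us) = dg u \<otimes>\<^bsub>\<Gamma>\<^sub>T\<^esub> dgl us"

lemma dgl_carrier [simp]: "dgl us \<in> carrier \<Gamma>\<^sub>T" by (induction us) auto

lemma dgl_append: "dgl (us @ vs) = dgl us \<otimes>\<^bsub>\<Gamma>\<^sub>T\<^esub> dgl vs"
  by (induction us) (auto simp: Gr.m_assoc)

primrec gob :: "shape \<Rightarrow> ('p, 'k::field) tri_ob" where
  "gob Unit = graded_unit \<Gamma>\<^sub>T"
| "gob (Leaf a) = triV G n \<sigma> T a"
| "gob (Node s t) = graded_tensor \<Gamma>\<^sub>T (gob s) (gob t)"

text \<open>The part of the basis that spans the homogeneous component of degree \<open>g\<close>.\<close>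

definition Bg :: "shape \<Rightarrow> 'p tri_elem \<Rightarrow> 'p set list set" where "Bg s g = {us \<in> B s. dgl us = g}"

lemma finite_Bg [simp]: "finite (Bg s g)" by (simp add: Bg_def)

lemma enc_Bg_Node: "enc (Node s t) ` Bg (Node s t) g =
    (\<Union>h\<in>carrier \<Gamma>\<^sub>T. \<Union>k\<in>{k \<in> carrier \<Gamma>\<^sub>T. h \<otimes>\<^bsub>\<Gamma>\<^sub>T\<^esub> k = g}. ipairs (enc s ` Bg s h) (enc t ` Bg t k))"
proof (rule subset_antisym; rule subsetI)
  fix i assume "i \<in> enc (Node s t) ` Bg (Node s t) g"
  then obtain xs ys where xy: "xs \<in> B s" "ys \<in> B t" "dgl (xs @ ys) = g" "i = enc (Node s t) (xs @ ys)"
    by (auto simp: Bg_def)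
  then have "i \<in> ipairs (enc s ` Bg s (dgl xs)) (enc t ` Bg t (dgl ys))" "dgl xs \<otimes>\<^bsub>\<Gamma>\<^sub>T\<^esub> dgl ys = g"
    by (auto simp: ipairs_def Bg_def dgl_append B_length)
  then show "i \<in> (\<Union>h\<in>carrier \<Gamma>\<^sub>T. \<Union>k\<in>{k \<in> carrier \<Gamma>\<^sub>T. h \<otimes>\<^bsub>\<Gamma>\<^sub>T\<^esub> k = g}. ipairs (enc s ` Bg s h) (enc t ` Bg t k))"
    using dgl_carrier by blast
next
  fix i assume "i \<in> (\<Union>h\<in>carrier \<Gamma>\<^sub>T. \<Union>k\<in>{k \<in> carrier \<Gamma>\<^sub>T. h \<otimes>\<^bsub>\<Gamma>\<^sub>T\<^esub> k = g}. ipairs (enc s ` Bg s h) (enc t ` Bg t k))"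
  then obtain xs ys where xy: "xs \<in> B s" "ys \<in> B t" "dgl xs \<otimes>\<^bsub>\<Gamma>\<^sub>T\<^esub> dgl ys = g" "i = Ipair (enc s xs) (enc t ys)"
    by (auto simp: Bg_def ipairs_def)
  then have "i = enc (Node s t) (xs @ ys)" "xs @ ys \<in> Bg (Node s t) g"
    by (auto simp: B_length Bg_def dgl_append)
  then show "i \<in> enc (Node s t) ` Bg (Node s t) g" by blast
qed

text \<open>Homogeneous components of iterated tensor products are coordinate spaces as well, because the degree
  of a concatenation is the product of the degrees.\<close>

lemma gob_eq: "gob s = (\<lambda>g. fsp (enc s ` Bg s g) :: ('p set, 'k::field) vec set)"
proof (induction s)
  case Unit
  have one: "fvs.span {one_vec} = (fsp {Iunit} :: ('p set, 'k) vec set)"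
    using span_ivec[of "{Iunit}", where 'k = 'k] by simp
  have Bg: "Bg Unit g = (if g = \<one>\<^bsub>\<Gamma>\<^sub>T\<^esub> then {[]} else {})" for g by (auto simp: Bg_def)
  show ?case by (rule HOL.ext) (simp add: graded_unit_def one Bg)
next
  case (Leaf a)
  have one: "fvs.span {one_vec} = (fsp {Iunit} :: ('p set, 'k) vec set)"
    using span_ivec[of "{Iunit}", where 'k = 'k] by simp
  consider "a = 0 \<or> a = int n" | "0 < a" "a < int n" | "a < 0 \<or> int n < a" by linarith
  then show ?case
  proof cases
    case 1
    have Bg: "Bg (Leaf a) g = (if g = \<one>\<^bsub>\<Gamma>\<^sub>T\<^esub> then if a = 0 then {[{}]} else {[pts]} else {})" for g
      using 1 by (cases "a = 0") (auto simp: Bg_def)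
    show ?thesis using 1 by (intro HOL.ext) (auto simp: triV_def graded_unit_def one Bg)
  next
    case 2
    have e: "Pi_dim G (nat a) = P a" using 2 by (auto simp: Pi_dim_rk P_def)
    have PA: "P a \<subseteq> PA" using 2 by (auto simp: PA_rk P_def)
    have i: "enc (Leaf a) ` Bg (Leaf a) g = Ibas ` {u \<in> P a. gen u = g}" for g
    proof -
      have "dgl [u] = gen u" if "u \<in> P a" for u using that PA gen_carrier by (auto simp: dg_def)
      then have "Bg (Leaf a) g = (\<lambda>u. [u]) ` {u \<in> P a. gen u = g}" by (auto simp: Bg_def simp del: dgl.simps)
      then show ?thesis using 2 by (simp add: image_image)
    qed
    have "{bas u | u. u \<in> P a \<and> gen u = g} = (ivec ` Ibas ` {u \<in> P a. gen u = g} :: ('p set, 'k) vec set)" for g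
      by auto
    then have "fvs.span {bas u | u. u \<in> P a \<and> gen u = g} = (fsp (enc (Leaf a) ` Bg (Leaf a) g) :: ('p set, 'k) vec set)" for g
      unfolding i using span_ivec[of "Ibas ` {u \<in> P a. gen u = g}", where 'k = 'k] by simp
    then show ?thesis using 2 by (simp add: triV_def e)
  next
    case 3
    then have "P a = {}" using P_out[of a] by auto
    then have "Bg (Leaf a) g = {}" for g by (auto simp: Bg_def)
    then show ?thesis using 3 by (auto simp: triV_def)
  qed
next
  case (Node s t)
  show ?case
  proof
    fix g
    have U: "\<Union>{tensor_space (gob s h) (gob t k) | h k. h \<in> carrier \<Gamma>\<^sub>T \<and> k \<in> carrier \<Gamma>\<^sub>T \<and> h \<otimes>\<^bsub>\<Gamma>\<^sub>T\<^esub> k = g} =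
        (\<Union>(h, k)\<in>{(h, k). h \<in> carrier \<Gamma>\<^sub>T \<and> k \<in> carrier \<Gamma>\<^sub>T \<and> h \<otimes>\<^bsub>\<Gamma>\<^sub>T\<^esub> k = g}.
          fsp (ipairs (enc s ` Bg s h) (enc t ` Bg t k)) :: ('p set, 'k) vec set)"
      unfolding Node.IH by (auto simp: tensor_space_fsp)
    have "gob (Node s t) g = fvs.span (\<Union>(h, k)\<in>{(h, k). h \<in> carrier \<Gamma>\<^sub>T \<and> k \<in> carrier \<Gamma>\<^sub>T \<and> h \<otimes>\<^bsub>\<Gamma>\<^sub>T\<^esub> k = g}.
          fsp (ipairs (enc s ` Bg s h) (enc t ` Bg t k)) :: ('p set, 'k) vec set)"
      by (simp add: graded_tensor_def U)
    also have "\<dots> = fsp (enc (Node s t) ` Bg (Node s t) g)"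
    proof
      let ?A = "{(h, k). h \<in> carrier \<Gamma>\<^sub>T \<and> k \<in> carrier \<Gamma>\<^sub>T \<and> h \<otimes>\<^bsub>\<Gamma>\<^sub>T\<^esub> k = g}"
      let ?U = "\<Union>(h, k)\<in>?A. fsp (ipairs (enc s ` Bg s h) (enc t ` Bg t k)) :: ('p set, 'k) vec set"
      have "ipairs (enc s ` Bg s h) (enc t ` Bg t k) \<subseteq> enc (Node s t) ` Bg (Node s t) g" if "(h, k) \<in> ?A" for h k
        using that unfolding enc_Bg_Node by blast
      then have "fsp (ipairs (enc s ` Bg s h) (enc t ` Bg t k)) \<subseteq> (fsp (enc (Node s t) ` Bg (Node s t) g) :: ('p set, 'k) vec set)"
        if "(h, k) \<in> ?A" for h k using that by (intro fsp_mono) blast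
      then have "?U \<subseteq> fsp (enc (Node s t) ` Bg (Node s t) g)" by blast
      then show "fvs.span ?U \<subseteq> fsp (enc (Node s t) ` Bg (Node s t) g)" by (rule fvs.span_minimal) simp
      have "ivec ` (enc (Node s t) ` Bg (Node s t) g) \<subseteq> ?U"
      proof
        fix x :: "('p set, 'k) vec" assume "x \<in> ivec ` (enc (Node s t) ` Bg (Node s t) g)"
        then obtain i where i: "x = ivec i" "i \<in> enc (Node s t) ` Bg (Node s t) g" by blast
        then obtain h k where "(h, k) \<in> ?A" "i \<in> ipairs (enc s ` Bg s h) (enc t ` Bg t k)"
          unfolding enc_Bg_Node by blast
        then show "x \<in> ?U" using i ivec_fsp by blast
      qed
      then have "fvs.span (ivec ` (enc (Node s t) ` Bg (Node s t) g)) \<subseteq> fvs.span ?U" by (rule fvs.span_mono)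
      then show "fsp (enc (Node s t) ` Bg (Node s t) g) \<subseteq> fvs.span ?U"
        by (simp only: span_ivec[OF finite_imageI[OF finite_Bg]])
    qed
    finally show "gob (Node s t) g = (fsp (enc (Node s t) ` Bg (Node s t) g) :: ('p set, 'k) vec set)" .
  qed
qed

lemma total_gob: "total (gob s :: ('p, 'k::field) tri_ob) = spc s"
proof -
  have "fvs.span (\<Union>g\<in>UNIV. fsp (enc s ` Bg s g)) = (fsp (enc s ` B s) :: ('p set, 'k) vec set)"
    by (rule span_UN_fsp) (auto simp: Bg_def)
  then show ?thesis by (simp add: total_def gob_eq spc_def)
qed

lemma gob_graded: "gob s \<in> (graded_spaces \<Gamma>\<^sub>T :: ('p, 'k::field) tri_ob set)"
  unfolding graded_spaces_def
proof (intro CollectI conjI allI impI ballI)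
  fix g
  show "fvs.subspace (gob s g :: ('p set, 'k) vec set)" by (simp add: gob_eq)
  show "gob s g = ({0} :: ('p set, 'k) vec set)" if "g \<notin> carrier \<Gamma>\<^sub>T"
  proof -
    have "Bg s g = {}" using that dgl_carrier by (auto simp: Bg_def)
    then show ?thesis by (simp add: gob_eq)
  qed
next
  have "total (gob s) = fvs.span (ivec ` enc s ` B s :: ('p set, 'k) vec set)"
    by (simp only: total_gob spc_def span_ivec[OF finite_imageI[OF finite_B]])
  then show "\<exists>A. finite A \<and> total (gob s) = (fvs.span A :: ('p set, 'k) vec set)"
    using finite_imageI[OF finite_imageI[OF finite_B]] by blast
next
  fix A and x :: "'p tri_elem \<Rightarrow> ('p set, 'k) vec" and g
  assume A: "finite A \<and> (\<forall>g\<in>A. x g \<in> gob s g) \<and> (\<Sum>g\<in>A. x g) = 0" and g: "g \<in> A"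
  show "x g = 0"
  proof
    fix i
    show "x g i = (0 :: ('p set, 'k) vec) i"
    proof (cases "i \<in> enc s ` Bg s g")
      case False
      then show ?thesis using A g by (auto simp: gob_eq fsp_def)
    next
      case True
      have "x h i = 0" if h: "h \<in> A" "h \<noteq> g" for h
      proof -
        have "i \<notin> enc s ` Bg s h"
        proof
          assume "i \<in> enc s ` Bg s h"
          then obtain us vs where "us \<in> Bg s h" "vs \<in> Bg s g" "enc s us = enc s vs" using True by auto
          then show False using h inj_onD[OF inj_enc] by (auto simp: Bg_def)
        qed
        then show ?thesis using A h by (auto simp: gob_eq fsp_def)
      qed
      then have "(\<Sum>h\<in>A. x h i) = x g i" using A g by (simp add: sum.remove)
      moreover have "(\<Sum>h\<in>A. x h i) = (\<Sum>h\<in>A. x h) i" by (simp add: sum_fun_apply)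
      ultimately show ?thesis using A by simp
    qed
  qed
qed

lemma lact_graded:
  assumes "\<And>us ws. us \<in> B s \<Longrightarrow> ws \<in> B s' \<Longrightarrow> A ws us \<noteq> 0 \<Longrightarrow> dgl us = dgl ws"
    and x: "x \<in> gob s g"
  shows "lact s s' A x \<in> (gob s' g :: ('p set, 'k::field) vec set)"
  unfolding gob_eq fsp_def
proof (intro CollectI allI impI)
  fix i assume i: "i \<notin> enc s' ` Bg s' g"
  show "lact s s' A x i = 0"
  proof (cases "i \<in> enc s' ` B s'")
    case False then show ?thesis using lact_spc[of s s' A x] by (simp add: spc_def fsp_def)
  next
    case True
    then obtain ws where ws: "ws \<in> B s'" "i = enc s' ws" by blast
    then have d: "dgl ws \<noteq> g" using i by (auto simp: Bg_def)
    have "A ws us * x (enc s us) = 0" if us: "us \<in> B s" for us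
    proof (cases "dgl us = g")
      case True then show ?thesis using assms(1)[OF us ws(1)] d by auto
    next
      case False
      then have "enc s us \<notin> enc s ` Bg s g" using us inj_onD[OF inj_enc[of s]] by (auto simp: Bg_def)
      then show ?thesis using x by (simp add: gob_eq fsp_def)
    qed
    then show ?thesis unfolding ws(2) lact_enc[OF ws(1)] by (simp add: sum.neutral)
  qed
qed

lemma gob_sub: "gob s g \<subseteq> (spc s :: ('p set, 'k::field) vec set)"
  unfolding gob_eq spc_def by (rule fsp_mono) (auto simp: Bg_def)

lemma shaped_GVec: "shaped_category G q n \<sigma> T (graded_spaces \<Gamma>\<^sub>T) total (\<lambda>V f W. \<forall>g. f ` V g \<subseteq> W g)
    (graded_tensor \<Gamma>\<^sub>T) (graded_unit \<Gamma>\<^sub>T) (gob :: shape \<Rightarrow> ('p, 'k::field) tri_ob) dgl"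
proof unfold_locales
  fix s s' and A :: "('p, 'k) lmat"
  assume A: "\<And>us ws. us \<in> B s \<Longrightarrow> ws \<in> B s' \<Longrightarrow> A ws us \<noteq> 0 \<Longrightarrow> dgl us = dgl ws"
  show "\<forall>g. restrict (lact s s' A) (spc s) ` gob s g \<subseteq> gob s' g"
  proof (intro allI subsetI)
    fix g y assume "y \<in> restrict (lact s s' A) (spc s) ` gob s g"
    then obtain x where "x \<in> gob s g" "y = lact s s' A x" using gob_sub by force
    then show "y \<in> gob s' g" using lact_graded[of s s' A x g] A by simp
  qed
qed (simp_all add: total_gob gob_graded)

lemma shaped_Vec: "shaped_category G q n \<sigma> T {V. \<exists>B. finite B \<and> V = fvs.span B} (\<lambda>V. V) (\<lambda>V f W. f ` V \<subseteq> W)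
    tensor_space (fvs.span {one_vec}) (spc :: shape \<Rightarrow> ('p set, 'k::field) vec set) dgl"
proof unfold_locales
  fix s
  have "spc s = fvs.span (ivec ` enc s ` B s :: ('p set, 'k) vec set)"
    by (simp only: spc_def span_ivec[OF finite_imageI[OF finite_B]])
  then show "(spc s :: ('p set, 'k) vec set) \<in> {V. \<exists>B. finite B \<and> V = fvs.span B}"
    using finite_imageI[OF finite_imageI[OF finite_B]] by blast
next
  show "fvs.span {one_vec} = (spc Unit :: ('p set, 'k) vec set)"
    using span_ivec[of "{Iunit}", where 'k = 'k] by (simp add: spc_def)
qed (auto simp: tensor_space_spc)

end

section \<open>The given merges and splits as matrices\<close>

text \<open>The parameter \<open>K\<close> only names the field over which both kinds of spaces are taken.\<close>

locale tri_field = tri_geometry G q n \<sigma> T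
  for G :: "('p, 'l) geometry" and q n \<sigma> T +
  fixes K :: "'k::field itself"
begin

sublocale GV: shaped_category G q n \<sigma> T "graded_spaces \<Gamma>\<^sub>T" total "\<lambda>V f W. \<forall>g. f ` V g \<subseteq> W g"
    "graded_tensor \<Gamma>\<^sub>T" "graded_unit \<Gamma>\<^sub>T" "gob :: shape \<Rightarrow> ('p, 'k) tri_ob" dgl
  by (rule shaped_GVec)

sublocale VV: shaped_category G q n \<sigma> T "{V. \<exists>B. finite B \<and> V = fvs.span B}" "\<lambda>V. V" "\<lambda>V f W. f ` V \<subseteq> W"
    tensor_space "fvs.span {one_vec}" "spc :: shape \<Rightarrow> ('p set, 'k) vec set" dgl
  by (rule shaped_Vec)

lemma GVec_cat: "GV.CC = GVec \<Gamma>\<^sub>T" by (simp add: GVec_def)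
lemma Vec_cat: "VV.CC = Vec" by (simp add: Vec_def)

lemma Pi_dim_P: "0 < a \<Longrightarrow> Pi_dim G (nat a) = P a"
  by (auto simp: Pi_dim_rk P_def)

lemma mat_eqI:
  assumes "\<And>x. x \<in> spc s \<Longrightarrow> lact s s' A x = f x"
  shows "Arr (gob s) (restrict f (spc s)) (gob s') = GV.mat s s' A"
proof -
  have "restrict f (spc s) = restrict (lact s s' A) (spc s)" by (rule restrict_ext) (simp only: assms)
  then show ?thesis by (simp only: GV.mat_def)
qed

text \<open>A merge or split with a label \<open>0\<close> is a unitor, whose shape contains \<open>Unit\<close> in place of \<open>Leaf 0\<close>; the
  two shapes have the same objects, and the two matrices act in the same way.\<close>

lemma mat_shape:
  assumes "gob s = (gob s2 :: ('p, 'k) tri_ob)" "gob s' = (gob s2' :: ('p, 'k) tri_ob)" "lact s s' A = lact s2 s2' D"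
  shows "GV.mat s s' A = GV.mat s2 s2' D"
  by (simp only: GV.mat_def total_gob[symmetric] assms)

lemma gob_0: "gob (Leaf 0) = (gob Unit :: ('p, 'k) tri_ob)" by (simp add: triV_def)

lemma tob: "gob s \<star>\<^bsub>GVec \<Gamma>\<^sub>T\<^esub> gob t = (gob (Node s t) :: ('p, 'k) tri_ob)"
  using GV.mat_fields(3)[of s t] by (simp only: GVec_cat)

lemmas tri_unfold = gob.simps(2)[symmetric] tob total_gob Pi_dim_P if_True if_False

lemma triM_pos:
  assumes "0 < a" "0 < b" "a + b \<le> int n"
  shows "triM G n \<sigma> T a b = (Arr (gob (Node (Leaf a) (Leaf b))) (\<lambda>x\<in>spc (Node (Leaf a) (Leaf b)).
      \<Sum>u\<in>P a. \<Sum>v\<in>P b. vscale (x (Ipair (Ibas u) (Ibas v))) (merge_val G n \<sigma> T a b u v)) (gob (Leaf (a + b))) :: ('p, 'k) tri_mor)"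
proof -
  have c: "(a = 0) = False" "(b = 0) = False" "(0 < a \<and> 0 < b \<and> a + b \<le> int n) = True" using assms by auto
  show ?thesis by (simp only: triM_def c tri_unfold Pi_dim_P[OF assms(1)] Pi_dim_P[OF assms(2)])
qed

lemma triS_pos:
  assumes "0 < a" "0 < b" "a + b < int n"
  shows "triS G n \<sigma> T a b = (Arr (gob (Leaf (a + b))) (\<lambda>x\<in>spc (Leaf (a + b)).
      \<Sum>u\<in>P (a + b). vscale (x (Ibas u)) (split_val G \<sigma> T a b u)) (gob (Node (Leaf a) (Leaf b))) :: ('p, 'k) tri_mor)"
proof -
  have c: "(a = 0) = False" "(b = 0) = False" "(0 < a \<and> 0 < b \<and> a + b < int n) = True" "0 < a + b" using assms by auto
  show ?thesis by (simp only: triS_def c(1-3) tri_unfold Pi_dim_P[OF c(4)])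
qed

lemma triS_full:
  assumes "0 < a" "0 < b" "a + b = int n"
  shows "triS G n \<sigma> T a b = (Arr (gob (Leaf (a + b))) (\<lambda>x\<in>spc (Leaf (a + b)).
      vscale (x Iunit) (\<Sum>u\<in>P a. tensor_vec (bas u) (bas (\<sigma> u)))) (gob (Node (Leaf a) (Leaf b))) :: ('p, 'k) tri_mor)"
proof -
  have c: "(a = 0) = False" "(b = 0) = False" "(0 < a \<and> 0 < b \<and> a + b < int n) = False"
    "(0 < a \<and> 0 < b \<and> a + b = int n) = True" using assms by auto
  show ?thesis by (simp only: triS_def c tri_unfold Pi_dim_P[OF assms(1)])
qed

lemma tri_degenerate:
  assumes "a \<noteq> 0" "b \<noteq> 0" "\<not> (0 < a \<and> 0 < b \<and> a + b \<le> int n)"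
  shows "triM G n \<sigma> T a b = Zero (GVec \<Gamma>\<^sub>T) (gob (Node (Leaf a) (Leaf b))) (gob (Leaf (a + b)) :: ('p, 'k) tri_ob)"
    "triS G n \<sigma> T a b = Zero (GVec \<Gamma>\<^sub>T) (gob (Leaf (a + b))) (gob (Node (Leaf a) (Leaf b)) :: ('p, 'k) tri_ob)"
proof -
  have c: "(a = 0) = False" "(b = 0) = False" "(0 < a \<and> 0 < b \<and> a + b \<le> int n) = False"
    "(0 < a \<and> 0 < b \<and> a + b < int n) = False" "(0 < a \<and> 0 < b \<and> a + b = int n) = False" using assms by auto
  show "triM G n \<sigma> T a b = Zero (GVec \<Gamma>\<^sub>T) (gob (Node (Leaf a) (Leaf b))) (gob (Leaf (a + b)) :: ('p, 'k) tri_ob)"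
    by (simp only: triM_def c tri_unfold)
  show "triS G n \<sigma> T a b = Zero (GVec \<Gamma>\<^sub>T) (gob (Leaf (a + b))) (gob (Node (Leaf a) (Leaf b)) :: ('p, 'k) tri_ob)"
    by (simp only: triS_def c tri_unfold)
qed

lemma degenerate_P:
  assumes "a \<noteq> 0" "b \<noteq> 0" "\<not> (0 < a \<and> 0 < b \<and> a + b \<le> int n)"
  shows "P a = {} \<or> P b = {} \<or> P (a + b) = {}"
  using assms P_out[of a] P_out[of b] P_out[of "a + b"] by linarith

lemma lact_expand:
  "lact s s' A x = (\<Sum>us\<in>B s. vscale (x (enc s us)) (\<Sum>ws\<in>B s'. vscale (A ws us) (ivec (enc s' ws))))"
proof
  fix i
  have "lact s s' A x i = (\<Sum>ws\<in>B s'. \<Sum>us\<in>B s. A ws us * x (enc s us) * ivec (enc s' ws) i)"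
    by (simp add: lact_def sum_fun_apply vscale_def sum_distrib_right)
  also have "\<dots> = (\<Sum>us\<in>B s. \<Sum>ws\<in>B s'. A ws us * x (enc s us) * ivec (enc s' ws) i)" by (rule sum.swap)
  finally show "lact s s' A x i = (\<Sum>us\<in>B s. vscale (x (enc s us)) (\<Sum>ws\<in>B s'. vscale (A ws us) (ivec (enc s' ws)))) i"
    by (simp add: sum_fun_apply vscale_def sum_distrib_left mult_ac)
qed

lemma sum_indicator_vscale:
  fixes f :: "'i \<Rightarrow> ('j \<Rightarrow> 'k)"
  assumes "finite A" "w \<in> A"
  shows "(\<Sum>x\<in>A. vscale (of_bool (x = w)) (f x)) = f w"
proof -
  have "(\<Sum>x\<in>A. vscale (of_bool (x = w)) (f x)) = (\<Sum>x\<in>A. if x = w then f w else 0)"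
    by (intro sum.cong) (auto simp: vscale_def fun_eq_iff)
  then show ?thesis using assms by simp
qed

lemma P_PA: "0 < a \<Longrightarrow> a < int n \<Longrightarrow> P a \<subseteq> PA" by (auto simp: PA_rk P_def)

lemma R_sigma_T:
  assumes "0 < a" "0 < b" "a + b < int n" "u \<in> P a" "v \<in> P b" "w \<in> P (a + b)"
  shows "R u v w \<longleftrightarrow> (u, v, \<sigma> w) \<in> T"
proof -
  have "u \<in> PA" "v \<in> PA" "w \<in> PA" using P_PA[of a] P_PA[of b] P_PA[of "a + b"] assms by auto
  moreover then have "w \<noteq> pts" by (simp add: PA_def)
  ultimately show ?thesis using R_PA_iff[of u v w] assms by (auto simp: P_def)
qed

lemma R_pts_sigma:
  assumes "0 < a" "a < int n" "u \<in> P a" "v \<in> S" shows "R u v pts \<longleftrightarrow> v = \<sigma> u"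
proof -
  have "u \<in> PA" using P_PA[of a] assms by auto
  then show ?thesis using R_sg[of u] R_left_cancel[of u v pts "sg u"] assms by (auto simp: sg_PA PA_S)
qed

text \<open>The cases in the definition of the merge, namely unitors, proper products, products equal to the
  whole space and zero spaces, are all instances of one matrix, because \<open>R\<close> includes the degenerate subspaces.\<close>

lemma triM_mat: "triM G n \<sigma> T a b = GV.mat (Node (Leaf a) (Leaf b)) (Leaf (a + b)) merge_mat"
proof -
  consider "a = 0" | "a \<noteq> 0" "b = 0" | "0 < a" "0 < b" "a + b < int n" | "0 < a" "0 < b" "a + b = int n"
    | "a \<noteq> 0" "b \<noteq> 0" "\<not> (0 < a \<and> 0 < b \<and> a + b \<le> int n)" by linarith
  then show ?thesis
  proof cases
    case 1
    have "GV.mat (Node Unit (Leaf b)) (Leaf b) idm = GV.mat (Node (Leaf 0) (Leaf b)) (Leaf b) merge_mat"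
    proof (rule mat_shape)
      have e: "merge_mat ws [{}, v] = (idm ws [v] :: 'k)" if "ws \<in> B (Leaf b)" "v \<in> P b" for ws v
        using that by (auto simp: merge_mat_def idm_def P_S)
      show "lact (Node Unit (Leaf b)) (Leaf b) idm = (lact (Node (Leaf 0) (Leaf b)) (Leaf b) merge_mat :: ('p set, 'k) vec \<Rightarrow> _)"
        unfolding lact_def sum_B_Node sum_B_Leaf by (rule HOL.ext) (simp add: e cong: sum.cong_simp)
    qed (simp_all only: gob.simps(3) gob_0)
    then show ?thesis using GV.mat_unitors(1)[of "Leaf b"] 1 by (simp add: triM_def GVec_cat del: gob.simps(3))
  next
    case 2
    have "GV.mat (Node (Leaf a) Unit) (Leaf a) idm = GV.mat (Node (Leaf a) (Leaf 0)) (Leaf a) merge_mat"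
    proof (rule mat_shape)
      have e: "merge_mat ws [v, {}] = (idm ws [v] :: 'k)" if "ws \<in> B (Leaf a)" "v \<in> P a" for ws v
        using that by (auto simp: merge_mat_def idm_def P_S)
      show "lact (Node (Leaf a) Unit) (Leaf a) idm = (lact (Node (Leaf a) (Leaf 0)) (Leaf a) merge_mat :: ('p set, 'k) vec \<Rightarrow> _)"
        unfolding lact_def sum_B_Node sum_B_Leaf by (rule HOL.ext) (simp add: e cong: sum.cong_simp)
    qed (simp_all only: gob.simps(3) gob_0)
    then show ?thesis using GV.mat_unitors(2)[of "Leaf a"] 2 by (simp add: triM_def GVec_cat del: gob.simps(3))
  next
    case 3
    then have le: "0 < a" "0 < b" "a + b \<le> int n" by auto
    have val: "merge_val G n \<sigma> T a b u v = (\<Sum>w\<in>P (a + b). vscale (of_bool (R u v w)) (bas w :: ('p set, 'k) vec))"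
      if uv: "u \<in> P a" "v \<in> P b" for u v
    proof (cases "\<exists>w\<in>P (a + b). R u v w")
      case True
      then obtain w where w: "w \<in> P (a + b)" "R u v w" by blast
      have iff: "w' \<in> P (a + b) \<and> (u, v, \<sigma> w') \<in> T \<longleftrightarrow> w' = w" for w'
        using R_sigma_T[OF 3 uv] w R_fun by blast
      have "R u v w' \<longleftrightarrow> w' = w" for w' using w R_fun by blast
      then have "(\<Sum>w\<in>P (a + b). vscale (of_bool (R u v w)) (bas w :: ('p set, 'k) vec)) = bas w"
        using sum_indicator_vscale[of "P (a + b)" w bas] w by simp
      moreover have "\<exists>w\<in>P (a + b). (u, v, \<sigma> w) \<in> T" using w R_sigma_T[OF 3 uv] by blast
      ultimately show ?thesis using 3 by (simp add: merge_val_def Pi_dim_P iff)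
    next
      case False
      then have "\<not> (\<exists>w\<in>P (a + b). (u, v, \<sigma> w) \<in> T)" using R_sigma_T[OF 3 uv] by blast
      moreover have "(\<Sum>w\<in>P (a + b). vscale (of_bool (R u v w)) (bas w :: ('p set, 'k) vec)) = 0"
        using False by (intro sum.neutral) (auto simp: vscale_def fun_eq_iff)
      ultimately show ?thesis using 3 by (simp add: merge_val_def Pi_dim_P)
    qed
    have "lact (Node (Leaf a) (Leaf b)) (Leaf (a + b)) merge_mat x = (\<Sum>u\<in>P a. \<Sum>v\<in>P b.
        vscale (x (Ipair (Ibas u) (Ibas v))) (merge_val G n \<sigma> T a b u v))" for x :: "('p set, 'k) vec"
      unfolding lact_expand sum_B_Node sum_B_Leaf using 3
      by (intro sum.cong) (auto simp: merge_mat_def val)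
    then have "Arr (gob (Node (Leaf a) (Leaf b))) (\<lambda>x\<in>spc (Node (Leaf a) (Leaf b)).
      \<Sum>u\<in>P a. \<Sum>v\<in>P b. vscale (x (Ipair (Ibas u) (Ibas v))) (merge_val G n \<sigma> T a b u v)) (gob (Leaf (a + b))) =
      GV.mat (Node (Leaf a) (Leaf b)) (Leaf (a + b)) merge_mat" by (rule mat_eqI)
    then show ?thesis by (simp only: triM_pos[OF le])
  next
    case 4
    then have le: "0 < a" "0 < b" "a + b \<le> int n" by auto
    have val: "merge_val G n \<sigma> T a b u v = (\<Sum>w\<in>P (a + b). vscale (of_bool (R u v w)) (one_vec :: ('p set, 'k) vec))"
      if uv: "u \<in> P a" "v \<in> P b" for u v
      using 4 R_pts_sigma[of a u v] uv P_S by (auto simp: merge_val_def vscale_def fun_eq_iff)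
    have "lact (Node (Leaf a) (Leaf b)) (Leaf (a + b)) merge_mat x = (\<Sum>u\<in>P a. \<Sum>v\<in>P b.
        vscale (x (Ipair (Ibas u) (Ibas v))) (merge_val G n \<sigma> T a b u v))" for x :: "('p set, 'k) vec"
      unfolding lact_expand sum_B_Node sum_B_Leaf using 4
      by (intro sum.cong) (auto simp: merge_mat_def val)
    then have "Arr (gob (Node (Leaf a) (Leaf b))) (\<lambda>x\<in>spc (Node (Leaf a) (Leaf b)).
      \<Sum>u\<in>P a. \<Sum>v\<in>P b. vscale (x (Ipair (Ibas u) (Ibas v))) (merge_val G n \<sigma> T a b u v)) (gob (Leaf (a + b))) =
      GV.mat (Node (Leaf a) (Leaf b)) (Leaf (a + b)) merge_mat" by (rule mat_eqI)
    then show ?thesis by (simp only: triM_pos[OF le])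
  next
    case 5
    have "GV.mat (Node (Leaf a) (Leaf b)) (Leaf (a + b)) merge_mat = GV.mat (Node (Leaf a) (Leaf b)) (Leaf (a + b)) (\<lambda>_ _. 0)"
    proof (rule GV.mat_cong)
      fix ws us assume "ws \<in> B (Leaf (a + b))" "us \<in> B (Node (Leaf a) (Leaf b))"
      then show "merge_mat ws us = (0::'k)" using degenerate_P[OF 5] by auto
    qed
    moreover have "triM G n \<sigma> T a b = Zero (GVec \<Gamma>\<^sub>T) (gob (Node (Leaf a) (Leaf b))) (gob (Leaf (a + b)) :: ('p, 'k) tri_ob)"
      using 5 by (rule tri_degenerate)
    ultimately show ?thesis by (simp only: GVec_cat[symmetric] GV.mat_zero)
  qed
qed

lemma triS_mat: "triS G n \<sigma> T a b = GV.mat (Leaf (a + b)) (Node (Leaf a) (Leaf b)) split_mat"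
proof -
  consider "a = 0" | "a \<noteq> 0" "b = 0" | "0 < a" "0 < b" "a + b < int n" | "0 < a" "0 < b" "a + b = int n"
    | "a \<noteq> 0" "b \<noteq> 0" "\<not> (0 < a \<and> 0 < b \<and> a + b \<le> int n)" by linarith
  then show ?thesis
  proof cases
    case 1
    have "GV.mat (Leaf b) (Node Unit (Leaf b)) idm = GV.mat (Leaf b) (Node (Leaf 0) (Leaf b)) split_mat"
    proof (rule mat_shape)
      have e: "split_mat [{}, v] [u] = (idm [v] [u] :: 'k)" if "v \<in> P b" "u \<in> P b" for u v
        using that by (auto simp: split_mat_def idm_def P_S)
      show "lact (Leaf b) (Node Unit (Leaf b)) idm = (lact (Leaf b) (Node (Leaf 0) (Leaf b)) split_mat :: ('p set, 'k) vec \<Rightarrow> _)"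
        unfolding lact_def sum_B_Node sum_B_Leaf by (rule HOL.ext) (simp add: e cong: sum.cong_simp)
    qed (simp_all only: gob.simps(3) gob_0)
    then show ?thesis using GV.mat_unitors(3)[of "Leaf b"] 1 by (simp add: triS_def GVec_cat del: gob.simps(3))
  next
    case 2
    have "GV.mat (Leaf a) (Node (Leaf a) Unit) idm = GV.mat (Leaf a) (Node (Leaf a) (Leaf 0)) split_mat"
    proof (rule mat_shape)
      have e: "split_mat [v, {}] [u] = (idm [v] [u] :: 'k)" if "v \<in> P a" "u \<in> P a" for u v
        using that by (auto simp: split_mat_def idm_def P_S)
      show "lact (Leaf a) (Node (Leaf a) Unit) idm = (lact (Leaf a) (Node (Leaf a) (Leaf 0)) split_mat :: ('p set, 'k) vec \<Rightarrow> _)"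
        unfolding lact_def sum_B_Node sum_B_Leaf by (rule HOL.ext) (simp add: e cong: sum.cong_simp)
    qed (simp_all only: gob.simps(3) gob_0)
    then show ?thesis using GV.mat_unitors(4)[of "Leaf a"] 2 by (simp add: triS_def GVec_cat del: gob.simps(3))
  next
    case 3
    have val: "split_val G \<sigma> T a b w = (\<Sum>u\<in>P a. \<Sum>v\<in>P b. vscale (of_bool (R u v w)) (ivec (Ipair (Ibas u) (Ibas v)) :: ('p set, 'k) vec))"
      if w: "w \<in> P (a + b)" for w
    proof -
      have "split_val G \<sigma> T a b w = (\<Sum>(u, v)\<in>{(u, v). u \<in> P a \<and> v \<in> P b \<and> R u v w}. ivec (Ipair (Ibas u) (Ibas v)) :: ('p set, 'k) vec)"
        unfolding split_val_def tensor_vec_ivec using 3 w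
        by (intro sum.cong) (auto simp: Pi_dim_P R_sigma_T[OF 3])
      also have "\<dots> = (\<Sum>(u, v)\<in>P a \<times> P b. vscale (of_bool (R u v w)) (ivec (Ipair (Ibas u) (Ibas v))))"
        by (rule sum.mono_neutral_cong_left) (auto simp: vscale_def fun_eq_iff)
      finally show ?thesis by (simp add: sum.cartesian_product)
    qed
    have "lact (Leaf (a + b)) (Node (Leaf a) (Leaf b)) split_mat x = (\<Sum>u\<in>P (a + b).
        vscale (x (Ibas u)) (split_val G \<sigma> T a b u))" for x :: "('p set, 'k) vec"
      unfolding lact_expand sum_B_Node sum_B_Leaf using 3
      by (intro sum.cong) (auto simp: split_mat_def val)
    then have "Arr (gob (Leaf (a + b))) (\<lambda>x\<in>spc (Leaf (a + b)).
      \<Sum>u\<in>P (a + b). vscale (x (Ibas u)) (split_val G \<sigma> T a b u)) (gob (Node (Leaf a) (Leaf b))) =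
      GV.mat (Leaf (a + b)) (Node (Leaf a) (Leaf b)) split_mat" by (rule mat_eqI)
    then show ?thesis by (simp only: triS_pos[OF 3])
  next
    case 4
    have val: "(\<Sum>u\<in>P a. tensor_vec (bas u) (bas (\<sigma> u))) =
        (\<Sum>u\<in>P a. \<Sum>v\<in>P b. vscale (of_bool (R u v pts)) (ivec (Ipair (Ibas u) (Ibas v)) :: ('p set, 'k) vec))"
    proof (rule sum.cong[OF HOL.refl])
      fix u assume u: "u \<in> P a"
      have su: "\<sigma> u \<in> P b"
        using u 4 P_PA[of a] rk_sigma[of u] sigma_PA(1)[of u] rk_le[of u] by (auto simp: P_def PA_S)
      have "(\<Sum>v\<in>P b. vscale (of_bool (R u v pts)) (ivec (Ipair (Ibas u) (Ibas v)) :: ('p set, 'k) vec)) =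
          (\<Sum>v\<in>P b. vscale (of_bool (v = \<sigma> u)) (ivec (Ipair (Ibas u) (Ibas v))))"
        using R_pts_sigma[of a u] u 4 P_S by (intro sum.cong) auto
      also have "\<dots> = ivec (Ipair (Ibas u) (Ibas (\<sigma> u)))" using su by (intro sum_indicator_vscale) auto
      finally show "tensor_vec (bas u) (bas (\<sigma> u)) = (\<Sum>v\<in>P b. vscale (of_bool (R u v pts)) (ivec (Ipair (Ibas u) (Ibas v)) :: ('p set, 'k) vec))"
        by (simp add: tensor_vec_ivec)
    qed
    have "lact (Leaf (a + b)) (Node (Leaf a) (Leaf b)) split_mat x =
        vscale (x Iunit) (\<Sum>u\<in>P a. tensor_vec (bas u) (bas (\<sigma> u)))" for x :: "('p set, 'k) vec"
      unfolding lact_expand sum_B_Node sum_B_Leaf using 4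
      by (simp add: split_mat_def val)
    then have "Arr (gob (Leaf (a + b))) (\<lambda>x\<in>spc (Leaf (a + b)).
      vscale (x Iunit) (\<Sum>u\<in>P a. tensor_vec (bas u) (bas (\<sigma> u)))) (gob (Node (Leaf a) (Leaf b))) =
      GV.mat (Leaf (a + b)) (Node (Leaf a) (Leaf b)) split_mat" by (rule mat_eqI)
    then show ?thesis by (simp only: triS_full[OF 4])
  next
    case 5
    have "GV.mat (Leaf (a + b)) (Node (Leaf a) (Leaf b)) split_mat = GV.mat (Leaf (a + b)) (Node (Leaf a) (Leaf b)) (\<lambda>_ _. 0)"
    proof (rule GV.mat_cong)
      fix ws us assume "ws \<in> B (Node (Leaf a) (Leaf b))" "us \<in> B (Leaf (a + b))"
      then show "split_mat ws us = (0::'k)" using degenerate_P[OF 5] by auto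
    qed
    moreover have "triS G n \<sigma> T a b = Zero (GVec \<Gamma>\<^sub>T) (gob (Leaf (a + b))) (gob (Node (Leaf a) (Leaf b)) :: ('p, 'k) tri_ob)"
      using 5 by (rule tri_degenerate)
    ultimately show ?thesis by (simp only: GVec_cat[symmetric] GV.mat_zero)
  qed
qed

lemma gob_n: "gob (Leaf (int n)) = (gob Unit :: ('p, 'k) tri_ob)" by (simp add: triV_def)

lemma triE_mat: "triE G n \<sigma> T = GV.ev" "triE' G n \<sigma> T = GV.coev"
proof -
  have l: "lact (Leaf (int n)) Unit (\<lambda>_ _. 1) = (lact Unit Unit idm :: ('p set, 'k) vec \<Rightarrow> _)"
    "lact Unit (Leaf (int n)) (\<lambda>_ _. 1) = (lact Unit Unit idm :: ('p set, 'k) vec \<Rightarrow> _)"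
    by (simp_all add: fun_eq_iff lact_def idm_def)
  have sp: "spc (Leaf (int n)) = (spc Unit :: ('p set, 'k) vec set)"
    by (simp only: total_gob[symmetric] gob_n)
  have i: "Idn GV.CC (Uob GV.CC) = Arr (gob Unit) (restrict (lact Unit Unit idm) (spc Unit)) (gob Unit)"
    using GV.mat_id[of Unit] by (simp only: GV.mat_fields(2) GV.mat_def)
  show "triE G n \<sigma> T = GV.ev"
    by (simp only: triE_def GVec_cat[symmetric] i GV.mat_def l sp gob_n)
  show "triE' G n \<sigma> T = GV.coev"
    by (simp only: triE'_def GVec_cat[symmetric] i GV.mat_def l sp gob_n)
qed

end

section \<open>Webs as matrices\<close>

text \<open>Source and target are read off from the term, so that the interpretation of a composite can sum
  over the basis of the middle object.\<close>

primrec wsrc :: "nat \<Rightarrow> 'k web_term \<Rightarrow> nat list" where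
  "wsrc n (WId X) = X" | "wsrc n (WMerge a b) = [a, b]" | "wsrc n (WSplit a b) = [a + b]"
| "wsrc n (WCross a b) = [a, b]" | "wsrc n WEv = [n]" | "wsrc n WCoev = []"
| "wsrc n (WComp g f) = wsrc n f" | "wsrc n (WTens f g) = wsrc n f @ wsrc n g"
| "wsrc n (WZero X Y) = X" | "wsrc n (WAdd f g) = wsrc n f" | "wsrc n (WScale c f) = wsrc n f"

primrec wtgt :: "nat \<Rightarrow> 'k web_term \<Rightarrow> nat list" where
  "wtgt n (WId X) = X" | "wtgt n (WMerge a b) = [a + b]" | "wtgt n (WSplit a b) = [a, b]"
| "wtgt n (WCross a b) = [b, a]" | "wtgt n WEv = []" | "wtgt n WCoev = [n]"
| "wtgt n (WComp g f) = wtgt n g" | "wtgt n (WTens f g) = wtgt n f @ wtgt n g"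
| "wtgt n (WZero X Y) = Y" | "wtgt n (WAdd f g) = wtgt n f" | "wtgt n (WScale c f) = wtgt n f"

lemma web_arr_type: "web_arr n X Y f \<Longrightarrow> wsrc n f = X \<and> wtgt n f = Y"
  by (induction rule: web_arr.induct) auto

lemma web_arr_objects: "web_arr n X Y f \<Longrightarrow> 1 \<le> n \<Longrightarrow> X \<in> web_objects n \<and> Y \<in> web_objects n"
  by (induction rule: web_arr.induct) (auto simp: web_objects_def)

lemma web_eq_arr:
  assumes "web_eq n X Y f g" and n: "1 \<le> n" shows "web_arr n X Y f \<and> web_arr n X Y g"
  using assms(1)
proof (induction rule: web_eq.induct)
  case (tens_id X Y)
  then have "X @ Y \<in> web_objects n" by (auto simp: web_objects_def)
  then show ?case using tens_id by (auto intro: web_arr.intros)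
next
  case (tens_assoc X X' f Y Y' g Z Z' h)
  have "web_arr n ((X @ Y) @ Z) ((X' @ Y') @ Z') (WTens (WTens f g) h)"
    using tens_assoc by (intro web_arr.intros)
  then show ?case using tens_assoc by (auto intro: web_arr.intros)
next
  case (tens_unit_left X Y f)
  have "web_arr n ([] @ X) ([] @ Y) (WTens (WId []) f)"
    using tens_unit_left by (intro web_arr.intros) (auto simp: web_objects_def)
  then show ?case using tens_unit_left by simp
next
  case (tens_unit_right X Y f)
  have "web_arr n (X @ []) (Y @ []) (WTens f (WId []))"
    using tens_unit_right by (intro web_arr.intros) (auto simp: web_objects_def)
  then show ?case using tens_unit_right by simp
qed (use web_arr_objects[OF _ n] in \<open>blast intro: web_arr.intros\<close>)+

lemma web_class_rep:
  assumes "web_arr n X Y f" "1 \<le> n" "h \<in> web_class n f" shows "web_eq n X Y f h"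
proof -
  obtain X' Y' where e: "web_eq n X' Y' f h" using assms by (auto simp: web_class_def)
  then have "web_arr n X' Y' f" using web_eq_arr assms by blast
  then have "X' = X" "Y' = Y" using web_arr_type assms by metis+
  then show ?thesis using e by simp
qed

lemma web_class_self: "web_arr n X Y f \<Longrightarrow> f \<in> web_class n f"
  by (auto simp: web_class_def intro: web_eq.refl)

context tri_geometry
begin

primrec Bl :: "nat list \<Rightarrow> 'p set list set" where
  "Bl [] = {[]}" | "Bl (a # X) = {u # us | u us. u \<in> P (int a) \<and> us \<in> Bl X}"

lemma Bl_length: "us \<in> Bl X \<Longrightarrow> length us = length X"
  by (induction X arbitrary: us) auto

lemma Bl_append: "Bl (X @ Y) = {xs @ ys | xs ys. xs \<in> Bl X \<and> ys \<in> Bl Y}"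
proof (induction X)
  case (Cons a X)
  show ?case
  proof (rule subset_antisym; rule subsetI)
    fix us assume "us \<in> Bl ((a # X) @ Y)"
    then obtain u xs ys where "us = (u # xs) @ ys" "u \<in> P (int a)" "xs \<in> Bl X" "ys \<in> Bl Y" using Cons by auto
    then show "us \<in> {xs @ ys | xs ys. xs \<in> Bl (a # X) \<and> ys \<in> Bl Y}"
      by (intro CollectI exI[of _ "u # xs"] exI[of _ ys]) auto
  next
    fix us assume "us \<in> {xs @ ys | xs ys. xs \<in> Bl (a # X) \<and> ys \<in> Bl Y}"
    then obtain u xs ys where "us = (u # xs) @ ys" "u \<in> P (int a)" "xs \<in> Bl X" "ys \<in> Bl Y" by auto
    then show "us \<in> Bl ((a # X) @ Y)" using Cons by auto
  qed
qed auto

lemma Bl_append_iff: "us \<in> Bl (X @ Y) \<longleftrightarrow> take (length X) us \<in> Bl X \<and> drop (length X) us \<in> Bl Y"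
proof
  assume "us \<in> Bl (X @ Y)"
  then show "take (length X) us \<in> Bl X \<and> drop (length X) us \<in> Bl Y" using Bl_length by (auto simp: Bl_append)
next
  assume "take (length X) us \<in> Bl X \<and> drop (length X) us \<in> Bl Y"
  then show "us \<in> Bl (X @ Y)" unfolding Bl_append by (metis (mono_tags, lifting) append_take_drop_id mem_Collect_eq)
qed

lemma finite_Bl [simp]: "finite (Bl X)"
  by (induction X) (auto simp: finite_image_set2)

lemma sum_Bl_append: "sum f (Bl (X @ Y)) = (\<Sum>xs\<in>Bl X. \<Sum>ys\<in>Bl Y. f (xs @ ys))"
proof -
  have e: "Bl (X @ Y) = (\<lambda>(xs, ys). xs @ ys) ` (Bl X \<times> Bl Y)" by (auto simp: Bl_append)
  have "inj_on (\<lambda>(xs, ys). xs @ ys) (Bl X \<times> Bl Y)" using Bl_length by (auto simp: inj_on_def)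
  then have "sum f (Bl (X @ Y)) = sum (f \<circ> (\<lambda>(xs, ys). xs @ ys)) (Bl X \<times> Bl Y)"
    unfolding e by (rule sum.reindex)
  then show ?thesis by (simp add: sum.cartesian_product comp_def split_def)
qed

text \<open>The matrix of a web in the bases \<open>Bl\<close>; a crossing is sent to its coefficients, without being expanded
  into merges and splits.\<close>

primrec sem :: "'k::field web_term \<Rightarrow> ('p, 'k) lmat" where
  "sem (WId X) = idm"
| "sem (WMerge a b) = merge_mat"
| "sem (WSplit a b) = split_mat"
| "sem (WCross a b) = (\<lambda>ws us. cross (us ! 0) (us ! 1) (ws ! 0) (ws ! 1))"
| "sem WEv = (\<lambda>ws us. 1)"
| "sem WCoev = (\<lambda>ws us. 1)"
| "sem (WComp g f) = mmul (Bl (wtgt n f)) (sem g) (sem f)"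
| "sem (WTens f g) = tmat (length (wtgt n f)) (length (wsrc n f)) (sem f) (sem g)"
| "sem (WZero X Y) = (\<lambda>ws us. 0)"
| "sem (WAdd f g) = (\<lambda>ws us. sem f ws us + sem g ws us)"
| "sem (WScale c f) = (\<lambda>ws us. c * sem f ws us)"

lemma dgl_mmul:
  assumes "mmul M D A ws us \<noteq> 0"
  obtains vs where "vs \<in> M" "D ws vs \<noteq> 0" "A vs us \<noteq> 0"
proof -
  obtain vs where "vs \<in> M" "D ws vs * A vs us \<noteq> 0"
    using assms sum.neutral[of M "\<lambda>vs. D ws vs * A vs us"] unfolding mmul_def by blast
  then show ?thesis using that by auto
qed

text \<open>A nonzero entry of a generator provides products in \<open>R\<close>; as these hold in the group, row and column
  have the same degree.\<close>

lemma sem_homogeneous: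
  "web_arr n X Y f \<Longrightarrow> us \<in> Bl X \<Longrightarrow> ws \<in> Bl Y \<Longrightarrow> sem f ws us \<noteq> 0 \<Longrightarrow> dgl us = dgl ws"
proof (induction X Y f arbitrary: us ws rule: web_arr.induct)
  interpret Gr: group \<Gamma>\<^sub>T by (rule group_tri)
  case (2 a b)
  then show ?case by (auto simp: merge_mat_def dg_R)
next
  interpret Gr: group \<Gamma>\<^sub>T by (rule group_tri)
  case (3 a b)
  then show ?case by (auto simp: split_mat_def dg_R)
next
  interpret Gr: group \<Gamma>\<^sub>T by (rule group_tri)
  case (4 a b)
  then obtain u v u' v' where w: "us = [u, v]" "ws = [u', v']" by auto
  then have "lower u v u' v' \<noteq> {}" using 4 by (auto simp: cross_def)
  then obtain x y y' t where R: "R x y u" "R x y' u'" "R y v t" "R y' v' t" by (auto simp: lower_def)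
  have "dg u \<otimes>\<^bsub>\<Gamma>\<^sub>T\<^esub> dg v = dg x \<otimes>\<^bsub>\<Gamma>\<^sub>T\<^esub> dg t" "dg u' \<otimes>\<^bsub>\<Gamma>\<^sub>T\<^esub> dg v' = dg x \<otimes>\<^bsub>\<Gamma>\<^sub>T\<^esub> dg t"
    using dg_R[OF R(1)] dg_R[OF R(2)] dg_R[OF R(3)] dg_R[OF R(4)] Gr.m_assoc[OF dg_carrier dg_carrier dg_carrier] by metis+
  then show ?case using w by simp
next
  interpret Gr: group \<Gamma>\<^sub>T by (rule group_tri)
  case 5
  then show ?case by auto
next
  interpret Gr: group \<Gamma>\<^sub>T by (rule group_tri)
  case 6
  then show ?case by auto
next
  case (7 X Y f Z g)
  have "mmul (Bl Y) (sem g) (sem f) ws us \<noteq> 0" using 7 web_arr_type[OF 7(1)] by simp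
  then obtain vs where "vs \<in> Bl Y" "sem g ws vs \<noteq> 0" "sem f vs us \<noteq> 0" using dgl_mmul by blast
  then show ?case using 7 by metis
next
  case (8 X Y f X' Y' g)
  have l: "length (wtgt n f) = length Y" "length (wsrc n f) = length X" using web_arr_type[OF 8(1)] by auto
  have "sem f (take (length Y) ws) (take (length X) us) \<noteq> 0" "sem g (drop (length Y) ws) (drop (length X) us) \<noteq> 0"
    using 8 l by (auto simp: tmat_def)
  then have "dgl (take (length X) us) = dgl (take (length Y) ws)" "dgl (drop (length X) us) = dgl (drop (length Y) ws)"
    using 8 by (simp_all add: Bl_append_iff)
  then show ?case using dgl_append[of "take (length X) us" "drop (length X) us"]
      dgl_append[of "take (length Y) ws" "drop (length Y) ws"] by simp
next
  case (10 X Y f g)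
  then have "sem f ws us \<noteq> 0 \<or> sem g ws us \<noteq> 0" by auto
  then show ?case using 10 by blast
qed (auto simp: idm_def)

text \<open>In a web the label \<open>0\<close> leaves no trace, so the subspace carrying it has to be deleted from the list;
  after this deletion, a merge, split or crossing with a label \<open>0\<close>, which is an identity, has the same
  entries as those with positive labels.\<close>

definition st :: "'p set \<Rightarrow> 'p set list" where "st u = (if u = {} then [] else [u])"

lemma st_lab: "u \<in> P (int a) \<Longrightarrow> length (st u) = length (lab a)"
  using rk_zero[of u] by (auto simp: st_def lab_def P_def)

lemma st_inj: "u \<in> P a \<Longrightarrow> v \<in> P a \<Longrightarrow> st u = st v \<longleftrightarrow> u = v"
  by (auto simp: st_def P_def split: if_splits)

lemma Bl_lab: "Bl (lab a) = st ` P (int a)"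
proof (cases "a = 0")
  case True then show ?thesis by (simp add: lab_def st_def)
next
  case False
  then have "st u = [u]" if "u \<in> P (int a)" for u using that by (auto simp: st_def P_def)
  then show ?thesis using False by (auto simp: lab_def image_iff)
qed

lemma sum_Bl_lab: "sum f (Bl (lab a)) = (\<Sum>u\<in>P (int a). f (st u))"
  unfolding Bl_lab using st_inj by (subst sum.reindex) (auto simp: inj_on_def)

lemma Bl_lab_cases: "us \<in> Bl (lab a) \<Longrightarrow> \<exists>u\<in>P (int a). us = st u" by (auto simp: Bl_lab)

lemma Bl_lab2_cases: "us \<in> Bl (lab a @ lab b) \<Longrightarrow> \<exists>u\<in>P (int a). \<exists>v\<in>P (int b). us = st u @ st v"
  by (auto simp: Bl_append Bl_lab)

lemma Bl_lab3_cases: "us \<in> Bl (lab a @ lab b @ lab c) \<Longrightarrow>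
    \<exists>u\<in>P (int a). \<exists>v\<in>P (int b). \<exists>w\<in>P (int c). us = st u @ st v @ st w"
  by (auto simp: Bl_append Bl_lab)

lemma idm_st: "u \<in> P a \<Longrightarrow> v \<in> P a \<Longrightarrow> idm (st u) (st v) = (of_bool (u = v) :: 'k::field)"
  by (simp add: idm_def st_inj)

lemma tmat_append: "length xs = l' \<Longrightarrow> length us = l \<Longrightarrow> tmat l' l A C (xs @ ys) (us @ vs) = A xs us * C ys vs"
  by (simp add: tmat_def)

lemma lab_type [simp]: "wsrc n (wmrg a b) = lab a @ lab b" "wtgt n (wmrg a b) = lab (a + b)"
  "wsrc n (wspl a b) = lab (a + b)" "wtgt n (wspl a b) = lab a @ lab b"
  "wsrc n (wcrs a b) = lab a @ lab b" "wtgt n (wcrs a b) = lab b @ lab a"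
  by (auto simp: wmrg_def wspl_def wcrs_def lab_def)

lemma st_ne: "u \<in> P (int a) \<Longrightarrow> a \<noteq> 0 \<Longrightarrow> st u = [u]" by (auto simp: st_def P_def)

lemma sem_wmrg:
  assumes "u \<in> P (int a)" "v \<in> P (int b)" "w \<in> P (int (a + b))"
  shows "sem (wmrg a b) (st w) (st u @ st v) = (of_bool (R u v w) :: 'k::field)"
proof -
  consider "a = 0" | "b = 0" "a \<noteq> 0" | "a \<noteq> 0" "b \<noteq> 0" by blast
  then show ?thesis
  proof cases
    case 1
    then have "u = {}" "v \<in> P (int b)" "w \<in> P (int b)" using assms by auto
    moreover have "sem (wmrg a b) = (idm :: ('p, 'k) lmat)" "st u = []" using 1 \<open>u = {}\<close> by (simp_all add: wmrg_def st_def)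
    ultimately show ?thesis using idm_st[of w "int b" v, where 'k = 'k] P_S by auto
  next
    case 2
    then have "v = {}" "u \<in> P (int a)" "w \<in> P (int a)" using assms by auto
    moreover have "sem (wmrg a b) = (idm :: ('p, 'k) lmat)" "st v = []" using 2 \<open>v = {}\<close> by (simp_all add: wmrg_def st_def)
    ultimately show ?thesis using idm_st[of w "int a" u, where 'k = 'k] P_S by auto
  next
    case 3
    then show ?thesis using assms by (simp add: wmrg_def st_ne[of u a] st_ne[of v b] st_ne[of w "a + b"] merge_mat_def)
  qed
qed

lemma sem_wspl:
  assumes "u \<in> P (int a)" "v \<in> P (int b)" "w \<in> P (int (a + b))"
  shows "sem (wspl a b) (st u @ st v) (st w) = (of_bool (R u v w) :: 'k::field)"
proof -
  consider "a = 0" | "b = 0" "a \<noteq> 0" | "a \<noteq> 0" "b \<noteq> 0" by blast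
  then show ?thesis
  proof cases
    case 1
    then have "u = {}" "v \<in> P (int b)" "w \<in> P (int b)" using assms by auto
    moreover have "sem (wspl a b) = (idm :: ('p, 'k) lmat)" "st u = []" using 1 \<open>u = {}\<close> by (simp_all add: wspl_def st_def)
    ultimately show ?thesis using idm_st[of v "int b" w, where 'k = 'k] P_S by auto
  next
    case 2
    then have "v = {}" "u \<in> P (int a)" "w \<in> P (int a)" using assms by auto
    moreover have "sem (wspl a b) = (idm :: ('p, 'k) lmat)" "st v = []" using 2 \<open>v = {}\<close> by (simp_all add: wspl_def st_def)
    ultimately show ?thesis using idm_st[of u "int a" w, where 'k = 'k] P_S by auto
  next
    case 3
    then show ?thesis using assms by (simp add: wspl_def st_ne[of u a] st_ne[of v b] st_ne[of w "a + b"] split_mat_def)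
  qed
qed

lemma cross_empty_left: "v \<in> S \<Longrightarrow> u' \<in> S \<Longrightarrow> cross {} v u' {} = (of_bool (u' = v) :: 'k::field)"
proof -
  assume S: "v \<in> S" "u' \<in> S"
  have "x = {} \<and> u' = v" if "R x y {}" "R x y' u'" "R y v t" "R y' {} t" for x y y' t
  proof -
    have "x = {}" "y = {}" using R_rk[OF that(1)] R_S[OF that(1)] rk_zero[of x] rk_zero[of y] by auto
    then show ?thesis using that by auto
  qed
  then have "lower {} v u' {} \<subseteq> {x. x = {} \<and> u' = v}" by (auto simp: lower_def)
  moreover have "{} \<in> lower {} v v {}" using S unfolding lower_def by auto
  ultimately have "lower {} v u' {} = (if u' = v then {{}} else {})" by auto
  then show ?thesis by (simp add: cross_def)
qed

lemma cross_empty_right: "u \<in> S \<Longrightarrow> v' \<in> S \<Longrightarrow> cross u {} {} v' = (of_bool (v' = u) :: 'k::field)"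
proof -
  assume S: "u \<in> S" "v' \<in> S"
  have "x = {} \<and> v' = u" if "R x y u" "R x y' {}" "R y {} t" "R y' v' t" for x y y' t
  proof -
    have "x = {}" "y' = {}" using R_rk[OF that(2)] R_S[OF that(2)] rk_zero[of x] rk_zero[of y'] by auto
    then show ?thesis using that by auto
  qed
  then have "lower u {} {} v' \<subseteq> {x. x = {} \<and> v' = u}" by (auto simp: lower_def)
  moreover have "{} \<in> lower u {} {} u" using S unfolding lower_def by auto
  ultimately have "lower u {} {} v' = (if v' = u then {{}} else {})" by auto
  then show ?thesis by (simp add: cross_def)
qed

lemma sem_wcrs:
  assumes "u \<in> P (int a)" "v \<in> P (int b)" "u' \<in> P (int b)" "v' \<in> P (int a)"
  shows "sem (wcrs a b) (st u' @ st v') (st u @ st v) = (cross u v u' v' :: 'k::field)"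
proof -
  consider "a = 0" | "b = 0" "a \<noteq> 0" | "a \<noteq> 0" "b \<noteq> 0" by blast
  then show ?thesis
  proof cases
    case 1
    then have e: "u = {}" "v' = {}" using assms by auto
    have "sem (wcrs a b) = (idm :: ('p, 'k) lmat)" "st u = []" "st v' = []" using 1 e by (simp_all add: wcrs_def st_def)
    moreover have "v \<in> S" "u' \<in> S" using assms P_S by auto
    ultimately show ?thesis using idm_st[OF assms(3,2), where 'k = 'k] cross_empty_left[of v u', where 'k = 'k] e by simp
  next
    case 2
    then have e: "v = {}" "u' = {}" using assms by auto
    have "sem (wcrs a b) = (idm :: ('p, 'k) lmat)" "st v = []" "st u' = []" using 2 e by (simp_all add: wcrs_def st_def)
    moreover have "u \<in> S" "v' \<in> S" using assms P_S by auto
    ultimately show ?thesis using idm_st[OF assms(4,1), where 'k = 'k] cross_empty_right[of u v', where 'k = 'k] e by simp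
  next
    case 3
    then show ?thesis using assms
      by (simp add: wcrs_def st_ne[of u a] st_ne[of v b] st_ne[of u' b] st_ne[of v' a])
  qed
qed

definition same_entries :: "nat list \<Rightarrow> nat list \<Rightarrow> ('p, 'k::field) lmat \<Rightarrow> ('p, 'k) lmat \<Rightarrow> bool" where
  "same_entries X Y A D \<longleftrightarrow> (\<forall>ws\<in>Bl Y. \<forall>us\<in>Bl X. A ws us = D ws us)"

lemma sem_merge_assoc:
  "same_entries (lab a @ lab b @ lab c) (lab (a + b + c))
     (sem (WComp (wmrg (a + b) c) (WTens (wmrg a b) (lid c)) :: 'k::field web_term))
     (sem (WComp (wmrg a (b + c)) (WTens (lid a) (wmrg b c))))"
  unfolding same_entries_def
proof (intro ballI)
  fix ws us assume "ws \<in> Bl (lab (a + b + c))" "us \<in> Bl (lab a @ lab b @ lab c)"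
  then obtain y u v w where w: "ws = st y" "us = st u @ st v @ st w" "y \<in> P (int (a + b + c))"
    "u \<in> P (int a)" "v \<in> P (int b)" "w \<in> P (int c)" using Bl_lab_cases Bl_lab3_cases by blast
  have y: "y \<in> P (int a + int b + int c)" using w(3) by simp
  have L: "sem (WComp (wmrg (a + b) c) (WTens (wmrg a b) (lid c))) ws us =
      (\<Sum>x\<in>P (int a + int b). \<Sum>w'\<in>P (int c). of_bool (R x w' y) * (of_bool (R u v x) * (of_bool (w' = w) :: 'k)))"
    unfolding w(1,2) sem.simps(7) mmul_def wtgt.simps lab_type sum_Bl_append sum_Bl_lab of_nat_add[symmetric]
  proof (intro sum.cong[OF HOL.refl] arg_cong2[where f = "(*)"])
    fix x w' assume x: "x \<in> P (int (a + b))" "w' \<in> P (int c)"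
    show "sem (wmrg (a + b) c) (st y) (st x @ st w') = of_bool (R x w' y)" by (rule sem_wmrg[OF x w(3)])
    have "sem (WTens (wmrg a b) (lid c)) (st x @ st w') ((st u @ st v) @ st w) =
        sem (wmrg a b) (st x) (st u @ st v) * (idm (st w') (st w) :: 'k)"
      unfolding sem.simps lab_type wtgt.simps wsrc.simps using x w st_lab by (intro tmat_append) simp_all
    then show "sem (WTens (wmrg a b) (lid c)) (st x @ st w') (st u @ st v @ st w) = of_bool (R u v x) * (of_bool (w' = w) :: 'k)"
      by (simp only: append_assoc sem_wmrg[OF w(4,5) x(1)] idm_st[OF x(2) w(6)])
  qed
  have "sem (WComp (wmrg a (b + c)) (WTens (lid a) (wmrg b c))) ws us =
      (\<Sum>u'\<in>P (int a). \<Sum>z\<in>P (int b + int c). of_bool (R u' z y) * (of_bool (u' = u) * (of_bool (R v w z) :: 'k)))"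
    unfolding w(1,2) sem.simps(7) mmul_def wtgt.simps lab_type sum_Bl_append sum_Bl_lab of_nat_add[symmetric]
  proof (intro sum.cong[OF HOL.refl] arg_cong2[where f = "(*)"])
    fix u' z assume x: "u' \<in> P (int a)" "z \<in> P (int (b + c))"
    show "sem (wmrg a (b + c)) (st y) (st u' @ st z) = of_bool (R u' z y)"
      using sem_wmrg[OF x, of y] w(3) by (simp add: add.assoc)
    have "sem (WTens (lid a) (wmrg b c)) (st u' @ st z) (st u @ (st v @ st w)) =
        (idm (st u') (st u) :: 'k) * sem (wmrg b c) (st z) (st v @ st w)"
      unfolding sem.simps lab_type wtgt.simps wsrc.simps using x w st_lab by (intro tmat_append) simp_all
    then show "sem (WTens (lid a) (wmrg b c)) (st u' @ st z) (st u @ st v @ st w) = of_bool (u' = u) * (of_bool (R v w z) :: 'k)"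
      by (simp only: append_assoc sem_wmrg[OF w(5,6) x(2)] idm_st[OF x(1) w(4)])
  qed
  then show "sem (WComp (wmrg (a + b) c) (WTens (wmrg a b) (lid c))) ws us =
      (sem (WComp (wmrg a (b + c)) (WTens (lid a) (wmrg b c))) ws us :: 'k)"
    using L merge_assoc_sum[OF y w(4-6), where 'k = 'k] by simp
qed

lemma sem_split_coassoc:
  "same_entries (lab (a + b + c)) (lab a @ lab b @ lab c)
     (sem (WComp (WTens (wspl a b) (lid c)) (wspl (a + b) c) :: 'k::field web_term))
     (sem (WComp (WTens (lid a) (wspl b c)) (wspl a (b + c))))"
  unfolding same_entries_def
proof (intro ballI)
  fix ws us assume "us \<in> Bl (lab (a + b + c))" "ws \<in> Bl (lab a @ lab b @ lab c)"
  then obtain y u v w where w: "us = st y" "ws = st u @ st v @ st w" "y \<in> P (int (a + b + c))"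
    "u \<in> P (int a)" "v \<in> P (int b)" "w \<in> P (int c)" using Bl_lab_cases Bl_lab3_cases by blast
  have y: "y \<in> P (int a + int b + int c)" using w(3) by simp
  have L: "sem (WComp (WTens (wspl a b) (lid c)) (wspl (a + b) c)) ws us =
      (\<Sum>x\<in>P (int (a + b)). \<Sum>w'\<in>P (int c). of_bool (R u v x) * of_bool (w = w') * (of_bool (R x w' y) :: 'k))"
    unfolding w(1,2) sem.simps(7) mmul_def wtgt.simps lab_type sum_Bl_append sum_Bl_lab
  proof (intro sum.cong[OF HOL.refl] arg_cong2[where f = "(*)"])
    fix x w' assume x: "x \<in> P (int (a + b))" "w' \<in> P (int c)"
    show "sem (wspl (a + b) c) (st x @ st w') (st y) = of_bool (R x w' y)" by (rule sem_wspl[OF x w(3)])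
    have "sem (WTens (wspl a b) (lid c)) ((st u @ st v) @ st w) (st x @ st w') =
        sem (wspl a b) (st u @ st v) (st x) * (idm (st w) (st w') :: 'k)"
      unfolding sem.simps lab_type wtgt.simps wsrc.simps using x w st_lab by (intro tmat_append) simp_all
    then show "sem (WTens (wspl a b) (lid c)) (st u @ st v @ st w) (st x @ st w') = of_bool (R u v x) * (of_bool (w = w') :: 'k)"
      by (simp only: append_assoc sem_wspl[OF w(4,5) x(1)] idm_st[OF w(6) x(2)])
  qed
  also have "\<dots> = (\<Sum>x\<in>P (int (a + b)). \<Sum>w'\<in>P (int c). if w' = w then of_bool (R u v x) * (of_bool (R x w y) :: 'k) else 0)"
    by (intro sum.cong) auto
  also have "\<dots> = (\<Sum>x\<in>P (int a + int b). of_bool (R u v x) * of_bool (R x w y))" using w by simp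
  finally have L: "sem (WComp (WTens (wspl a b) (lid c)) (wspl (a + b) c)) ws us = \<dots>" .
  have "sem (WComp (WTens (lid a) (wspl b c)) (wspl a (b + c))) ws us =
      (\<Sum>u'\<in>P (int a). \<Sum>z\<in>P (int (b + c)). of_bool (u = u') * of_bool (R v w z) * (of_bool (R u' z y) :: 'k))"
    unfolding w(1,2) sem.simps(7) mmul_def wtgt.simps lab_type sum_Bl_append sum_Bl_lab
  proof (intro sum.cong[OF HOL.refl] arg_cong2[where f = "(*)"])
    fix u' z assume x: "u' \<in> P (int a)" "z \<in> P (int (b + c))"
    show "sem (wspl a (b + c)) (st u' @ st z) (st y) = of_bool (R u' z y)"
      using sem_wspl[OF x, of y] w(3) by (simp add: add.assoc)
    have "sem (WTens (lid a) (wspl b c)) (st u @ (st v @ st w)) (st u' @ st z) =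
        (idm (st u) (st u') :: 'k) * sem (wspl b c) (st v @ st w) (st z)"
      unfolding sem.simps lab_type wtgt.simps wsrc.simps using x w st_lab by (intro tmat_append) simp_all
    then show "sem (WTens (lid a) (wspl b c)) (st u @ st v @ st w) (st u' @ st z) = of_bool (u = u') * (of_bool (R v w z) :: 'k)"
      by (simp only: append_assoc sem_wspl[OF w(5,6) x(2)] idm_st[OF w(4) x(1)])
  qed
  also have "\<dots> = (\<Sum>u'\<in>P (int a). if u' = u then \<Sum>z\<in>P (int (b + c)). of_bool (R v w z) * (of_bool (R u z y) :: 'k) else 0)"
    by (rule sum.cong[OF HOL.refl]) auto
  also have "\<dots> = (\<Sum>z\<in>P (int b + int c). of_bool (R v w z) * of_bool (R u z y))" using w by simp
  finally show "sem (WComp (WTens (wspl a b) (lid c)) (wspl (a + b) c)) ws us =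
      (sem (WComp (WTens (lid a) (wspl b c)) (wspl a (b + c))) ws us :: 'k)"
    using L split_coassoc_sum[OF y w(4-6), where 'k = 'k] by simp
qed

lemma sem_bigon:
  assumes q1: "of_nat q = (1::'k::field)"
  shows "same_entries (lab (a + b)) (lab (a + b)) (sem (WComp (wmrg a b) (wspl a b) :: 'k web_term))
    (sem (WScale (of_nat ((a + b) choose a)) (lid (a + b))))"
  unfolding same_entries_def
proof (intro ballI)
  fix ws us assume "ws \<in> Bl (lab (a + b))" "us \<in> Bl (lab (a + b))"
  then obtain w' w where w: "ws = st w'" "us = st w" "w' \<in> P (int (a + b))" "w \<in> P (int (a + b))"
    using Bl_lab_cases by blast
  have "sem (WComp (wmrg a b) (wspl a b)) ws us =
      (\<Sum>u\<in>P (int a). \<Sum>v\<in>P (int b). of_bool (R u v w') * (of_bool (R u v w) :: 'k))"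
    unfolding w(1,2) sem.simps(7) mmul_def wtgt.simps lab_type sum_Bl_append sum_Bl_lab
    by (intro sum.cong[OF HOL.refl] arg_cong2[where f = "(*)"] sem_wmrg sem_wspl w)
  then show "sem (WComp (wmrg a b) (wspl a b)) ws us = (sem (WScale (of_nat ((a + b) choose a)) (lid (a + b))) ws us :: 'k)"
    using bigon_sum[OF q1 w(4,3)] idm_st[OF w(3,4), where 'k = 'k] w(1,2) by simp
qed

end

section \<open>Soundness of the web relations\<close>

context tri_geometry
begin

text \<open>A term vanishes unless its products are defined, and then its labels are forced by those of \<open>u\<close>, \<open>v\<close>,
  \<open>p\<close> and \<open>w\<close>; so the restrictions on the ranks may be dropped.\<close>

lemma sum_levels_extend:
  assumes uv: "u \<in> P (int a)" "v \<in> P (int c)" "u' \<in> P (int b)" "v' \<in> P (int d)" and e: "a + c = b + d"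
    and s: "s \<le> a" "s \<le> b" "b \<le> c + s" and p: "p \<in> P (int s)" "w \<in> P (int (c + s - b))"
  shows "(\<Sum>y'\<in>P (int (b - s)). \<Sum>g'\<in>P (int (a - s)). of_bool (R p y' u') * of_bool (R g' w v') *
        (\<Sum>y\<in>P (int (a - s)). \<Sum>g\<in>P (int (b - s)). cross y g y' g' * (of_bool (R p y u) * of_bool (R g w v)))) =
      (\<Sum>g\<in>S. \<Sum>g'\<in>S. \<Sum>y\<in>S. \<Sum>y'\<in>S.
        of_bool (R g w v) * of_bool (R g' w v') * (of_bool (R p y u) * of_bool (R p y' u') * (cross y g y' g' :: 'k::field)))"
    (is "?L = ?R")
proof -
  define T where "T y' g' y g = of_bool (R g w v) * of_bool (R g' w v') *
      (of_bool (R p y u) * of_bool (R p y' u') * (cross y g y' g' :: 'k))" for y' g' y g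
  let ?A = "P (int (b - s)) \<times> P (int (a - s)) \<times> P (int (a - s)) \<times> P (int (b - s))" and ?S = "S \<times> S \<times> S \<times> S"
  have "?L = (\<Sum>y'\<in>P (int (b - s)). \<Sum>g'\<in>P (int (a - s)). \<Sum>y\<in>P (int (a - s)). \<Sum>g\<in>P (int (b - s)). T y' g' y g)"
    unfolding T_def sum_distrib_left by (intro sum.cong HOL.refl) (simp only: mult_ac)
  also have "\<dots> = (\<Sum>(y', g', y, g)\<in>?A. T y' g' y g)" by (simp add: sum.cartesian_product)
  also have "\<dots> = (\<Sum>(y', g', y, g)\<in>?S. T y' g' y g)"
  proof (rule sum.mono_neutral_left)
    show "?A \<subseteq> ?S" using P_S by auto
    show "\<forall>i\<in>?S - ?A. (case i of (y', g', y, g) \<Rightarrow> T y' g' y g) = 0"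
    proof
      fix i assume i: "i \<in> ?S - ?A"
      obtain y' g' y g where ieq: "i = (y', g', y, g)" by (cases i) auto
      have "\<not> (R g w v \<and> R g' w v' \<and> R p y u \<and> R p y' u')"
      proof
        assume r: "R g w v \<and> R g' w v' \<and> R p y u \<and> R p y' u'"
        then have "rk v = rk g + rk w" "rk v' = rk g' + rk w" "rk u = rk p + rk y" "rk u' = rk p + rk y'"
          using R_rk by blast+
        moreover have "rk v = c" "rk v' = d" "rk u = a" "rk u' = b" "rk p = s" "rk w = c + s - b"
          using uv p by (auto simp: P_def)
        ultimately have "rk g = b - s" "rk g' = a - s" "rk y = a - s" "rk y' = b - s" using e s by auto
        moreover have "g \<in> S" "g' \<in> S" "y \<in> S" "y' \<in> S" using r R_S by blast+
        ultimately show False using i ieq by (auto simp: P_def)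
      qed
      then show "(case i of (y', g', y, g) \<Rightarrow> T y' g' y g) = 0" unfolding ieq T_def by auto
    qed
  qed auto
  also have "\<dots> = (\<Sum>(g, g', y, y')\<in>?S. T y' g' y g)"
    by (rule sum.reindex_bij_witness[of _ "\<lambda>(g, g', y, y'). (y', g', y, g)" "\<lambda>(y', g', y, g). (g, g', y, y')"]) auto
  also have "\<dots> = (\<Sum>g\<in>S. \<Sum>g'\<in>S. \<Sum>y\<in>S. \<Sum>y'\<in>S. T y' g' y g)" by (simp add: sum.cartesian_product)
  finally show ?thesis unfolding T_def .
qed

lemma sum_by_level: "(\<Sum>s<n + 1. \<Sum>p\<in>P (int s). f p) = sum f S"
proof -
  have "(\<Sum>s<n + 1. \<Sum>p\<in>P (int s). f p) = (\<Sum>s<n + 1. \<Sum>p | p \<in> S \<and> rk p = s. f p)"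
    by (simp add: P_def)
  also have "\<dots> = sum f S"
    by (rule sum.group) (use rk_le in \<open>auto simp: less_Suc_eq_le\<close>)
  finally show ?thesis .
qed

text \<open>Grouping the terms by \<open>w\<close> instead of the label \<open>s\<close> of \<open>p\<close> turns the right hand side of the bialgebra
  relation into the sum evaluated by \<open>bialgebra_sum\<close>.\<close>

lemma bialgebra_level_sum:
  assumes q1: "of_nat q = (1::'k::field)"
    and uv: "u \<in> P (int a)" "v \<in> P (int c)" "u' \<in> P (int b)" "v' \<in> P (int d)" and e: "a + c = b + d"
  shows "(\<Sum>s<n + 1. if s \<le> a \<and> s \<le> b \<and> b \<le> c + s then
      \<Sum>p\<in>P (int s). \<Sum>y'\<in>P (int (b - s)). \<Sum>g'\<in>P (int (a - s)). \<Sum>w\<in>P (int (c + s - b)).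
        of_bool (R p y' u') * of_bool (R g' w v') *
        (\<Sum>y\<in>P (int (a - s)). \<Sum>g\<in>P (int (b - s)). cross y g y' g' * (of_bool (R p y u) * of_bool (R g w v)))
      else 0) = (of_bool (\<exists>t. R u v t \<and> R u' v' t) :: 'k)"
proof -
  have rks: "rk u = a" "rk v = c" "rk u' = b" "rk v' = d" using uv by (auto simp: P_def)
  have S: "u \<in> S" "v \<in> S" "u' \<in> S" "v' \<in> S" using uv P_S by auto
  define F where "F p w = (\<Sum>g\<in>S. \<Sum>g'\<in>S. \<Sum>y\<in>S. \<Sum>y'\<in>S.
      of_bool (R g w v) * of_bool (R g' w v') * (of_bool (R p y u) * of_bool (R p y' u') * (cross y g y' g' :: 'k)))" for p w
  have zero: "F p w = 0" if "a < rk p \<or> b < rk p" for p w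
  proof -
    have "\<not> (R p y u \<and> R p y' u')" for y y' using that R_rk[of p y u] R_rk[of p y' u'] rks by auto
    then show ?thesis unfolding F_def by (intro sum.neutral ballI) auto
  qed
  have step: "(if s \<le> a \<and> s \<le> b \<and> b \<le> c + s then
      \<Sum>p\<in>P (int s). \<Sum>y'\<in>P (int (b - s)). \<Sum>g'\<in>P (int (a - s)). \<Sum>w\<in>P (int (c + s - b)).
        of_bool (R p y' u') * of_bool (R g' w v') *
        (\<Sum>y\<in>P (int (a - s)). \<Sum>g\<in>P (int (b - s)). cross y g y' g' * (of_bool (R p y u) * of_bool (R g w v)))
      else 0) = (\<Sum>p\<in>P (int s). \<Sum>w | w \<in> S \<and> rk p + rk v = rk w + rk u'. F p w)" (is "?L = ?R") for s
  proof (cases "s \<le> a \<and> s \<le> b \<and> b \<le> c + s")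
    case True
    have W: "{w. w \<in> S \<and> rk p + rk v = rk w + rk u'} = P (int (c + s - b))" if "p \<in> P (int s)" for p
      using that True rks by (auto simp: P_def)
    have "?L = (\<Sum>p\<in>P (int s). \<Sum>w\<in>P (int (c + s - b)). \<Sum>y'\<in>P (int (b - s)). \<Sum>g'\<in>P (int (a - s)).
        of_bool (R p y' u') * of_bool (R g' w v') *
        (\<Sum>y\<in>P (int (a - s)). \<Sum>g\<in>P (int (b - s)). cross y g y' g' * (of_bool (R p y u) * of_bool (R g w v))))"
    proof -
      have sw: "(\<Sum>x\<in>X. \<Sum>y\<in>Y. \<Sum>z\<in>Z. f x y z) = (\<Sum>z\<in>Z. \<Sum>x\<in>X. \<Sum>y\<in>Y. f x y z)"
        for X Y Z and f :: "'p set \<Rightarrow> 'p set \<Rightarrow> 'p set \<Rightarrow> 'k"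
        by (subst sum.swap[of _ Z]) (subst sum.swap[of _ Z X], rule HOL.refl)
      show ?thesis unfolding if_P[OF True] by (intro sum.cong[OF HOL.refl]) (rule sw)
    qed
    also have "\<dots> = (\<Sum>p\<in>P (int s). \<Sum>w\<in>P (int (c + s - b)). F p w)"
      unfolding F_def using True by (intro sum.cong[OF HOL.refl] sum_levels_extend[OF uv e]) auto
    also have "\<dots> = ?R" using W by (intro sum.cong[OF HOL.refl]) simp
    finally show ?thesis .
  next
    case False
    have "(\<Sum>w | w \<in> S \<and> rk p + rk v = rk w + rk u'. F p w) = 0" if "p \<in> P (int s)" for p
    proof (rule sum.neutral, rule ballI)
      fix w assume "w \<in> {w. w \<in> S \<and> rk p + rk v = rk w + rk u'}"
      moreover have "rk p = s" using that by (auto simp: P_def)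
      ultimately have "a < rk p \<or> b < rk p" using False rks by auto
      then show "F p w = 0" by (rule zero)
    qed
    then show ?thesis by (simp add: if_not_P[OF False])
  qed
  have "(\<Sum>s<n + 1. \<Sum>p\<in>P (int s). \<Sum>w | w \<in> S \<and> rk p + rk v = rk w + rk u'. F p w) =
      (\<Sum>p\<in>S. \<Sum>w | w \<in> S \<and> rk p + rk v = rk w + rk u'. F p w)" by (rule sum_by_level)
  also have "\<dots> = (\<Sum>w\<in>S. \<Sum>p | p \<in> S \<and> rk p + rk v = rk w + rk u'. F p w)"
    by (rule sum.swap_restrict) auto
  also have "\<dots> = of_bool (\<exists>t. R u v t \<and> R u' v' t)"
    unfolding F_def by (rule bialgebra_sum[OF q1 S]) (use rks e in simp)
  finally show ?thesis using step by simp
qed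

lemma sem_wsum: "sem (wsum X Y ts) ws us = (\<Sum>t\<leftarrow>ts. sem t ws us)"
  by (induction ts) (simp_all add: wsum_def)

lemma sum_list_concat_map: "(\<Sum>t\<leftarrow>concat (map h xs). g t) = (\<Sum>x\<leftarrow>xs. \<Sum>t\<leftarrow>h x. g t)" for g :: "'t \<Rightarrow> 'k::comm_monoid_add"
  by (induction xs) simp_all

lemma sem_bialgebra_term:
  assumes uv: "u \<in> P (int a)" "v \<in> P (int c)" "u' \<in> P (int b)" "v' \<in> P (int d)" and e: "a + c = b + d"
    and s: "s \<le> a" "s \<le> b" "b \<le> c + s"
  shows "sem (WComp (WTens (wmrg s (b - s)) (wmrg (a - s) (c + s - b)))
          (WComp (WTens (lid s) (WTens (wcrs (a - s) (b - s)) (lid (c + s - b))))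
            (WTens (wspl s (a - s)) (wspl (b - s) (c + s - b))))) (st u' @ st v') (st u @ st v) =
      (\<Sum>p\<in>P (int s). \<Sum>y'\<in>P (int (b - s)). \<Sum>g'\<in>P (int (a - s)). \<Sum>w\<in>P (int (c + s - b)).
        of_bool (R p y' u') * of_bool (R g' w v') *
        (\<Sum>y\<in>P (int (a - s)). \<Sum>g\<in>P (int (b - s)). (cross y g y' g' :: 'k::field) * (of_bool (R p y u) * of_bool (R g w v))))"
proof -
  have l: "a - s + (c + s - b) = d" "b - s + (c + s - b) = c" "s + (a - s) = a" "s + (b - s) = b" using e s by auto
  let ?Z = "WTens (wspl s (a - s)) (wspl (b - s) (c + s - b)) :: 'k web_term"
    and ?X = "WTens (lid s) (WTens (wcrs (a - s) (b - s)) (lid (c + s - b))) :: 'k web_term"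
    and ?M = "WTens (wmrg s (b - s)) (wmrg (a - s) (c + s - b)) :: 'k web_term"
  have Z: "sem ?Z ((st p @ st y) @ st g @ st w) (st u @ st v) = of_bool (R p y u) * of_bool (R g w v)"
    if "p \<in> P (int s)" "y \<in> P (int (a - s))" "g \<in> P (int (b - s))" "w \<in> P (int (c + s - b))" for p y g w
  proof -
    have "sem ?Z ((st p @ st y) @ st g @ st w) (st u @ st v) =
        sem (wspl s (a - s)) (st p @ st y) (st u) * sem (wspl (b - s) (c + s - b)) (st g @ st w) (st v)"
      unfolding sem.simps lab_type wtgt.simps wsrc.simps l using that uv st_lab by (intro tmat_append) simp_all
    also have "\<dots> = of_bool (R p y u) * of_bool (R g w v)"
      using sem_wspl[OF that(1,2), of u, where 'k = 'k] sem_wspl[OF that(3,4), of v, where 'k = 'k] uv by (simp only: l)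
    finally show ?thesis .
  qed
  have M: "sem ?M (st u' @ st v') ((st p @ st y') @ st g' @ st w) = of_bool (R p y' u') * of_bool (R g' w v')"
    if "p \<in> P (int s)" "y' \<in> P (int (b - s))" "g' \<in> P (int (a - s))" "w \<in> P (int (c + s - b))" for p y' g' w
  proof -
    have "sem ?M (st u' @ st v') ((st p @ st y') @ st g' @ st w) =
        sem (wmrg s (b - s)) (st u') (st p @ st y') * sem (wmrg (a - s) (c + s - b)) (st v') (st g' @ st w)"
      unfolding sem.simps lab_type wtgt.simps wsrc.simps l using that uv st_lab by (intro tmat_append) simp_all
    also have "\<dots> = of_bool (R p y' u') * of_bool (R g' w v')"
      using sem_wmrg[OF that(1,2), of u', where 'k = 'k] sem_wmrg[OF that(3,4), of v', where 'k = 'k] uv by (simp only: l)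
    finally show ?thesis .
  qed
  have X: "sem ?X (st p @ (st y' @ st g') @ st w) (st p0 @ (st y @ st g) @ st w0) =
      of_bool (p = p0) * (cross y g y' g' * of_bool (w = w0))"
    if "p \<in> P (int s)" "y' \<in> P (int (b - s))" "g' \<in> P (int (a - s))" "w \<in> P (int (c + s - b))"
      "p0 \<in> P (int s)" "y \<in> P (int (a - s))" "g \<in> P (int (b - s))" "w0 \<in> P (int (c + s - b))" for p y' g' w p0 y g w0
  proof -
    have "sem ?X (st p @ (st y' @ st g') @ st w) (st p0 @ (st y @ st g) @ st w0) =
        idm (st p) (st p0) * sem (WTens (wcrs (a - s) (b - s)) (lid (c + s - b))) ((st y' @ st g') @ st w) ((st y @ st g) @ st w0)"
      unfolding sem.simps(8)[of "lid s"] sem.simps(1) wtgt.simps wsrc.simps using that st_lab by (intro tmat_append) simp_all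
    also have "sem (WTens (wcrs (a - s) (b - s)) (lid (c + s - b))) ((st y' @ st g') @ st w) ((st y @ st g) @ st w0) =
        sem (wcrs (a - s) (b - s)) (st y' @ st g') (st y @ st g) * idm (st w) (st w0)"
      unfolding sem.simps lab_type wtgt.simps wsrc.simps using that st_lab by (intro tmat_append) simp_all
    finally show ?thesis
      using sem_wcrs[OF that(6,7,2,3), where 'k = 'k] idm_st[OF that(1,5), where 'k = 'k] idm_st[OF that(4,8), where 'k = 'k] by simp
  qed
  have XZ: "sem (WComp ?X ?Z) ((st p @ st y') @ st g' @ st w) (st u @ st v) =
      (\<Sum>y\<in>P (int (a - s)). \<Sum>g\<in>P (int (b - s)). cross y g y' g' * (of_bool (R p y u) * of_bool (R g w v)))"
    if "p \<in> P (int s)" "y' \<in> P (int (b - s))" "g' \<in> P (int (a - s))" "w \<in> P (int (c + s - b))" for p y' g' w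
  proof -
    have "sem (WComp ?X ?Z) ((st p @ st y') @ st g' @ st w) (st u @ st v) =
        (\<Sum>p0\<in>P (int s). \<Sum>y\<in>P (int (a - s)). \<Sum>g\<in>P (int (b - s)). \<Sum>w0\<in>P (int (c + s - b)).
          sem ?X ((st p @ st y') @ st g' @ st w) ((st p0 @ st y) @ st g @ st w0) * sem ?Z ((st p0 @ st y) @ st g @ st w0) (st u @ st v))"
      unfolding sem.simps(7) mmul_def wtgt.simps lab_type sum_Bl_append sum_Bl_lab ..
    also have "\<dots> = (\<Sum>p0\<in>P (int s). \<Sum>y\<in>P (int (a - s)). \<Sum>g\<in>P (int (b - s)). \<Sum>w0\<in>P (int (c + s - b)).
          of_bool (p = p0) * (cross y g y' g' * of_bool (w = w0)) * (of_bool (R p0 y u) * of_bool (R g w0 v)))"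
    proof (intro sum.cong[OF HOL.refl] arg_cong2[where f = "(*)"])
      fix p0 y g w0 assume m: "p0 \<in> P (int s)" "y \<in> P (int (a - s))" "g \<in> P (int (b - s))" "w0 \<in> P (int (c + s - b))"
      show "sem ?X ((st p @ st y') @ st g' @ st w) ((st p0 @ st y) @ st g @ st w0) = of_bool (p = p0) * (cross y g y' g' * of_bool (w = w0))"
        using X[OF that m] by (simp only: append_assoc)
    qed (rule Z)
    also have "\<dots> = (\<Sum>p0\<in>P (int s). if p0 = p then \<Sum>y\<in>P (int (a - s)). \<Sum>g\<in>P (int (b - s)). \<Sum>w0\<in>P (int (c + s - b)).
          if w0 = w then cross y g y' g' * (of_bool (R p y u) * of_bool (R g w v)) else 0 else 0)"
    proof (rule sum.cong[OF HOL.refl])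
      fix p0
      show "(\<Sum>y\<in>P (int (a - s)). \<Sum>g\<in>P (int (b - s)). \<Sum>w0\<in>P (int (c + s - b)).
            of_bool (p = p0) * (cross y g y' g' * of_bool (w = w0)) * (of_bool (R p0 y u) * of_bool (R g w0 v))) =
          (if p0 = p then \<Sum>y\<in>P (int (a - s)). \<Sum>g\<in>P (int (b - s)). \<Sum>w0\<in>P (int (c + s - b)).
            if w0 = w then cross y g y' g' * (of_bool (R p y u) * of_bool (R g w v)) else 0 else 0 :: 'k)"
      proof (cases "p0 = p")
        case True
        show ?thesis unfolding True simp_thms if_True by (intro sum.cong HOL.refl) auto
      next
        case False
        then have "of_bool (p = p0) = (0::'k)" by simp
        then show ?thesis using False by (simp only: mult_zero_left sum.neutral_const if_False)
      qed
    qed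
    also have "\<dots> = (\<Sum>y\<in>P (int (a - s)). \<Sum>g\<in>P (int (b - s)). cross y g y' g' * (of_bool (R p y u) * of_bool (R g w v)))"
      using that by simp
    finally show ?thesis .
  qed
  have "sem (WComp ?M (WComp ?X ?Z)) (st u' @ st v') (st u @ st v) =
      (\<Sum>p\<in>P (int s). \<Sum>y'\<in>P (int (b - s)). \<Sum>g'\<in>P (int (a - s)). \<Sum>w\<in>P (int (c + s - b)).
        sem ?M (st u' @ st v') ((st p @ st y') @ st g' @ st w) * sem (WComp ?X ?Z) ((st p @ st y') @ st g' @ st w) (st u @ st v))"
    unfolding sem.simps(7)[of ?M] mmul_def wtgt.simps lab_type sum_Bl_append sum_Bl_lab by (simp only: append_assoc)
  also have "\<dots> = (\<Sum>p\<in>P (int s). \<Sum>y'\<in>P (int (b - s)). \<Sum>g'\<in>P (int (a - s)). \<Sum>w\<in>P (int (c + s - b)).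
        of_bool (R p y' u') * of_bool (R g' w v') *
        (\<Sum>y\<in>P (int (a - s)). \<Sum>g\<in>P (int (b - s)). cross y g y' g' * (of_bool (R p y u) * of_bool (R g w v))))"
    by (intro sum.cong[OF HOL.refl] arg_cong2[where f = "(*)"] M XZ)
  finally show ?thesis .
qed

lemma sem_bialgebra:
  assumes q1: "of_nat q = (1::'k::field)" and ab: "a \<le> n" "a + c = b + d"
  shows "same_entries (lab a @ lab c) (lab b @ lab d)
     (sem (if a + c \<le> n then WComp (wspl b d) (wmrg a c) else WZero (lab a @ lab c) (lab b @ lab d) :: 'k web_term))
     (sem (wsum (lab a @ lab c) (lab b @ lab d)
        [WComp (WTens (wmrg s (b - s)) (wmrg (a - s) (c + s - b)))
          (WComp (WTens (lid s) (WTens (wcrs (a - s) (b - s)) (lid (c + s - b))))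
            (WTens (wspl s (a - s)) (wspl (b - s) (c + s - b)))).
         s \<leftarrow> [0..<n + 1], s \<le> a, s \<le> b, b \<le> c + s]))" (is "same_entries _ _ (sem ?L) (sem ?R)")
  unfolding same_entries_def
proof (intro ballI)
  fix ws us assume "us \<in> Bl (lab a @ lab c)" "ws \<in> Bl (lab b @ lab d)"
  then obtain u v u' v' where w: "us = st u @ st v" "ws = st u' @ st v'" and
    uv: "u \<in> P (int a)" "v \<in> P (int c)" "u' \<in> P (int b)" "v' \<in> P (int d)" using Bl_lab2_cases by metis
  have "sem ?L ws us = (of_bool (\<exists>t. R u v t \<and> R u' v' t) :: 'k)"
  proof (cases "a + c \<le> n")
    case True
    have "sem (WComp (wspl b d) (wmrg a c)) ws us = (\<Sum>t\<in>P (int (a + c)). of_bool (R u' v' t) * (of_bool (R u v t) :: 'k))"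
      unfolding w sem.simps(7) mmul_def wtgt.simps lab_type sum_Bl_append sum_Bl_lab
      by (intro sum.cong[OF HOL.refl] arg_cong2[where f = "(*)"] sem_wmrg sem_wspl uv) (simp_all add: ab(2))
    also have "\<dots> = (\<Sum>t\<in>P (int (a + c)). of_bool (R u v t \<and> R u' v' t))" by (intro sum.cong) auto
    also have "\<dots> = of_bool (\<exists>t\<in>P (int (a + c)). R u v t \<and> R u' v' t)"
      by (rule sum_of_bool_unique[OF finite_P]) (metis R_fun)
    also have "(\<exists>t\<in>P (int (a + c)). R u v t \<and> R u' v' t) \<longleftrightarrow> (\<exists>t. R u v t \<and> R u' v' t)"
      using P_rank(2)[OF _ uv(1,2)] by auto
    finally show ?thesis using True by simp
  next
    case False
    have "\<not> R u v t" for t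
    proof
      assume r: "R u v t"
      then have "rk t = a + c" using R_rk uv by (simp add: P_def)
      then show False using rk_le[of t] R_S[OF r] False by simp
    qed
    then show ?thesis using False by simp
  qed
  also have "\<dots> = (\<Sum>s<n + 1. if s \<le> a \<and> s \<le> b \<and> b \<le> c + s then
      \<Sum>p\<in>P (int s). \<Sum>y'\<in>P (int (b - s)). \<Sum>g'\<in>P (int (a - s)). \<Sum>w\<in>P (int (c + s - b)).
        of_bool (R p y' u') * of_bool (R g' w v') *
        (\<Sum>y\<in>P (int (a - s)). \<Sum>g\<in>P (int (b - s)). cross y g y' g' * (of_bool (R p y u) * of_bool (R g w v)))
      else 0)" by (rule bialgebra_level_sum[OF q1 uv ab(2), symmetric])
  also have "\<dots> = (\<Sum>s<n + 1. if s \<le> a \<and> s \<le> b \<and> b \<le> c + s then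
      sem (WComp (WTens (wmrg s (b - s)) (wmrg (a - s) (c + s - b)))
          (WComp (WTens (lid s) (WTens (wcrs (a - s) (b - s)) (lid (c + s - b))))
            (WTens (wspl s (a - s)) (wspl (b - s) (c + s - b))))) ws us else 0)"
    unfolding w by (intro sum.cong[OF HOL.refl] if_cong HOL.refl sem_bialgebra_term[OF uv ab(2), symmetric]) auto
  also have "\<dots> = sem ?R ws us"
    unfolding sem_wsum sum_list_concat_map interv_sum_list_conv_sum_set_nat
    by (rule sum.cong) (auto simp del: sem.simps)
  finally show "sem ?L ws us = sem ?R ws us" .
qed

lemma Bl_pair: "us \<in> Bl [a, b] \<longleftrightarrow> (\<exists>u\<in>P (int a). \<exists>v\<in>P (int b). us = [u, v])" by auto

lemma sem_ev_cross_left: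
  "same_entries [a, n] [a] (sem (WComp (WTens WEv (WId [a])) (WCross a n) :: 'k::field web_term)) (sem (WScale ((-1) ^ a) (WTens (WId [a]) WEv)))"
  unfolding same_entries_def
proof (intro ballI)
  fix ws us assume "us \<in> Bl [a, n]" "ws \<in> Bl [a]"
  then obtain u w where w: "us = [u, pts]" "ws = [w]" "u \<in> P (int a)" "w \<in> P (int a)" by (auto simp: Bl_pair)
  have "sem (WComp (WTens WEv (WId [a])) (WCross a n)) ws us =
      (\<Sum>vs\<in>Bl ([n] @ [a]). idm ws (drop 1 vs) * (cross u pts (vs ! 0) (vs ! 1) :: 'k))"
    by (simp add: mmul_def tmat_def w del: Bl.simps)
  also have "\<dots> = (\<Sum>x\<in>P (int a). idm [w] [x] * cross u pts pts x)"
    unfolding sum_Bl_append w(2) by (simp add: sum.reindex inj_on_def image_def[symmetric] Setcompr_eq_image)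
  also have "\<dots> = (\<Sum>x\<in>P (int a). if x = w then cross u pts pts w else 0)" by (intro sum.cong) (auto simp: idm_def)
  also have "\<dots> = cross u pts pts w" using w by simp
  also have "\<dots> = (if w = u then (-1) ^ rk u else 0)" using w P_S by (intro cross_pts_right) auto
  also have "rk u = a" using w by (simp add: P_def)
  finally show "sem (WComp (WTens WEv (WId [a])) (WCross a n)) ws us = (sem (WScale ((-1) ^ a) (WTens (WId [a]) WEv)) ws us :: 'k)"
    by (auto simp: w tmat_def idm_def)
qed

lemma sem_ev_cross_right:
  "same_entries [n, a] [a] (sem (WComp (WTens (WId [a]) WEv) (WCross n a) :: 'k::field web_term)) (sem (WScale ((-1) ^ a) (WTens WEv (WId [a]))))"
  unfolding same_entries_def
proof (intro ballI)
  fix ws us assume "us \<in> Bl [n, a]" "ws \<in> Bl [a]"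
  then obtain u w where w: "us = [pts, u]" "ws = [w]" "u \<in> P (int a)" "w \<in> P (int a)" by (auto simp: Bl_pair)
  have "sem (WComp (WTens (WId [a]) WEv) (WCross n a)) ws us =
      (\<Sum>vs\<in>Bl ([a] @ [n]). idm ws (take 1 vs) * (cross pts u (vs ! 0) (vs ! 1) :: 'k))"
    by (simp add: mmul_def tmat_def w del: Bl.simps)
  also have "\<dots> = (\<Sum>x\<in>P (int a). idm [w] [x] * cross pts u x pts)"
    unfolding sum_Bl_append w(2) by (simp add: sum.reindex inj_on_def image_def[symmetric] Setcompr_eq_image)
  also have "\<dots> = (\<Sum>x\<in>P (int a). if x = w then cross pts u w pts else 0)" by (intro sum.cong) (auto simp: idm_def)
  also have "\<dots> = cross pts u w pts" using w by simp
  also have "\<dots> = (if w = u then (-1) ^ rk u else 0)" using w P_S by (intro cross_pts_left) auto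
  also have "rk u = a" using w by (simp add: P_def)
  finally show "sem (WComp (WTens (WId [a]) WEv) (WCross n a)) ws us = (sem (WScale ((-1) ^ a) (WTens WEv (WId [a]))) ws us :: 'k)"
    by (auto simp: w tmat_def idm_def)
qed

lemma sem_web_rel:
  assumes q1: "of_nat q = (1::'k::field)" and "web_rel n X Y f g"
  shows "same_entries X Y (sem (f :: 'k web_term)) (sem g)"
  using assms(2)
proof cases
  case (bialgebra a b c d)
  show ?thesis unfolding bialgebra(1-4) using bialgebra(5,9) by (rule sem_bialgebra[OF q1])
next
  case coev_ev
  have "n \<noteq> 0" using n3 by simp
  then show ?thesis unfolding coev_ev same_entries_def by (auto simp: mmul_def idm_def)
next
  case ev_coev
  have "(\<Sum>vs\<in>Bl [n]. 1 :: 'k) = 1" by simp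
  then show ?thesis unfolding ev_coev same_entries_def by (auto simp: mmul_def idm_def)
next
  case (merge_assoc a b c)
  then show ?thesis using sem_merge_assoc by blast
next
  case (split_coassoc a b c)
  then show ?thesis using sem_split_coassoc by blast
next
  case (bigon a b)
  then show ?thesis using sem_bigon[OF q1] by blast
next
  case (ev_cross_left a)
  then show ?thesis using sem_ev_cross_left by blast
next
  case (ev_cross_right a)
  then show ?thesis using sem_ev_cross_right by blast
qed

text \<open>Besides the defining relations, the congruence consists of the axioms of a strict linear monoidal
  category, which hold for matrices indexed by lists.\<close>

lemma sem_sound:
  assumes q1: "of_nat q = (1::'k::field)" and "web_eq n X Y f g"
  shows "same_entries X Y (sem (f :: 'k web_term)) (sem g)"
  using assms(2)
proof (induction rule: web_eq.induct)
  case (rel X Y f g)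
  then show ?case using sem_web_rel[OF q1] by blast
next
  case (refl X Y f)
  then show ?case by (simp add: same_entries_def)
next
  case (sym X Y f g)
  then show ?case by (simp add: same_entries_def)
next
  case (trans X Y f g h)
  then show ?case by (simp add: same_entries_def)
next
  case (comp_cong X Y f f' Z g g')
  have "wtgt n f = Y" "wtgt n f' = Y" using web_eq_arr[OF comp_cong(1)] web_arr_type n3 by auto
  then show ?case using comp_cong by (simp add: same_entries_def mmul_def)
next
  case (tens_cong X Y f f' X' Y' g g')
  have "wtgt n f = Y" "wtgt n f' = Y" "wsrc n f = X" "wsrc n f' = X"
    using web_eq_arr[OF tens_cong(1)] web_arr_type n3 by auto
  then show ?case using tens_cong by (simp add: same_entries_def tmat_def Bl_append_iff)
next
  case (comp_id_left X Y f)
  have "wtgt n f = Y" using web_arr_type[OF comp_id_left] by simp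
  then show ?case by (simp add: same_entries_def mmul_def idm_def of_bool_def if_distrib if_distribR cong: if_cong)
next
  case (comp_id_right X Y f)
  then show ?case by (simp add: same_entries_def mmul_def idm_def of_bool_def if_distrib if_distribR cong: if_cong)
next
  case (comp_assoc W X f Y g Z h)
  have "wtgt n g = Y" "wtgt n f = X" using web_arr_type comp_assoc by auto
  have "sem (WComp (WComp h g) f) ws us = sem (WComp h (WComp g f)) ws us" for ws us
  proof -
    have "sem (WComp (WComp h g) f) ws us = (\<Sum>xs\<in>Bl X. \<Sum>ys\<in>Bl Y. sem h ws ys * (sem g ys xs * sem f xs us))"
      by (simp only: sem.simps mmul_def \<open>wtgt n g = Y\<close> \<open>wtgt n f = X\<close> sum_distrib_right mult.assoc)
    also have "\<dots> = (\<Sum>ys\<in>Bl Y. \<Sum>xs\<in>Bl X. sem h ws ys * (sem g ys xs * sem f xs us))" by (rule sum.swap)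
    also have "\<dots> = sem (WComp h (WComp g f)) ws us"
      by (simp only: sem.simps wtgt.simps mmul_def \<open>wtgt n g = Y\<close> \<open>wtgt n f = X\<close> sum_distrib_left)
    finally show ?thesis .
  qed
  then show ?case by (simp add: same_entries_def del: sem.simps)
next
  case (tens_id X Y)
  then show ?case by (auto simp: same_entries_def tmat_def idm_def) (metis append_take_drop_id)+
next
  case (interchange X Y f Z g X' Y' f' Z' g')
  have t: "wtgt n f = Y" "wtgt n g = Z" "wsrc n f = X" "wsrc n g = Y" "wtgt n f' = Y'" using web_arr_type interchange by auto
  show ?case unfolding same_entries_def
  proof (intro ballI)
    fix ws us assume "ws \<in> Bl (Z @ Z')" "us \<in> Bl (X @ X')"
    have "sem (WComp (WTens g g') (WTens f f')) ws us = (\<Sum>ys\<in>Bl Y. \<Sum>ys'\<in>Bl Y'.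
       (sem g (take (length Z) ws) ys * sem f ys (take (length X) us)) *
       (sem g' (drop (length Z) ws) ys' * sem f' ys' (drop (length X) us)))"
      unfolding sem.simps mmul_def t wtgt.simps wsrc.simps sum_Bl_append
      by (intro sum.cong[OF HOL.refl]) (simp add: tmat_def Bl_length mult_ac)
    also have "\<dots> = sem (WTens (WComp g f) (WComp g' f')) ws us"
      unfolding sum_product[symmetric] by (simp add: t tmat_def mmul_def)
    finally show "sem (WTens (WComp g f) (WComp g' f')) ws us = sem (WComp (WTens g g') (WTens f f')) ws us" ..
  qed
next
  case (tens_assoc X X' f Y Y' g Z Z' h)
  have t: "wtgt n f = X'" "wsrc n f = X" "wtgt n g = Y'" "wsrc n g = Y" using web_arr_type tens_assoc by auto
  show ?case by (simp add: same_entries_def t tmat_def mult.assoc drop_take add.commute)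
next
  case (tens_unit_left X Y f)
  then show ?case by (simp add: same_entries_def tmat_def idm_def)
next
  case (tens_unit_right X Y f)
  have t: "wtgt n f = Y" "wsrc n f = X" using web_arr_type tens_unit_right by auto
  show ?case by (simp add: same_entries_def tmat_def idm_def t Bl_length)
next
  case (comp_add_left X Y f Z g h)
  have t: "wtgt n f = Y" using web_arr_type comp_add_left by auto
  then show ?case by (simp add: same_entries_def mmul_def distrib_right sum.distrib)
next
  case (comp_add_right X Y f g Z h)
  have t: "wtgt n f = Y" "wtgt n g = Y" using web_arr_type comp_add_right by auto
  then show ?case by (simp add: same_entries_def mmul_def distrib_left sum.distrib)
next
  case (comp_scale_left X Y f Z g c)
  then show ?case by (simp add: same_entries_def mmul_def sum_distrib_left mult.assoc)
next
  case (comp_scale_right X Y f Z g c)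
  then show ?case by (simp add: same_entries_def mmul_def sum_distrib_left mult.left_commute)
next
  case (tens_add_left X Y f g X' Y' h)
  have "wtgt n f = Y" "wtgt n g = Y" "wsrc n f = X" "wsrc n g = X" using web_arr_type tens_add_left by auto
  then show ?case by (simp add: same_entries_def tmat_def distrib_right)
next
  case (tens_add_right X Y h X' Y' f g)
  then show ?case by (simp add: same_entries_def tmat_def distrib_left)
next
  case (tens_scale_left X Y f X' Y' g c)
  then show ?case by (simp add: same_entries_def tmat_def)
next
  case (tens_scale_right X Y f X' Y' g c)
  then show ?case by (simp add: same_entries_def tmat_def)
qed (simp_all add: same_entries_def algebra_simps)

end

section \<open>The functor on webs\<close>

text \<open>Words are bracketed to the right, and a single letter is not tensored with the unit object, so that
  the functor sends the word \<open>[a]\<close> to the object of label \<open>a\<close> itself.\<close>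

fun shp :: "nat list \<Rightarrow> shape" where
  "shp [] = Unit" | "shp [a] = Leaf (int a)" | "shp (a # b # X) = Node (Leaf (int a)) (shp (b # X))"

lemma slen_shp [simp]: "slen (shp X) = length X"
  by (induction X rule: shp.induct) auto

lemma (in tri_geometry) B_shp: "B (shp X) = Bl X"
proof (induction X rule: shp.induct)
  case (3 a b X)
  have "Bl [a] = (\<lambda>u. [u]) ` P (int a)" by auto
  then have "B (shp (a # b # X)) = Bl ([a] @ b # X)" by (simp only: shp.simps B.simps 3 Bl_append)
  then show ?case by simp
qed auto

lemma (in tri_geometry) B_Node_shp: "B (Node (shp X) (shp Y)) = B (shp (X @ Y))"
  by (simp add: B_shp Bl_append)

context shaped_category
begin

lemma comp_idm_right: "B s = B t \<Longrightarrow> Cmp CC (mat t r A) (mat s t idm) = mat s r A"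
  unfolding mat_comp by (rule mat_cong) (simp add: col_id)

lemma comp_idm_left: "B t = B r \<Longrightarrow> Cmp CC (mat t r idm) (mat s t A) = mat s r A"
  unfolding mat_comp by (rule mat_cong) (simp add: row_id)

lemma tens_idm: "slen s = slen s' \<Longrightarrow> Tmor CC (mat s s' idm) (mat t t' idm) = mat (Node s t) (Node s' t') idm"
proof -
  have e: "take l ws = take l us \<and> drop l ws = drop l us \<longleftrightarrow> ws = us" for l and ws us :: "'p set list"
    by (metis append_take_drop_id)
  assume "slen s = slen s'"
  then show ?thesis
    unfolding mat_tens by (intro mat_cong) (simp only: tmat_def idm_def of_bool_conj[symmetric] e)
qed

lemma mat_idm_hom: "mat s t idm \<in> Hom CC (ob s) (ob t)"
  by (rule mat_hom) (simp add: idm_def)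

lemma mat_idm_iso: "B s = B t \<Longrightarrow> is_iso CC (ob s) (ob t) (mat s t idm)"
  unfolding is_iso_def using mat_idm_hom[of s t] mat_idm_hom[of t s] comp_idm_right[of s t s idm] comp_idm_right[of t s t idm]
  by (auto simp: mat_id)

text \<open>A class of webs is sent to the matrix of any representative; as lists do not remember brackets, the
  coherence isomorphisms are identity matrices.\<close>

definition web_functor :: "(nat list, 'k web_term set, 'o, ('o, ('p set, 'k) vec) arrow) mon_functor" where
  "web_functor =
     \<lparr>Fob = (\<lambda>X. ob (shp X)),
      Fmor = (\<lambda>A. let f = (SOME f. f \<in> A) in mat (shp (wsrc n f)) (shp (wtgt n f)) (sem f)),
      Fmul = (\<lambda>X Y. mat (Node (shp X) (shp Y)) (shp (X @ Y)) idm),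
      Funit = mat Unit Unit idm\<rparr>"

lemma one_le_n: "1 \<le> n" using n3 by simp

context
  assumes q1: "of_nat q = (1::'k)"
begin

lemma functor_on_terms:
  assumes "A \<noteq> {}" "\<And>h. h \<in> A \<Longrightarrow> web_eq n X Y f h"
  shows "Fmor web_functor A = mat (shp X) (shp Y) (sem f)"
proof -
  define h where "h = (SOME h. h \<in> A)"
  have "h \<in> A" unfolding h_def using assms(1) by (simp add: some_in_eq)
  then have e: "web_eq n X Y f h" by (rule assms(2))
  have "wsrc n h = X" "wtgt n h = Y" using web_eq_arr[OF e one_le_n] web_arr_type by blast+
  moreover have "mat (shp X) (shp Y) (sem h) = mat (shp X) (shp Y) (sem f)"
    using sem_sound[OF q1 e] by (intro mat_cong) (simp add: B_shp same_entries_def)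
  ultimately show ?thesis by (simp add: web_functor_def h_def[symmetric])
qed

lemma functor_on_class:
  assumes "web_arr n X Y f" shows "Fmor web_functor (web_class n f) = mat (shp X) (shp Y) (sem f)"
  by (rule functor_on_terms) (use web_class_self[OF assms] web_class_rep[OF assms one_le_n] in auto)

text \<open>Composition, sums and tensor products of classes are unions over representatives, all of which are
  equivalent by the congruence rule for the operation.\<close>

lemma functor_on_operation:
  assumes f: "web_arr n X1 Y1 f" and g: "web_arr n X2 Y2 g"
    and cong: "\<And>f' g'. web_eq n X1 Y1 f f' \<Longrightarrow> web_eq n X2 Y2 g g' \<Longrightarrow> web_eq n X Y (H f g) (H f' g')"
  shows "Fmor web_functor (\<Union>f'\<in>web_class n f. \<Union>g'\<in>web_class n g. web_class n (H f' g')) = mat (shp X) (shp Y) (sem (H f g))"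
proof (rule functor_on_terms)
  have "web_eq n X Y (H f g) (H f g)" by (rule cong[OF web_eq.refl[OF f] web_eq.refl[OF g]])
  then have "web_arr n X Y (H f g)" using web_eq_arr one_le_n by blast
  then show "(\<Union>f'\<in>web_class n f. \<Union>g'\<in>web_class n g. web_class n (H f' g')) \<noteq> {}"
    using web_class_self[OF f] web_class_self[OF g] web_class_self[of n X Y "H f g"] by blast
  fix h assume "h \<in> (\<Union>f'\<in>web_class n f. \<Union>g'\<in>web_class n g. web_class n (H f' g'))"
  then obtain f' g' where fg: "f' \<in> web_class n f" "g' \<in> web_class n g" "h \<in> web_class n (H f' g')" by blast
  have e: "web_eq n X Y (H f g) (H f' g')"
    using cong web_class_rep[OF f one_le_n fg(1)] web_class_rep[OF g one_le_n fg(2)] by blast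
  then have "web_eq n X Y (H f' g') h" using web_class_rep[OF _ one_le_n fg(3)] web_eq_arr[OF e one_le_n] by blast
  then show "web_eq n X Y (H f g) h" using e web_eq.trans by blast
qed

text \<open>Functoriality is the definition of \<open>sem\<close>, and each coherence condition is an equation between identity
  matrices; soundness is used only through the independence of representatives.\<close>

lemma web_functor_monoidal:
  assumes hom: "\<And>X Y f us ws. \<lbrakk>web_arr n X Y f; us \<in> Bl X; ws \<in> Bl Y; sem f ws us \<noteq> (0::'k)\<rbrakk> \<Longrightarrow> deg us = deg ws"
  shows "linear_monoidal_functor (Web n) CC web_functor"
proof
  have Fob: "Fob web_functor X = ob (shp X)" for X by (simp add: web_functor_def)
  have Fmul: "Fmul web_functor X Y = mat (Node (shp X) (shp Y)) (shp (X @ Y)) idm" for X Y by (simp add: web_functor_def)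
  have Funit: "Funit web_functor = mat Unit Unit idm" by (simp add: web_functor_def)
  have HomD: "\<exists>t. f = web_class n t \<and> web_arr n X Y t" if "f \<in> Hom (Web n) X Y" for f :: "'k web_term set" and X Y
    using that by (auto simp: Web_def)
  have F_id: "Fmor web_functor (web_class n (WId X)) = mat (shp X) (shp X) idm" if "X \<in> web_objects n" for X
    using functor_on_class[OF web_arr.intros(1)[OF that]] by simp
  have app: "X @ Y \<in> web_objects n" if "X \<in> web_objects n" "Y \<in> web_objects n" for X Y
    using that by (auto simp: web_objects_def)
  note W = Web_def lin_mon_cat.simps
  fix X Y Z X' Y' :: "nat list" and f g :: "'k web_term set" and c :: 'k
  show "Fob web_functor X \<in> Ob CC" by (simp add: Fob ob_obs)
  show "Fmor web_functor f \<in> Hom CC (Fob web_functor X) (Fob web_functor Y)" if f: "f \<in> Hom (Web n) X Y"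
  proof -
    obtain t where t: "f = web_class n t" "web_arr n X Y t" using HomD f by blast
    show ?thesis unfolding Fob t(1) functor_on_class[OF t(2)]
      by (rule mat_hom) (use hom[OF t(2)] in \<open>simp add: B_shp\<close>)
  qed
  show "is_iso CC (Uob CC) (Fob web_functor (Uob (Web n))) (Funit web_functor)"
    using mat_idm_iso[of Unit Unit] by (simp add: Fob Funit W)
  show "Fmor web_functor (Cmp (Web n) g f) = Cmp CC (Fmor web_functor g) (Fmor web_functor f)"
    if f: "f \<in> Hom (Web n) X Y" and g: "g \<in> Hom (Web n) Y Z"
  proof -
    obtain s t where st: "f = web_class n s" "web_arr n X Y s" "g = web_class n t" "web_arr n Y Z t" using HomD f g by metis
    have "Fmor web_functor (Cmp (Web n) g f) = mat (shp X) (shp Z) (sem (WComp t s))"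
      unfolding st(1,3) W by (rule functor_on_operation[OF st(4,2)]) (rule web_eq.comp_cong)
    then show ?thesis using web_arr_type[OF st(2)]
      by (simp add: st(1,3) functor_on_class[OF st(2)] functor_on_class[OF st(4)] mat_comp B_shp)
  qed
  show "Fmor web_functor (Add (Web n) f g) = Add CC (Fmor web_functor f) (Fmor web_functor g)"
    if f: "f \<in> Hom (Web n) X Y" and g: "g \<in> Hom (Web n) X Y"
  proof -
    obtain s t where st: "f = web_class n s" "web_arr n X Y s" "g = web_class n t" "web_arr n X Y t" using HomD f g by metis
    have "Fmor web_functor (Add (Web n) f g) = mat (shp X) (shp Y) (sem (WAdd s t))"
      unfolding st(1,3) W by (rule functor_on_operation[OF st(2,4)]) (rule web_eq.add_cong)
    then show ?thesis by (simp add: st(1,3) functor_on_class[OF st(2)] functor_on_class[OF st(4)] mat_add)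
  qed
  show "Fmor web_functor (Smul (Web n) c f) = Smul CC c (Fmor web_functor f)" if f: "f \<in> Hom (Web n) X Y"
  proof -
    obtain s where st: "f = web_class n s" "web_arr n X Y s" using HomD f by metis
    have ne: "web_class n s \<noteq> {}" using web_class_self[OF st(2)] by blast
    have "Fmor web_functor (\<Union>s'\<in>web_class n s. \<Union>s''\<in>web_class n s. web_class n (WScale c s')) = mat (shp X) (shp Y) (sem (WScale c s))"
      by (rule functor_on_operation[OF st(2) st(2), where H = "\<lambda>s _. WScale c s"]) (rule web_eq.scale_cong)
    moreover have "(\<Union>s'\<in>web_class n s. \<Union>s''\<in>web_class n s. web_class n (WScale c s')) = Smul (Web n) c f"
      using ne by (auto simp: W st(1))
    ultimately show ?thesis by (simp add: st(1) functor_on_class[OF st(2)] mat_smul)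
  qed
  show "Fmor web_functor (Tmor (Web n) f g) \<cdot>\<^bsub>CC\<^esub> Fmul web_functor X Y =
      Fmul web_functor X' Y' \<cdot>\<^bsub>CC\<^esub> (Tmor CC (Fmor web_functor f) (Fmor web_functor g))"
    if f: "f \<in> Hom (Web n) X X'" and g: "g \<in> Hom (Web n) Y Y'"
  proof -
    obtain s t where st: "f = web_class n s" "web_arr n X X' s" "g = web_class n t" "web_arr n Y Y' t" using HomD f g by metis
    have l: "wsrc n s = X" "wtgt n s = X'" using web_arr_type[OF st(2)] by auto
    have "Fmor web_functor (Tmor (Web n) f g) = mat (shp (X @ Y)) (shp (X' @ Y')) (sem (WTens s t))"
      unfolding st(1,3) W by (rule functor_on_operation[OF st(2,4)]) (rule web_eq.tens_cong)
    then have "Fmor web_functor (Tmor (Web n) f g) \<cdot>\<^bsub>CC\<^esub> Fmul web_functor X Y =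
        mat (Node (shp X) (shp Y)) (shp (X' @ Y')) (sem (WTens s t))"
      by (simp only: Fmul comp_idm_right[OF B_Node_shp])
    also have "\<dots> = Fmul web_functor X' Y' \<cdot>\<^bsub>CC\<^esub> (Tmor CC (Fmor web_functor f) (Fmor web_functor g))"
      by (simp only: st(1,3) functor_on_class[OF st(2)] functor_on_class[OF st(4)] mat_tens Fmul comp_idm_left[OF B_Node_shp]
        sem.simps l slen_shp)
    finally show ?thesis .
  qed
  assume X: "X \<in> Ob (Web n)"
  then have X': "X \<in> web_objects n" by (simp add: W)
  show "Fmor web_functor (Idn (Web n) X) = Idn CC (Fob web_functor X)"
    using F_id[OF X'] by (simp add: W Fob mat_id)
  show "Fmor web_functor (Lun (Web n) X) \<cdot>\<^bsub>CC\<^esub> Fmul web_functor (Uob (Web n)) X \<cdot>\<^bsub>CC\<^esub>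
      (Tmor CC (Funit web_functor) (Idn CC (Fob web_functor X))) = Lun CC (Fob web_functor X)"
    using F_id[OF X'] by (simp add: W Fob Fmul Funit mat_id tens_idm comp_idm_left comp_idm_right mat_unitors B_Unit del: B.simps)
  show "Fmor web_functor (Run (Web n) X) \<cdot>\<^bsub>CC\<^esub> Fmul web_functor X (Uob (Web n)) \<cdot>\<^bsub>CC\<^esub>
      (Tmor CC (Idn CC (Fob web_functor X)) (Funit web_functor)) = Run CC (Fob web_functor X)"
    using F_id[OF X'] by (simp add: W Fob Fmul Funit mat_id tens_idm comp_idm_left comp_idm_right mat_unitors B_Unit del: B.simps)
  assume Y: "Y \<in> Ob (Web n)"
  show "is_iso CC (Fob web_functor X \<star>\<^bsub>CC\<^esub> Fob web_functor Y) (Fob web_functor (X \<star>\<^bsub>Web n\<^esub> Y)) (Fmul web_functor X Y)"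
    using mat_idm_iso[OF B_Node_shp[of X Y]] by (simp add: Fob Fmul W)
  assume Z: "Z \<in> Ob (Web n)"
  have "X @ Y @ Z \<in> web_objects n" using X Y Z by (auto simp: W intro: app)
  then show "Fmor web_functor (Assoc (Web n) X Y Z) \<cdot>\<^bsub>CC\<^esub> Fmul web_functor (X \<star>\<^bsub>Web n\<^esub> Y) Z \<cdot>\<^bsub>CC\<^esub>
        (Tmor CC (Fmul web_functor X Y) (Idn CC (Fob web_functor Z))) =
      Fmul web_functor X (Y \<star>\<^bsub>Web n\<^esub> Z) \<cdot>\<^bsub>CC\<^esub> (Tmor CC (Idn CC (Fob web_functor X)) (Fmul web_functor Y Z)) \<cdot>\<^bsub>CC\<^esub>
        Assoc CC (Fob web_functor X) (Fob web_functor Y) (Fob web_functor Z)"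
    using F_id[of "X @ Y @ Z"] B_Node_shp[of X "Y @ Z"] B_Node_shp[of "X @ Y" Z] B_Node_shp[of Y Z]
    by (simp add: W Fob Fmul mat_id tens_idm comp_idm_left comp_idm_right mat_assoc B_assoc B_Node_shp del: B.simps)
qed

lemma web_functor_values:
  "Fob web_functor [a] = ob (Leaf (int a))"
  "1 \<le> a \<Longrightarrow> 1 \<le> b \<Longrightarrow> a + b \<le> n \<Longrightarrow>
    Cmp CC (Fmor web_functor (web_class n (WMerge a b))) (Fmul web_functor [a] [b]) = merge (int a) (int b) (int a + int b)"
  "1 \<le> a \<Longrightarrow> 1 \<le> b \<Longrightarrow> a + b \<le> n \<Longrightarrow>
    Fmor web_functor (web_class n (WSplit a b)) = Cmp CC (Fmul web_functor [a] [b]) (split (int a) (int b) (int a + int b))"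
  "Fmor web_functor (web_class n WEv) = Cmp CC (Funit web_functor) ev"
  "Cmp CC (Fmor web_functor (web_class n WCoev)) (Funit web_functor) = coev"
  by (simp_all add: functor_on_class[OF web_arr.intros(2)] functor_on_class[OF web_arr.intros(3)]
    functor_on_class[OF web_arr.intros(5)] functor_on_class[OF web_arr.intros(6)] comp_idm_right comp_idm_left del: B.simps)
    (simp_all add: web_functor_def comp_idm_right comp_idm_left del: B.simps)

end

end

context tri_field
begin

lemma forget_mat: "Fmor (forget \<Gamma>\<^sub>T) (GV.mat s s' A) = VV.mat s s' A"
  by (simp only: forget_def mon_functor.simps GV.mat_sel total_gob VV.mat_def)

lemma forget_web_functor: "functor_comp Vec (forget \<Gamma>\<^sub>T) GV.web_functor = VV.web_functor"
proof -
  have un: "Uob Vec = (spc Unit :: ('p set, 'k) vec set)" using VV.mat_fields(2) by (simp only: Vec_cat)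
  have id: "\<iota>\<^bsub>Vec\<^esub> (spc s) = VV.mat s s idm" for s using VV.mat_id[of s] by (simp only: Vec_cat)
  have right_id: "VV.mat s t A \<cdot>\<^bsub>Vec\<^esub> VV.mat s s idm = VV.mat s t A" for s t A
    using VV.comp_idm_right[OF HOL.refl] by (simp only: Vec_cat)
  have mor: "Fmor (forget \<Gamma>\<^sub>T) (Fmor GV.web_functor A) = Fmor VV.web_functor A" for A :: "'k web_term set"
    by (simp only: GV.web_functor_def VV.web_functor_def mon_functor.simps Let_def forget_mat)
  have mul: "Fmor (forget \<Gamma>\<^sub>T) (Fmul GV.web_functor X Y) \<cdot>\<^bsub>Vec\<^esub> Fmul (forget \<Gamma>\<^sub>T) (Fob GV.web_functor X) (Fob GV.web_functor Y) =
      Fmul VV.web_functor X Y" for X Y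
    unfolding GV.web_functor_def VV.web_functor_def mon_functor.simps forget_mat
    by (simp only: forget_def mon_functor.simps total_gob tensor_space_spc id right_id)
  have unit: "Fmor (forget \<Gamma>\<^sub>T) (Funit GV.web_functor) \<cdot>\<^bsub>Vec\<^esub> Funit (forget \<Gamma>\<^sub>T) = Funit VV.web_functor"
    unfolding GV.web_functor_def VV.web_functor_def mon_functor.simps forget_mat
    by (simp only: forget_def mon_functor.simps un id right_id)
  have fob: "Fob (forget \<Gamma>\<^sub>T) (Fob GV.web_functor X) = Fob VV.web_functor X" for X
    by (simp only: GV.web_functor_def VV.web_functor_def mon_functor.simps forget_def total_gob)
  show ?thesis unfolding functor_comp_def mor mul unit fob by simp
qed

end

section \<open>The relations and the fiber functor for a triangle presentation\<close>

theorem theorem4p2: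
  fixes G :: "('p, 'l) geometry" and n p q :: nat
    and \<sigma> :: "'p set \<Rightarrow> 'p set" and T :: "('p set \<times> 'p set \<times> 'p set) set"
    and \<Gamma> :: "'p tri_elem monoid"
    and C :: "(('p, 'k::field) tri_ob, ('p, 'k) tri_mor, 'k) lin_mon_cat" (structure)
    and V :: "int \<Rightarrow> ('p, 'k) tri_ob" and M S :: "int \<Rightarrow> int \<Rightarrow> ('p, 'k) tri_mor"
    and E E' :: "('p, 'k) tri_mor"
  assumes "3 \<le> n"
    and "projective_geometry G" "alg_dim G (points G) = n" "has_order G q"
    and "type_reversing_involution G n \<sigma>" "triangle_presentation G n \<sigma> T"
    and "CHAR('k) = p" "n - 1 \<le> p" "[q = 1] (mod p)"
    and "\<Gamma> = tri_group G n \<sigma> T" "C = GVec \<Gamma>"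
    and "V = triV G n \<sigma> T" "M = triM G n \<sigma> T" "S = triS G n \<sigma> T"
    and "E = triE G n \<sigma> T" "E' = triE' G n \<sigma> T"
  shows
    "\<comment> \<open>associativity and coassociativity\<close>
    (\<forall>a b c :: int. 0 \<le> a \<and> 0 \<le> b \<and> 0 \<le> c \<and> a + b + c \<le> int n \<longrightarrow>
       M (a + b) c \<cdot> (M a b \<boxtimes> \<iota> (V c)) =
       M a (b + c) \<cdot> (\<iota> (V a) \<boxtimes> M b c) \<cdot> \<alpha> (V a) (V b) (V c)) \<and>
    (\<forall>a b c :: int. 0 \<le> a \<and> 0 \<le> b \<and> 0 \<le> c \<and> a + b + c \<le> int n \<longrightarrow>
       \<alpha> (V a) (V b) (V c) \<cdot> (S a b \<boxtimes> \<iota> (V c)) \<cdot> S (a + b) c =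
       (\<iota> (V a) \<boxtimes> S b c) \<cdot> S a (b + c)) \<and>
    \<comment> \<open>bigon bursting\<close>
    (\<forall>a b :: int. 0 \<le> a \<and> 0 \<le> b \<and> a + b \<le> int n \<longrightarrow>
       M a b \<cdot> S a b = Smul C (of_nat (nat (a + b) choose nat a)) (\<iota> (V (a + b)))) \<and>
    \<comment> \<open>first square switch\<close>
    (\<forall>a b c d :: int. 0 \<le> a \<and> 0 \<le> b \<and> 0 \<le> c \<and> 0 \<le> d \<and> d \<le> a \<and> {a, b, a + c - d, b + d - c} \<subseteq> {0..int n} \<longrightarrow>
       (M (a - d) c \<boxtimes> \<iota> (V (b + d - c))) \<cdot> \<alpha>' (V (a - d)) (V c) (V (b + d - c)) \<cdot>
         (\<iota> (V (a - d)) \<boxtimes> S c (b + d - c)) \<cdot> (\<iota> (V (a - d)) \<boxtimes> M d b) \<cdot>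
         \<alpha> (V (a - d)) (V d) (V b) \<cdot> (S (a - d) d \<boxtimes> \<iota> (V b)) =
       hom_sum C (V a \<star> V b) (V (a + c - d) \<star> V (b + d - c))
         (\<lambda>t. Smul C (of_int (int_binom (a - b + c - d) (nat t)))
            ((\<iota> (V (a + c - d)) \<boxtimes> M (d - t) (b - c + t)) \<cdot>
             \<alpha> (V (a + c - d)) (V (d - t)) (V (b - c + t)) \<cdot>
             (S (a + c - d) (d - t) \<boxtimes> \<iota> (V (b - c + t))) \<cdot> (M a (c - t) \<boxtimes> \<iota> (V (b - c + t))) \<cdot>
             \<alpha>' (V a) (V (c - t)) (V (b - c + t)) \<cdot> (\<iota> (V a) \<boxtimes> S (c - t) (b - c + t))))
         [0..min c d]) \<and>
    \<comment> \<open>second square switch\<close>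
    (\<forall>a b c d :: int. 0 \<le> a \<and> 0 \<le> b \<and> 0 \<le> c \<and> 0 \<le> d \<and> c \<le> b \<and> {a, b, a + c - d, b + d - c} \<subseteq> {0..int n} \<longrightarrow>
       (\<iota> (V (a + c - d)) \<boxtimes> M d (b - c)) \<cdot> \<alpha> (V (a + c - d)) (V d) (V (b - c)) \<cdot>
         (S (a + c - d) d \<boxtimes> \<iota> (V (b - c))) \<cdot> (M a c \<boxtimes> \<iota> (V (b - c))) \<cdot>
         \<alpha>' (V a) (V c) (V (b - c)) \<cdot> (\<iota> (V a) \<boxtimes> S c (b - c)) =
       hom_sum C (V a \<star> V b) (V (a + c - d) \<star> V (b + d - c))
         (\<lambda>t. Smul C (of_int (int_binom (b - a + d - c) (nat t)))
            ((M (a - d + t) (c - t) \<boxtimes> \<iota> (V (b + d - c))) \<cdot>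
             \<alpha>' (V (a - d + t)) (V (c - t)) (V (b + d - c)) \<cdot>
             (\<iota> (V (a - d + t)) \<boxtimes> S (c - t) (b + d - c)) \<cdot> (\<iota> (V (a - d + t)) \<boxtimes> M (d - t) b) \<cdot>
             \<alpha> (V (a - d + t)) (V (d - t)) (V b) \<cdot> (S (a - d + t) (d - t) \<boxtimes> \<iota> (V b))))
         [0..min c d]) \<and>
    \<comment> \<open>rigidity; the unit object is inserted and removed by unitors\<close>
    (\<forall>a :: int. 1 \<le> a \<and> a \<le> int n - 1 \<longrightarrow>
       \<iota> (V a) =
       Lun C (V a) \<cdot> (E \<boxtimes> \<iota> (V a)) \<cdot> (M a (int n - a) \<boxtimes> \<iota> (V a)) \<cdot> \<alpha>' (V a) (V (int n - a)) (V a) \<cdot>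
         (\<iota> (V a) \<boxtimes> S (int n - a) a) \<cdot> (\<iota> (V a) \<boxtimes> E') \<cdot> Run' C (V a)) \<and>
    (\<forall>a :: int. 1 \<le> a \<and> a \<le> int n - 1 \<longrightarrow>
       \<iota> (V a) =
       Run C (V a) \<cdot> (\<iota> (V a) \<boxtimes> E) \<cdot> (\<iota> (V a) \<boxtimes> M (int n - a) a) \<cdot> \<alpha> (V a) (V (int n - a)) (V a) \<cdot>
         (S a (int n - a) \<boxtimes> \<iota> (V a)) \<cdot> (E' \<boxtimes> \<iota> (V a)) \<cdot> Lun' C (V a)) \<and>
    \<comment> \<open>the functor on webs\<close>
    (\<exists>F. linear_monoidal_functor (Web n) C F \<and>
       (\<forall>a\<in>{1..n}. Fob F [a] = V (int a)) \<and>
       (\<forall>a b. 1 \<le> a \<and> 1 \<le> b \<and> a + b \<le> n \<longrightarrow>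
          Fmor F (web_class n (WMerge a b)) \<cdot> Fmul F [a] [b] = M (int a) (int b) \<and>
          Fmor F (web_class n (WSplit a b)) = Fmul F [a] [b] \<cdot> S (int a) (int b)) \<and>
       Fmor F (web_class n WEv) = Funit F \<cdot> E \<and>
       Fmor F (web_class n WCoev) \<cdot> Funit F = E' \<and>
       fiber_functor (Web n) (functor_comp Vec (forget \<Gamma>) F))"
proof -
  interpret tri_field G q n \<sigma> T "TYPE('k)"
    by (intro tri_field.intro tri_geometry.intro ordered_geometry.intro ordered_geometry_axioms.intro
      tri_geometry_axioms.intro assms)
  have q1: "of_nat q = (1::'k)"
    using assms(7,9) of_nat_eq_iff_cong_CHAR[of q 1, where 'a = 'k] by simp
  have C: "C = GV.CC" by (simp only: assms GVec_cat)
  have V: "V a = gob (Leaf a)" for a by (simp add: assms)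
  have M: "M a b = GV.merge a b (a + b)" for a b by (simp only: assms triM_mat)
  have S: "S a b = GV.split a b (a + b)" for a b by (simp only: assms triS_mat)
  have E: "E = GV.ev" "E' = GV.coev" by (simp_all only: assms triE_mat)
  have tob: "gob s \<star>\<^bsub>GV.CC\<^esub> gob t = (gob (Node s t) :: ('p, 'k) tri_ob)" for s t by (rule GV.mat_fields(3))
  show ?thesis
  proof (intro conjI allI impI, goal_cases)
    case (1 a b c)
    show ?case
      unfolding C V M using GV.merge_assoc[OF HOL.refl HOL.refl HOL.refl, of a b c] by (simp only: add.assoc)
  next
    case (2 a b c)
    show ?case
      unfolding C V S using GV.split_coassoc[OF HOL.refl HOL.refl HOL.refl, of a b c] by (simp only: add.assoc)
  next
    case (3 a b)
    then obtain x y where "a = int x" "b = int y" by (metis nonneg_int_cases)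
    then show ?case
      unfolding C V M S using GV.bigon[OF q1, of x y] by (simp only: of_nat_add[symmetric] nat_int)
  next
    case (4 a b c d)
    \<comment> \<open>Brings the labels computed by \<open>M\<close> and \<open>S\<close> to the form used in the ladders.\<close>
    have l: "a - d + c = a + c - d" "c + (b + d - c) = d + b" "a - d + d = a"
      "d - t + (b - c + t) = b + d - c" "a + c - d + (d - t) = a + c - t" "a + (c - t) = a + c - t"
      "c - t + (b - c + t) = b" for t by auto
    show ?case
      unfolding C V M S tob l by (rule GV.first_square_switch[OF q1]) (use 4 in auto)
  next
    case (5 a b c d)
    have l: "d + (b - c) = b + d - c" "a + c - d + d = a + c" "c + (b - c) = b"
      "a - d + t + (c - t) = a + c - d" "c - t + (b + d - c) = d - t + b" "a - d + t + (d - t) = a" for t by auto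
    show ?case
      unfolding C V M S tob l by (rule GV.second_square_switch[OF q1]) (use 5 in auto)
  next
    case (6 a)
    have l: "a + (int n - a) = int n" "int n - a + a = int n" by auto
    show ?case
      unfolding C V M S E l by (rule GV.zigzag1)
  next
    case (7 a)
    have l: "a + (int n - a) = int n" "int n - a + a = int n" by auto
    show ?case
      unfolding C V M S E l by (rule GV.zigzag2)
  next
    case 8
    have "linear_monoidal_functor (Web n) C GV.web_functor"
      unfolding C by (rule GV.web_functor_monoidal[OF q1 sem_homogeneous])
    moreover have "linear_monoidal_functor (Web n) VV.CC VV.web_functor"
      by (rule VV.web_functor_monoidal[OF q1 sem_homogeneous])
    then have "fiber_functor (Web n) (functor_comp Vec (forget \<Gamma>) GV.web_functor)"
      by (simp only: fiber_functor_def assms(10) forget_web_functor Vec_cat)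
    ultimately show ?case
      unfolding V M S E using GV.web_functor_values[OF q1, folded C] by blast
  qed
qed

end
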